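(* Let $m,n\ge1$ and $\mathfrak g=\mathfrak{gl}(m|n)$ over $\mathbb C$. Let $\beta=\delta_s-\epsilon_t$ ($1\le s\le m$, $1\le t\le n$) be a positive odd root, and let $\lambda\in P^+$ be such that $\lambda-\beta\in P^+$ and $(\lambda+\rho,\beta)=0$. Let $v_\lambda^+$ denote the highest weight vector of the Kac module $K(\lambda)$ and let $S_{-\beta}=\sum_{J\in\mathcal A}d_JE_J\in U(\mathfrak n^-)$. Then $S_{-\beta}v_\lambda^+$ is a singular vector (in particular nonzero) of weight $\lambda-\beta$ in $K(\lambda)$, and it is the unique such singular vector up to a scalar multiple. In particular, $$\mathrm{Hom}_{\mathfrak g}\big(K(\lambda-\beta),K(\lambda)\big)=\mathbb C .$$
   Context: Let $I=\{\overline m,\overline{m-1},\ldots,\overline 1,1,2,\ldots,n\}$ with total order $\overline m<\overline{m-1}<\cdots<\overline 1<1<2<\cdots<n$. The Lie superalgebra $\mathfrak g=\mathfrak{gl}(m|n)$ has standard basis of matrix units $E_{i,j}$ $(i,j\in I)$; $E_{i,j}$ is even if $i,j$ are both barred or both unbarred, and odd otherwise. There is a $\mathbb Z$-grading $\mathfrak g=\mathfrak g_{-1}\oplus\mathfrak g_0\oplus\mathfrak g_1$, where $\mathfrak g_0$ is the even part, $\mathfrak g_{1}$ is spanned by the $E_{\overline i,p}$ and $\mathfrak g_{-1}$ by the $E_{p,\overline i}$ ($1\le i\le m$, $1\le p\le n$). $\mathfrak h$ is the Cartan subalgebra of diagonal matrices, and $\mathfrak n^-$ (resp. $\mathfrak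 n^+$) is the subalgebra of strictly lower (resp. strictly upper) triangular matrices with respect to the order on $I$. $\{\delta_m,\ldots,\delta_1,\epsilon_1,\ldots,\epsilon_n\}\subset\mathfrak h^*$ is the basis dual to $\{E_{\overline m,\overline m},\ldots,E_{\overline 1,\overline 1},E_{1,1},\ldots,E_{n,n}\}$. The symmetric form on $\mathfrak h^*$ is given by $(\delta_i,\epsilon_k)=0$, $(\delta_i,\delta_j)=-(\epsilon_i,\epsilon_j)=1$ if $i=j$ and $0$ if $i\ne j$. A weight $\lambda=\sum_i a_i\delta_i+\sum_j b_j\epsilon_j$ is written $(a_m,\ldots,a_1\,|\,b_1,\ldots,b_n)$. The Weyl vector is $\rho=\sum_{i=1}^m i\delta_i-\sum_{j=1}^n j\epsilon_j-\frac{m+n+1}{2}\big(\sum_{i=1}^m\delta_i-\sum_{j=1}^n\epsilon_j\big)$, so $(\lambda+\rho,\delta_s-\epsilon_t)=0$ if and only if $a_s+b_t+s-t=0$. $P^+$ is the set of dominant integral weights: those $\lambda$ with $a_{i}-a_{j}\in\mathbb Z_{\ge0}$ for all $m\ge i>j\ge1$ and $b_p-b_q\in\mathbb Z_{\ge0}$ for all $1\le p<q\le n$. For $\lambda\in P^+$, $L^0(\lambda)$ is the finite-dimensional irreducible $\mathfrak g_0$-module of highest weight $\lambda$, extended to a $\mathfrak g_0\oplus\mathfrak g_1$-module by trivial action of $\mathfrak g_1$, and the Kac module is $K(\lambda)=\mathrm{Ind}_{\mathfrak g_0\oplus\mathfrak g_1}^{\mathfrak g}L^0(\lambda)$. A nonzero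 vector $v$ in a $\mathfrak g$-module is singular if $\mathfrak n^+\cdot v=0$. $\mathrm{Hom}_{\mathfrak g}$ denotes the space of $U(\mathfrak g)$-linear maps. Given $\beta=\delta_s-\epsilon_t$ and $\lambda$, define scalars $c_k$ for $k\in I$ with $\overline s<k<t$ by $c_{\overline{k}}=a_s-a_k+s-1-k$ for $1\le k\le s-1$, and $c_k=b_t-b_k-(t-k)$ for $1\le k\le t-1$. Let $\mathcal A$ be the set of all subsets $J=\{j_1<j_2<\cdots<j_p\}$ (including $J=\emptyset$) of $\{k\in I:\overline s<k<t\}$. For $J\in\mathcal A$ put $E_J=E_{t,j_p}E_{j_p,j_{p-1}}\cdots E_{j_1,\overline s}\in U(\mathfrak n^-)$, with $E_\emptyset=E_{t,\overline s}$, and $d_J=\prod_{\overline s<k<t,\;k\notin J}c_k$ (empty product $=1$). *)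

theory Defs
  imports "HOL-Algebra.Algebra" "HOL-Library.Function_Algebras" "HOL-Library.Poly_Mapping"
    Complex_Main
begin

section \<open>Modules over a not necessarily commutative ring\<close>

text \<open>The record of HOL-Algebra modules is reused; the locale \<open>module\<close> itself insists on a
  commutative ring of scalars. The ring operations \<open>mult\<close> and \<open>one\<close> of the record play no role.\<close>

locale left_module = R?: ring R + M?: abelian_group M
  for R :: "('r, 'q) ring_scheme" (structure) and M :: "('r, 'v, 'w) module_scheme" (structure) +
  assumes smult_closed:
      "\<lbrakk>a \<in> carrier R; x \<in> carrier M\<rbrakk> \<Longrightarrow> a \<odot>\<^bsub>M\<^esub> x \<in> carrier M"
    and smult_l_distr:
      "\<lbrakk>a \<in> carrier R; b \<in> carrier R; x \<in> carrier M\<rbrakk> \<Longrightarrow>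
        (a \<oplus>\<^bsub>R\<^esub> b) \<odot>\<^bsub>M\<^esub> x = a \<odot>\<^bsub>M\<^esub> x \<oplus>\<^bsub>M\<^esub> b \<odot>\<^bsub>M\<^esub> x"
    and smult_r_distr:
      "\<lbrakk>a \<in> carrier R; x \<in> carrier M; y \<in> carrier M\<rbrakk> \<Longrightarrow>
        a \<odot>\<^bsub>M\<^esub> (x \<oplus>\<^bsub>M\<^esub> y) = a \<odot>\<^bsub>M\<^esub> x \<oplus>\<^bsub>M\<^esub> a \<odot>\<^bsub>M\<^esub> y"
    and smult_assoc:
      "\<lbrakk>a \<in> carrier R; b \<in> carrier R; x \<in> carrier M\<rbrakk> \<Longrightarrow>
        (a \<otimes>\<^bsub>R\<^esub> b) \<odot>\<^bsub>M\<^esub> x = a \<odot>\<^bsub>M\<^esub> (b \<odot>\<^bsub>M\<^esub> x)"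
    and smult_one:
      "x \<in> carrier M \<Longrightarrow> \<one>\<^bsub>R\<^esub> \<odot>\<^bsub>M\<^esub> x = x"

definition irreducible_module :: "('r, 'q) ring_scheme \<Rightarrow> ('r, 'v, 'w) module_scheme \<Rightarrow> bool" where
  "irreducible_module R M \<longleftrightarrow> left_module R M \<and> carrier M \<noteq> {\<zero>\<^bsub>M\<^esub>} \<and>
     (\<forall>N. submodule N R M \<longrightarrow> N = {\<zero>\<^bsub>M\<^esub>} \<or> N = carrier M)"

definition restrict_scalars ::
    "('s \<Rightarrow> 'r) \<Rightarrow> ('r, 'v) module \<Rightarrow> ('s, 'v) module" where
  "restrict_scalars \<psi> M =
     \<lparr>carrier = carrier M, monoid.mult = monoid.mult M, one = one M,
      ring.zero = ring.zero M, ring.add = ring.add M,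
      smult = (\<lambda>y x. \<psi> y \<odot>\<^bsub>M\<^esub> x)\<rparr>"

text \<open>For a ring homomorphism \<open>\<phi> : S \<rightarrow> R\<close> and a left \<open>S\<close>-module \<open>M\<close>, the left \<open>R\<close>-module
  \<open>R \<otimes>\<^sub>S M\<close>, where \<open>R\<close> is a right \<open>S\<close>-module through \<open>\<phi>\<close>: the free abelian group on
  \<open>R \<times> M\<close> modulo biadditivity and \<open>S\<close>-balancedness.\<close>

definition balanced_rels ::
    "('r, 'q) ring_scheme \<Rightarrow> ('s, 'p) ring_scheme \<Rightarrow> ('s \<Rightarrow> 'r) \<Rightarrow> ('s, 'v) module
      \<Rightarrow> (('r \<times> 'v) \<Rightarrow>\<^sub>0 int) set" where
  "balanced_rels R S \<phi> M =
     {frag_of (u \<oplus>\<^bsub>R\<^esub> u', x) - frag_of (u, x) - frag_of (u', x) | u u' x.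
        u \<in> carrier R \<and> u' \<in> carrier R \<and> x \<in> carrier M} \<union>
     {frag_of (u, x \<oplus>\<^bsub>M\<^esub> x') - frag_of (u, x) - frag_of (u, x') | u x x'.
        u \<in> carrier R \<and> x \<in> carrier M \<and> x' \<in> carrier M} \<union>
     {frag_of (u \<otimes>\<^bsub>R\<^esub> \<phi> y, x) - frag_of (u, y \<odot>\<^bsub>M\<^esub> x) | u y x.
        u \<in> carrier R \<and> y \<in> carrier S \<and> x \<in> carrier M}"

definition tensor_kernel ::
    "('r, 'q) ring_scheme \<Rightarrow> ('s, 'p) ring_scheme \<Rightarrow> ('s \<Rightarrow> 'r) \<Rightarrow> ('s, 'v) module
      \<Rightarrow> (('r \<times> 'v) \<Rightarrow>\<^sub>0 int) set" where
  "tensor_kernel R S \<phi> M =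
     generate (free_Abelian_group (carrier R \<times> carrier M)) (balanced_rels R S \<phi> M)"

definition pure_tensor ::
    "('r, 'q) ring_scheme \<Rightarrow> ('s, 'p) ring_scheme \<Rightarrow> ('s \<Rightarrow> 'r) \<Rightarrow> ('s, 'v) module
      \<Rightarrow> 'r \<Rightarrow> 'v \<Rightarrow> (('r \<times> 'v) \<Rightarrow>\<^sub>0 int) set" where
  "pure_tensor R S \<phi> M u x =
     tensor_kernel R S \<phi> M #>\<^bsub>free_Abelian_group (carrier R \<times> carrier M)\<^esub> frag_of (u, x)"

definition extend_scalars ::
    "('r, 'q) ring_scheme \<Rightarrow> ('s, 'p) ring_scheme \<Rightarrow> ('s \<Rightarrow> 'r) \<Rightarrow> ('s, 'v) module
      \<Rightarrow> ('r, (('r \<times> 'v) \<Rightarrow>\<^sub>0 int) set) module" where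
  "extend_scalars R S \<phi> M =
     (let F = free_Abelian_group (carrier R \<times> carrier M); N = tensor_kernel R S \<phi> M in
      \<lparr>carrier = carrier (F Mod N), monoid.mult = undefined, one = undefined,
       ring.zero = \<one>\<^bsub>F Mod N\<^esub>, ring.add = (\<lambda>A B. A \<otimes>\<^bsub>F Mod N\<^esub> B),
       smult = (\<lambda>r A. \<Union>f\<in>A. N #>\<^bsub>F\<^esub> frag_extend (\<lambda>(u, x). frag_of (r \<otimes>\<^bsub>R\<^esub> u, x)) f)\<rparr>)"

section \<open>The Lie superalgebra \<open>gl(m|n)\<close>\<close>

text \<open>The barred index \<open>k\<close> is encoded as the integer \<open>-k\<close> and the unbarred index \<open>k\<close> as the integer
  \<open>k\<close>, so that the total order on indices is the order of the integers and the barred indices are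
  the negative ones. Addition and subtraction of matrices and weights are pointwise.\<close>

type_synonym mat = "int \<Rightarrow> int \<Rightarrow> complex"
type_synonym weight = "int \<Rightarrow> complex"

definition bar :: "nat \<Rightarrow> int" where
  "bar k = - int k"

definition idx :: "nat \<Rightarrow> nat \<Rightarrow> int set" where
  "idx m n = bar ` {1..m} \<union> int ` {1..n}"

definition mat_mult :: "nat \<Rightarrow> nat \<Rightarrow> mat \<Rightarrow> mat \<Rightarrow> mat" where
  "mat_mult m n x y = (\<lambda>i k. \<Sum>j\<in>idx m n. x i j * y j k)"

definition mat_scale :: "complex \<Rightarrow> mat \<Rightarrow> mat" where
  "mat_scale c x = (\<lambda>i j. c * x i j)"

definition mat_unit :: "int \<Rightarrow> int \<Rightarrow> mat" where
  "mat_unit i j = (\<lambda>k l. if k = i \<and> l = j then 1 else 0)"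

definition gl :: "nat \<Rightarrow> nat \<Rightarrow> mat set" where
  "gl m n = {x. \<forall>i j. x i j \<noteq> 0 \<longrightarrow> i \<in> idx m n \<and> j \<in> idx m n}"

text \<open>Homogeneity of parity \<open>p\<close>, with \<open>p = 0\<close> for even and \<open>p = 1\<close> for odd.\<close>

definition homogeneous :: "nat \<Rightarrow> mat \<Rightarrow> bool" where
  "homogeneous p x \<longleftrightarrow>
     p \<in> {0, 1} \<and> (\<forall>i j. x i j \<noteq> 0 \<longrightarrow> (if (i < 0) = (j < 0) then p = 0 else p = 1))"

definition even_part :: "mat \<Rightarrow> mat" where
  "even_part x = (\<lambda>i j. if (i < 0) = (j < 0) then x i j else 0)"

definition superbracket :: "nat \<Rightarrow> nat \<Rightarrow> nat \<Rightarrow> nat \<Rightarrow> mat \<Rightarrow> mat \<Rightarrow> mat" where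
  "superbracket m n p q x y = mat_mult m n x y - mat_scale ((-1) ^ (p * q)) (mat_mult m n y x)"

definition g_zero :: "nat \<Rightarrow> nat \<Rightarrow> mat set" where
  "g_zero m n = {x \<in> gl m n. homogeneous 0 x}"

definition g_plus :: "nat \<Rightarrow> nat \<Rightarrow> mat set" where
  "g_plus m n = {x \<in> gl m n. \<forall>i j. x i j \<noteq> 0 \<longrightarrow> i < 0 \<and> 0 < j}"

definition parabolic :: "nat \<Rightarrow> nat \<Rightarrow> mat set" where
  "parabolic m n = {x + y | x y. x \<in> g_zero m n \<and> y \<in> g_plus m n}"

definition n_plus :: "nat \<Rightarrow> nat \<Rightarrow> mat set" where
  "n_plus m n = {x \<in> gl m n. \<forall>i j. x i j \<noteq> 0 \<longrightarrow> i < j}"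

definition cartan :: "nat \<Rightarrow> nat \<Rightarrow> mat set" where
  "cartan m n = {x \<in> gl m n. \<forall>i j. x i j \<noteq> 0 \<longrightarrow> i = j}"

section \<open>Universal enveloping algebras\<close>

datatype 'a free_monoid = Word (letters: "'a list")

instantiation free_monoid :: (type) monoid_add
begin

definition zero_free_monoid :: "'a free_monoid" where
  "0 = Word []"

definition plus_free_monoid :: "'a free_monoid \<Rightarrow> 'a free_monoid \<Rightarrow> 'a free_monoid" where
  "v + w = Word (letters v @ letters w)"

instance
  by standard (simp_all add: zero_free_monoid_def plus_free_monoid_def)

end

type_synonym free_alg = "mat free_monoid \<Rightarrow>\<^sub>0 complex"

definition letter :: "mat \<Rightarrow> free_alg" where
  "letter x = Poly_Mapping.single (Word [x]) 1"

definition const :: "complex \<Rightarrow> free_alg" where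
  "const c = Poly_Mapping.single 0 c"

text \<open>The free associative algebra on the underlying set of \<open>\<aa>\<close>.\<close>

definition free_algebra :: "mat set \<Rightarrow> free_alg ring" where
  "free_algebra \<aa> =
     \<lparr>carrier = {u. \<forall>w \<in> Poly_Mapping.keys u. set (letters w) \<subseteq> \<aa>},
      monoid.mult = (*), one = 1, ring.zero = 0, ring.add = (+)\<rparr>"

text \<open>The first two families of relations turn the free algebra on the set \<open>\<aa>\<close> into the tensor
  algebra of the vector space \<open>\<aa>\<close>.\<close>

definition enveloping_rels :: "nat \<Rightarrow> nat \<Rightarrow> mat set \<Rightarrow> free_alg set" where
  "enveloping_rels m n \<aa> =
     {letter (x + y) - letter x - letter y | x y. x \<in> \<aa> \<and> y \<in> \<aa>} \<union>
     {letter (mat_scale c x) - const c * letter x | c x. x \<in> \<aa>} \<union>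
     {letter x * letter y - const ((-1) ^ (p * q)) * letter y * letter x
        - letter (superbracket m n p q x y) | p q x y.
        x \<in> \<aa> \<and> y \<in> \<aa> \<and> homogeneous p x \<and> homogeneous q y}"

definition enveloping_ideal :: "nat \<Rightarrow> nat \<Rightarrow> mat set \<Rightarrow> free_alg set" where
  "enveloping_ideal m n \<aa> = Idl\<^bsub>free_algebra \<aa>\<^esub> (enveloping_rels m n \<aa>)"

definition UEA :: "nat \<Rightarrow> nat \<Rightarrow> mat set \<Rightarrow> free_alg set ring" where
  "UEA m n \<aa> = free_algebra \<aa> Quot enveloping_ideal m n \<aa>"

definition UEA_class :: "nat \<Rightarrow> nat \<Rightarrow> mat set \<Rightarrow> free_alg \<Rightarrow> free_alg set" where
  "UEA_class m n \<aa> u = enveloping_ideal m n \<aa> +>\<^bsub>free_algebra \<aa>\<^esub> u"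

abbreviation UEA_gen :: "nat \<Rightarrow> nat \<Rightarrow> mat set \<Rightarrow> mat \<Rightarrow> free_alg set" where
  "UEA_gen m n \<aa> x \<equiv> UEA_class m n \<aa> (letter x)"

abbreviation UEA_const :: "nat \<Rightarrow> nat \<Rightarrow> mat set \<Rightarrow> complex \<Rightarrow> free_alg set" where
  "UEA_const m n \<aa> c \<equiv> UEA_class m n \<aa> (const c)"

text \<open>The homomorphism of enveloping algebras into \<open>U(\<bb>)\<close> induced by a homomorphism \<open>f\<close> of Lie
  superalgebras with target \<open>\<bb>\<close>.\<close>

definition UEA_map :: "nat \<Rightarrow> nat \<Rightarrow> mat set \<Rightarrow> (mat \<Rightarrow> mat) \<Rightarrow> free_alg set \<Rightarrow> free_alg set" where
  "UEA_map m n \<bb> f A =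
     (\<Union>u\<in>A. UEA_class m n \<bb>
       (\<Sum>w\<in>Poly_Mapping.keys u.
          Poly_Mapping.single (Word (map f (letters w))) (Poly_Mapping.lookup u w)))"

section \<open>Weights\<close>

text \<open>A weight \<open>(a\<^sub>m,\<dots>,a\<^sub>1|b\<^sub>1,\<dots>,b\<^sub>n)\<close> is the function with value \<open>a\<^sub>i\<close> at \<open>bar i\<close> and \<open>b\<^sub>j\<close> at
  \<open>int j\<close>; values outside \<open>idx m n\<close> are never used.\<close>

definition delta :: "nat \<Rightarrow> weight" where
  "delta i = (\<lambda>k. if k = bar i then 1 else 0)"

definition eps :: "nat \<Rightarrow> weight" where
  "eps j = (\<lambda>k. if k = int j then 1 else 0)"

definition weight_apply :: "nat \<Rightarrow> nat \<Rightarrow> weight \<Rightarrow> mat \<Rightarrow> complex" where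
  "weight_apply m n \<mu> h = (\<Sum>i\<in>idx m n. \<mu> i * h i i)"

definition weight_form :: "nat \<Rightarrow> nat \<Rightarrow> weight \<Rightarrow> weight \<Rightarrow> complex" where
  "weight_form m n \<mu> \<nu> =
     (\<Sum>i=1..m. \<mu> (bar i) * \<nu> (bar i)) - (\<Sum>j=1..n. \<mu> (int j) * \<nu> (int j))"

definition rho :: "nat \<Rightarrow> nat \<Rightarrow> weight" where
  "rho m n = (\<lambda>k. (\<Sum>i=1..m. of_nat i * delta i k) - (\<Sum>j=1..n. of_nat j * eps j k)
     - of_nat (m + n + 1) / 2 * ((\<Sum>i=1..m. delta i k) - (\<Sum>j=1..n. eps j k)))"

definition dominant :: "nat \<Rightarrow> nat \<Rightarrow> weight \<Rightarrow> bool" where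
  "dominant m n \<mu> \<longleftrightarrow>
     (\<forall>i j. 1 \<le> j \<and> j < i \<and> i \<le> m \<longrightarrow> \<mu> (bar i) - \<mu> (bar j) \<in> \<nat>) \<and>
     (\<forall>p q. 1 \<le> p \<and> p < q \<and> q \<le> n \<longrightarrow> \<mu> (int p) - \<mu> (int q) \<in> \<nat>)"

text \<open>In the following, \<open>M\<close> is a \<open>U(\<aa>)\<close>-module for a subalgebra \<open>\<aa>\<close> of \<open>gl(m|n)\<close> containing the
  diagonal matrices.\<close>

definition singular :: "nat \<Rightarrow> nat \<Rightarrow> mat set \<Rightarrow> (free_alg set, 'v) module \<Rightarrow> 'v \<Rightarrow> bool" where
  "singular m n \<aa> M v \<longleftrightarrow> v \<in> carrier M \<and> v \<noteq> \<zero>\<^bsub>M\<^esub> \<and>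
     (\<forall>x \<in> \<aa> \<inter> n_plus m n. UEA_gen m n \<aa> x \<odot>\<^bsub>M\<^esub> v = \<zero>\<^bsub>M\<^esub>)"

definition has_weight ::
    "nat \<Rightarrow> nat \<Rightarrow> mat set \<Rightarrow> (free_alg set, 'v) module \<Rightarrow> weight \<Rightarrow> 'v \<Rightarrow> bool" where
  "has_weight m n \<aa> M \<mu> v \<longleftrightarrow> v \<in> carrier M \<and>
     (\<forall>h \<in> cartan m n.
        UEA_gen m n \<aa> h \<odot>\<^bsub>M\<^esub> v = UEA_const m n \<aa> (weight_apply m n \<mu> h) \<odot>\<^bsub>M\<^esub> v)"

definition highest_weight_vector ::
    "nat \<Rightarrow> nat \<Rightarrow> mat set \<Rightarrow> (free_alg set, 'v) module \<Rightarrow> weight \<Rightarrow> 'v \<Rightarrow> bool" where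
  "highest_weight_vector m n \<aa> M \<mu> v \<longleftrightarrow> singular m n \<aa> M v \<and> has_weight m n \<aa> M \<mu> v"

definition finite_dim :: "nat \<Rightarrow> nat \<Rightarrow> mat set \<Rightarrow> (free_alg set, 'v) module \<Rightarrow> bool" where
  "finite_dim m n \<aa> M \<longleftrightarrow>
     (\<exists>B. finite B \<and> B \<subseteq> carrier M \<and>
       (\<forall>v \<in> carrier M. \<exists>c. v = (\<Oplus>\<^bsub>M\<^esub>b\<in>B. UEA_const m n \<aa> (c b) \<odot>\<^bsub>M\<^esub> b)))"

section \<open>Kac modules\<close>

text \<open>\<open>L\<close> is (a model of) the irreducible module \<open>L\<^sup>0(\<mu>)\<close>, which is determined up to isomorphism.\<close>

definition is_L0 :: "nat \<Rightarrow> nat \<Rightarrow> weight \<Rightarrow> (free_alg set, 'v) module \<Rightarrow> bool" where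
  "is_L0 m n \<mu> L \<longleftrightarrow> irreducible_module (UEA m n (g_zero m n)) L \<and> finite_dim m n (g_zero m n) L \<and>
     (\<exists>v. highest_weight_vector m n (g_zero m n) L \<mu> v)"

text \<open>Extension of a \<open>\<gg>\<^sub>0\<close>-module by the trivial action of \<open>\<gg>\<^sub>1\<close>, i.e. pull-back along the
  projection \<open>\<gg>\<^sub>0 \<oplus> \<gg>\<^sub>1 \<rightarrow> \<gg>\<^sub>0\<close>, which is \<open>even_part\<close>.\<close>

definition inflate ::
    "nat \<Rightarrow> nat \<Rightarrow> (free_alg set, 'v) module \<Rightarrow> (free_alg set, 'v) module" where
  "inflate m n L = restrict_scalars (UEA_map m n (g_zero m n) even_part) L"

definition kac ::
    "nat \<Rightarrow> nat \<Rightarrow> (free_alg set, 'v) module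
      \<Rightarrow> (free_alg set, ((free_alg set \<times> 'v) \<Rightarrow>\<^sub>0 int) set) module" where
  "kac m n L =
     extend_scalars (UEA m n (gl m n)) (UEA m n (parabolic m n)) (UEA_map m n (gl m n) id) (inflate m n L)"

definition kac_vector ::
    "nat \<Rightarrow> nat \<Rightarrow> (free_alg set, 'v) module \<Rightarrow> 'v \<Rightarrow> ((free_alg set \<times> 'v) \<Rightarrow>\<^sub>0 int) set" where
  "kac_vector m n L v =
     pure_tensor (UEA m n (gl m n)) (UEA m n (parabolic m n)) (UEA_map m n (gl m n) id) (inflate m n L)
       \<one>\<^bsub>UEA m n (gl m n)\<^esub> v"

text \<open>The complex vector space \<open>Hom\<^bsub>\<gg>\<^esub>(M, N)\<close>; maps are made extensional outside \<open>carrier M\<close>.\<close>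

definition Hom_g ::
    "nat \<Rightarrow> nat \<Rightarrow> (free_alg set, 'v) module \<Rightarrow> (free_alg set, 'w) module
      \<Rightarrow> (complex, 'v \<Rightarrow> 'w) module" where
  "Hom_g m n M N =
     \<lparr>carrier = {f \<in> carrier M \<rightarrow>\<^sub>E carrier N.
        (\<forall>x \<in> carrier M. \<forall>y \<in> carrier M. f (x \<oplus>\<^bsub>M\<^esub> y) = f x \<oplus>\<^bsub>N\<^esub> f y) \<and>
        (\<forall>u \<in> carrier (UEA m n (gl m n)). \<forall>x \<in> carrier M. f (u \<odot>\<^bsub>M\<^esub> x) = u \<odot>\<^bsub>N\<^esub> f x)},
      monoid.mult = undefined, one = undefined,
      ring.zero = (\<lambda>x\<in>carrier M. \<zero>\<^bsub>N\<^esub>),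
      ring.add = (\<lambda>f g. \<lambda>x\<in>carrier M. f x \<oplus>\<^bsub>N\<^esub> g x),
      smult = (\<lambda>c f. \<lambda>x\<in>carrier M. UEA_const m n (gl m n) c \<odot>\<^bsub>N\<^esub> f x)\<rparr>"

section \<open>The element \<open>S\<^bsub>-\<beta>\<^esub>\<close>\<close>

definition between :: "nat \<Rightarrow> nat \<Rightarrow> nat \<Rightarrow> nat \<Rightarrow> int set" where
  "between m n s t = {k \<in> idx m n. bar s < k \<and> k < int t}"

text \<open>In the first case the barred index \<open>k\<close> of the usual formula is \<open>-k\<close> here.\<close>

definition c_coeff :: "weight \<Rightarrow> nat \<Rightarrow> nat \<Rightarrow> int \<Rightarrow> complex" where
  "c_coeff \<mu> s t k =
     (if k < 0 then \<mu> (bar s) - \<mu> k + of_nat s - 1 - of_int (- k)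
      else \<mu> (int t) - \<mu> k - (of_nat t - of_int k))"

definition d_coeff :: "nat \<Rightarrow> nat \<Rightarrow> weight \<Rightarrow> nat \<Rightarrow> nat \<Rightarrow> int set \<Rightarrow> complex" where
  "d_coeff m n \<mu> s t J = (\<Prod>k\<in>between m n s t - J. c_coeff \<mu> s t k)"

text \<open>\<open>chain [i\<^sub>0, i\<^sub>1, \<dots>, i\<^sub>r]\<close> is the product of the matrix units
  \<open>E\<^bsub>i\<^sub>r,i\<^sub>r\<^sub>-\<^sub>1\<^esub> \<cdots> E\<^bsub>i\<^sub>2,i\<^sub>1\<^esub> E\<^bsub>i\<^sub>1,i\<^sub>0\<^esub>\<close>.\<close>

fun chain :: "nat \<Rightarrow> nat \<Rightarrow> int list \<Rightarrow> free_alg set" where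
  "chain m n (i # j # xs) = chain m n (j # xs) \<otimes>\<^bsub>UEA m n (gl m n)\<^esub> UEA_gen m n (gl m n) (mat_unit j i)"
| "chain m n _ = \<one>\<^bsub>UEA m n (gl m n)\<^esub>"

definition E_prod :: "nat \<Rightarrow> nat \<Rightarrow> nat \<Rightarrow> nat \<Rightarrow> int set \<Rightarrow> free_alg set" where
  "E_prod m n s t J = chain m n (bar s # sorted_list_of_set J @ [int t])"

definition S_elem :: "nat \<Rightarrow> nat \<Rightarrow> weight \<Rightarrow> nat \<Rightarrow> nat \<Rightarrow> free_alg set" where
  "S_elem m n \<mu> s t =
     (\<Oplus>\<^bsub>UEA m n (gl m n)\<^esub>J\<in>Pow (between m n s t).
        UEA_const m n (gl m n) (d_coeff m n \<mu> s t J) \<otimes>\<^bsub>UEA m n (gl m n)\<^esub> E_prod m n s t J)"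

end

theory Submission
  imports Defs "HOL-Library.Product_Lexorder"
begin

text \<open>The Kac module is identified with the Fock space \<open>\<Lambda>(\<gg>\<^sub>-\<^sub>1) \<otimes> L\<^sup>0(\<lambda>)\<close>. There the odd lowering
  operators are creation operators and all other matrix units are explicit expressions in creation
  and annihilation operators; checking the relations of \<open>gl(m|n)\<close> gives a homomorphism out of the Kac
  module, and it is invertible because the Kac module is spanned by the words in \<open>\<gg>\<^sub>-\<^sub>1\<close> applied to
  \<open>1 \<otimes> L\<^sup>0(\<lambda>)\<close>.

  In the Fock space \<open>S v\<close> satisfies a recursion in its set of intermediate indices, from which the simple
  root vectors are seen to annihilate it, and its component at \<open>E\<^bsub>t, bar s\<^esub>\<close> is a nonzero multiple of
  \<open>v\<close> by dominance and atypicality. A vector of weight \<open>\<lambda> - \<beta>\<close> has degree one, and if it is singular it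
  is determined by its coefficient of \<open>v\<close> in that component; this gives uniqueness.

  For the homomorphism, the \<open>\<gg>\<^sub>0\<close>-submodule of \<open>L\<^sup>0(\<lambda> - \<beta>) \<oplus> K(\<lambda>)\<close> generated by \<open>(v', S v)\<close> is the
  graph of a map: otherwise it would contain a \<open>\<gg>\<^sub>0\<close>-singular vector \<open>(0, y)\<close>, whose weight the
  Casimir elements of the two blocks of \<open>\<gg>\<^sub>0\<close> force to be \<open>\<lambda> - \<beta>\<close>, although \<open>y\<close> arises from \<open>S v\<close> by proper
  lowering.\<close>

section \<open>Complex-valued functions as vectors\<close>

text \<open>Both the enveloping algebra and the induced module are bare quotients, so a statement
  such as \<open>S v \<noteq> 0\<close> cannot be read off from them. The Fock space supplies
  coordinates: injectivity of the map into it is the linear independence of the ordered words in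
  g_{-1}. The component of \<open>S v\<close> at \<open>E_{t, bar s}\<close> is the product of
  \<open>c_k\<close> over the barred and of \<open>1 + c_k\<close> over the unbarred indices in
  between; the extra 1 comes from the commutator of \<open>E_{t,k}\<close> with
  \<open>E_{k, bar s}\<close>. The delicate point is the homomorphism. A singular vector of dominant
  weight only generates some highest weight module over g_0, and it has to be shown that this is the
  irreducible one. Extremal vectors of degree one have leading terms of weight
  \<open>\<lambda> - \<delta>_k + \<epsilon>_r\<close>; the Casimir values separate these weights
  because \<open>\<lambda> + \<rho>\<close> is regular within each block. The one case left, weight
  \<open>\<lambda> - \<beta>\<close>, is excluded by an operator built from diagonal matrices that
  tells the generator from its proper lowerings.\<close>

definition sc :: "complex \<Rightarrow> ('b \<Rightarrow> complex) \<Rightarrow> 'b \<Rightarrow> complex" where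
  "sc c f = (\<lambda>x. c * f x)"

interpretation fs: vector_space "sc :: complex \<Rightarrow> ('b \<Rightarrow> complex) \<Rightarrow> 'b \<Rightarrow> complex"
  by standard (auto simp: sc_def fun_eq_iff algebra_simps)

definition lin :: "(('b \<Rightarrow> complex) \<Rightarrow> 'c \<Rightarrow> complex) \<Rightarrow> bool" where
  "lin T \<longleftrightarrow> (\<forall>f g. T (f + g) = T f + T g) \<and> (\<forall>c f. T (sc c f) = sc c (T f))"

lemma lin_add: "lin T \<Longrightarrow> T (f + g) = T f + T g"
  and lin_sc: "lin T \<Longrightarrow> T (sc c f) = sc c (T f)"
  by (auto simp: lin_def)

lemma lin_zero:
  assumes "lin T" shows "T 0 = 0"
  using lin_sc[OF assms, of 0 0] by simp

lemma lin_minus: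
  assumes "lin T" shows "T (- f) = - T f"
  using lin_sc[OF assms, of "- 1" f] by simp

lemma lin_diff:
  assumes "lin T" shows "T (f - g) = T f - T g"
  using lin_add[OF assms, of f "- g"] by (simp add: lin_minus[OF assms])

lemma lin_sum:
  assumes "lin T" shows "T (sum f A) = (\<Sum>a\<in>A. T (f a))"
proof (induction A rule: infinite_finite_induct)
  case (insert a A)
  then have "T (sum f (insert a A)) = (\<Sum>a\<in>insert a A. T (f a))"
    by (simp add: lin_add[OF assms])
  then show ?case .
next
  case (infinite A)
  then have "T (sum f A) = (\<Sum>a\<in>A. T (f a))" by (simp add: lin_zero[OF assms])
  then show ?case .
next
  case empty
  have "T (sum f {}) = (\<Sum>a\<in>{}. T (f a))" by (simp add: lin_zero[OF assms])
  then show ?case .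
qed

lemma lin_plus: "lin S \<Longrightarrow> lin T \<Longrightarrow> lin (\<lambda>f. S f + T f)"
  by (auto simp: lin_def algebra_simps fs.scale_right_distrib)

lemma lin_subtract: "lin S \<Longrightarrow> lin T \<Longrightarrow> lin (\<lambda>f. S f - T f)"
  by (auto simp: lin_def algebra_simps fs.scale_right_diff_distrib)

lemma lin_comp: "lin S \<Longrightarrow> lin T \<Longrightarrow> lin (\<lambda>f. S (T f))"
  by (auto simp: lin_def)

lemma lin_smul: "lin T \<Longrightarrow> lin (\<lambda>f. sc c (T f))"
  by (auto simp: lin_def fs.scale_right_distrib mult.commute)

lemma lin_id: "lin (\<lambda>f. f)"
  by (auto simp: lin_def)

lemma lin_setsum:
  assumes "\<And>a. a \<in> A \<Longrightarrow> lin (T a)"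
  shows "lin (\<lambda>f. \<Sum>a\<in>A. T a f)"
  using assms
proof (induction A rule: infinite_finite_induct)
  case (insert a A)
  then have "lin (\<lambda>f. T a f + (\<Sum>a\<in>A. T a f))" by (intro lin_plus) auto
  then have "lin (\<lambda>f. \<Sum>a\<in>insert a A. T a f)" using insert.hyps by simp
  then show ?case .
qed (simp_all add: lin_def)

section \<open>Free algebras\<close>

definition word_act :: "(mat \<Rightarrow> ('b \<Rightarrow> complex) \<Rightarrow> 'b \<Rightarrow> complex) \<Rightarrow> mat free_monoid \<Rightarrow>
    ('b \<Rightarrow> complex) \<Rightarrow> 'b \<Rightarrow> complex" where
  "word_act op w f = foldr op (letters w) f"

definition free_act :: "(mat \<Rightarrow> ('b \<Rightarrow> complex) \<Rightarrow> 'b \<Rightarrow> complex) \<Rightarrow> free_alg \<Rightarrow>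
    ('b \<Rightarrow> complex) \<Rightarrow> 'b \<Rightarrow> complex" where
  "free_act op u f = (\<Sum>w\<in>Poly_Mapping.keys u. sc (Poly_Mapping.lookup u w) (word_act op w f))"

definition free_map :: "(mat \<Rightarrow> mat) \<Rightarrow> free_alg \<Rightarrow> free_alg" where
  "free_map f u = (\<Sum>w\<in>Poly_Mapping.keys u.
     Poly_Mapping.single (Word (map f (letters w))) (Poly_Mapping.lookup u w))"

lemma letters_add [simp]: "letters (v + w) = letters v @ letters w"
  by (simp add: plus_free_monoid_def)

lemma letters_zero [simp]: "letters 0 = []"
  by (simp add: zero_free_monoid_def)

text \<open>Coefficients may cancel, so the support of \<open>u + v\<close> can be smaller than the
  union of the supports. As \<open>g w 0 = 0\<close>, all three sums can be taken over that union,
  where additivity applies termwise.\<close>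

lemma sum_keys_add:
  fixes u v :: "'a \<Rightarrow>\<^sub>0 complex" and g :: "'a \<Rightarrow> complex \<Rightarrow> 'd::comm_monoid_add"
  assumes "\<And>w. g w 0 = 0" and "\<And>w a b. g w (a + b) = g w a + g w b"
  shows "(\<Sum>w\<in>Poly_Mapping.keys (u + v). g w (Poly_Mapping.lookup (u + v) w)) =
    (\<Sum>w\<in>Poly_Mapping.keys u. g w (Poly_Mapping.lookup u w)) +
    (\<Sum>w\<in>Poly_Mapping.keys v. g w (Poly_Mapping.lookup v w))"
proof -
  let ?A = "Poly_Mapping.keys u \<union> Poly_Mapping.keys v"
  have *: "(\<Sum>w\<in>Poly_Mapping.keys x. g w (Poly_Mapping.lookup x w)) =
      (\<Sum>w\<in>?A. g w (Poly_Mapping.lookup x w))" if "Poly_Mapping.keys x \<subseteq> ?A" for x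
    by (rule sum.mono_neutral_left) (use that assms(1) in \<open>auto simp: in_keys_iff\<close>)
  show ?thesis
    using assms(2) by (subst (1 2 3) *) (auto simp: lookup_add sum.distrib dest: Poly_Mapping.keys_add[THEN subsetD])
qed

lemma free_act_add: "free_act op (u + v) f = free_act op u f + free_act op v f"
  unfolding free_act_def by (rule sum_keys_add) (auto simp: fs.scale_left_distrib)

lemma free_map_add: "free_map f (u + v) = free_map f u + free_map f v"
  unfolding free_map_def by (rule sum_keys_add) (auto simp: single_add)

lemma free_act_single: "free_act op (Poly_Mapping.single w c) f = sc c (word_act op w f)"
  by (cases "c = 0") (auto simp: free_act_def)

lemma free_map_single:
  "free_map f (Poly_Mapping.single w c) = Poly_Mapping.single (Word (map f (letters w))) c"
  by (cases "c = 0") (auto simp: free_map_def)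

lemma free_act_zero [simp]: "free_act op 0 f = 0"
  by (simp add: free_act_def)

lemma free_map_zero [simp]: "free_map f 0 = 0"
  by (simp add: free_map_def)

lemma additive_minus:
  fixes g :: "'a::ab_group_add \<Rightarrow> 'd::ab_group_add"
  assumes "\<And>u v. g (u + v) = g u + g v"
  shows "g (u - v) = g u - g v" and "g (- u) = - g u"
proof -
  show *: "g (u - v) = g u - g v" for u v
    using assms[of "u - v" v] by simp
  show "g (- u) = - g u"
    using *[of 0 u] *[of u u] by simp
qed

lemma free_act_diff: "free_act op (u - v) f = free_act op u f - free_act op v f"
  using additive_minus(1)[of "\<lambda>u. free_act op u f" u v] free_act_add[of op] by blast

lemma free_map_diff: "free_map f (u - v) = free_map f u - free_map f v"
  and free_map_uminus: "free_map f (- u) = - free_map f u"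
  using additive_minus[of "free_map f"] free_map_add[of f] by blast+

lemma poly_mapping_sum_single:
  "u = (\<Sum>w\<in>Poly_Mapping.keys u. Poly_Mapping.single w (Poly_Mapping.lookup u w))"
proof (rule poly_mapping_eqI)
  fix k
  have "Poly_Mapping.lookup (\<Sum>w\<in>A. Poly_Mapping.single w (Poly_Mapping.lookup u w)) k =
      (if k \<in> A then Poly_Mapping.lookup u k else 0)" if "finite A" for A
    using that by (induction A rule: finite_induct) (auto simp: lookup_add lookup_single when_def)
  then show "Poly_Mapping.lookup u k =
      Poly_Mapping.lookup (\<Sum>w\<in>Poly_Mapping.keys u. Poly_Mapping.single w (Poly_Mapping.lookup u w)) k"
    by (simp add: in_keys_iff)
qed

lemma free_alg_single_induct:
  assumes "\<And>w c. P (Poly_Mapping.single w c)" and "\<And>u v. P u \<Longrightarrow> P v \<Longrightarrow> P (u + v)"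
  shows "P (u :: free_alg)"
proof -
  have *: "P (\<Sum>w\<in>A. Poly_Mapping.single w (Poly_Mapping.lookup u w))" if "finite A" for A
    using that by (induction A rule: finite_induct) (use assms assms(1)[of 0 0] in auto)
  have "u = (\<Sum>w\<in>Poly_Mapping.keys u. Poly_Mapping.single w (Poly_Mapping.lookup u w))"
    by (rule poly_mapping_sum_single)
  with *[OF finite_keys[of u]] show ?thesis by metis
qed

lemma word_act_add: "word_act op (v + w) f = word_act op v (word_act op w f)"
  by (simp add: word_act_def)

lemma lin_word_act:
  assumes "\<And>x. lin (op x)"
  shows "lin (word_act op w)"
proof -
  have "lin (foldr op xs)" for xs
    by (induction xs) (auto simp: lin_def lin_add[OF assms] lin_sc[OF assms])
  then show ?thesis by (simp add: word_act_def lin_def)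
qed

lemma lin_free_act: "(\<And>x. lin (op x)) \<Longrightarrow> lin (free_act op u)"
  unfolding free_act_def by (intro lin_setsum lin_smul lin_word_act)

text \<open>The coefficients of \<open>v\<close> have to pass through the operators of
  \<open>u\<close>, which is where linearity of each \<open>op x\<close> enters.\<close>

lemma free_act_mult:
  assumes "\<And>x. lin (op x)"
  shows "free_act op (u * v) f = free_act op u (free_act op v f)"
proof (induction u rule: free_alg_single_induct)
  case (1 w c)
  show ?case
  proof (induction v rule: free_alg_single_induct)
    case (1 w' c')
    show ?case
      by (simp add: mult_single free_act_single word_act_add lin_sc[OF lin_word_act[OF assms]])
  next
    case (2 u v)
    then have "free_act op (Poly_Mapping.single w c * (u + v)) f =
        free_act op (Poly_Mapping.single w c) (free_act op (u + v) f)"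
      by (simp add: distrib_left free_act_add lin_add[OF lin_free_act[OF assms]])
    then show ?case .
  qed
next
  case (2 u v)
  then show ?case by (simp add: distrib_right free_act_add)
qed

lemma free_map_mult: "free_map f (u * v) = free_map f u * free_map f v"
proof (induction u rule: free_alg_single_induct)
  case (1 w c)
  show ?case
    by (induction v rule: free_alg_single_induct)
      (simp_all add: mult_single free_map_single distrib_left free_map_add plus_free_monoid_def)
next
  case (2 u v)
  then show ?case by (simp add: distrib_right free_map_add)
qed

lemma free_act_letter: "free_act op (letter x) f = op x f"
  by (simp add: letter_def free_act_single word_act_def)

lemma free_act_const: "free_act op (const c) f = sc c f"
  by (simp add: const_def free_act_single word_act_def)

lemma free_map_letter: "free_map f (letter x) = letter (f x)"
  by (simp add: letter_def free_map_single)

lemma free_map_const: "free_map f (const c) = const c"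
  by (simp add: const_def free_map_single zero_free_monoid_def)

lemma const_one: "const 1 = 1"
  by (simp add: const_def)

lemma const_zero: "const 0 = 0"
  by (simp add: const_def)

lemma const_add: "const (a + b) = const a + const b"
  by (simp add: const_def single_add)

lemma const_mult: "const (a * b) = const a * const b"
  by (simp add: const_def mult_single)

lemma const_central: "const c * u = u * const c"
  by (induction u rule: free_alg_single_induct)
    (simp_all add: const_def mult_single mult.commute distrib_left distrib_right)

lemma carrier_free_algebra:
  "u \<in> carrier (free_algebra \<aa>) \<longleftrightarrow> (\<forall>w\<in>Poly_Mapping.keys u. set (letters w) \<subseteq> \<aa>)"
  by (simp add: free_algebra_def)

lemma free_algebra_simps [simp]:
  "u \<otimes>\<^bsub>free_algebra \<aa>\<^esub> v = u * v" "u \<oplus>\<^bsub>free_algebra \<aa>\<^esub> v = u + v"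
  "\<one>\<^bsub>free_algebra \<aa>\<^esub> = 1" "\<zero>\<^bsub>free_algebra \<aa>\<^esub> = 0"
  by (simp_all add: free_algebra_def)

lemma free_algebra_closed:
  "0 \<in> carrier (free_algebra \<aa>)" "1 \<in> carrier (free_algebra \<aa>)"
  "u \<in> carrier (free_algebra \<aa>) \<Longrightarrow> v \<in> carrier (free_algebra \<aa>) \<Longrightarrow> u + v \<in> carrier (free_algebra \<aa>)"
  "u \<in> carrier (free_algebra \<aa>) \<Longrightarrow> v \<in> carrier (free_algebra \<aa>) \<Longrightarrow> u * v \<in> carrier (free_algebra \<aa>)"
  "u \<in> carrier (free_algebra \<aa>) \<Longrightarrow> - u \<in> carrier (free_algebra \<aa>)"
  "u \<in> carrier (free_algebra \<aa>) \<Longrightarrow> v \<in> carrier (free_algebra \<aa>) \<Longrightarrow> u - v \<in> carrier (free_algebra \<aa>)"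
  "const c \<in> carrier (free_algebra \<aa>)"
  "x \<in> \<aa> \<Longrightarrow> letter x \<in> carrier (free_algebra \<aa>)"
proof -
  show "const c \<in> carrier (free_algebra \<aa>)"
    by (auto simp: carrier_free_algebra const_def zero_free_monoid_def split: if_splits)
  show "x \<in> \<aa> \<Longrightarrow> letter x \<in> carrier (free_algebra \<aa>)"
    by (auto simp: carrier_free_algebra letter_def)
  show "u \<in> carrier (free_algebra \<aa>) \<Longrightarrow> v \<in> carrier (free_algebra \<aa>) \<Longrightarrow> u * v \<in> carrier (free_algebra \<aa>)"
    using keys_mult[of u v] by (fastforce simp: carrier_free_algebra)
  show "u \<in> carrier (free_algebra \<aa>) \<Longrightarrow> v \<in> carrier (free_algebra \<aa>) \<Longrightarrow> u + v \<in> carrier (free_algebra \<aa>)"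
    using Poly_Mapping.keys_add[of u v] by (fastforce simp: carrier_free_algebra)
  show "u \<in> carrier (free_algebra \<aa>) \<Longrightarrow> v \<in> carrier (free_algebra \<aa>) \<Longrightarrow> u - v \<in> carrier (free_algebra \<aa>)"
    using keys_diff[of u v] by (fastforce simp: carrier_free_algebra)
qed (auto simp: carrier_free_algebra zero_free_monoid_def)

lemma ring_free_algebra: "ring (free_algebra \<aa>)"
proof (rule ringI)
  show "abelian_group (free_algebra \<aa>)"
    by (rule abelian_groupI) (auto simp: free_algebra_closed algebra_simps intro!: bexI[of _ "- u" for u])
  show "Group.monoid (free_algebra \<aa>)"
    by (rule monoidI) (auto simp: free_algebra_closed algebra_simps)
qed (auto simp: algebra_simps)

lemma free_algebra_a_inv: "u \<in> carrier (free_algebra \<aa>) \<Longrightarrow> \<ominus>\<^bsub>free_algebra \<aa>\<^esub> u = - u"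
  by (rule abelian_group.minus_equality[OF ring.is_abelian_group[OF ring_free_algebra]])
    (auto simp: free_algebra_closed)

text \<open>Words over \<aa> are products of letters, and every element is a finite sum of scaled
  words; the constants cover the empty word. Membership in the carrier is carried along so that the
  closure hypotheses apply to the partial sums.\<close>

lemma free_algebra_induct [consumes 1, case_names const letter add mult]:
  assumes u: "u \<in> carrier (free_algebra \<aa>)" and c: "\<And>c. P (const c)"
    and l: "\<And>x. x \<in> \<aa> \<Longrightarrow> P (letter x)"
    and a: "\<And>u v. u \<in> carrier (free_algebra \<aa>) \<Longrightarrow> v \<in> carrier (free_algebra \<aa>) \<Longrightarrow> P u \<Longrightarrow> P v \<Longrightarrow> P (u + v)"
    and m: "\<And>u v. u \<in> carrier (free_algebra \<aa>) \<Longrightarrow> v \<in> carrier (free_algebra \<aa>) \<Longrightarrow> P u \<Longrightarrow> P v \<Longrightarrow> P (u * v)"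
  shows "P u"
proof -
  have w: "P (Poly_Mapping.single (Word xs) c) \<and> Poly_Mapping.single (Word xs) c \<in> carrier (free_algebra \<aa>)"
    if "set xs \<subseteq> \<aa>" for xs c
    using that
  proof (induction xs)
    case Nil
    then show ?case
      using c[of c] free_algebra_closed(7)[of c \<aa>] by (simp add: const_def zero_free_monoid_def)
  next
    case (Cons x xs)
    have "Poly_Mapping.single (Word (x # xs)) c = letter x * Poly_Mapping.single (Word xs) c"
      by (simp add: letter_def mult_single plus_free_monoid_def)
    with Cons show ?case by (auto intro: m l free_algebra_closed)
  qed
  have *: "P (\<Sum>w\<in>A. Poly_Mapping.single w (Poly_Mapping.lookup u w)) \<and>
    (\<Sum>w\<in>A. Poly_Mapping.single w (Poly_Mapping.lookup u w)) \<in> carrier (free_algebra \<aa>)"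
    if "finite A" "\<forall>w\<in>A. set (letters w) \<subseteq> \<aa>" for A
    using that
  proof (induction A rule: finite_induct)
    case empty
    then show ?case using c[of 0] by (simp add: const_zero free_algebra_closed)
  next
    case (insert w A)
    then show ?case
      using w[of "letters w" "Poly_Mapping.lookup u w"] by (auto intro!: a free_algebra_closed)
  qed
  have "u = (\<Sum>w\<in>Poly_Mapping.keys u. Poly_Mapping.single w (Poly_Mapping.lookup u w))"
    by (rule poly_mapping_sum_single)
  with *[OF finite_keys[of u]] u show ?thesis unfolding carrier_free_algebra by metis
qed

section \<open>Universal enveloping algebras\<close>

lemma free_algebra_idealI:
  assumes "J \<subseteq> carrier (free_algebra \<aa>)" "0 \<in> J"
    and "\<And>a b. a \<in> J \<Longrightarrow> b \<in> J \<Longrightarrow> a + b \<in> J" and neg: "\<And>a. a \<in> J \<Longrightarrow> - a \<in> J"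
    and "\<And>a x. a \<in> J \<Longrightarrow> x \<in> carrier (free_algebra \<aa>) \<Longrightarrow> x * a \<in> J"
    and "\<And>a x. a \<in> J \<Longrightarrow> x \<in> carrier (free_algebra \<aa>) \<Longrightarrow> a * x \<in> J"
  shows "ideal J (free_algebra \<aa>)"
proof (rule idealI[OF ring_free_algebra])
  show "subgroup J (add_monoid (free_algebra \<aa>))"
  proof (rule group.subgroupI)
    show "group (add_monoid (free_algebra \<aa>))"
      using abelian_group.a_group[OF ring.is_abelian_group[OF ring_free_algebra]] .
    fix a assume a: "a \<in> J"
    then have "inv\<^bsub>add_monoid (free_algebra \<aa>)\<^esub> a = - a"
      using free_algebra_a_inv[of a \<aa>] assms(1) unfolding a_inv_def by blast
    with a neg show "inv\<^bsub>add_monoid (free_algebra \<aa>)\<^esub> a \<in> J" by simp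
  qed (use assms in auto)
qed (use assms in auto)

text \<open>These closure properties place the defining relations inside the free algebra on \<aa>.
  The bracket concerns homogeneous arguments, because its sign is read off from their
  parities.\<close>

locale lie_subspace =
  fixes m n :: nat and \<aa> :: "mat set"
  assumes add_mem: "x \<in> \<aa> \<Longrightarrow> y \<in> \<aa> \<Longrightarrow> x + y \<in> \<aa>"
    and scale_mem: "x \<in> \<aa> \<Longrightarrow> mat_scale c x \<in> \<aa>"
    and bracket_mem: "x \<in> \<aa> \<Longrightarrow> y \<in> \<aa> \<Longrightarrow> homogeneous p x \<Longrightarrow> homogeneous q y \<Longrightarrow>
      superbracket m n p q x y \<in> \<aa>"
begin

abbreviation "F \<equiv> free_algebra \<aa>"
abbreviation "I \<equiv> enveloping_ideal m n \<aa>"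
abbreviation "U \<equiv> UEA m n \<aa>"
abbreviation "cls \<equiv> UEA_class m n \<aa>"

lemma rels_carrier: "enveloping_rels m n \<aa> \<subseteq> carrier F"
  unfolding enveloping_rels_def
  by (auto intro!: free_algebra_closed add_mem scale_mem bracket_mem)

lemma ideal_I: "ideal I F"
  unfolding enveloping_ideal_def by (rule ring.genideal_ideal[OF ring_free_algebra rels_carrier])

lemma rels_I: "enveloping_rels m n \<aa> \<subseteq> I"
  unfolding enveloping_ideal_def by (rule ring.genideal_self[OF ring_free_algebra rels_carrier])

lemma I_minimal: "ideal J F \<Longrightarrow> enveloping_rels m n \<aa> \<subseteq> J \<Longrightarrow> I \<subseteq> J"
  unfolding enveloping_ideal_def by (rule ring.genideal_minimal[OF ring_free_algebra])

lemma ring_U: "ring U"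
  unfolding UEA_def by (rule ideal.quotient_is_ring[OF ideal_I])

lemma cls_hom: "cls \<in> ring_hom F U"
  unfolding UEA_def UEA_class_def[abs_def] by (rule ideal.rcos_ring_hom[OF ideal_I])

lemma carrier_U: "carrier U = cls ` carrier F"
  by (auto simp: UEA_def UEA_class_def[abs_def] FactRing_def A_RCOSETS_def')

lemma cls_closed: "u \<in> carrier F \<Longrightarrow> cls u \<in> carrier U"
  by (simp add: carrier_U)

lemma cls_add: "u \<in> carrier F \<Longrightarrow> v \<in> carrier F \<Longrightarrow> cls u \<oplus>\<^bsub>U\<^esub> cls v = cls (u + v)"
  using ring_hom_add[OF cls_hom] by simp

lemma cls_mult: "u \<in> carrier F \<Longrightarrow> v \<in> carrier F \<Longrightarrow> cls u \<otimes>\<^bsub>U\<^esub> cls v = cls (u * v)"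
  using ring_hom_mult[OF cls_hom] by simp

lemma cls_one: "cls 1 = \<one>\<^bsub>U\<^esub>"
  using ring_hom_one[OF cls_hom] by simp

lemma cls_zero: "cls 0 = \<zero>\<^bsub>U\<^esub>"
  using ring_hom_zero[OF cls_hom ring_free_algebra ring_U] by simp

lemma mem_cls: "u \<in> carrier F \<Longrightarrow> v \<in> cls u \<longleftrightarrow> v \<in> carrier F \<and> v - u \<in> I"
proof -
  assume u: "u \<in> carrier F"
  have sub: "I \<subseteq> carrier F"
    using ideal.Icarr[OF ideal_I] by blast
  have "v \<in> cls u \<longleftrightarrow> (\<exists>i\<in>I. v = i + u)"
    by (auto simp: UEA_class_def a_r_coset_def' )
  also have "\<dots> \<longleftrightarrow> v - u \<in> I" by (metis add_diff_cancel diff_add_cancel)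
  also have "\<dots> \<longleftrightarrow> v \<in> carrier F \<and> v - u \<in> I"
    using sub u free_algebra_closed(3)[of "v - u" \<aa> u] by auto
  finally show ?thesis .
qed

lemma I_add: "u \<in> I \<Longrightarrow> v \<in> I \<Longrightarrow> u + v \<in> I"
  using additive_subgroup.a_closed[OF ideal.axioms(1)[OF ideal_I]] by simp

lemma I_neg: "u \<in> I \<Longrightarrow> - u \<in> I"
  using additive_subgroup.a_inv_closed[OF ideal.axioms(1)[OF ideal_I], of u]
    free_algebra_a_inv ideal.Icarr[OF ideal_I, of u] by metis

lemma cls_eqI:
  assumes "u \<in> carrier F" "v \<in> carrier F" "u - v \<in> I"
  shows "cls u = cls v"
proof -
  have "w - u \<in> I \<longleftrightarrow> w - v \<in> I" for w
    using I_add[of "w - u" "u - v"] I_add[of "w - v" "- (u - v)"] I_neg[OF assms(3)] assms(3) by auto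
  then show ?thesis using mem_cls[OF assms(1)] mem_cls[OF assms(2)] by blast
qed

lemma cls_self: "u \<in> carrier F \<Longrightarrow> u \<in> cls u"
  using additive_subgroup.zero_closed[OF ideal.axioms(1)[OF ideal_I]]
  by (simp add: mem_cls)

abbreviation "gen \<equiv> UEA_gen m n \<aa>"
abbreviation "cst \<equiv> UEA_const m n \<aa>"

lemma gen_closed: "x \<in> \<aa> \<Longrightarrow> gen x \<in> carrier U"
  and cst_closed: "cst c \<in> carrier U"
  by (auto intro: cls_closed free_algebra_closed)

lemma gen_add:
  assumes "x \<in> \<aa>" "y \<in> \<aa>" shows "gen (x + y) = gen x \<oplus>\<^bsub>U\<^esub> gen y"
proof -
  have "letter (x + y) - letter x - letter y \<in> I"
    using rels_I assms unfolding enveloping_rels_def by blast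
  then have "cls (letter (x + y)) = cls (letter x + letter y)"
    using assms by (intro cls_eqI free_algebra_closed add_mem) (auto simp: diff_diff_eq)
  then show ?thesis using assms by (simp add: cls_add free_algebra_closed)
qed

lemma gen_scale:
  assumes "x \<in> \<aa>" shows "gen (mat_scale c x) = cst c \<otimes>\<^bsub>U\<^esub> gen x"
proof -
  have "letter (mat_scale c x) - const c * letter x \<in> I"
    using rels_I assms unfolding enveloping_rels_def by blast
  then have "cls (letter (mat_scale c x)) = cls (const c * letter x)"
    using assms by (intro cls_eqI free_algebra_closed scale_mem) auto
  then show ?thesis using assms by (simp add: cls_mult free_algebra_closed)
qed

lemma gen_bracket:
  assumes "x \<in> \<aa>" "y \<in> \<aa>" "homogeneous p x" "homogeneous q y"
  shows "gen x \<otimes>\<^bsub>U\<^esub> gen y =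
    cst ((-1) ^ (p * q)) \<otimes>\<^bsub>U\<^esub> (gen y \<otimes>\<^bsub>U\<^esub> gen x) \<oplus>\<^bsub>U\<^esub> gen (superbracket m n p q x y)"
proof -
  have "letter x * letter y - const ((-1) ^ (p * q)) * letter y * letter x
        - letter (superbracket m n p q x y) \<in> I"
    using rels_I assms unfolding enveloping_rels_def by blast
  then have "cls (letter x * letter y) =
      cls (const ((-1) ^ (p * q)) * (letter y * letter x) + letter (superbracket m n p q x y))"
    using assms bracket_mem[OF assms]
    by (intro cls_eqI free_algebra_closed) (auto simp: algebra_simps)
  then show ?thesis
    using assms bracket_mem[OF assms] by (simp add: cls_mult cls_add free_algebra_closed)
qed

lemma cst_one: "cst 1 = \<one>\<^bsub>U\<^esub>"
  by (simp add: const_one cls_one)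

lemma cst_zero: "cst 0 = \<zero>\<^bsub>U\<^esub>"
  by (simp add: const_zero cls_zero)

lemma cst_add: "cst (a + b) = cst a \<oplus>\<^bsub>U\<^esub> cst b"
  by (simp add: const_add cls_add free_algebra_closed)

lemma cst_mult: "cst (a * b) = cst a \<otimes>\<^bsub>U\<^esub> cst b"
  by (simp add: const_mult cls_mult free_algebra_closed)

lemma U_induct [consumes 1, case_names cst gen add mult]:
  assumes u: "u \<in> carrier U" and c: "\<And>c. P (cst c)"
    and l: "\<And>x. x \<in> \<aa> \<Longrightarrow> P (gen x)"
    and a: "\<And>u v. u \<in> carrier U \<Longrightarrow> v \<in> carrier U \<Longrightarrow> P u \<Longrightarrow> P v \<Longrightarrow> P (u \<oplus>\<^bsub>U\<^esub> v)"
    and m: "\<And>u v. u \<in> carrier U \<Longrightarrow> v \<in> carrier U \<Longrightarrow> P u \<Longrightarrow> P v \<Longrightarrow> P (u \<otimes>\<^bsub>U\<^esub> v)"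
  shows "P u"
proof -
  obtain w where w: "w \<in> carrier F" "u = cls w"
    using u by (auto simp: carrier_U)
  from w(1) have "P (cls w)"
  proof (induction w rule: free_algebra_induct)
    case (add u v)
    then show ?case using a[of "cls u" "cls v"] by (simp add: cls_closed cls_add)
  next
    case (mult u v)
    then show ?case using m[of "cls u" "cls v"] by (simp add: cls_closed cls_mult)
  qed (auto intro: c l)
  then show ?thesis using w by simp
qed

lemma cst_central:
  assumes "u \<in> carrier U" shows "cst c \<otimes>\<^bsub>U\<^esub> u = u \<otimes>\<^bsub>U\<^esub> cst c"
  using assms by (auto simp: carrier_U cls_mult free_algebra_closed const_central)

end

section \<open>Functoriality of enveloping algebras\<close>

locale lie_map = A: lie_subspace m n \<aa> + B: lie_subspace m n \<bb> for m n \<aa> \<bb> +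
  fixes f :: "mat \<Rightarrow> mat"
  assumes f_mem: "x \<in> \<aa> \<Longrightarrow> f x \<in> \<bb>"
    and f_add: "x \<in> \<aa> \<Longrightarrow> y \<in> \<aa> \<Longrightarrow> f (x + y) = f x + f y"
    and f_scale: "x \<in> \<aa> \<Longrightarrow> f (mat_scale c x) = mat_scale c (f x)"
    and f_hom: "x \<in> \<aa> \<Longrightarrow> homogeneous p x \<Longrightarrow> homogeneous p (f x)"
    and f_bracket: "x \<in> \<aa> \<Longrightarrow> y \<in> \<aa> \<Longrightarrow> homogeneous p x \<Longrightarrow> homogeneous q y \<Longrightarrow>
      f (superbracket m n p q x y) = superbracket m n p q (f x) (f y)"
begin

abbreviation "\<phi> \<equiv> UEA_map m n \<bb> f"

lemma free_map_closed: "u \<in> carrier A.F \<Longrightarrow> free_map f u \<in> carrier B.F"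
  by (induction u rule: free_algebra_induct)
    (auto simp: free_map_const free_map_letter free_map_add free_map_mult
      intro!: free_algebra_closed f_mem)

lemma free_map_rels: "free_map f ` enveloping_rels m n \<aa> \<subseteq> enveloping_rels m n \<bb>"
proof
  fix y assume "y \<in> free_map f ` enveloping_rels m n \<aa>"
  then obtain r where r: "r \<in> enveloping_rels m n \<aa>" and y: "y = free_map f r" by blast
  note s = y free_map_diff free_map_mult free_map_letter free_map_const
  from r consider (a) x x' where "x \<in> \<aa>" "x' \<in> \<aa>" "r = letter (x + x') - letter x - letter x'"
    | (s) c x where "x \<in> \<aa>" "r = letter (mat_scale c x) - const c * letter x"
    | (b) p q x x' where "x \<in> \<aa>" "x' \<in> \<aa>" "homogeneous p x" "homogeneous q x'"
      "r = letter x * letter x' - const ((-1) ^ (p * q)) * letter x' * letter x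
        - letter (superbracket m n p q x x')"
    unfolding enveloping_rels_def by blast
  then show "y \<in> enveloping_rels m n \<bb>"
  proof cases
    case a
    then show ?thesis
      by (auto simp: s f_add enveloping_rels_def intro!: f_mem)
  next
    case s
    then have "y = letter (mat_scale c (f x)) - const c * letter (f x)"
      by (simp add: y free_map_diff free_map_mult free_map_letter free_map_const f_scale)
    with s f_mem show ?thesis unfolding enveloping_rels_def by blast
  next
    case b
    then have "y = letter (f x) * letter (f x') - const ((-1) ^ (p * q)) * letter (f x') * letter (f x)
        - letter (superbracket m n p q (f x) (f x'))"
      by (simp add: s f_bracket)
    with b f_mem f_hom show ?thesis unfolding enveloping_rels_def by blast
  qed
qed

text \<open>The preimage of the target ideal is a two-sided ideal containing the relations of the
  source, so minimality of the generated ideal gives the inclusion.\<close>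

lemma free_map_ideal: "u \<in> A.I \<Longrightarrow> free_map f u \<in> B.I"
proof -
  let ?J = "{u \<in> carrier A.F. free_map f u \<in> B.I}"
  interpret BI: ideal B.I B.F by (rule B.ideal_I)
  have z: "0 \<in> B.I" by (rule additive_subgroup.zero_closed[OF BI.additive_subgroup_axioms, unfolded free_algebra_simps])
  have "ideal ?J A.F"
    by (rule free_algebra_idealI)
      (use BI.I_l_closed BI.I_r_closed in
        \<open>auto simp: free_map_mult free_map_closed free_algebra_closed free_map_add free_map_uminus z
          intro: B.I_add B.I_neg\<close>)
  moreover have "enveloping_rels m n \<aa> \<subseteq> ?J"
    using A.rels_carrier B.rels_I free_map_rels by blast
  ultimately show "u \<in> A.I \<Longrightarrow> free_map f u \<in> B.I" using A.I_minimal by blast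
qed

text \<open>\<open>UEA_map\<close> is a union over all representatives of a class; by
  \<open>free_map_ideal\<close> each of them contributes the same coset.\<close>

lemma map_cls:
  assumes "u \<in> carrier A.F" shows "\<phi> (A.cls u) = B.cls (free_map f u)"
proof -
  have "B.cls (free_map f v) = B.cls (free_map f u)" if "v \<in> A.cls u" for v
    using that free_map_ideal[of "v - u"] A.mem_cls[OF assms] assms
    by (intro B.cls_eqI free_map_closed) (auto simp: free_map_diff)
  then show ?thesis
    using A.cls_self[OF assms] unfolding UEA_map_def free_map_def by blast
qed

lemma map_ring_hom: "\<phi> \<in> ring_hom A.U B.U"
proof (rule ring_hom_memI)
  fix x y assume "x \<in> carrier A.U" "y \<in> carrier A.U"
  then obtain u v where *: "u \<in> carrier A.F" "v \<in> carrier A.F" "x = A.cls u" "y = A.cls v"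
    by (auto simp: A.carrier_U)
  then show "\<phi> (x \<otimes>\<^bsub>A.U\<^esub> y) = \<phi> x \<otimes>\<^bsub>B.U\<^esub> \<phi> y"
    by (simp add: A.cls_mult map_cls free_algebra_closed free_map_closed free_map_mult B.cls_mult)
  from * show "\<phi> (x \<oplus>\<^bsub>A.U\<^esub> y) = \<phi> x \<oplus>\<^bsub>B.U\<^esub> \<phi> y"
    by (simp add: A.cls_add map_cls free_algebra_closed free_map_closed free_map_add B.cls_add)
next
  have "free_map f 1 = 1" using free_map_const[of f 1] by (simp add: const_one)
  then show "\<phi> \<one>\<^bsub>A.U\<^esub> = \<one>\<^bsub>B.U\<^esub>"
    by (simp add: A.cls_one[symmetric] B.cls_one[symmetric] map_cls free_algebra_closed)
next
  fix x assume "x \<in> carrier A.U"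
  then show "\<phi> x \<in> carrier B.U"
    by (auto simp: A.carrier_U map_cls free_map_closed intro!: B.cls_closed)
qed

lemma map_gen: "x \<in> \<aa> \<Longrightarrow> \<phi> (A.gen x) = B.gen (f x)"
  by (simp add: map_cls free_algebra_closed free_map_letter)

lemma map_cst: "\<phi> (A.cst c) = B.cst c"
  by (simp add: map_cls free_algebra_closed free_map_const)

end

section \<open>Representations of enveloping algebras by linear operators\<close>

locale op_rep = lie_subspace m n \<aa> for m n \<aa> +
  fixes W :: "('b \<Rightarrow> complex) set" and op :: "mat \<Rightarrow> ('b \<Rightarrow> complex) \<Rightarrow> 'b \<Rightarrow> complex"
  assumes W: "fs.subspace W"
    and lin_op: "lin (op x)"
    and op_mem: "x \<in> \<aa> \<Longrightarrow> f \<in> W \<Longrightarrow> op x f \<in> W"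
    and op_add: "x \<in> \<aa> \<Longrightarrow> y \<in> \<aa> \<Longrightarrow> f \<in> W \<Longrightarrow> op (x + y) f = op x f + op y f"
    and op_scale: "x \<in> \<aa> \<Longrightarrow> f \<in> W \<Longrightarrow> op (mat_scale c x) f = sc c (op x f)"
    and op_bracket: "x \<in> \<aa> \<Longrightarrow> y \<in> \<aa> \<Longrightarrow> homogeneous p x \<Longrightarrow> homogeneous q y \<Longrightarrow> f \<in> W \<Longrightarrow>
      op x (op y f) - sc ((-1) ^ (p * q)) (op y (op x f)) = op (superbracket m n p q x y) f"
begin

lemma free_act_mem: "u \<in> carrier F \<Longrightarrow> f \<in> W \<Longrightarrow> free_act op u f \<in> W"
proof (induction u arbitrary: f rule: free_algebra_induct)
  case (const c)
  then show ?case using W by (simp add: free_act_const fs.subspace_scale)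
next
  case (letter x)
  then show ?case by (simp add: free_act_letter op_mem)
next
  case (add u v)
  then have "free_act op (u + v) f \<in> W" using W by (simp add: free_act_add fs.subspace_add)
  then show ?case .
next
  case (mult u v)
  then show ?case by (simp add: free_act_mult[OF lin_op])
qed

text \<open>The elements annihilating \<open>W\<close> form a two-sided ideal: left multiples
  because operators are linear, right multiples because \<open>W\<close> is stable. It contains the
  relations, hence the ideal they generate.\<close>

lemma free_act_ideal: "u \<in> I \<Longrightarrow> f \<in> W \<Longrightarrow> free_act op u f = 0"
proof -
  let ?J = "{u \<in> carrier F. \<forall>f\<in>W. free_act op u f = 0}"
  have 0: "0 \<in> W" using W by (rule fs.subspace_0)
  have neg: "free_act op (- a) f = - free_act op a f" for a f
    using free_act_diff[of op 0 a f] by simp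
  have "ideal ?J F"
    by (rule free_algebra_idealI)
      (auto simp: free_act_mult[OF lin_op] free_act_mem free_algebra_closed neg free_act_add
      lin_zero[OF lin_free_act[OF lin_op]])
  moreover have "enveloping_rels m n \<aa> \<subseteq> ?J"
  proof
    fix r assume r: "r \<in> enveloping_rels m n \<aa>"
    note s = free_act_diff free_act_mult[OF lin_op] free_act_letter free_act_const
    from r consider (a) x x' where "x \<in> \<aa>" "x' \<in> \<aa>" "r = letter (x + x') - letter x - letter x'"
      | (s) c x where "x \<in> \<aa>" "r = letter (mat_scale c x) - const c * letter x"
      | (b) p q x x' where "x \<in> \<aa>" "x' \<in> \<aa>" "homogeneous p x" "homogeneous q x'"
        "r = letter x * letter x' - const ((-1) ^ (p * q)) * letter x' * letter x
          - letter (superbracket m n p q x x')"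
      unfolding enveloping_rels_def by blast
    then have "\<forall>f\<in>W. free_act op r f = 0"
    proof cases
      case a
      have "op (x + x') f - op x f - op x' f = 0" if "f \<in> W" for f
        unfolding op_add[OF a(1,2) that] by (simp add: fun_eq_iff)
      then show ?thesis unfolding a(3) s by blast
    next
      case s
      then show ?thesis
        by (simp add: free_act_diff free_act_mult[OF lin_op] free_act_letter free_act_const op_scale)
    next
      case b
      have "free_act op r f = 0" if "f \<in> W" for f
        unfolding b(5) s op_bracket[OF b(1-4) that, symmetric] by simp
      then show ?thesis by blast
    qed
    then show "r \<in> ?J" using r rels_carrier by auto
  qed
  ultimately show "u \<in> I \<Longrightarrow> f \<in> W \<Longrightarrow> free_act op u f = 0"
    using I_minimal by blast
qed

text \<open>A class acts through an arbitrary representative. By \<open>free_act_ideal\<close> the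
  choice is immaterial on \<open>W\<close>.\<close>

definition act :: "free_alg set \<Rightarrow> ('b \<Rightarrow> complex) \<Rightarrow> 'b \<Rightarrow> complex" where
  "act A = free_act op (SOME u. u \<in> A)"

definition rep_module :: "(free_alg set, 'b \<Rightarrow> complex) module" where
  "rep_module = \<lparr>carrier = W, monoid.mult = undefined, one = undefined,
     ring.zero = 0, ring.add = (+), smult = act\<rparr>"

lemma act_cls:
  assumes "u \<in> carrier F" "f \<in> W" shows "act (cls u) f = free_act op u f"
proof -
  have "(SOME v. v \<in> cls u) \<in> cls u"
    using cls_self[OF assms(1)] by (rule someI)
  then have "(SOME v. v \<in> cls u) - u \<in> I" by (simp add: mem_cls[OF assms(1)])
  from free_act_ideal[OF this assms(2)] show ?thesis by (simp add: act_def free_act_diff)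
qed

lemma act_gen: "x \<in> \<aa> \<Longrightarrow> f \<in> W \<Longrightarrow> act (gen x) f = op x f"
  by (simp add: act_cls free_algebra_closed free_act_letter)

lemma act_cst: "f \<in> W \<Longrightarrow> act (cst c) f = sc c f"
  by (simp add: act_cls free_algebra_closed free_act_const)

lemma rep_module_simps [simp]:
  "carrier rep_module = W" "f \<oplus>\<^bsub>rep_module\<^esub> g = f + g" "\<zero>\<^bsub>rep_module\<^esub> = 0"
  "u \<odot>\<^bsub>rep_module\<^esub> f = act u f"
  by (simp_all add: rep_module_def)

lemma left_module_rep: "left_module U rep_module"
proof (intro left_module.intro left_module_axioms.intro ring_U)
  have neg: "\<exists>y\<in>W. y + x = 0" if "x \<in> W" for x
    using that W by (intro bexI[of _ "- x"]) (simp_all add: fs.subspace_neg)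
  show "abelian_group rep_module"
    by (rule abelian_groupI) (use W neg in \<open>auto simp: fs.subspace_add fs.subspace_0 algebra_simps\<close>)
  fix a x assume a: "a \<in> carrier U" and x: "x \<in> carrier rep_module"
  then obtain u where u: "u \<in> carrier F" "a = cls u" by (auto simp: carrier_U)
  from u x show "a \<odot>\<^bsub>rep_module\<^esub> x \<in> carrier rep_module"
    by (simp add: act_cls free_act_mem)
  {
    fix y assume "y \<in> carrier rep_module"
    with u x show "a \<odot>\<^bsub>rep_module\<^esub> (x \<oplus>\<^bsub>rep_module\<^esub> y) =
        a \<odot>\<^bsub>rep_module\<^esub> x \<oplus>\<^bsub>rep_module\<^esub> a \<odot>\<^bsub>rep_module\<^esub> y"
      using W by (simp add: act_cls fs.subspace_add lin_add[OF lin_free_act[OF lin_op]])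
  }
  fix b assume b: "b \<in> carrier U"
  then obtain v where v: "v \<in> carrier F" "b = cls v" by (auto simp: carrier_U)
  show "(a \<oplus>\<^bsub>U\<^esub> b) \<odot>\<^bsub>rep_module\<^esub> x = a \<odot>\<^bsub>rep_module\<^esub> x \<oplus>\<^bsub>rep_module\<^esub> b \<odot>\<^bsub>rep_module\<^esub> x"
    using u v x by (simp add: cls_add act_cls free_algebra_closed free_act_add)
  show "(a \<otimes>\<^bsub>U\<^esub> b) \<odot>\<^bsub>rep_module\<^esub> x = a \<odot>\<^bsub>rep_module\<^esub> (b \<odot>\<^bsub>rep_module\<^esub> x)"
    using u v x by (simp add: cls_mult act_cls free_algebra_closed free_act_mult[OF lin_op] free_act_mem)
next
  fix x assume "x \<in> carrier rep_module"
  then show "\<one>\<^bsub>U\<^esub> \<odot>\<^bsub>rep_module\<^esub> x = x"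
    using act_cst[of x 1] by (simp add: cst_one)
qed

end

section \<open>Modules and extension of scalars\<close>

lemma (in abelian_group) additive_map_zero:
  assumes "abelian_group N" "h \<in> carrier G \<rightarrow> carrier N"
    and "\<And>x y. x \<in> carrier G \<Longrightarrow> y \<in> carrier G \<Longrightarrow> h (x \<oplus> y) = h x \<oplus>\<^bsub>N\<^esub> h y"
  shows "h \<zero> = \<zero>\<^bsub>N\<^esub>"
proof -
  interpret N: abelian_group N by fact
  have c: "h \<zero> \<in> carrier N" using assms(2) by blast
  have "h \<zero> \<oplus>\<^bsub>N\<^esub> h \<zero> = h \<zero> \<oplus>\<^bsub>N\<^esub> \<zero>\<^bsub>N\<^esub>"
    using assms(3)[of \<zero> \<zero>] c by simp
  then show ?thesis using c by (metis N.add.l_cancel N.zero_closed)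
qed

lemma (in abelian_group) add_minus_cancel:
  "x \<in> carrier G \<Longrightarrow> y \<in> carrier G \<Longrightarrow> (x \<oplus> y) \<ominus> y = x"
  "x \<in> carrier G \<Longrightarrow> y \<in> carrier G \<Longrightarrow> (x \<ominus> y) \<oplus> y = x"
  by (simp_all add: minus_eq a_assoc r_neg l_neg)

lemma (in abelian_group) additive_map_minus:
  assumes "abelian_group N" "h \<in> carrier G \<rightarrow> carrier N"
    and h: "\<And>x y. x \<in> carrier G \<Longrightarrow> y \<in> carrier G \<Longrightarrow> h (x \<oplus> y) = h x \<oplus>\<^bsub>N\<^esub> h y"
    and xy: "x \<in> carrier G" "y \<in> carrier G"
  shows "h (x \<ominus> y) = h x \<ominus>\<^bsub>N\<^esub> h y"
proof -
  interpret N: abelian_group N by fact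
  have c: "h z \<in> carrier N" if "z \<in> carrier G" for z using assms(2) that by blast
  have "h x = h (x \<ominus> y) \<oplus>\<^bsub>N\<^esub> h y"
    using h[of "x \<ominus> y" y] xy by (simp add: add_minus_cancel)
  then show ?thesis using xy by (simp add: N.add_minus_cancel c)
qed

lemma (in left_module) smult_r_null: "a \<in> carrier R \<Longrightarrow> a \<odot>\<^bsub>M\<^esub> \<zero>\<^bsub>M\<^esub> = \<zero>\<^bsub>M\<^esub>"
  using M.additive_map_zero[OF M.abelian_group_axioms, of "\<lambda>x. a \<odot>\<^bsub>M\<^esub> x"] smult_closed smult_r_distr
  by blast

lemma (in left_module) smult_l_null: "x \<in> carrier M \<Longrightarrow> \<zero>\<^bsub>R\<^esub> \<odot>\<^bsub>M\<^esub> x = \<zero>\<^bsub>M\<^esub>"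
  using R.additive_map_zero[OF M.abelian_group_axioms, of "\<lambda>a. a \<odot>\<^bsub>M\<^esub> x"] smult_closed smult_l_distr
  by blast

definition module_hom ::
    "('r, 'q) ring_scheme \<Rightarrow> ('r, 'v, 'c) module_scheme \<Rightarrow> ('r, 'w, 'd) module_scheme \<Rightarrow> ('v \<Rightarrow> 'w) \<Rightarrow> bool" where
  "module_hom R M N h \<longleftrightarrow> h \<in> carrier M \<rightarrow> carrier N \<and>
     (\<forall>x\<in>carrier M. \<forall>y\<in>carrier M. h (x \<oplus>\<^bsub>M\<^esub> y) = h x \<oplus>\<^bsub>N\<^esub> h y) \<and>
     (\<forall>u\<in>carrier R. \<forall>x\<in>carrier M. h (u \<odot>\<^bsub>M\<^esub> x) = u \<odot>\<^bsub>N\<^esub> h x)"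

lemma module_homD:
  assumes "module_hom R M N h"
  shows "x \<in> carrier M \<Longrightarrow> h x \<in> carrier N"
    and "x \<in> carrier M \<Longrightarrow> y \<in> carrier M \<Longrightarrow> h (x \<oplus>\<^bsub>M\<^esub> y) = h x \<oplus>\<^bsub>N\<^esub> h y"
    and "u \<in> carrier R \<Longrightarrow> x \<in> carrier M \<Longrightarrow> h (u \<odot>\<^bsub>M\<^esub> x) = u \<odot>\<^bsub>N\<^esub> h x"
  using assms by (auto simp: module_hom_def)

lemma module_hom_zero:
  "module_hom R M N h \<Longrightarrow> left_module R M \<Longrightarrow> left_module R N \<Longrightarrow> h \<zero>\<^bsub>M\<^esub> = \<zero>\<^bsub>N\<^esub>"
  unfolding module_hom_def left_module_def
  by (intro abelian_group.additive_map_zero) auto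

lemma module_hom_minus:
  "module_hom R M N h \<Longrightarrow> left_module R M \<Longrightarrow> left_module R N \<Longrightarrow> x \<in> carrier M \<Longrightarrow> y \<in> carrier M \<Longrightarrow>
    h (x \<ominus>\<^bsub>M\<^esub> y) = h x \<ominus>\<^bsub>N\<^esub> h y"
  unfolding module_hom_def left_module_def
  by (intro abelian_group.additive_map_minus) auto

lemma module_hom_comp:
  "module_hom R M N g \<Longrightarrow> module_hom R N P h \<Longrightarrow> module_hom R M P (h \<circ> g)"
  by (auto simp: module_hom_def Pi_iff)

lemmas (in abelian_monoid) finsum_mono_neutral_cong_left = add.finprod_mono_neutral_cong_left
  and finsum_mono_neutral_cong_right = add.finprod_mono_neutral_cong_right

lemma module_hom_inv_into:
  assumes h: "module_hom R M N h" "bij_betw h (carrier M) (carrier N)" and M: "left_module R M"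
  shows "module_hom R N M (inv_into (carrier M) h)"
proof -
  interpret M: left_module R M by (rule M)
  let ?g = "inv_into (carrier M) h"
  have g: "?g y \<in> carrier M" "h (?g y) = y" if "y \<in> carrier N" for y
    using that h(2) by (auto simp: bij_betw_def inv_into_into f_inv_into_f)
  have gh: "?g (h x) = x" if "x \<in> carrier M" for x
    using that h(2) by (simp add: bij_betw_def)
  show ?thesis
    unfolding module_hom_def
  proof (intro conjI ballI)
    fix x y assume xy: "x \<in> carrier N" "y \<in> carrier N"
    show "?g (x \<oplus>\<^bsub>N\<^esub> y) = ?g x \<oplus>\<^bsub>M\<^esub> ?g y"
      using gh[of "?g x \<oplus>\<^bsub>M\<^esub> ?g y"] module_homD(2)[OF h(1), of "?g x" "?g y"] g xy by simp
  next
    fix u x assume ux: "u \<in> carrier R" "x \<in> carrier N"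
    show "?g (u \<odot>\<^bsub>N\<^esub> x) = u \<odot>\<^bsub>M\<^esub> ?g x"
      using gh[of "u \<odot>\<^bsub>M\<^esub> ?g x"] module_homD(3)[OF h(1) ux(1), of "?g x"] g ux M.smult_closed by simp
  qed (use g in auto)
qed

section \<open>The induced module and its universal property\<close>

locale scalar_extension = R: ring R + S: ring S + M: left_module S M
  for R :: "('r, 'q) ring_scheme" (structure) and S :: "('s, 'p) ring_scheme" (structure)
    and \<phi> :: "'s \<Rightarrow> 'r" and M :: "('s, 'v) module" (structure) +
  assumes \<phi>_hom: "\<phi> \<in> ring_hom S R"
begin

abbreviation "G \<equiv> free_Abelian_group (carrier R \<times> carrier M)"
abbreviation "T \<equiv> tensor_kernel R S \<phi> M"
abbreviation "K \<equiv> extend_scalars R S \<phi> M"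
abbreviation "tensor \<equiv> pure_tensor R S \<phi> M"

definition lmul :: "'r \<Rightarrow> (('r \<times> 'v) \<Rightarrow>\<^sub>0 int) \<Rightarrow> (('r \<times> 'v) \<Rightarrow>\<^sub>0 int)" where
  "lmul r = frag_extend (\<lambda>(u, x). frag_of (r \<otimes>\<^bsub>R\<^esub> u, x))"

definition q :: "(('r \<times> 'v) \<Rightarrow>\<^sub>0 int) \<Rightarrow> (('r \<times> 'v) \<Rightarrow>\<^sub>0 int) set" where
  "q c = T #>\<^bsub>G\<^esub> c"

lemma \<phi>_closed: "y \<in> carrier S \<Longrightarrow> \<phi> y \<in> carrier R"
  using \<phi>_hom by (rule ring_hom_closed)

lemma G_zero: "0 \<in> carrier G"
  and G_add: "a \<in> carrier G \<Longrightarrow> b \<in> carrier G \<Longrightarrow> a + b \<in> carrier G"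
  and G_diff: "a \<in> carrier G \<Longrightarrow> b \<in> carrier G \<Longrightarrow> a - b \<in> carrier G"
  and G_neg: "a \<in> carrier G \<Longrightarrow> - a \<in> carrier G"
  using Poly_Mapping.keys_add[of a b] keys_diff[of a b] by auto

lemma rels_G: "balanced_rels R S \<phi> M \<subseteq> carrier G"
  unfolding balanced_rels_def
  by (auto simp: \<phi>_closed M.smult_closed frag_of_in_free_Abelian_group
      simp del: carrier_free_Abelian_group_iff intro!: G_diff)

lemma T_subgroup: "subgroup T G"
  unfolding tensor_kernel_def by (intro group.generate_is_subgroup group_free_Abelian_group rels_G)

lemma rels_T: "balanced_rels R S \<phi> M \<subseteq> T"
  unfolding tensor_kernel_def by (auto intro: generate.incl)

lemma T_G: "c \<in> T \<Longrightarrow> c \<in> carrier G"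
  using subgroup.subset[OF T_subgroup] by blast

lemma T_zero: "0 \<in> T"
  using subgroup.one_closed[OF T_subgroup] by simp

lemma T_add: "a \<in> T \<Longrightarrow> b \<in> T \<Longrightarrow> a + b \<in> T"
  using subgroup.m_closed[OF T_subgroup] by simp

lemma T_neg: "a \<in> T \<Longrightarrow> - a \<in> T"
  using subgroup.m_inv_closed[OF T_subgroup, of a] T_G[of a] by simp

lemma T_diff: "a \<in> T \<Longrightarrow> b \<in> T \<Longrightarrow> a - b \<in> T"
  using T_add[of a "- b"] T_neg[of b] by simp

text \<open>Closure under zero and differences subsumes the identity, the inverses and the products
  of the generated subgroup, and the three kinds of relations become separate cases.\<close>

lemma T_induct [consumes 1, case_names zero diff add_left add_right balanced]:
  assumes "c \<in> T" and zero: "P 0" and diff: "\<And>a b. P a \<Longrightarrow> P b \<Longrightarrow> P (a - b)"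
    and add_left: "\<And>u u' x. u \<in> carrier R \<Longrightarrow> u' \<in> carrier R \<Longrightarrow> x \<in> carrier M \<Longrightarrow>
      P (frag_of (u \<oplus>\<^bsub>R\<^esub> u', x) - frag_of (u, x) - frag_of (u', x))"
    and add_right: "\<And>u x x'. u \<in> carrier R \<Longrightarrow> x \<in> carrier M \<Longrightarrow> x' \<in> carrier M \<Longrightarrow>
      P (frag_of (u, x \<oplus>\<^bsub>M\<^esub> x') - frag_of (u, x) - frag_of (u, x'))"
    and balanced: "\<And>u y x. u \<in> carrier R \<Longrightarrow> y \<in> carrier S \<Longrightarrow> x \<in> carrier M \<Longrightarrow>
      P (frag_of (u \<otimes>\<^bsub>R\<^esub> \<phi> y, x) - frag_of (u, y \<odot>\<^bsub>M\<^esub> x))"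
  shows "P c"
proof -
  have neg: "P (- a)" if "P a" for a using diff[OF zero that] by simp
  have plus: "P (a + b)" if "P a" "P b" for a b using diff[OF that(1) neg[OF that(2)]] by simp
  have rel: "P h" if "h \<in> balanced_rels R S \<phi> M" for h
    using that unfolding balanced_rels_def
    by (elim UnE CollectE exE conjE) (simp_all only: add_left add_right balanced)
  show ?thesis
    using assms(1) unfolding tensor_kernel_def
  proof (induction rule: generate.induct)
    case (inv h)
    then have "h \<in> carrier G" using rels_G by blast
    then have "inv\<^bsub>G\<^esub> h = - h" by simp
    then show ?case using neg rel inv by metis
  next
    case one
    then show ?case using zero by simp
  next
    case (incl h)
    then show ?case by (rule rel)
  next
    case (eng a b)
    then show ?case using plus by simp
  qed
qed

lemma T_normal: "T \<lhd> G"
  using comm_group.normal_iff_subgroup[OF abelian_free_Abelian_group] T_subgroup by blast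

lemma mem_q: "v \<in> q c \<longleftrightarrow> v - c \<in> T"
proof -
  have "v \<in> q c \<longleftrightarrow> (\<exists>i\<in>T. v = i + c)" by (auto simp: q_def r_coset_def)
  also have "\<dots> \<longleftrightarrow> v - c \<in> T" by (metis add_diff_cancel diff_add_cancel)
  finally show ?thesis .
qed

lemma q_eq_iff: "q a = q b \<longleftrightarrow> a - b \<in> T"
proof
  assume "q a = q b"
  then show "a - b \<in> T" using mem_q[of a a] mem_q[of a b] T_zero by simp
next
  assume *: "a - b \<in> T"
  have "v - a \<in> T \<longleftrightarrow> v - b \<in> T" for v
    using T_add[of "v - a" "a - b"] T_diff[of "v - b" "a - b"] * by auto
  then show "q a = q b" using mem_q by blast
qed

lemma q_self: "c \<in> q c"
  by (simp add: mem_q T_zero)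

lemma carrier_K: "carrier K = q ` carrier G"
  by (auto simp: extend_scalars_def Let_def FactGroup_def RCOSETS_def q_def)

lemma q_closed: "c \<in> carrier G \<Longrightarrow> q c \<in> carrier K"
  by (simp add: carrier_K)

lemma K_add: "a \<in> carrier G \<Longrightarrow> b \<in> carrier G \<Longrightarrow> q a \<oplus>\<^bsub>K\<^esub> q b = q (a + b)"
  using normal.rcos_sum[OF T_normal, of a b]
  by (simp add: extend_scalars_def Let_def FactGroup_def q_def)

lemma K_zero: "\<zero>\<^bsub>K\<^esub> = q 0"
proof -
  have "q 0 = T" by (auto simp: mem_q)
  then show ?thesis by (simp add: extend_scalars_def Let_def FactGroup_def)
qed

lemma lmul_of [simp]: "lmul r (frag_of (u, x)) = frag_of (r \<otimes>\<^bsub>R\<^esub> u, x)"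
  by (simp add: lmul_def)

lemma lmul_zero [simp]: "lmul r 0 = 0"
  and lmul_add: "lmul r (a + b) = lmul r a + lmul r b"
  and lmul_diff: "lmul r (a - b) = lmul r a - lmul r b"
  by (simp_all add: lmul_def frag_extend_add frag_extend_diff)

lemma G_induct [consumes 1, case_names zero diff tensor]:
  assumes "c \<in> carrier G" "P 0"
    and "\<And>x y. x \<in> carrier G \<Longrightarrow> y \<in> carrier G \<Longrightarrow> P x \<Longrightarrow> P y \<Longrightarrow> P (x - y)"
    and "\<And>u x. u \<in> carrier R \<Longrightarrow> x \<in> carrier M \<Longrightarrow> P (frag_of (u, x))"
  shows "P c"
  by (rule free_Abelian_group_induct[where S = "carrier R \<times> carrier M"]) (use assms in auto)

lemma lmul_G:
  assumes "r \<in> carrier R" "c \<in> carrier G" shows "lmul r c \<in> carrier G"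
  using assms(2)
proof (induction c rule: G_induct)
  case zero
  show ?case using G_zero by simp
next
  case (diff x y)
  then show ?case using G_diff by (simp add: lmul_diff del: carrier_free_Abelian_group_iff)
next
  case (tensor u x)
  then show ?case using assms(1) by simp
qed

lemma rel_T:
  "u \<in> carrier R \<Longrightarrow> u' \<in> carrier R \<Longrightarrow> x \<in> carrier M \<Longrightarrow>
    frag_of (u \<oplus>\<^bsub>R\<^esub> u', x) - frag_of (u, x) - frag_of (u', x) \<in> T"
  "u \<in> carrier R \<Longrightarrow> x \<in> carrier M \<Longrightarrow> x' \<in> carrier M \<Longrightarrow>
    frag_of (u, x \<oplus>\<^bsub>M\<^esub> x') - frag_of (u, x) - frag_of (u, x') \<in> T"
  "u \<in> carrier R \<Longrightarrow> y \<in> carrier S \<Longrightarrow> x \<in> carrier M \<Longrightarrow>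
    frag_of (u \<otimes>\<^bsub>R\<^esub> \<phi> y, x) - frag_of (u, y \<odot>\<^bsub>M\<^esub> x) \<in> T"
  by (rule subsetD[OF rels_T], unfold balanced_rels_def, blast)+

text \<open>Left multiplication turns each relation into a relation of the same kind; for the
  balanced ones this is associativity, since \<open>S\<close> acts on \<open>R\<close> from the
  right.\<close>

lemma lmul_T:
  assumes r: "r \<in> carrier R" and "c \<in> T" shows "lmul r c \<in> T"
  using assms(2)
proof (induction c rule: T_induct)
  case (add_left u u' x)
  then show ?case
    using r rel_T(1)[of "r \<otimes>\<^bsub>R\<^esub> u" "r \<otimes>\<^bsub>R\<^esub> u'" x] by (simp add: lmul_diff R.r_distr)
next
  case (add_right u x x')
  then show ?case using r rel_T(2)[of "r \<otimes>\<^bsub>R\<^esub> u" x x'] by (simp add: lmul_diff)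
next
  case (balanced u y x)
  then show ?case
    using r rel_T(3)[of "r \<otimes>\<^bsub>R\<^esub> u" y x] by (simp add: lmul_diff R.m_assoc \<phi>_closed)
qed (simp_all add: lmul_diff T_zero T_diff)

text \<open>The scalar multiplication of \<open>extend_scalars\<close> is a union over the
  representatives of a coset; \<open>lmul_T\<close> makes them all yield the same coset.\<close>

lemma K_smult:
  assumes "r \<in> carrier R" "c \<in> carrier G" shows "r \<odot>\<^bsub>K\<^esub> q c = q (lmul r c)"
proof -
  have "q (lmul r v) = q (lmul r c)" if "v \<in> q c" for v
    using that lmul_T[OF assms(1), of "v - c"] by (simp add: q_eq_iff mem_q lmul_diff)
  moreover have "r \<odot>\<^bsub>K\<^esub> q c = (\<Union>f\<in>q c. q (lmul r f))"
    by (simp add: extend_scalars_def Let_def q_def lmul_def)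
  ultimately show ?thesis using q_self[of c] by blast
qed

lemma tensor_eq: "tensor u x = q (frag_of (u, x))"
  by (simp add: pure_tensor_def q_def)

lemma left_module_K: "left_module R K"
proof (intro left_module.intro left_module_axioms.intro R.ring_axioms)
  show "abelian_group K"
  proof (rule abelian_groupI)
    fix x assume "x \<in> carrier K"
    then obtain a where "a \<in> carrier G" "x = q a" by (auto simp: carrier_K)
    then show "\<exists>y\<in>carrier K. y \<oplus>\<^bsub>K\<^esub> x = \<zero>\<^bsub>K\<^esub>"
      by (intro bexI[of _ "q (- a)"]) (simp_all only: K_add K_zero q_closed G_neg add.left_inverse)
  qed (auto simp: carrier_K K_add K_zero G_zero G_add ac_simps simp del: carrier_free_Abelian_group_iff)
  fix a x assume a: "a \<in> carrier R" and x: "x \<in> carrier K"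
  then obtain c where c: "c \<in> carrier G" "x = q c" by (auto simp: carrier_K)
  from a c show "a \<odot>\<^bsub>K\<^esub> x \<in> carrier K"
    by (simp add: K_smult q_closed lmul_G del: carrier_free_Abelian_group_iff)
  {
    fix y assume "y \<in> carrier K"
    then obtain d where d: "d \<in> carrier G" "y = q d" by (auto simp: carrier_K)
    with a c show "a \<odot>\<^bsub>K\<^esub> (x \<oplus>\<^bsub>K\<^esub> y) = a \<odot>\<^bsub>K\<^esub> x \<oplus>\<^bsub>K\<^esub> a \<odot>\<^bsub>K\<^esub> y"
      by (simp add: K_smult K_add lmul_G lmul_add G_add del: carrier_free_Abelian_group_iff)
  }
  fix b assume b: "b \<in> carrier R"
  \<comment> \<open>In the free abelian group the two sides involve different generators; they agree
    only modulo additivity in the first argument.\<close>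
  from c(1) have "lmul (a \<oplus>\<^bsub>R\<^esub> b) c - (lmul a c + lmul b c) \<in> T"
  proof (induction c rule: G_induct)
    case (diff x y)
    then show ?case
      using T_diff[OF diff(3,4)] by (simp add: lmul_diff algebra_simps)
  next
    case (tensor u x)
    then show ?case
      using rel_T(1)[of "a \<otimes>\<^bsub>R\<^esub> u" "b \<otimes>\<^bsub>R\<^esub> u" x] a b by (simp add: R.l_distr diff_diff_eq)
  qed (simp add: T_zero)
  then show "(a \<oplus>\<^bsub>R\<^esub> b) \<odot>\<^bsub>K\<^esub> x = a \<odot>\<^bsub>K\<^esub> x \<oplus>\<^bsub>K\<^esub> b \<odot>\<^bsub>K\<^esub> x"
    using a b c by (simp add: K_smult K_add lmul_G q_eq_iff del: carrier_free_Abelian_group_iff)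
  from c(1) have "lmul (a \<otimes>\<^bsub>R\<^esub> b) c = lmul a (lmul b c)"
    by (induction c rule: G_induct) (use a b in \<open>auto simp: lmul_diff R.m_assoc\<close>)
  then show "(a \<otimes>\<^bsub>R\<^esub> b) \<odot>\<^bsub>K\<^esub> x = a \<odot>\<^bsub>K\<^esub> (b \<odot>\<^bsub>K\<^esub> x)"
    using a b c by (simp add: K_smult lmul_G del: carrier_free_Abelian_group_iff)
next
  fix x assume x: "x \<in> carrier K"
  then obtain c where c: "c \<in> carrier G" "x = q c" by (auto simp: carrier_K)
  from c(1) have "lmul \<one>\<^bsub>R\<^esub> c = c"
    by (induction c rule: G_induct) (auto simp: lmul_diff)
  then show "\<one>\<^bsub>R\<^esub> \<odot>\<^bsub>K\<^esub> x = x"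
    using c by (simp add: K_smult del: carrier_free_Abelian_group_iff)
qed

sublocale K: left_module R K
  by (rule left_module_K)

lemma tensor_closed: "u \<in> carrier R \<Longrightarrow> x \<in> carrier M \<Longrightarrow> tensor u x \<in> carrier K"
  by (simp add: tensor_eq q_closed)

lemma tensor_smult:
  "r \<in> carrier R \<Longrightarrow> u \<in> carrier R \<Longrightarrow> x \<in> carrier M \<Longrightarrow> r \<odot>\<^bsub>K\<^esub> tensor u x = tensor (r \<otimes>\<^bsub>R\<^esub> u) x"
  by (simp add: tensor_eq K_smult)

lemma tensor_add_right:
  assumes "u \<in> carrier R" "x \<in> carrier M" "x' \<in> carrier M"
  shows "tensor u (x \<oplus>\<^bsub>M\<^esub> x') = tensor u x \<oplus>\<^bsub>K\<^esub> tensor u x'"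
proof -
  have "frag_of (u, x \<oplus>\<^bsub>M\<^esub> x') - frag_of (u, x) - frag_of (u, x') \<in> T"
    using assms by (rule rel_T)
  then have "q (frag_of (u, x \<oplus>\<^bsub>M\<^esub> x')) = q (frag_of (u, x) + frag_of (u, x'))"
    by (simp add: q_eq_iff diff_diff_eq)
  then show ?thesis using assms by (simp add: tensor_eq K_add)
qed

lemma tensor_balanced:
  assumes "u \<in> carrier R" "y \<in> carrier S" "x \<in> carrier M"
  shows "tensor (u \<otimes>\<^bsub>R\<^esub> \<phi> y) x = tensor u (y \<odot>\<^bsub>M\<^esub> x)"
proof -
  have "frag_of (u \<otimes>\<^bsub>R\<^esub> \<phi> y, x) - frag_of (u, y \<odot>\<^bsub>M\<^esub> x) \<in> T"
    using assms by (rule rel_T)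
  then show ?thesis by (simp add: q_eq_iff tensor_eq)
qed

lemma tensor_one: "u \<in> carrier R \<Longrightarrow> x \<in> carrier M \<Longrightarrow> tensor u x = u \<odot>\<^bsub>K\<^esub> tensor \<one>\<^bsub>R\<^esub> x"
  by (simp add: tensor_smult)

lemma K_induct [consumes 1, case_names zero diff tensor]:
  assumes "k \<in> carrier K" "P \<zero>\<^bsub>K\<^esub>"
    and d: "\<And>x y. x \<in> carrier K \<Longrightarrow> y \<in> carrier K \<Longrightarrow> P x \<Longrightarrow> P y \<Longrightarrow> P (x \<ominus>\<^bsub>K\<^esub> y)"
    and "\<And>u x. u \<in> carrier R \<Longrightarrow> x \<in> carrier M \<Longrightarrow> P (u \<odot>\<^bsub>K\<^esub> tensor \<one>\<^bsub>R\<^esub> x)"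
  shows "P k"
proof -
  obtain c where c: "c \<in> carrier G" "k = q c" using assms(1) by (auto simp: carrier_K)
  from c(1) have "P (q c)"
  proof (induction c rule: G_induct)
    case zero
    then show ?case using assms(2) by (simp add: K_zero)
  next
    case (diff x y)
    have "q x \<ominus>\<^bsub>K\<^esub> q y = q (x - y)"
    proof -
      have "q (x - y) \<oplus>\<^bsub>K\<^esub> q y = q x"
        using diff(1,2) by (simp add: K_add G_diff del: carrier_free_Abelian_group_iff)
      then show ?thesis
        using K.M.add_minus_cancel(1)[OF q_closed q_closed, OF G_diff[OF diff(1,2)] diff(2)] by simp
    qed
    then show ?case using d[OF q_closed q_closed, OF diff(1,2) diff(3,4)] by simp
  next
    case (tensor u x)
    then show ?case using assms(4)[OF tensor] tensor_one[OF tensor] by (simp add: tensor_eq)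
  qed
  then show ?thesis using c by simp
qed

lemma module_hom_eqI:
  assumes N: "left_module R N" and f: "module_hom R K N f" and g: "module_hom R K N g"
    and eq: "\<And>x. x \<in> carrier M \<Longrightarrow> f (tensor \<one>\<^bsub>R\<^esub> x) = g (tensor \<one>\<^bsub>R\<^esub> x)" and "k \<in> carrier K"
  shows "f k = g k"
  using assms(5)
proof (induction k rule: K_induct)
  case zero
  show ?case using module_hom_zero[OF f left_module_K N] module_hom_zero[OF g left_module_K N] by simp
next
  case (diff x y)
  then show ?case
    using module_hom_minus[OF f left_module_K N] module_hom_minus[OF g left_module_K N] by simp
next
  case (tensor u x)
  then show ?case using module_homD(3)[OF f] module_homD(3)[OF g] eq by (simp add: tensor_closed)
qed

text \<open>The free abelian group supplies an additive map sending the generator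
  \<open>(u, x)\<close> to \<open>u\<close> acting on \<open>j x\<close>. The module laws of
  \<open>N\<close> and the two hypotheses on \<open>j\<close> are what makes it vanish on the three
  kinds of relations.\<close>

lemma universal:
  assumes N: "left_module R N" and j: "j \<in> carrier M \<rightarrow> carrier N"
    and ja: "\<And>x y. x \<in> carrier M \<Longrightarrow> y \<in> carrier M \<Longrightarrow> j (x \<oplus>\<^bsub>M\<^esub> y) = j x \<oplus>\<^bsub>N\<^esub> j y"
    and jm: "\<And>y x. y \<in> carrier S \<Longrightarrow> x \<in> carrier M \<Longrightarrow> j (y \<odot>\<^bsub>M\<^esub> x) = \<phi> y \<odot>\<^bsub>N\<^esub> j x"
  obtains h where "module_hom R K N h"
    "\<And>u x. u \<in> carrier R \<Longrightarrow> x \<in> carrier M \<Longrightarrow> h (tensor u x) = u \<odot>\<^bsub>N\<^esub> j x"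
proof -
  interpret N: left_module R N by (rule N)
  have jc: "j x \<in> carrier N" if "x \<in> carrier M" for x using j that by blast
  have "(\<lambda>(u, x). u \<odot>\<^bsub>N\<^esub> j x) ` (carrier R \<times> carrier M) \<subseteq> carrier (add_monoid N)"
    by (auto simp: jc N.smult_closed)
  then obtain h0 where h0: "h0 \<in> hom G (add_monoid N)"
    "\<And>p. p \<in> carrier R \<times> carrier M \<Longrightarrow> h0 (frag_of p) = (case p of (u, x) \<Rightarrow> u \<odot>\<^bsub>N\<^esub> j x)"
    by (elim comm_group.free_Abelian_group_universal[OF N.M.a_comm_group]) blast
  interpret h0: group_hom G "add_monoid N" h0
    by (rule group_hom.intro[OF group_free_Abelian_group N.M.a_group], rule group_hom_axioms.intro, rule h0(1))
  have h0a: "h0 (a + b) = h0 a \<oplus>\<^bsub>N\<^esub> h0 b" if "a \<in> carrier G" "b \<in> carrier G" for a b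
    using h0.hom_mult[OF that] by simp
  have h0c: "h0 a \<in> carrier N" if "a \<in> carrier G" for a
    using h0.hom_closed[OF that] by simp
  have h0z: "h0 0 = \<zero>\<^bsub>N\<^esub>" using h0.hom_one by simp
  have h0d: "h0 (a - b) = h0 a \<ominus>\<^bsub>N\<^esub> h0 b" if "a \<in> carrier G" "b \<in> carrier G" for a b
  proof -
    have "h0 (a - b) \<oplus>\<^bsub>N\<^esub> h0 b = h0 a" using h0a[OF G_diff[OF that] that(2)] by simp
    then show ?thesis
      using N.M.add_minus_cancel(1)[OF h0c h0c, OF G_diff[OF that] that(2)] by simp
  qed
  have h0eq: "h0 (a - b) = \<zero>\<^bsub>N\<^esub>" if "a \<in> carrier G" "b \<in> carrier G" "h0 a = h0 b" for a b
    using h0d[OF that(1,2)] that h0c by (simp add: N.M.minus_eq N.M.r_neg)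
  \<comment> \<open>Membership in the carrier is part of the claim because \<open>h0\<close> is
    additive on the carrier only, which the case of differences uses.\<close>
  have kill: "h0 c = \<zero>\<^bsub>N\<^esub> \<and> c \<in> carrier G" if "c \<in> T" for c
    using that
  proof (induction c rule: T_induct)
    case zero
    then show ?case using h0z G_zero by simp
  next
    case (diff a b)
    then show ?case using h0eq[of a b] G_diff[of a b] by metis
  next
    case (add_left u u' x)
    then have "h0 (frag_of (u \<oplus>\<^bsub>R\<^esub> u', x)) = h0 (frag_of (u, x) + frag_of (u', x))"
      by (simp add: h0a h0(2) jc N.smult_l_distr)
    with add_left show ?case
      using h0eq[of "frag_of (u \<oplus>\<^bsub>R\<^esub> u', x)" "frag_of (u, x) + frag_of (u', x)"] G_add G_diff
      by (simp add: diff_diff_eq frag_of_in_free_Abelian_group del: carrier_free_Abelian_group_iff)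
  next
    case (add_right u x x')
    then have "h0 (frag_of (u, x \<oplus>\<^bsub>M\<^esub> x')) = h0 (frag_of (u, x) + frag_of (u, x'))"
      by (simp add: h0a h0(2) jc ja N.smult_r_distr)
    with add_right show ?case
      using h0eq[of "frag_of (u, x \<oplus>\<^bsub>M\<^esub> x')" "frag_of (u, x) + frag_of (u, x')"] G_add G_diff
      by (simp add: diff_diff_eq frag_of_in_free_Abelian_group del: carrier_free_Abelian_group_iff)
  next
    case (balanced u y x)
    then have "h0 (frag_of (u \<otimes>\<^bsub>R\<^esub> \<phi> y, x)) = h0 (frag_of (u, y \<odot>\<^bsub>M\<^esub> x))"
      by (simp add: h0(2) jc jm N.smult_assoc \<phi>_closed M.smult_closed)
    with balanced show ?case
      using h0eq[of "frag_of (u \<otimes>\<^bsub>R\<^esub> \<phi> y, x)" "frag_of (u, y \<odot>\<^bsub>M\<^esub> x)"] G_diff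
      by (simp add: M.smult_closed \<phi>_closed frag_of_in_free_Abelian_group del: carrier_free_Abelian_group_iff)
  qed
  define h where "h A = h0 (SOME c. c \<in> A)" for A
  have hq: "h (q c) = h0 c" if c: "c \<in> carrier G" for c
  proof -
    have "(SOME d. d \<in> q c) \<in> q c" using q_self by (rule someI)
    then have "(SOME d. d \<in> q c) - c \<in> T" by (simp add: mem_q)
    from kill[OF this] have 1: "h0 ((SOME d. d \<in> q c) - c) = \<zero>\<^bsub>N\<^esub>" "(SOME d. d \<in> q c) - c \<in> carrier G"
      by blast+
    from h0a[OF this(2) c] this(1) c h0c[OF c] show ?thesis by (simp add: h_def)
  qed
  have ht: "h (tensor u x) = u \<odot>\<^bsub>N\<^esub> j x" if "u \<in> carrier R" "x \<in> carrier M" for u x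
    using that by (simp add: tensor_eq hq h0(2))
  have "h0 (lmul r c) = r \<odot>\<^bsub>N\<^esub> h0 c" if r: "r \<in> carrier R" and "c \<in> carrier G" for r c
    using that(2)
  proof (induction c rule: G_induct)
    case zero
    then show ?case by (simp add: h0z N.smult_r_null r)
  next
    case (diff x y)
    have "h0 (lmul r (x - y)) = r \<odot>\<^bsub>N\<^esub> h0 x \<ominus>\<^bsub>N\<^esub> r \<odot>\<^bsub>N\<^esub> h0 y"
      using diff h0d[OF lmul_G lmul_G, OF r diff(1) r diff(2)] by (simp add: lmul_diff)
    also have "\<dots> = r \<odot>\<^bsub>N\<^esub> (h0 x \<ominus>\<^bsub>N\<^esub> h0 y)"
      using N.M.additive_map_minus[OF N.M.abelian_group_axioms, of "\<lambda>x. r \<odot>\<^bsub>N\<^esub> x" "h0 x" "h0 y"]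
        N.smult_closed[OF r] N.smult_r_distr[OF r] h0c diff(1,2) by simp
    finally show ?case using h0d[OF diff(1,2)] by simp
  next
    case (tensor u x)
    then show ?case using r by (simp add: h0(2) jc N.smult_assoc)
  qed
  then have "module_hom R K N h"
    unfolding module_hom_def
    by (auto simp: carrier_K hq h0c K_add h0a K_smult lmul_G G_add simp del: carrier_free_Abelian_group_iff)
  with ht that show thesis by blast
qed

end

section \<open>Matrix units\<close>

lemma mem_idx: "i \<in> idx m n \<longleftrightarrow> (- int m \<le> i \<and> i < 0) \<or> (0 < i \<and> i \<le> int n)"
proof -
  have "i \<in> bar ` {1..m} \<longleftrightarrow> - int m \<le> i \<and> i < 0"
    by (auto simp: bar_def image_iff intro!: bexI[of _ "nat (- i)"])
  moreover have "i \<in> int ` {1..n} \<longleftrightarrow> 0 < i \<and> i \<le> int n"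
    by (auto simp: image_iff intro!: bexI[of _ "nat i"])
  ultimately show ?thesis by (auto simp: idx_def)
qed

lemma finite_idx [simp]: "finite (idx m n)"
  by (simp add: idx_def)

lemma gl_iff: "x \<in> gl m n \<longleftrightarrow> (\<forall>i j. x i j \<noteq> 0 \<longrightarrow> i \<in> idx m n \<and> j \<in> idx m n)"
  by (simp add: gl_def)

lemma g_zero_iff: "x \<in> g_zero m n \<longleftrightarrow> x \<in> gl m n \<and> (\<forall>i j. x i j \<noteq> 0 \<longrightarrow> (i < 0) = (j < 0))"
  by (auto simp: g_zero_def homogeneous_def split: if_splits)

lemma even_part_g_zero: "x \<in> gl m n \<Longrightarrow> even_part x \<in> g_zero m n"
  by (auto simp: g_zero_iff gl_iff even_part_def split: if_splits)

text \<open>These are the block upper triangular matrices: if the lower left block vanishes,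
  removing the even part leaves a matrix in the upper right block.\<close>

lemma parabolic_iff: "x \<in> parabolic m n \<longleftrightarrow> x \<in> gl m n \<and> (\<forall>i j. x i j \<noteq> 0 \<longrightarrow> \<not> (0 < i \<and> j < 0))"
proof
  assume "x \<in> parabolic m n"
  then obtain y z where x: "x = y + z" and y: "y \<in> g_zero m n" and z: "z \<in> g_plus m n"
    unfolding parabolic_def by blast
  have "i \<in> idx m n \<and> j \<in> idx m n \<and> \<not> (0 < i \<and> j < 0)" if "x i j \<noteq> 0" for i j
  proof -
    have "y i j \<noteq> 0 \<or> z i j \<noteq> 0" using that x by auto
    then show ?thesis
    proof
      assume "y i j \<noteq> 0"
      then have "i \<in> idx m n" "j \<in> idx m n" "(i < 0) = (j < 0)" using y by (simp_all add: g_zero_iff gl_iff)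
      then show ?thesis by auto
    next
      assume "z i j \<noteq> 0"
      then have "i \<in> idx m n" "j \<in> idx m n" "i < 0" using z by (simp_all add: g_plus_def gl_iff)
      then show ?thesis by auto
    qed
  qed
  then show "x \<in> gl m n \<and> (\<forall>i j. x i j \<noteq> 0 \<longrightarrow> \<not> (0 < i \<and> j < 0))"
    by (simp add: gl_iff)
next
  assume x: "x \<in> gl m n \<and> (\<forall>i j. x i j \<noteq> 0 \<longrightarrow> \<not> (0 < i \<and> j < 0))"
  have "x - even_part x \<in> g_plus m n"
    unfolding g_plus_def gl_iff mem_Collect_eq
  proof (intro conjI allI impI)
    fix i j assume "(x - even_part x) i j \<noteq> 0"
    then have *: "x i j \<noteq> 0" "(i < 0) \<noteq> (j < 0)" by (auto simp: even_part_def split: if_splits)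
    with x have ij: "i \<in> idx m n" "j \<in> idx m n" "\<not> (0 < i \<and> j < 0)" by (auto simp: gl_iff)
    then show "i \<in> idx m n" "j \<in> idx m n" by auto
    from ij * show "i < 0" "0 < j" by (auto simp: mem_idx)
  qed
  moreover have "x = even_part x + (x - even_part x)" by simp
  ultimately show "x \<in> parabolic m n"
    using even_part_g_zero[of x m n] x unfolding parabolic_def by blast
qed

lemma g_zero_subset_parabolic: "g_zero m n \<subseteq> parabolic m n"
proof
  fix x assume x: "x \<in> g_zero m n"
  have "\<not> (0 < i \<and> j < 0)" if "x i j \<noteq> 0" for i j
    using x that by (metis g_zero_iff less_asym)
  with x show "x \<in> parabolic m n" by (simp add: g_zero_iff parabolic_iff)
qed

lemma parabolic_subset_gl: "parabolic m n \<subseteq> gl m n"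
  by (auto simp: parabolic_iff)

lemma mat_mult_nonzero:
  assumes "mat_mult m n x y i k \<noteq> 0"
  obtains j where "j \<in> idx m n" "x i j \<noteq> 0" "y j k \<noteq> 0"
  using assms unfolding mat_mult_def by (metis (no_types, lifting) mult_zero_left mult_zero_right sum.neutral)

lemma superbracket_nonzero:
  assumes "superbracket m n p q x y i k \<noteq> 0"
  obtains j where "j \<in> idx m n" "x i j \<noteq> 0 \<and> y j k \<noteq> 0 \<or> y i j \<noteq> 0 \<and> x j k \<noteq> 0"
proof -
  have "mat_mult m n x y i k \<noteq> 0 \<or> mat_mult m n y x i k \<noteq> 0"
    using assms by (auto simp: superbracket_def mat_scale_def)
  then show thesis using that by (metis mat_mult_nonzero)
qed

lemma add_nonzero: "(x + y) i j \<noteq> 0 \<Longrightarrow> x i j \<noteq> 0 \<or> y i j \<noteq> 0" for x y :: mat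
  by auto

lemma superbracket_gl:
  assumes "x \<in> gl m n" "y \<in> gl m n" shows "superbracket m n p q x y \<in> gl m n"
  unfolding gl_iff
proof (intro allI impI)
  fix i j assume "superbracket m n p q x y i j \<noteq> 0"
  then show "i \<in> idx m n \<and> j \<in> idx m n"
    by (rule superbracket_nonzero) (use assms in \<open>auto simp: gl_iff\<close>)
qed

lemma lie_gl: "lie_subspace m n (gl m n)"
proof
  show "x \<in> gl m n \<Longrightarrow> y \<in> gl m n \<Longrightarrow> x + y \<in> gl m n" for x y
    unfolding gl_iff by (meson add_nonzero)
  show "mat_scale c x \<in> gl m n" if "x \<in> gl m n" for c x
    using that by (auto simp: gl_iff mat_scale_def)
qed (rule superbracket_gl)

lemma lie_g_zero: "lie_subspace m n (g_zero m n)"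
proof
  show "x \<in> g_zero m n \<Longrightarrow> y \<in> g_zero m n \<Longrightarrow> x + y \<in> g_zero m n" for x y
    unfolding g_zero_iff gl_iff by (meson add_nonzero)
  fix p q x y assume *: "x \<in> g_zero m n" "y \<in> g_zero m n"
  show "superbracket m n p q x y \<in> g_zero m n"
    unfolding g_zero_iff
  proof (intro conjI allI impI superbracket_gl)
    fix i j assume "superbracket m n p q x y i j \<noteq> 0"
    then show "(i < 0) = (j < 0)"
      by (rule superbracket_nonzero) (use * in \<open>auto simp: g_zero_iff\<close>)
  qed (use * in \<open>auto simp: g_zero_iff\<close>)
qed (auto simp: g_zero_iff gl_iff mat_scale_def)

lemma lie_parabolic: "lie_subspace m n (parabolic m n)"
proof
  show "x \<in> parabolic m n \<Longrightarrow> y \<in> parabolic m n \<Longrightarrow> x + y \<in> parabolic m n" for x y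
    unfolding parabolic_iff gl_iff by (meson add_nonzero)
  fix p q x y assume *: "x \<in> parabolic m n" "y \<in> parabolic m n"
  show "superbracket m n p q x y \<in> parabolic m n"
    unfolding parabolic_iff
  proof (intro conjI allI impI superbracket_gl)
    fix i k assume "superbracket m n p q x y i k \<noteq> 0"
    then show "\<not> (0 < i \<and> k < 0)"
    proof (rule superbracket_nonzero)
      fix j assume j: "j \<in> idx m n" "x i j \<noteq> 0 \<and> y j k \<noteq> 0 \<or> y i j \<noteq> 0 \<and> x j k \<noteq> 0"
      then have "\<not> (0 < i \<and> j < 0)" "\<not> (0 < j \<and> k < 0)" using * by (auto simp: parabolic_iff)
      with j(1) show ?thesis by (auto simp: mem_idx)
    qed
  qed (use * in \<open>auto simp: parabolic_iff\<close>)
qed (auto simp: parabolic_iff gl_iff mat_scale_def)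

lemma lie_map_incl: "lie_map m n (parabolic m n) (gl m n) id"
  by (intro lie_map.intro lie_map_axioms.intro lie_parabolic lie_gl)
    (use parabolic_subset_gl in auto)

text \<open>The diagonal blocks of a product of block triangular matrices are the products of the
  diagonal blocks. On all of \<open>gl\<close> this fails, since a product of two odd matrices can
  be even and nonzero; so the projection is a homomorphism on the parabolic subalgebra.\<close>

lemma even_part_mult:
  assumes "x \<in> parabolic m n" "y \<in> parabolic m n"
  shows "even_part (mat_mult m n x y) = mat_mult m n (even_part x) (even_part y)"
proof (intro ext)
  fix i k
  have "(if (i < 0) = (k < 0) then x i j * y j k else 0) = even_part x i j * even_part y j k"
    if "j \<in> idx m n" for j
  proof (cases "x i j = 0 \<or> y j k = 0")
    case False
    then have "\<not> (0 < i \<and> j < 0)" "\<not> (0 < j \<and> k < 0)" "i \<in> idx m n" "j \<in> idx m n" "k \<in> idx m n"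
      using assms by (auto simp: parabolic_iff gl_iff)
    then show ?thesis by (auto simp: even_part_def mem_idx)
  qed (auto simp: even_part_def)
  then have "(\<Sum>j\<in>idx m n. (if (i < 0) = (k < 0) then x i j * y j k else 0)) =
      (\<Sum>j\<in>idx m n. even_part x i j * even_part y j k)"
    by (rule sum.cong[OF refl])
  then show "even_part (mat_mult m n x y) i k = mat_mult m n (even_part x) (even_part y) i k"
    unfolding mat_mult_def by (auto simp: even_part_def)
qed

lemma lie_map_even: "lie_map m n (parabolic m n) (g_zero m n) even_part"
proof (intro lie_map.intro lie_map_axioms.intro lie_parabolic lie_g_zero)
  show "x \<in> parabolic m n \<Longrightarrow> even_part x \<in> g_zero m n" for x
    using even_part_g_zero parabolic_subset_gl by blast
  show "x \<in> parabolic m n \<Longrightarrow> homogeneous p x \<Longrightarrow> homogeneous p (even_part x)" for p x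
    by (auto simp: homogeneous_def even_part_def)
  show "even_part (superbracket m n p q x y) = superbracket m n p q (even_part x) (even_part y)"
    if "x \<in> parabolic m n" "y \<in> parabolic m n" for p q x y
    unfolding superbracket_def even_part_mult[OF that, symmetric] even_part_mult[OF that(2,1), symmetric]
    by (auto simp: fun_eq_iff even_part_def mat_scale_def)
qed (auto simp: even_part_def mat_scale_def fun_eq_iff)

definition parity :: "int \<Rightarrow> int \<Rightarrow> nat" where
  "parity i j = (if (i < 0) = (j < 0) then 0 else 1)"

definition ssgn :: "int \<Rightarrow> int \<Rightarrow> int \<Rightarrow> int \<Rightarrow> complex" where
  "ssgn i j k l = (-1) ^ (parity i j * parity k l)"

lemma mat_unit_gl: "i \<in> idx m n \<Longrightarrow> j \<in> idx m n \<Longrightarrow> mat_unit i j \<in> gl m n"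
  by (auto simp: gl_iff mat_unit_def split: if_splits)

lemma mat_unit_g_zero:
  "i \<in> idx m n \<Longrightarrow> j \<in> idx m n \<Longrightarrow> (i < 0) = (j < 0) \<Longrightarrow> mat_unit i j \<in> g_zero m n"
  by (auto simp: g_zero_iff mat_unit_gl) (auto simp: mat_unit_def split: if_splits)

lemma mat_unit_parabolic:
  "i \<in> idx m n \<Longrightarrow> j \<in> idx m n \<Longrightarrow> \<not> (0 < i \<and> j < 0) \<Longrightarrow> mat_unit i j \<in> parabolic m n"
  by (auto simp: parabolic_iff mat_unit_gl) (auto simp: mat_unit_def split: if_splits)

lemma homogeneous_mat_unit: "homogeneous (parity i j) (mat_unit i j)"
  by (auto simp: homogeneous_def mat_unit_def parity_def split: if_splits)

lemma mat_mult_unit: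
  assumes "j \<in> idx m n"
  shows "mat_mult m n (mat_unit i j) (mat_unit k l) = (if j = k then mat_unit i l else 0)"
proof (intro ext)
  fix a b
  have "(\<Sum>c\<in>idx m n. mat_unit i j a c * mat_unit k l c b) =
      (\<Sum>c\<in>idx m n. if c = j then (if a = i \<and> j = k \<and> b = l then 1 else 0) else 0)"
    by (rule sum.cong) (auto simp: mat_unit_def)
  also have "\<dots> = (if a = i \<and> j = k \<and> b = l then 1 else 0)" using assms by simp
  finally show "mat_mult m n (mat_unit i j) (mat_unit k l) a b = (if j = k then mat_unit i l else 0) a b"
    by (auto simp: mat_mult_def mat_unit_def)
qed

lemma superbracket_unit:
  assumes "j \<in> idx m n" "l \<in> idx m n"
  shows "superbracket m n (parity i j) (parity k l) (mat_unit i j) (mat_unit k l) =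
    (if j = k then mat_unit i l else 0) - mat_scale (ssgn i j k l) (if l = i then mat_unit k j else 0)"
  using assms by (simp add: superbracket_def mat_mult_unit ssgn_def)

lemma mat_expand:
  assumes x: "x \<in> gl m n"
  shows "x = (\<Sum>(i, j)\<in>{(i, j) \<in> idx m n \<times> idx m n. x i j \<noteq> 0}. mat_scale (x i j) (mat_unit i j))"
proof (intro ext)
  fix a b
  have *: "sum f A a b = (\<Sum>p\<in>A. f p a b)" for f :: "int \<times> int \<Rightarrow> mat" and A
    by (induction A rule: infinite_finite_induct) auto
  let ?A = "{(i, j) \<in> idx m n \<times> idx m n. x i j \<noteq> 0}"
  have fin: "finite ?A" by (rule finite_subset[of _ "idx m n \<times> idx m n"]) auto
  have "(\<Sum>(i, j)\<in>?A. mat_scale (x i j) (mat_unit i j)) a b = (\<Sum>p\<in>?A. if p = (a, b) then x a b else 0)"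
    unfolding * by (rule sum.cong) (auto simp: mat_scale_def mat_unit_def split: if_splits)
  also have "\<dots> = x a b" using x fin by (auto simp: gl_iff)
  finally show "x a b = (\<Sum>(i, j)\<in>?A. mat_scale (x i j) (mat_unit i j)) a b" by simp
qed

text \<open>\<open>T\<close> is additive only on \<aa>, so the induction also records that the
  partial sums stay in \<aa>. It runs over the nonzero entries, because the units at other positions
  may lie outside \<aa>; these enter at the end with coefficient 0.\<close>

lemma (in lie_subspace) linear_expand:
  fixes T :: "mat \<Rightarrow> 'b \<Rightarrow> complex"
  assumes x: "x \<in> gl m n" "\<And>i j. i \<in> idx m n \<Longrightarrow> j \<in> idx m n \<Longrightarrow> x i j \<noteq> 0 \<Longrightarrow> mat_unit i j \<in> \<aa>"
    and zero: "0 \<in> \<aa>"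
    and T_add: "\<And>x y. x \<in> \<aa> \<Longrightarrow> y \<in> \<aa> \<Longrightarrow> T (x + y) = T x + T y"
    and T_scale: "\<And>c x. x \<in> \<aa> \<Longrightarrow> T (mat_scale c x) = sc c (T x)"
  shows "T x = (\<Sum>i\<in>idx m n. \<Sum>j\<in>idx m n. sc (x i j) (T (mat_unit i j)))"
proof -
  let ?A = "{(i, j) \<in> idx m n \<times> idx m n. x i j \<noteq> 0}"
  have T0: "T 0 = 0"
  proof -
    have "mat_scale 0 0 = (0 :: mat)" by (auto simp: mat_scale_def fun_eq_iff)
    with T_scale[OF zero, of 0] show ?thesis by simp
  qed
  have main: "T (\<Sum>(i, j)\<in>B. mat_scale (x i j) (mat_unit i j)) = (\<Sum>(i, j)\<in>B. sc (x i j) (T (mat_unit i j))) \<and>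
      (\<Sum>(i, j)\<in>B. mat_scale (x i j) (mat_unit i j)) \<in> \<aa>" if "finite B" "B \<subseteq> ?A" for B
    using that
  proof (induction B rule: finite_induct)
    case empty
    then show ?case using T0 zero by (simp add: zero_fun_def)
  next
    case (insert p B)
    obtain i j where p: "p = (i, j)" by force
    have u: "mat_unit i j \<in> \<aa>" using insert.prems x(2) by (auto simp: p)
    let ?s = "\<Sum>(i, j)\<in>B. mat_scale (x i j) (mat_unit i j)"
    have s: "?s \<in> \<aa>" "T ?s = (\<Sum>(i, j)\<in>B. sc (x i j) (T (mat_unit i j)))" using insert by auto
    have e: "(\<Sum>(i, j)\<in>insert p B. mat_scale (x i j) (mat_unit i j)) = mat_scale (x i j) (mat_unit i j) + ?s"
      "(\<Sum>(i, j)\<in>insert p B. sc (x i j) (T (mat_unit i j))) =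
        sc (x i j) (T (mat_unit i j)) + (\<Sum>(i, j)\<in>B. sc (x i j) (T (mat_unit i j)))"
      using insert.hyps by (simp_all add: p)
    show ?case
      unfolding e using T_add[OF scale_mem[OF u] s(1)] T_scale[OF u] s add_mem[OF scale_mem[OF u] s(1)]
      by metis
  qed
  have fin: "finite ?A" by (rule finite_subset[of _ "idx m n \<times> idx m n"]) auto
  have "T x = (\<Sum>(i, j)\<in>?A. sc (x i j) (T (mat_unit i j)))"
    using main[OF fin subset_refl] mat_expand[OF x(1)] by metis
  also have "\<dots> = (\<Sum>(i, j)\<in>idx m n \<times> idx m n. sc (x i j) (T (mat_unit i j)))"
    by (rule sum.mono_neutral_left) auto
  finally show ?thesis by (simp add: sum.cartesian_product)
qed

lemma mat_unit_n_plus: "i \<in> idx m n \<Longrightarrow> j \<in> idx m n \<Longrightarrow> i < j \<Longrightarrow> mat_unit i j \<in> n_plus m n"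
  by (auto simp: n_plus_def mat_unit_gl) (auto simp: mat_unit_def split: if_splits)

lemma mat_unit_cartan: "i \<in> idx m n \<Longrightarrow> mat_unit i i \<in> cartan m n"
  by (auto simp: cartan_def mat_unit_gl) (auto simp: mat_unit_def split: if_splits)

lemma n_plus_gl: "x \<in> n_plus m n \<Longrightarrow> x \<in> gl m n" and cartan_gl: "x \<in> cartan m n \<Longrightarrow> x \<in> gl m n"
  by (auto simp: n_plus_def cartan_def)

lemma weight_apply_unit: "i \<in> idx m n \<Longrightarrow> weight_apply m n \<mu> (mat_unit i i) = \<mu> i"
proof -
  assume i: "i \<in> idx m n"
  have "weight_apply m n \<mu> (mat_unit i i) = (\<Sum>k\<in>idx m n. if k = i then \<mu> i else 0)"
    unfolding weight_apply_def by (rule sum.cong) (auto simp: mat_unit_def)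
  then show ?thesis using i by simp
qed

section \<open>Representations given by the action of the matrix units\<close>

definition unit_op ::
    "nat \<Rightarrow> nat \<Rightarrow> (int \<Rightarrow> int \<Rightarrow> ('b \<Rightarrow> complex) \<Rightarrow> 'b \<Rightarrow> complex) \<Rightarrow> mat \<Rightarrow> ('b \<Rightarrow> complex) \<Rightarrow> 'b \<Rightarrow> complex"
  where "unit_op m n E x f = (\<Sum>i\<in>idx m n. \<Sum>j\<in>idx m n. sc (x i j) (E i j f))"

lemma unit_op_unit:
  assumes "i \<in> idx m n" "j \<in> idx m n" shows "unit_op m n E (mat_unit i j) f = E i j f"
proof -
  have "unit_op m n E (mat_unit i j) f = (\<Sum>k\<in>idx m n. if k = i then E i j f else 0)"
    unfolding unit_op_def
  proof (rule sum.cong[OF refl])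
    fix k assume "k \<in> idx m n"
    have "(\<Sum>l\<in>idx m n. sc (mat_unit i j k l) (E k l f)) = (\<Sum>l\<in>idx m n. if l = j then (if k = i then E i j f else 0) else 0)"
      by (rule sum.cong) (auto simp: mat_unit_def)
    then show "(\<Sum>l\<in>idx m n. sc (mat_unit i j k l) (E k l f)) = (if k = i then E i j f else 0)"
      using assms by simp
  qed
  then show ?thesis using assms by simp
qed

lemma unit_op_diag:
  assumes h: "h \<in> cartan m n" and f: "\<And>i. i \<in> idx m n \<Longrightarrow> E i i f = sc (\<mu> i) f"
  shows "unit_op m n E h f = sc (weight_apply m n \<mu> h) f"
proof -
  have "(\<Sum>j\<in>idx m n. sc (h i j) (E i j f)) = sc (\<mu> i * h i i) f" if i: "i \<in> idx m n" for i
  proof -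
    have "(\<Sum>j\<in>idx m n. sc (h i j) (E i j f)) = (\<Sum>j\<in>idx m n. if j = i then sc (h i i) (E i i f) else 0)"
      using h by (intro sum.cong refl) (auto simp: cartan_def)
    then show ?thesis using i f[OF i] by (simp add: mult.commute)
  qed
  then have "unit_op m n E h f = (\<Sum>i\<in>idx m n. sc (\<mu> i * h i i) f)"
    unfolding unit_op_def by (intro sum.cong refl)
  then show ?thesis by (simp add: weight_apply_def fs.scale_sum_left)
qed

lemma unit_op_upper:
  assumes x: "x \<in> n_plus m n" and f: "\<And>i j. i \<in> idx m n \<Longrightarrow> j \<in> idx m n \<Longrightarrow> i < j \<Longrightarrow> E i j f = 0"
  shows "unit_op m n E x f = 0"
  unfolding unit_op_def
proof (intro sum.neutral ballI)
  fix i j assume ij: "i \<in> idx m n" "j \<in> idx m n"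
  show "sc (x i j) (E i j f) = 0"
  proof (cases "x i j = 0")
    case True
    then show ?thesis by simp
  next
    case False
    then have "i < j" using x by (simp add: n_plus_def)
    then show ?thesis using f[OF ij] by simp
  qed
qed

text \<open>A representation is prescribed on the matrix units alone; \<open>op_bracket\<close>
  extends their relations bilinearly to all homogeneous matrices.\<close>

locale gl_rep =
  fixes m n :: nat and W :: "('b \<Rightarrow> complex) set"
    and E :: "int \<Rightarrow> int \<Rightarrow> ('b \<Rightarrow> complex) \<Rightarrow> 'b \<Rightarrow> complex"
  assumes W: "fs.subspace W"
    and lin_E: "i \<in> idx m n \<Longrightarrow> j \<in> idx m n \<Longrightarrow> lin (E i j)"
    and E_mem: "i \<in> idx m n \<Longrightarrow> j \<in> idx m n \<Longrightarrow> f \<in> W \<Longrightarrow> E i j f \<in> W"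
    and E_bracket: "i \<in> idx m n \<Longrightarrow> j \<in> idx m n \<Longrightarrow> k \<in> idx m n \<Longrightarrow> l \<in> idx m n \<Longrightarrow> f \<in> W \<Longrightarrow>
      E i j (E k l f) - sc (ssgn i j k l) (E k l (E i j f)) =
        (if j = k then E i l f else 0) - sc (ssgn i j k l) (if l = i then E k j f else 0)"
begin

abbreviation "op \<equiv> unit_op m n E"

lemma lin_op: "lin (op x)"
  unfolding unit_op_def[abs_def] by (intro lin_setsum lin_smul lin_E)

lemma op_op:
  "op x (op y f) = (\<Sum>i\<in>idx m n. \<Sum>j\<in>idx m n. \<Sum>k\<in>idx m n. \<Sum>l\<in>idx m n.
     sc (x i j * y k l) (E i j (E k l f)))"
proof -
  have "E i j (op y f) = (\<Sum>k\<in>idx m n. \<Sum>l\<in>idx m n. sc (y k l) (E i j (E k l f)))"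
    if "i \<in> idx m n" "j \<in> idx m n" for i j
    unfolding unit_op_def by (simp add: lin_sum[OF lin_E[OF that]] lin_sc[OF lin_E[OF that]])
  then show ?thesis
    unfolding unit_op_def[of m n E x]
    by (intro sum.cong refl) (simp add: fs.scale_sum_right)
qed

lemma op_bracket:
  assumes x: "homogeneous p x" and y: "homogeneous q y" and f: "f \<in> W"
  shows "op x (op y f) - sc ((-1) ^ (p * q)) (op y (op x f)) = op (superbracket m n p q x y) f"
proof -
  let ?I = "idx m n" and ?c = "(-1) ^ (p * q) :: complex"
  have yx: "op y (op x f) = (\<Sum>i\<in>?I. \<Sum>j\<in>?I. \<Sum>k\<in>?I. \<Sum>l\<in>?I. sc (x i j * y k l) (E k l (E i j f)))"
  proof -
    have "op y (op x f) = (\<Sum>k\<in>?I. \<Sum>l\<in>?I. \<Sum>i\<in>?I. \<Sum>j\<in>?I. sc (x i j * y k l) (E k l (E i j f)))"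
      unfolding op_op by (simp only: mult.commute)
    also have "\<dots> = (\<Sum>k\<in>?I. \<Sum>i\<in>?I. \<Sum>l\<in>?I. \<Sum>j\<in>?I. sc (x i j * y k l) (E k l (E i j f)))"
      by (rule sum.cong[OF refl], rule sum.swap)
    also have "\<dots> = (\<Sum>i\<in>?I. \<Sum>k\<in>?I. \<Sum>l\<in>?I. \<Sum>j\<in>?I. sc (x i j * y k l) (E k l (E i j f)))"
      by (rule sum.swap)
    also have "\<dots> = (\<Sum>i\<in>?I. \<Sum>k\<in>?I. \<Sum>j\<in>?I. \<Sum>l\<in>?I. sc (x i j * y k l) (E k l (E i j f)))"
      by (rule sum.cong[OF refl], rule sum.cong[OF refl], rule sum.swap)
    also have "\<dots> = (\<Sum>i\<in>?I. \<Sum>j\<in>?I. \<Sum>k\<in>?I. \<Sum>l\<in>?I. sc (x i j * y k l) (E k l (E i j f)))"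
      by (rule sum.cong[OF refl], rule sum.swap)
    finally show ?thesis .
  qed
  have "op x (op y f) - sc ?c (op y (op x f)) =
      (\<Sum>i\<in>?I. \<Sum>j\<in>?I. \<Sum>k\<in>?I. \<Sum>l\<in>?I.
        sc (x i j * y k l) (E i j (E k l f) - sc ?c (E k l (E i j f))))"
    unfolding yx unfolding op_op
    by (simp only: fs.scale_sum_right sum_subtractf[symmetric] fs.scale_right_diff_distrib
        fs.scale_scale mult.commute mult.left_commute)
  also have "\<dots> = (\<Sum>i\<in>?I. \<Sum>j\<in>?I. \<Sum>k\<in>?I. \<Sum>l\<in>?I.
        sc (x i j * y k l) ((if j = k then E i l f else 0) - sc ?c (if l = i then E k j f else 0)))"
  proof (intro sum.cong refl)
    fix i j k l assume *: "i \<in> ?I" "j \<in> ?I" "k \<in> ?I" "l \<in> ?I"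
    show "sc (x i j * y k l) (E i j (E k l f) - sc ?c (E k l (E i j f))) =
      sc (x i j * y k l) ((if j = k then E i l f else 0) - sc ?c (if l = i then E k j f else 0))"
    proof (cases "x i j * y k l = 0")
      case False
      then have "x i j \<noteq> 0" "y k l \<noteq> 0" by auto
      \<comment> \<open>A homogeneous matrix is nonzero only at positions of its own parity, so in
        every surviving term the global sign is the sign of the two units.\<close>
      then have "p = parity i j" "q = parity k l"
        using x y by (auto simp: homogeneous_def parity_def split: if_splits)
      then have "?c = ssgn i j k l" by (simp add: ssgn_def)
      then show ?thesis using E_bracket[OF * f] by simp
    qed simp
  qed
  also have "\<dots> = (\<Sum>i\<in>?I. \<Sum>j\<in>?I. \<Sum>k\<in>?I. \<Sum>l\<in>?I. if j = k then sc (x i j * y k l) (E i l f) else 0) -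
      (\<Sum>i\<in>?I. \<Sum>j\<in>?I. \<Sum>k\<in>?I. \<Sum>l\<in>?I. if l = i then sc (?c * (y k l * x i j)) (E k j f) else 0)"
  proof -
    have "sc (x i j * y k l) ((if j = k then E i l f else 0) - sc ?c (if l = i then E k j f else 0)) =
        (if j = k then sc (x i j * y k l) (E i l f) else 0) -
        (if l = i then sc (?c * (y k l * x i j)) (E k j f) else 0)" for i j k l
      by (auto simp: fs.scale_right_diff_distrib mult.commute mult.left_commute)
    then show ?thesis by (simp only: sum_subtractf)
  qed
  also have "(\<Sum>i\<in>?I. \<Sum>j\<in>?I. \<Sum>k\<in>?I. \<Sum>l\<in>?I. if j = k then sc (x i j * y k l) (E i l f) else 0) =
      op (mat_mult m n x y) f"
  proof -
    have "(\<Sum>i\<in>?I. \<Sum>j\<in>?I. \<Sum>k\<in>?I. \<Sum>l\<in>?I. if j = k then sc (x i j * y k l) (E i l f) else 0) =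
        (\<Sum>i\<in>?I. \<Sum>j\<in>?I. \<Sum>l\<in>?I. \<Sum>k\<in>?I. if j = k then sc (x i j * y k l) (E i l f) else 0)"
      by (rule sum.cong[OF refl], rule sum.cong[OF refl], rule sum.swap)
    also have "\<dots> = (\<Sum>i\<in>?I. \<Sum>j\<in>?I. \<Sum>l\<in>?I. sc (x i j * y j l) (E i l f))"
      by (intro sum.cong refl) (simp add: sum.delta')
    also have "\<dots> = (\<Sum>i\<in>?I. \<Sum>l\<in>?I. \<Sum>j\<in>?I. sc (x i j * y j l) (E i l f))"
      by (rule sum.cong[OF refl], rule sum.swap)
    finally show ?thesis by (simp add: unit_op_def mat_mult_def fs.scale_sum_left)
  qed
  also have "(\<Sum>i\<in>?I. \<Sum>j\<in>?I. \<Sum>k\<in>?I. \<Sum>l\<in>?I. if l = i then sc (?c * (y k l * x i j)) (E k j f) else 0) =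
      sc ?c (op (mat_mult m n y x) f)"
  proof -
    have "(\<Sum>i\<in>?I. \<Sum>j\<in>?I. \<Sum>k\<in>?I. \<Sum>l\<in>?I. if l = i then sc (?c * (y k l * x i j)) (E k j f) else 0) =
        (\<Sum>i\<in>?I. \<Sum>j\<in>?I. \<Sum>k\<in>?I. sc (?c * (y k i * x i j)) (E k j f))"
      by (intro sum.cong refl) (simp add: sum.delta)
    also have "\<dots> = (\<Sum>j\<in>?I. \<Sum>i\<in>?I. \<Sum>k\<in>?I. sc (?c * (y k i * x i j)) (E k j f))"
      by (rule sum.swap)
    also have "\<dots> = (\<Sum>j\<in>?I. \<Sum>k\<in>?I. \<Sum>i\<in>?I. sc (?c * (y k i * x i j)) (E k j f))"
      by (rule sum.cong[OF refl], rule sum.swap)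
    also have "\<dots> = (\<Sum>k\<in>?I. \<Sum>j\<in>?I. \<Sum>i\<in>?I. sc (?c * (y k i * x i j)) (E k j f))"
      by (rule sum.swap)
    finally show ?thesis
      by (simp add: unit_op_def mat_mult_def fs.scale_sum_left fs.scale_sum_right sum_distrib_left)
  qed
  also have "op (mat_mult m n x y) f - sc ?c (op (mat_mult m n y x) f) = op (superbracket m n p q x y) f"
    unfolding unit_op_def superbracket_def
    by (simp add: fs.scale_sum_right sum_subtractf[symmetric] mat_scale_def fs.scale_left_diff_distrib)
  finally show ?thesis .
qed

sublocale op_rep m n "gl m n" W op
proof (intro op_rep.intro op_rep_axioms.intro lie_gl W lin_op op_bracket)
  show "op x f \<in> W" if "f \<in> W" for x f
    unfolding unit_op_def using W that by (intro fs.subspace_sum fs.subspace_scale E_mem)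
  show "op (x + y) f = op x f + op y f" for x y f
    by (simp add: unit_op_def fs.scale_left_distrib sum.distrib)
  show "op (mat_scale c x) f = sc c (op x f)" for c x f
    by (simp add: unit_op_def mat_scale_def fs.scale_sum_right)
qed

lemma op_unit: "i \<in> idx m n \<Longrightarrow> j \<in> idx m n \<Longrightarrow> op (mat_unit i j) f = E i j f"
  by (rule unit_op_unit)

end

section \<open>Highest weight theory for the even part\<close>

definition ev :: "nat \<Rightarrow> nat \<Rightarrow> int \<Rightarrow> int \<Rightarrow> bool" where
  "ev m n i j \<longleftrightarrow> i \<in> idx m n \<and> j \<in> idx m n \<and> (i < 0) = (j < 0)"

locale g0_rep =
  fixes m n :: nat and V :: "('b \<Rightarrow> complex) set"
    and \<rho> :: "int \<Rightarrow> int \<Rightarrow> ('b \<Rightarrow> complex) \<Rightarrow> 'b \<Rightarrow> complex"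
  assumes V: "fs.subspace V"
    and lin_\<rho>: "ev m n i j \<Longrightarrow> lin (\<rho> i j)"
    and \<rho>_mem: "ev m n i j \<Longrightarrow> x \<in> V \<Longrightarrow> \<rho> i j x \<in> V"
    and \<rho>_comm: "ev m n i j \<Longrightarrow> ev m n k l \<Longrightarrow> x \<in> V \<Longrightarrow>
      \<rho> i j (\<rho> k l x) = \<rho> k l (\<rho> i j x) + (if j = k then \<rho> i l x else 0) - (if l = i then \<rho> k j x else 0)"
begin

abbreviation "e \<equiv> ev m n"

definition invariant :: "('b \<Rightarrow> complex) set \<Rightarrow> bool" where
  "invariant N \<longleftrightarrow> fs.subspace N \<and> N \<subseteq> V \<and> (\<forall>i j x. e i j \<longrightarrow> x \<in> N \<longrightarrow> \<rho> i j x \<in> N)"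

definition extremal :: "('b \<Rightarrow> complex) \<Rightarrow> bool" where
  "extremal x \<longleftrightarrow> x \<in> V \<and> (\<forall>i j. e i j \<longrightarrow> i < j \<longrightarrow> \<rho> i j x = 0)"

lemma e_diag: "i \<in> idx m n \<Longrightarrow> e i i"
  by (simp add: ev_def)

lemma e_trans: "e i j \<Longrightarrow> e j k \<Longrightarrow> e i k"
  by (auto simp: ev_def)

lemma image_span:
  assumes T: "lin T" and "x \<in> fs.span A" and "\<And>a. a \<in> A \<Longrightarrow> T a \<in> N" and N: "fs.subspace N"
  shows "T x \<in> N"
proof -
  have "fs.subspace {x. T x \<in> N}"
    using N by (intro fs.subspaceI)
      (simp_all add: lin_zero[OF T] lin_add[OF T] lin_sc[OF T] fs.subspace_0 fs.subspace_add fs.subspace_scale)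
  then show ?thesis using fs.span_minimal[of A "{x. T x \<in> N}"] assms(2,3) by blast
qed

lemma span_V: "A \<subseteq> V \<Longrightarrow> fs.span A \<subseteq> V"
  using V by (rule fs.span_minimal[rotated])

text \<open>The vectors obtained from \<open>y\<close> by lowering and diagonal operators span an invariant subspace
  when \<open>y\<close> is extremal.\<close>

inductive desc :: "('b \<Rightarrow> complex) \<Rightarrow> ('b \<Rightarrow> complex) \<Rightarrow> bool" for y where
  base: "desc y y"
| step: "desc y x \<Longrightarrow> e i j \<Longrightarrow> j \<le> i \<Longrightarrow> desc y (\<rho> i j x)"

lemma desc_V: "desc y x \<Longrightarrow> y \<in> V \<Longrightarrow> x \<in> V"
  by (induction rule: desc.induct) (auto intro: \<rho>_mem)

lemma desc_lower: "x \<in> fs.span {x. desc y x} \<Longrightarrow> e i j \<Longrightarrow> j \<le> i \<Longrightarrow> \<rho> i j x \<in> fs.span {x. desc y x}"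
  by (rule image_span[OF lin_\<rho>]) (auto intro: fs.span_base desc.step)

text \<open>A raising unit is moved past the outermost operator of a word. The commutator is a
  single even unit applied to a shorter word, which the induction hypothesis covers because it
  quantifies over all even units; at the end of the word extremality kills the raising unit.\<close>

lemma desc_invariant:
  assumes "extremal y" shows "invariant (fs.span {x. desc y x})"
proof -
  have y: "y \<in> V" using assms by (simp add: extremal_def)
  have *: "\<rho> i j x \<in> fs.span {x. desc y x}" if "desc y x" "e i j" for x i j
    using that
  proof (induction arbitrary: i j rule: desc.induct)
    case base
    show ?case
    proof (cases "j \<le> i")
      case True
      then show ?thesis using base desc.step[OF desc.base] by (blast intro: fs.span_base)
    next
      case False
      then have "\<rho> i j y = 0" using assms base by (simp add: extremal_def)
      then show ?thesis using fs.span_zero by metis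
    qed
  next
    case (step x a b)
    show ?case
    proof (cases "j \<le> i")
      case True
      then show ?thesis using step by (intro fs.span_base) (auto intro: desc.step)
    next
      case False
      have "\<rho> a b (\<rho> i j x) \<in> fs.span {x. desc y x}"
        by (rule desc_lower[OF step(4)[OF step(5)] step(2,3)])
      moreover have "(if j = a then \<rho> i b x else 0) \<in> fs.span {x. desc y x}"
        using step e_trans by (auto intro: fs.span_zero)
      moreover have "(if b = i then \<rho> a j x else 0) \<in> fs.span {x. desc y x}"
        using step e_trans by (auto intro: fs.span_zero)
      ultimately show ?thesis
        unfolding \<rho>_comm[OF step(5,2) desc_V[OF step(1) y]]
        by (intro fs.span_diff fs.span_add)
    qed
  qed
  show ?thesis
    unfolding invariant_def
  proof (intro conjI allI impI)
    show "fs.span {x. desc y x} \<subseteq> V" using desc_V y by (intro span_V) auto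
    fix i j x assume "e i j" "x \<in> fs.span {x. desc y x}"
    then show "\<rho> i j x \<in> fs.span {x. desc y x}"
      by (rule image_span[OF lin_\<rho> _ _ fs.subspace_span]) (use \<open>e i j\<close> * in blast)
  qed simp
qed

subsection \<open>Casimir operators\<close>

text \<open>The quadratic Casimir element of the general linear algebra on the index set
  \<open>blk\<close>.\<close>

definition casimir :: "int set \<Rightarrow> ('b \<Rightarrow> complex) \<Rightarrow> 'b \<Rightarrow> complex" where
  "casimir blk x = (\<Sum>i\<in>blk. \<Sum>j\<in>blk. \<rho> i j (\<rho> j i x))"

text \<open>The eigenvalue on a highest weight vector: for \<open>i < j\<close>, normal ordering of
  \<open>E i j E j i\<close> leaves the commutator \<open>E i i - E j j\<close>; for
  \<open>i = j\<close> a square remains, and for \<open>i > j\<close> nothing.\<close>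

definition casimir_value :: "int set \<Rightarrow> weight \<Rightarrow> complex" where
  "casimir_value blk \<mu> = (\<Sum>i\<in>blk. \<Sum>j\<in>blk. if i < j then \<mu> i - \<mu> j else if i = j then \<mu> i * \<mu> i else 0)"

lemma lin_casimir:
  assumes "\<And>i j. i \<in> blk \<Longrightarrow> j \<in> blk \<Longrightarrow> e i j" shows "lin (casimir blk)"
proof -
  have "lin (\<lambda>x. \<Sum>j\<in>blk. \<rho> i j (\<rho> j i x))" if i: "i \<in> blk" for i
    using lin_setsum[of blk "\<lambda>j x. \<rho> i j (\<rho> j i x)"] lin_comp[OF lin_\<rho>[OF assms[OF i]] lin_\<rho>[OF assms[OF _ i]]]
    by blast
  then show ?thesis
    using lin_setsum[of blk "\<lambda>i x. \<Sum>j\<in>blk. \<rho> i j (\<rho> j i x)"] unfolding casimir_def[abs_def] by blast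
qed

text \<open>The commutator with \<open>E k l\<close> produces four single sums, which cancel in
  pairs if \<open>k\<close> and \<open>l\<close> are both in the block or both outside it.\<close>

lemma casimir_comm:
  assumes blk: "\<And>i j. i \<in> blk \<Longrightarrow> j \<in> blk \<Longrightarrow> e i j" and "finite blk"
    and kl: "e k l" "k \<in> blk \<longleftrightarrow> l \<in> blk" and x: "x \<in> V"
  shows "casimir blk (\<rho> k l x) = \<rho> k l (casimir blk x)"
proof -
  have rearr: "a + p - q + r - s = a + (p - s) + (r - q)" for a p q r s :: "'b \<Rightarrow> complex"
    by simp
  have *: "\<rho> i j (\<rho> j i (\<rho> k l x)) = \<rho> k l (\<rho> i j (\<rho> j i x)) + ((if j = k then \<rho> i l (\<rho> k i x) else 0) -
      (if l = j then \<rho> i l (\<rho> k i x) else 0)) +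
      ((if i = k then \<rho> k j (\<rho> j l x) else 0) - (if l = i then \<rho> k j (\<rho> j l x) else 0))"
    if ij: "i \<in> blk" "j \<in> blk" for i j
  proof -
    have eij: "e i j" "e j i" using blk ij by auto
    have 1: "\<rho> j i (\<rho> k l x) = \<rho> k l (\<rho> j i x) + (if i = k then \<rho> j l x else 0) - (if l = j then \<rho> k i x else 0)"
      by (rule \<rho>_comm[OF eij(2) kl(1) x])
    have 2: "\<rho> i j (\<rho> k l (\<rho> j i x)) = \<rho> k l (\<rho> i j (\<rho> j i x)) + (if j = k then \<rho> i l (\<rho> j i x) else 0) -
        (if l = i then \<rho> k j (\<rho> j i x) else 0)"
      by (rule \<rho>_comm[OF eij(1) kl(1) \<rho>_mem[OF eij(2) x]])
    have "\<rho> i j (\<rho> j i (\<rho> k l x)) = \<rho> i j (\<rho> k l (\<rho> j i x)) + \<rho> i j (if i = k then \<rho> j l x else 0) -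
        \<rho> i j (if l = j then \<rho> k i x else 0)"
      unfolding 1 lin_add[OF lin_\<rho>[OF eij(1)]] lin_diff[OF lin_\<rho>[OF eij(1)]] by (rule refl)
    also have "\<dots> = \<rho> k l (\<rho> i j (\<rho> j i x)) + (if j = k then \<rho> i l (\<rho> j i x) else 0) -
        (if l = i then \<rho> k j (\<rho> j i x) else 0) + (if i = k then \<rho> i j (\<rho> j l x) else 0) -
        (if l = j then \<rho> i j (\<rho> k i x) else 0)"
      unfolding 2 using lin_zero[OF lin_\<rho>[OF eij(1)]] by simp
    also have "(if j = k then \<rho> i l (\<rho> j i x) else 0) = (if j = k then \<rho> i l (\<rho> k i x) else 0)" by simp
    also have "(if l = i then \<rho> k j (\<rho> j i x) else 0) = (if l = i then \<rho> k j (\<rho> j l x) else 0)" by simp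
    also have "(if i = k then \<rho> i j (\<rho> j l x) else 0) = (if i = k then \<rho> k j (\<rho> j l x) else 0)" by simp
    also have "(if l = j then \<rho> i j (\<rho> k i x) else 0) = (if l = j then \<rho> i l (\<rho> k i x) else 0)" by simp
    finally show ?thesis by (simp only: rearr)
  qed
  have "casimir blk (\<rho> k l x) = (\<Sum>i\<in>blk. \<Sum>j\<in>blk. \<rho> k l (\<rho> i j (\<rho> j i x)) +
      ((if j = k then \<rho> i l (\<rho> k i x) else 0) - (if l = j then \<rho> i l (\<rho> k i x) else 0)) +
      ((if i = k then \<rho> k j (\<rho> j l x) else 0) - (if l = i then \<rho> k j (\<rho> j l x) else 0)))"
    unfolding casimir_def by (intro sum.cong refl) (rule *)
  also have "\<dots> = (\<Sum>i\<in>blk. \<Sum>j\<in>blk. \<rho> k l (\<rho> i j (\<rho> j i x))) +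
      ((\<Sum>i\<in>blk. \<Sum>j\<in>blk. if j = k then \<rho> i l (\<rho> k i x) else 0) -
       (\<Sum>i\<in>blk. \<Sum>j\<in>blk. if l = j then \<rho> i l (\<rho> k i x) else 0)) +
      ((\<Sum>i\<in>blk. \<Sum>j\<in>blk. if i = k then \<rho> k j (\<rho> j l x) else 0) -
       (\<Sum>i\<in>blk. \<Sum>j\<in>blk. if l = i then \<rho> k j (\<rho> j l x) else 0))"
    by (simp only: sum.distrib sum_subtractf)
  also have "(\<Sum>i\<in>blk. \<Sum>j\<in>blk. if j = k then \<rho> i l (\<rho> k i x) else 0) =
       (\<Sum>i\<in>blk. \<Sum>j\<in>blk. if l = j then \<rho> i l (\<rho> k i x) else 0)"
    using kl(2) \<open>finite blk\<close> by - (rule sum.cong[OF refl], auto simp: sum.delta sum.delta')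
  also have "(\<Sum>i\<in>blk. \<Sum>j\<in>blk. if i = k then \<rho> k j (\<rho> j l x) else 0) =
       (\<Sum>i\<in>blk. \<Sum>j\<in>blk. if l = i then \<rho> k j (\<rho> j l x) else 0)"
  proof -
    have "(\<Sum>i\<in>blk. \<Sum>j\<in>blk. if i = k then \<rho> k j (\<rho> j l x) else 0) =
        (\<Sum>j\<in>blk. \<Sum>i\<in>blk. if i = k then \<rho> k j (\<rho> j l x) else 0)" by (rule sum.swap)
    also have "\<dots> = (\<Sum>j\<in>blk. \<Sum>i\<in>blk. if l = i then \<rho> k j (\<rho> j l x) else 0)"
      using kl(2) \<open>finite blk\<close> by - (rule sum.cong[OF refl], auto simp: sum.delta sum.delta')
    also have "\<dots> = (\<Sum>i\<in>blk. \<Sum>j\<in>blk. if l = i then \<rho> k j (\<rho> j l x) else 0)" by (rule sum.swap)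
    finally show ?thesis .
  qed
  also have "(\<Sum>i\<in>blk. \<Sum>j\<in>blk. \<rho> k l (\<rho> i j (\<rho> j i x))) = \<rho> k l (casimir blk x)"
    unfolding casimir_def by (simp add: lin_sum[OF lin_\<rho>[OF kl(1)]])
  finally show ?thesis by simp
qed

text \<open>The diagonal operators are left unevaluated because the formula is later applied to a
  vector of the Fock space of which only one component is known explicitly.\<close>

lemma casimir_extremal:
  assumes blk: "\<And>i j. i \<in> blk \<Longrightarrow> j \<in> blk \<Longrightarrow> e i j" and x: "extremal x"
  shows "casimir blk x = (\<Sum>i\<in>blk. \<Sum>j\<in>blk. if i < j then \<rho> i i x - \<rho> j j x
    else if i = j then \<rho> i i (\<rho> i i x) else 0)"
  unfolding casimir_def
proof (intro sum.cong refl)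
  fix i j assume ij: "i \<in> blk" "j \<in> blk"
  have xV: "x \<in> V" using x by (simp add: extremal_def)
  have eij: "e i j" "e j i" using blk ij by auto
  consider "i < j" | "i = j" | "j < i" by linarith
  then show "\<rho> i j (\<rho> j i x) = (if i < j then \<rho> i i x - \<rho> j j x
    else if i = j then \<rho> i i (\<rho> i i x) else 0)"
  proof cases
    case 1
    then have "\<rho> i j x = 0" using x eij by (simp add: extremal_def)
    then show ?thesis
      using 1 \<rho>_comm[OF eij xV] lin_zero[OF lin_\<rho>[OF eij(2)]] by simp
  next
    case 3
    then have "\<rho> j i x = 0" using x eij by (simp add: extremal_def)
    then show ?thesis using 3 lin_zero[OF lin_\<rho>[OF eij(1)]] by simp
  qed simp
qed

end

locale hw_vector = g0_rep m n V \<rho>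
  for m n and V :: "('b \<Rightarrow> complex) set" and \<rho> +
  fixes v0 :: "'b \<Rightarrow> complex" and \<mu> :: weight
  assumes v0: "extremal v0" and v0_nz: "v0 \<noteq> 0"
    and v0_weight: "i \<in> idx m n \<Longrightarrow> \<rho> i i v0 = sc (\<mu> i) v0"
begin

lemma v0_V: "v0 \<in> V"
  using v0 by (simp add: extremal_def)

text \<open>The first argument is the height, the sum of the gaps \<open>i - j\<close> of the
  lowering units used. It belongs to the word and not to the vector, so a word that evaluates to
  zero keeps its height.\<close>

inductive lw :: "int \<Rightarrow> ('b \<Rightarrow> complex) \<Rightarrow> bool" where
  base: "lw 0 v0"
| step: "lw k x \<Longrightarrow> e i j \<Longrightarrow> j < i \<Longrightarrow> lw (k + (i - j)) (\<rho> i j x)"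

lemma lw_V: "lw k x \<Longrightarrow> x \<in> V"
  by (induction rule: lw.induct) (auto intro: \<rho>_mem v0_V)

lemma lw_height: "lw k x \<Longrightarrow> 0 \<le> k"
  by (induction rule: lw.induct) auto

lemma lw_zero: "lw k x \<Longrightarrow> k \<le> 0 \<Longrightarrow> x = v0"
  by (induction rule: lw.induct) (auto dest: lw_height)

text \<open>A unit \<open>E a b\<close> adds 1 to the weight at \<open>a\<close> and subtracts 1 at
  \<open>b\<close>, so the functional with coefficient \<open>i\<close> at index \<open>i\<close>
  grows by the gap \<open>a - b\<close>. Diagonal operators can therefore detect the height.\<close>

lemma lw_weight:
  "lw k x \<Longrightarrow> \<exists>\<nu>. (\<forall>i\<in>idx m n. \<rho> i i x = sc (\<nu> i) x) \<and>
    (\<Sum>i\<in>idx m n. of_int i * \<nu> i) = (\<Sum>i\<in>idx m n. of_int i * \<mu> i) + of_int k"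
proof (induction rule: lw.induct)
  case base
  then show ?case using v0_weight by (intro exI[of _ \<mu>]) auto
next
  case (step k x a b)
  then obtain \<nu> where \<nu>: "\<And>i. i \<in> idx m n \<Longrightarrow> \<rho> i i x = sc (\<nu> i) x"
    "(\<Sum>i\<in>idx m n. of_int i * \<nu> i) = (\<Sum>i\<in>idx m n. of_int i * \<mu> i) + of_int k" by blast
  have ab: "a \<in> idx m n" "b \<in> idx m n" using step by (auto simp: ev_def)
  define \<nu>' where "\<nu>' i = \<nu> i + (if i = a then 1 else 0) - (if i = b then 1 else 0)" for i
  have "\<rho> i i (\<rho> a b x) = sc (\<nu>' i) (\<rho> a b x)" if "i \<in> idx m n" for i
  proof -
    have "\<rho> i i (\<rho> a b x) = \<rho> a b (\<rho> i i x) + (if i = a then \<rho> i b x else 0) - (if b = i then \<rho> a i x else 0)"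
      by (rule \<rho>_comm[OF e_diag[OF that] step(2) lw_V[OF step(1)]])
    also have "\<dots> = sc (\<nu> i) (\<rho> a b x) + (if i = a then \<rho> a b x else 0) - (if i = b then \<rho> a b x else 0)"
      using \<nu>(1)[OF that] lin_sc[OF lin_\<rho>[OF step(2)]] by auto
    finally show ?thesis
      by (simp add: \<nu>'_def fs.scale_left_distrib fs.scale_left_diff_distrib)
  qed
  moreover have "(\<Sum>i\<in>idx m n. of_int i * \<nu>' i) = (\<Sum>i\<in>idx m n. of_int i * \<mu> i) + of_int (k + (a - b))"
  proof -
    have "(\<Sum>i\<in>idx m n. of_int i * \<nu>' i) = (\<Sum>i\<in>idx m n. of_int i * \<nu> i +
        (if i = a then of_int a else 0) - (if i = b then of_int b else 0))"
      by (rule sum.cong) (auto simp: \<nu>'_def algebra_simps)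
    also have "\<dots> = (\<Sum>i\<in>idx m n. of_int i * \<nu> i) + of_int a - of_int b"
      using ab by (simp add: sum.distrib sum_subtractf)
    finally show ?thesis using \<nu>(2) by simp
  qed
  ultimately show ?case by blast
qed

section \<open>The height filtration of a highest weight module\<close>

definition filt :: "int \<Rightarrow> ('b \<Rightarrow> complex) set" where
  "filt k = fs.span {x. \<exists>l\<le>k. lw l x}"

definition cyc :: "('b \<Rightarrow> complex) set" where
  "cyc = fs.span {x. \<exists>l. lw l x}"

definition low :: "('b \<Rightarrow> complex) set" where
  "low = fs.span {x. \<exists>l>0. lw l x}"

lemma subspace_filt: "fs.subspace (filt k)"
  and subspace_cyc: "fs.subspace cyc"
  and subspace_low: "fs.subspace low"
  by (simp_all add: filt_def cyc_def low_def)

lemma cyc_V: "cyc \<subseteq> V" and low_V: "low \<subseteq> V"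
  unfolding cyc_def low_def using lw_V by (intro span_V; auto)+

lemma lw_filt: "lw l x \<Longrightarrow> l \<le> k \<Longrightarrow> x \<in> filt k"
  unfolding filt_def by (rule fs.span_base) blast

lemma filt_lower: "x \<in> filt k \<Longrightarrow> e i j \<Longrightarrow> j < i \<Longrightarrow> \<rho> i j x \<in> filt (k + (i - j))"
  unfolding filt_def[of k]
  by (rule image_span[OF lin_\<rho> _ _ subspace_filt]) (auto intro: lw_filt lw.step)

text \<open>The unit is moved past the outermost lowering unit. In each commutator term the two gaps
  merge into one gap equal to their sum, so all three terms lie in the same step of the
  filtration.\<close>

lemma lw_act: "lw k x \<Longrightarrow> e i j \<Longrightarrow> \<rho> i j x \<in> filt (k + (i - j))"
proof (induction arbitrary: i j rule: lw.induct)
  case base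
  consider "j < i" | "i = j" | "i < j" by linarith
  then show ?case
  proof cases
    case 1
    then show ?thesis using base by (intro lw_filt[OF lw.step[OF lw.base]]) auto
  next
    case 2
    then have "\<rho> i j v0 = sc (\<mu> i) v0" using v0_weight base by (simp add: ev_def)
    then show ?thesis
      using 2 fs.subspace_scale[OF subspace_filt lw_filt[OF lw.base order_refl]] by simp
  next
    case 3
    then have "\<rho> i j v0 = 0" using v0 base by (simp add: extremal_def)
    then show ?thesis using fs.subspace_0[OF subspace_filt] by metis
  qed
next
  case (step k x a b)
  show ?case
  proof (cases "j < i")
    case True
    then show ?thesis using lw.step[OF lw.step[OF step(1-3)] step(5)] by (intro lw_filt) auto
  next
    case False
    have 1: "\<rho> a b (\<rho> i j x) \<in> filt (k + (a - b) + (i - j))"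
      using filt_lower[OF step(4)[OF step(5)] step(2,3)] by (simp add: algebra_simps)
    have 2: "(if j = a then \<rho> i b x else 0) \<in> filt (k + (a - b) + (i - j))"
    proof (cases "j = a")
      case True
      then show ?thesis using step(4)[of i b] step(2,5) e_trans by (auto simp: algebra_simps)
    qed (simp add: fs.subspace_0[OF subspace_filt])
    have 3: "(if b = i then \<rho> a j x else 0) \<in> filt (k + (a - b) + (i - j))"
    proof (cases "b = i")
      case True
      then show ?thesis using step(4)[of a j] step(2,5) e_trans by (auto simp: algebra_simps)
    qed (simp add: fs.subspace_0[OF subspace_filt])
    show ?thesis
      unfolding \<rho>_comm[OF step(5,2) lw_V[OF step(1)]]
      by (intro fs.subspace_diff[OF subspace_filt] fs.subspace_add[OF subspace_filt] 1 2 3)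
  qed
qed

lemma filt_mono: "k \<le> l \<Longrightarrow> filt k \<subseteq> filt l"
  unfolding filt_def by (rule fs.span_mono) (auto intro: order_trans)

lemma filt_act:
  assumes "x \<in> filt k" "e i j" shows "\<rho> i j x \<in> filt (k + (i - j))"
proof (rule image_span[OF lin_\<rho>[OF assms(2)] assms(1)[unfolded filt_def] _ subspace_filt])
  fix a assume "a \<in> {x. \<exists>l\<le>k. lw l x}"
  then obtain l where l: "l \<le> k" "lw l a" by blast
  show "\<rho> i j a \<in> filt (k + (i - j))"
    using lw_act[OF l(2) assms(2)] filt_mono[of "l + (i - j)" "k + (i - j)"] l(1) by auto
qed

lemma filt_neg: "k < 0 \<Longrightarrow> filt k = {0}"
proof -
  assume "k < 0"
  then have "{x. \<exists>l\<le>k. lw l x} = {}" by (auto dest!: lw_height)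
  then show ?thesis unfolding filt_def by (simp only: fs.span_empty)
qed

lemma cyc_filt:
  assumes "x \<in> cyc" obtains k where "0 \<le> k" "x \<in> filt k"
proof -
  have "fs.subspace (\<Union>k\<in>{0..}. filt k)"
  proof (rule fs.subspaceI)
    show "0 \<in> (\<Union>k\<in>{0..}. filt k)" using fs.subspace_0[OF subspace_filt, of 0] by auto
  next
    fix x y assume "x \<in> (\<Union>k\<in>{0..}. filt k)" "y \<in> (\<Union>k\<in>{0..}. filt k)"
    then obtain k l where kl: "0 \<le> k" "0 \<le> l" "x \<in> filt k" "y \<in> filt l" by auto
    then have "x \<in> filt (max k l)" "y \<in> filt (max k l)"
      using filt_mono[of k "max k l"] filt_mono[of l "max k l"] by auto
    then have "x + y \<in> filt (max k l)" by (intro fs.subspace_add[OF subspace_filt])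
    then show "x + y \<in> (\<Union>k\<in>{0..}. filt k)" using kl by (intro UN_I[of "max k l"]) auto
  next
    fix c x assume "x \<in> (\<Union>k\<in>{0..}. filt k)"
    then show "sc c x \<in> (\<Union>k\<in>{0..}. filt k)" using fs.subspace_scale[OF subspace_filt] by blast
  qed
  moreover have "{x. \<exists>l. lw l x} \<subseteq> (\<Union>k\<in>{0..}. filt k)"
    by (auto intro: lw_filt lw_height)
  ultimately show ?thesis
    using that assms fs.span_minimal[of "{x. \<exists>l. lw l x}" "\<Union>k\<in>{0..}. filt k"]
    unfolding cyc_def by auto
qed

lemma filt_cyc: "filt k \<subseteq> cyc"
  unfolding filt_def cyc_def by (rule fs.span_mono) auto

lemma cyc_invariant: "invariant cyc"
  unfolding invariant_def
proof (intro conjI allI impI subspace_cyc cyc_V)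
  fix i j x assume "e i j" "x \<in> cyc"
  then show "\<rho> i j x \<in> cyc"
    using filt_act filt_cyc by (metis cyc_filt subsetD)
qed

lemma v0_cyc: "v0 \<in> cyc"
  unfolding cyc_def using lw.base by (blast intro: fs.span_base)

lemma low_act: "x \<in> low \<Longrightarrow> e i j \<Longrightarrow> j \<le> i \<Longrightarrow> \<rho> i j x \<in> low"
  unfolding low_def
proof (rule image_span[OF lin_\<rho>])
  fix a assume ij: "e i j" "j \<le> i" and "a \<in> {x. \<exists>l>0. lw l x}"
  then obtain l where l: "0 < l" "lw l a" by blast
  show "\<rho> i j a \<in> fs.span {x. \<exists>l>0. lw l x}"
  proof (cases "i = j")
    case True
    then obtain c where "\<rho> i j a = sc c a" using lw_weight[OF l(2)] ij by (auto simp: ev_def)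
    then show ?thesis using l by (auto intro: fs.span_scale fs.span_base)
  next
    case False
    then show ?thesis using l lw.step[OF l(2) ij(1)] ij(2)
      by (intro fs.span_base CollectI exI[of _ "l + (i - j)"]) auto
  qed
qed auto

text \<open>The next operator multiplies a lowering word of height \<open>k\<close> by \<open>(k - 1) \<cdots> (k - K)\<close>; this
  separates \<open>v0\<close> from the words of positive height.\<close>

definition heightop :: "('b \<Rightarrow> complex) \<Rightarrow> 'b \<Rightarrow> complex" where
  "heightop x = (\<Sum>i\<in>idx m n. sc (of_int i) (\<rho> i i x))"

fun sep :: "nat \<Rightarrow> ('b \<Rightarrow> complex) \<Rightarrow> 'b \<Rightarrow> complex" where
  "sep 0 x = x"
| "sep (Suc K) x = heightop (sep K x) - sc ((\<Sum>i\<in>idx m n. of_int i * \<mu> i) + of_nat (Suc K)) (sep K x)"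

lemma lin_heightop: "lin heightop"
  unfolding heightop_def[abs_def] by (intro lin_setsum lin_smul lin_\<rho> e_diag)

lemma lin_sep: "lin (sep K)"
proof (induction K)
  case 0
  show ?case by (simp add: lin_def)
next
  case (Suc K)
  have "lin (\<lambda>x. heightop (sep K x) - sc ((\<Sum>i\<in>idx m n. of_int i * \<mu> i) + of_nat (Suc K)) (sep K x))"
    by (rule lin_subtract[OF lin_comp[OF lin_heightop Suc] lin_smul[OF Suc]])
  moreover have "sep (Suc K) = (\<lambda>x. heightop (sep K x) -
      sc ((\<Sum>i\<in>idx m n. of_int i * \<mu> i) + of_nat (Suc K)) (sep K x))"
    by (rule ext) simp
  ultimately show ?case by (simp only:)
qed

lemma sep_lw:
  assumes "lw k x" shows "sep K x = sc (\<Prod>j=1..K. of_int k - of_nat j) x"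
proof (induction K)
  case 0
  have "sep 0 x = sc (\<Prod>j=1..0. of_int k - of_nat j) x" by simp
  then show ?case .
next
  case (Suc K)
  obtain \<nu> where \<nu>: "\<And>i. i \<in> idx m n \<Longrightarrow> \<rho> i i x = sc (\<nu> i) x"
    "(\<Sum>i\<in>idx m n. of_int i * \<nu> i) = (\<Sum>i\<in>idx m n. of_int i * \<mu> i) + of_int k"
    using lw_weight[OF assms] by blast
  have "heightop x = sc (\<Sum>i\<in>idx m n. of_int i * \<nu> i) x"
    unfolding heightop_def fs.scale_sum_left by (intro sum.cong refl) (simp add: \<nu>(1))
  then have h: "heightop x = sc ((\<Sum>i\<in>idx m n. of_int i * \<mu> i) + of_int k) x" using \<nu>(2) by simp
  have "sep (Suc K) x = sc (\<Prod>j=1..K. of_int k - of_nat j)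
      (sc (of_int k - of_nat (Suc K)) x)"
    unfolding sep.simps Suc lin_sc[OF lin_heightop] h
    by (simp add: fun_eq_iff sc_def algebra_simps)
  then have "sep (Suc K) x = sc (\<Prod>j=1..Suc K. of_int k - of_nat j) x"
    by (simp add: mult.commute)
  then show ?case .
qed

text \<open>On a word of height \<open>l\<close> the product contains the factor
  \<open>l - j\<close> with \<open>j = l\<close> once \<open>K\<close> reaches \<open>l\<close>.
  Vanishing for all larger \<open>K'\<close> makes the property stable under sums.\<close>

lemma sep_low:
  assumes "x \<in> low" shows "\<exists>K. \<forall>K'\<ge>K. sep K' x = 0"
proof -
  let ?S = "{x. \<exists>K. \<forall>K'\<ge>K. sep K' x = 0}"
  have "fs.subspace ?S"
  proof (rule fs.subspaceI)
    show "0 \<in> ?S" by (auto simp: lin_zero[OF lin_sep])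
  next
    fix x y assume "x \<in> ?S" "y \<in> ?S"
    then obtain K L where "\<forall>K'\<ge>K. sep K' x = 0" "\<forall>K'\<ge>L. sep K' y = 0" by blast
    then show "x + y \<in> ?S" by (auto intro!: exI[of _ "max K L"] simp: lin_add[OF lin_sep])
  next
    fix c x assume "x \<in> ?S"
    then show "sc c x \<in> ?S" by (auto simp: lin_sc[OF lin_sep])
  qed
  moreover have "{x. \<exists>l>0. lw l x} \<subseteq> ?S"
  proof clarify
    fix x and l :: int assume l: "0 < l" "lw l x"
    have "sep K x = 0" if "nat l \<le> K" for K
    proof -
      have "(\<Prod>j=1..K. of_int l - of_nat j :: complex) = 0"
        using l that by (intro prod_zero bexI[of _ "nat l"]) auto
      then show ?thesis by (simp add: sep_lw[OF l(2)])
    qed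
    then show "\<exists>K. \<forall>K'\<ge>K. sep K' x = 0" by blast
  qed
  ultimately show ?thesis
    using assms fs.span_minimal[of "{x. \<exists>l>0. lw l x}" ?S] unfolding low_def by blast
qed

text \<open>At height zero the factor is \<open>(-1)^K K!\<close>, which never vanishes, whereas a
  large \<open>K\<close> annihilates any given vector of \<open>low\<close>.\<close>

lemma v0_notin_low:
  assumes "sc c v0 \<in> low" shows "c = 0"
proof -
  obtain K where "sep K (sc c v0) = 0" using sep_low[OF assms] by blast
  then have "sc (c * (\<Prod>j=1..K. - of_nat j)) v0 = 0"
    using sep_lw[OF lw.base, of K] by (simp add: lin_sc[OF lin_sep])
  then have "c * (\<Prod>j=1..K. - of_nat j) = 0" using v0_nz by (simp add: fs.scale_eq_0_iff)
  then show ?thesis by (auto simp: prod_zero_iff)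
qed

lemma cyc_decomp:
  assumes "x \<in> cyc" obtains c where "x - sc c v0 \<in> low"
proof -
  let ?S = "{x. \<exists>c. x - sc c v0 \<in> low}"
  have "fs.subspace ?S"
  proof (rule fs.subspaceI)
    show "0 \<in> ?S" using fs.subspace_0[OF subspace_low] by (auto intro: exI[of _ 0])
  next
    fix x y assume "x \<in> ?S" "y \<in> ?S"
    then obtain c d where "x - sc c v0 \<in> low" "y - sc d v0 \<in> low" by blast
    then have "(x - sc c v0) + (y - sc d v0) \<in> low" by (rule fs.subspace_add[OF subspace_low])
    moreover have "(x - sc c v0) + (y - sc d v0) = x + y - sc (c + d) v0"
      by (simp add: fs.scale_left_distrib)
    ultimately show "x + y \<in> ?S" by auto
  next
    fix d x assume "x \<in> ?S"
    then obtain c where "x - sc c v0 \<in> low" by blast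
    then have "sc d (x - sc c v0) \<in> low" by (rule fs.subspace_scale[OF subspace_low])
    then show "sc d x \<in> ?S" by (auto simp: fs.scale_right_diff_distrib)
  qed
  moreover have "{x. \<exists>l. lw l x} \<subseteq> ?S"
  proof clarify
    fix x l assume l: "lw l x"
    show "\<exists>c. x - sc c v0 \<in> low"
    proof (cases "l \<le> 0")
      case True
      then have "x - sc 1 v0 = 0" using lw_zero[OF l] by simp
      then show ?thesis using fs.subspace_0[OF subspace_low] by metis
    next
      case False
      then have "x \<in> low"
        using l unfolding low_def by (intro fs.span_base CollectI exI[of _ l]) auto
      then show ?thesis by (intro exI[of _ 0]) simp
    qed
  qed
  ultimately show thesis
    using that assms fs.span_minimal[of "{x. \<exists>l. lw l x}" ?S] unfolding cyc_def by blast
qed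

text \<open>The Casimir element commutes with the lowering units, so every lowering word inherits
  the eigenvalue of \<open>v0\<close>.\<close>

lemma casimir_cyc:
  assumes blk: "\<And>i j. i \<in> blk \<Longrightarrow> j \<in> blk \<Longrightarrow> e i j" "finite blk"
    and blk': "\<And>k l. e k l \<Longrightarrow> k \<in> blk \<longleftrightarrow> l \<in> blk" and x: "x \<in> cyc"
  shows "casimir blk x = sc (casimir_value blk \<mu>) x"
proof -
  have v: "casimir blk v0 = sc (casimir_value blk \<mu>) v0"
  proof -
    have "casimir blk v0 = (\<Sum>i\<in>blk. \<Sum>j\<in>blk. if i < j then \<rho> i i v0 - \<rho> j j v0
        else if i = j then \<rho> i i (\<rho> i i v0) else 0)"
      by (rule casimir_extremal[OF blk(1) v0])
    also have "\<dots> = (\<Sum>i\<in>blk. \<Sum>j\<in>blk. sc (if i < j then \<mu> i - \<mu> j else if i = j then \<mu> i * \<mu> i else 0) v0)"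
    proof (intro sum.cong refl)
      fix i j assume "i \<in> blk" "j \<in> blk"
      then have ij: "i \<in> idx m n" "j \<in> idx m n" using blk(1) by (auto simp: ev_def)
      show "(if i < j then \<rho> i i v0 - \<rho> j j v0 else if i = j then \<rho> i i (\<rho> i i v0) else 0) =
          sc (if i < j then \<mu> i - \<mu> j else if i = j then \<mu> i * \<mu> i else 0) v0"
        by (simp add: v0_weight[OF ij(1)] v0_weight[OF ij(2)] lin_sc[OF lin_\<rho>[OF e_diag[OF ij(1)]]]
            lin_sc[OF lin_\<rho>[OF e_diag[OF ij(2)]]] fs.scale_left_diff_distrib)
    qed
    finally show ?thesis by (simp add: casimir_value_def fs.scale_sum_left)
  qed
  have l: "casimir blk y = sc (casimir_value blk \<mu>) y" if "lw k y" for k y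
    using that
  proof (induction rule: lw.induct)
    case (step k x i j)
    have "casimir blk (\<rho> i j x) = \<rho> i j (casimir blk x)"
      by (rule casimir_comm[OF blk step(2) blk'[OF step(2)] lw_V[OF step(1)]])
    also have "\<dots> = sc (casimir_value blk \<mu>) (\<rho> i j x)"
      unfolding step(4) by (rule lin_sc[OF lin_\<rho>[OF step(2)]])
    finally show ?case .
  qed (rule v)
  have "lin (\<lambda>x. casimir blk x - sc (casimir_value blk \<mu>) x)"
    by (rule lin_subtract[OF lin_casimir[OF blk(1)] lin_smul[OF lin_id]])
  then have "casimir blk x - sc (casimir_value blk \<mu>) x \<in> {0}"
    by (rule image_span[OF _ x[unfolded cyc_def]]) (use l in auto)
  then show ?thesis by simp
qed

lemma irreducible_cyc:
  assumes "\<And>N. invariant N \<Longrightarrow> N = {0} \<or> N = V" shows "cyc = V"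
  using assms[OF cyc_invariant] v0_cyc v0_nz by blast

text \<open>After subtraction of its \<open>v0\<close> part an extremal vector lies in
  \<open>low\<close>. The invariant subspace generated by it is reached by lowering and diagonal
  operators, so it stays in \<open>low\<close> and misses \<open>v0\<close>; irreducibility makes it
  zero.\<close>

lemma irreducible_extremal:
  assumes irr: "\<And>N. invariant N \<Longrightarrow> N = {0} \<or> N = V" and x: "extremal x"
  obtains c where "x = sc c v0"
proof -
  have "x \<in> cyc" using x irreducible_cyc[OF irr] by (simp add: extremal_def)
  then obtain c where c: "x - sc c v0 \<in> low" by (rule cyc_decomp)
  let ?y = "x - sc c v0"
  have y: "extremal ?y"
    unfolding extremal_def
  proof (intro conjI allI impI)
    show "?y \<in> V" using c low_V by blast
    fix i j assume ij: "e i j" "i < j"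
    then show "\<rho> i j ?y = 0"
      using x v0 unfolding lin_diff[OF lin_\<rho>[OF ij(1)]] lin_sc[OF lin_\<rho>[OF ij(1)]]
      by (simp add: extremal_def)
  qed
  have "z \<in> low" if "desc ?y z" for z
    using that
  proof (induction rule: desc.induct)
    case base
    show ?case by (rule c)
  next
    case (step z i j)
    then show ?case by (intro low_act)
  qed
  then have sub: "fs.span {z. desc ?y z} \<subseteq> low"
    using subspace_low by (intro fs.span_minimal) auto
  have "v0 \<notin> low" using v0_notin_low[of 1] by auto
  then have "fs.span {z. desc ?y z} \<noteq> V" using sub v0_V by blast
  then have "fs.span {z. desc ?y z} = {0}" using irr[OF desc_invariant[OF y]] by blast
  moreover have "?y \<in> fs.span {z. desc ?y z}" by (blast intro: fs.span_base desc.base)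
  ultimately have "?y = 0" by blast
  then have "x = sc c v0" by simp
  then show thesis by (rule that)
qed

end

section \<open>Coordinates on finite-dimensional modules\<close>

lemma (in left_module) smult_finsum:
  assumes u: "u \<in> carrier R" and f: "\<And>b. b \<in> B \<Longrightarrow> f b \<in> carrier M" and "finite B"
  shows "u \<odot>\<^bsub>M\<^esub> (\<Oplus>\<^bsub>M\<^esub>b\<in>B. f b) = (\<Oplus>\<^bsub>M\<^esub>b\<in>B. u \<odot>\<^bsub>M\<^esub> f b)"
  using assms(3) f
proof (induction B rule: finite_induct)
  case empty
  then show ?case by (simp add: smult_r_null u)
next
  case (insert b B)
  have "(\<Oplus>\<^bsub>M\<^esub>b\<in>insert b B. f b) = f b \<oplus>\<^bsub>M\<^esub> (\<Oplus>\<^bsub>M\<^esub>b\<in>B. f b)"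
    using insert by (intro M.finsum_insert) auto
  moreover have "(\<Oplus>\<^bsub>M\<^esub>b\<in>insert b B. u \<odot>\<^bsub>M\<^esub> f b) = u \<odot>\<^bsub>M\<^esub> f b \<oplus>\<^bsub>M\<^esub> (\<Oplus>\<^bsub>M\<^esub>b\<in>B. u \<odot>\<^bsub>M\<^esub> f b)"
    using insert u by (intro M.finsum_insert) (auto simp: smult_closed)
  moreover have "(\<Oplus>\<^bsub>M\<^esub>b\<in>B. f b) \<in> carrier M"
    using insert by (intro M.finsum_closed) auto
  ultimately show ?case using insert u by (simp add: smult_r_distr)
qed

locale fd_module = A: lie_subspace m n \<aa> + left_module "UEA m n \<aa>" L
  for m n \<aa> and L :: "(free_alg set, 'a) module" +
  assumes fd: "finite_dim m n \<aa> L"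
begin

definition lc :: "'a set \<Rightarrow> ('a \<Rightarrow> complex) \<Rightarrow> 'a" where
  "lc C c = (\<Oplus>\<^bsub>L\<^esub>b\<in>C. A.cst (c b) \<odot>\<^bsub>L\<^esub> b)"

definition spanning :: "'a set \<Rightarrow> bool" where
  "spanning C \<longleftrightarrow> finite C \<and> C \<subseteq> carrier L \<and> (\<forall>v\<in>carrier L. \<exists>c. v = lc C c)"

text \<open>Independence is obtained from minimality of the cardinality: by \<open>dec_inj\<close> a
  nontrivial relation would allow one vector to be discarded.\<close>

definition basis :: "'a set" where
  "basis = (SOME C. spanning C \<and> (\<forall>C'. spanning C' \<longrightarrow> card C \<le> card C'))"

lemma cst_closed': "b \<in> carrier L \<Longrightarrow> A.cst c \<odot>\<^bsub>L\<^esub> b \<in> carrier L"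
  by (simp add: smult_closed A.cst_closed)

lemma lc_closed: "C \<subseteq> carrier L \<Longrightarrow> lc C c \<in> carrier L"
  unfolding lc_def by (intro M.finsum_closed) (auto intro: cst_closed')

lemma lc_add:
  assumes "C \<subseteq> carrier L" shows "lc C (c + d) = lc C c \<oplus>\<^bsub>L\<^esub> lc C d"
proof -
  have "lc C (c + d) = (\<Oplus>\<^bsub>L\<^esub>b\<in>C. A.cst (c b) \<odot>\<^bsub>L\<^esub> b \<oplus>\<^bsub>L\<^esub> A.cst (d b) \<odot>\<^bsub>L\<^esub> b)"
    unfolding lc_def using assms
    by (intro M.finsum_cong refl)
      (auto simp: A.cst_add smult_l_distr A.cst_closed cst_closed' simp_implies_def)
  also have "\<dots> = lc C c \<oplus>\<^bsub>L\<^esub> lc C d"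
    unfolding lc_def using assms by (intro M.finsum_addf) (auto intro: cst_closed')
  finally show ?thesis .
qed

lemma lc_scale:
  assumes "C \<subseteq> carrier L" "finite C" shows "lc C (sc a c) = A.cst a \<odot>\<^bsub>L\<^esub> lc C c"
proof -
  have "A.cst a \<odot>\<^bsub>L\<^esub> lc C c = (\<Oplus>\<^bsub>L\<^esub>b\<in>C. A.cst a \<odot>\<^bsub>L\<^esub> (A.cst (c b) \<odot>\<^bsub>L\<^esub> b))"
    unfolding lc_def using assms by (intro smult_finsum) (auto simp: A.cst_closed cst_closed')
  also have "\<dots> = lc C (sc a c)"
    unfolding lc_def using assms
    by (intro M.finsum_cong refl)
      (auto simp: sc_def A.cst_mult smult_assoc A.cst_closed cst_closed' simp_implies_def)
  finally show ?thesis ..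
qed

lemma lc_remove:
  assumes "insert b C \<subseteq> carrier L" "finite C" "b \<notin> C" "c b = 0"
  shows "lc (insert b C) c = lc C c"
proof -
  have "lc (insert b C) c = A.cst (c b) \<odot>\<^bsub>L\<^esub> b \<oplus>\<^bsub>L\<^esub> lc C c"
    unfolding lc_def using assms(1-3) by (intro M.finsum_insert) (auto intro: cst_closed')
  then show ?thesis
    using assms lc_closed[of C] by (simp add: A.cst_zero smult_l_null)
qed

lemma spanning_basis: "spanning basis" and basis_minimal: "spanning C \<Longrightarrow> card basis \<le> card C"
proof -
  obtain C where "spanning C"
    using fd unfolding finite_dim_def spanning_def lc_def by blast
  then have "\<exists>C. spanning C \<and> (\<forall>C'. spanning C' \<longrightarrow> card C \<le> card C')"
    by (rule ex_has_least_nat)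
  from someI_ex[OF this] show "spanning basis" "spanning C \<Longrightarrow> card basis \<le> card C" for C
    unfolding basis_def by blast+
qed

lemma finite_basis [simp]: "finite basis"
  and basis_carrier: "basis \<subseteq> carrier L"
  using spanning_basis by (auto simp: spanning_def)

abbreviation "dec \<equiv> lc basis"

lemma dec_closed: "dec c \<in> carrier L"
  by (rule lc_closed[OF basis_carrier])

lemma dec_add: "dec (c + d) = dec c \<oplus>\<^bsub>L\<^esub> dec d"
  by (rule lc_add[OF basis_carrier])

lemma dec_scale: "dec (sc a c) = A.cst a \<odot>\<^bsub>L\<^esub> dec c"
  by (rule lc_scale[OF basis_carrier finite_basis])

lemma dec_zero: "dec 0 = \<zero>\<^bsub>L\<^esub>"
  using dec_scale[of 0 0] by (simp add: A.cst_zero smult_l_null dec_closed)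

lemma dec_cong: "(\<And>b. b \<in> basis \<Longrightarrow> c b = d b) \<Longrightarrow> dec c = dec d"
  unfolding lc_def using basis_carrier
  by (intro M.finsum_cong refl) (auto simp: simp_implies_def cst_closed')

lemma dec_inj:
  assumes "dec d = \<zero>\<^bsub>L\<^esub>" "b \<in> basis" shows "d b = 0"
proof (rule ccontr)
  assume nz: "d b \<noteq> 0"
  let ?C = "basis - {b}"
  have C: "basis = insert b ?C" "finite ?C" "b \<notin> ?C" "insert b ?C \<subseteq> carrier L"
    using assms(2) basis_carrier by auto
  have "spanning ?C"
    unfolding spanning_def
  proof (intro conjI ballI)
    fix v assume "v \<in> carrier L"
    then obtain c where v: "v = dec c" using spanning_basis by (auto simp: spanning_def)
    let ?c = "c + sc (- (c b / d b)) d"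
    have "dec ?c = v"
      unfolding dec_add dec_scale assms(1)
      using dec_closed[of c] by (simp add: v smult_r_null A.cst_closed)
    moreover have "lc (insert b ?C) ?c = lc ?C ?c"
      using C nz by (intro lc_remove) (auto simp: sc_def)
    ultimately show "\<exists>c. v = lc ?C c" using C(1) by metis
  qed (use C in auto)
  then show False
    using basis_minimal[of ?C] card_Diff1_less[OF finite_basis assms(2)] by linarith
qed

text \<open>Support in the basis makes coordinates unique, since \<open>dec\<close> ignores all
  other values.\<close>

definition V :: "('a \<Rightarrow> complex) set" where
  "V = {c. \<forall>b. b \<notin> basis \<longrightarrow> c b = 0}"

definition co :: "'a \<Rightarrow> 'a \<Rightarrow> complex" where
  "co v = (SOME c. c \<in> V \<and> dec c = v)"

lemma subspace_V: "fs.subspace V"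
  by (rule fs.subspaceI) (auto simp: V_def sc_def)

lemma co_props: "v \<in> carrier L \<Longrightarrow> co v \<in> V \<and> dec (co v) = v"
proof -
  assume "v \<in> carrier L"
  then obtain c where "v = dec c" using spanning_basis by (auto simp: spanning_def)
  then have "(\<lambda>b. if b \<in> basis then c b else 0) \<in> V \<and> dec (\<lambda>b. if b \<in> basis then c b else 0) = v"
    by (auto simp: V_def intro: dec_cong)
  then have "\<exists>c. c \<in> V \<and> dec c = v" by blast
  from someI_ex[OF this] show ?thesis unfolding co_def .
qed

lemma co_V: "v \<in> carrier L \<Longrightarrow> co v \<in> V"
  and dec_co: "v \<in> carrier L \<Longrightarrow> dec (co v) = v"
  using co_props by auto

lemma dec_inj_V:
  assumes "c \<in> V" "d \<in> V" "dec c = dec d" shows "c = d"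
proof
  fix b
  have "dec (c + sc (- 1) d) = dec c \<oplus>\<^bsub>L\<^esub> A.cst (- 1) \<odot>\<^bsub>L\<^esub> dec c"
    unfolding dec_add dec_scale assms(3) ..
  also have "\<dots> = dec (c + sc (- 1) c)" unfolding dec_add dec_scale ..
  also have "\<dots> = \<zero>\<^bsub>L\<^esub>" by (simp add: dec_zero)
  finally have "b \<in> basis \<Longrightarrow> (c + sc (- 1) d) b = 0" by (rule dec_inj)
  then show "c b = d b"
    using assms(1,2) by (cases "b \<in> basis") (auto simp: V_def sc_def)
qed

lemma co_dec: "c \<in> V \<Longrightarrow> co (dec c) = c"
  by (rule dec_inj_V) (auto simp: co_V dec_closed dec_co)

lemma co_add: "v \<in> carrier L \<Longrightarrow> w \<in> carrier L \<Longrightarrow> co (v \<oplus>\<^bsub>L\<^esub> w) = co v + co w"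
  by (rule dec_inj_V) (auto simp: co_V dec_co dec_add fs.subspace_add[OF subspace_V])

lemma co_scale: "v \<in> carrier L \<Longrightarrow> co (A.cst c \<odot>\<^bsub>L\<^esub> v) = sc c (co v)"
  by (rule dec_inj_V) (auto simp: co_V dec_co dec_scale cst_closed' fs.subspace_scale[OF subspace_V])

lemma co_zero: "co \<zero>\<^bsub>L\<^esub> = 0"
  using co_dec[of 0] fs.subspace_0[OF subspace_V] by (simp add: dec_zero)

lemma co_eq_0: "v \<in> carrier L \<Longrightarrow> co v = 0 \<longleftrightarrow> v = \<zero>\<^bsub>L\<^esub>"
  using co_zero dec_zero dec_co by metis

definition \<rho> :: "int \<Rightarrow> int \<Rightarrow> ('a \<Rightarrow> complex) \<Rightarrow> 'a \<Rightarrow> complex" where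
  "\<rho> i j c = co (A.gen (mat_unit i j) \<odot>\<^bsub>L\<^esub> dec c)"

lemma gen_closed': "x \<in> \<aa> \<Longrightarrow> v \<in> carrier L \<Longrightarrow> A.gen x \<odot>\<^bsub>L\<^esub> v \<in> carrier L"
  by (simp add: smult_closed A.gen_closed)

lemma co_gen_add: "x \<in> \<aa> \<Longrightarrow> y \<in> \<aa> \<Longrightarrow> v \<in> carrier L \<Longrightarrow>
    co (A.gen (x + y) \<odot>\<^bsub>L\<^esub> v) = co (A.gen x \<odot>\<^bsub>L\<^esub> v) + co (A.gen y \<odot>\<^bsub>L\<^esub> v)"
  by (simp add: A.gen_add smult_l_distr A.gen_closed co_add gen_closed')

lemma co_gen_scale: "x \<in> \<aa> \<Longrightarrow> v \<in> carrier L \<Longrightarrow>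
    co (A.gen (mat_scale c x) \<odot>\<^bsub>L\<^esub> v) = sc c (co (A.gen x \<odot>\<^bsub>L\<^esub> v))"
  by (simp add: A.gen_scale smult_assoc A.gen_closed A.cst_closed co_scale gen_closed')

lemma lin_\<rho>: "mat_unit i j \<in> \<aa> \<Longrightarrow> lin (\<rho> i j)"
  unfolding lin_def \<rho>_def
proof (intro conjI allI)
  fix c d assume a: "mat_unit i j \<in> \<aa>"
  show "co (A.gen (mat_unit i j) \<odot>\<^bsub>L\<^esub> dec (c + d)) =
      co (A.gen (mat_unit i j) \<odot>\<^bsub>L\<^esub> dec c) + co (A.gen (mat_unit i j) \<odot>\<^bsub>L\<^esub> dec d)"
    using a by (simp add: dec_add smult_r_distr A.gen_closed dec_closed co_add gen_closed')
next
  fix k c assume a: "mat_unit i j \<in> \<aa>"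
  have "A.gen (mat_unit i j) \<odot>\<^bsub>L\<^esub> dec (sc k c) = A.cst k \<odot>\<^bsub>L\<^esub> (A.gen (mat_unit i j) \<odot>\<^bsub>L\<^esub> dec c)"
    using a by (simp add: dec_scale smult_assoc[symmetric] A.gen_closed A.cst_closed A.cst_central dec_closed)
  then show "co (A.gen (mat_unit i j) \<odot>\<^bsub>L\<^esub> dec (sc k c)) = sc k (co (A.gen (mat_unit i j) \<odot>\<^bsub>L\<^esub> dec c))"
    using a by (simp add: co_scale gen_closed' dec_closed)
qed

lemma co_gen_unit: "v \<in> carrier L \<Longrightarrow> co (A.gen (mat_unit i j) \<odot>\<^bsub>L\<^esub> v) = \<rho> i j (co v)"
  by (simp add: \<rho>_def dec_co)

end

locale even_module = fd_module m n "g_zero m n" L for m n and L :: "(free_alg set, 'a) module" +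
  assumes irr: "irreducible_module (UEA m n (g_zero m n)) L"
begin

lemma ev_unit: "ev m n i j \<Longrightarrow> mat_unit i j \<in> g_zero m n"
  by (auto simp: ev_def intro: mat_unit_g_zero)

lemma zero_g_zero: "0 \<in> g_zero m n"
  by (simp add: g_zero_iff gl_iff)

sublocale rep: g0_rep m n V \<rho>
proof
  show "fs.subspace V" by (rule subspace_V)
  fix i j assume ij: "ev m n i j"
  show "lin (\<rho> i j)" by (rule lin_\<rho>[OF ev_unit[OF ij]])
  fix x assume x: "x \<in> V"
  show "\<rho> i j x \<in> V" unfolding \<rho>_def by (intro co_V gen_closed' ev_unit ij dec_closed)
  fix k l assume kl: "ev m n k l"
  let ?a = "mat_unit i j" and ?b = "mat_unit k l"
  let ?p = "if j = k then mat_unit i l else 0" and ?q = "if l = i then mat_unit k j else 0"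
  let ?v = "dec x"
  have p: "?p \<in> g_zero m n" "?q \<in> g_zero m n"
    using ij kl zero_g_zero by (auto simp: ev_def intro!: mat_unit_g_zero)
  have par: "parity i j = 0" "parity k l = 0" using ij kl by (auto simp: parity_def ev_def)
  have "superbracket m n (parity i j) (parity k l) ?a ?b = ?p - mat_scale (ssgn i j k l) ?q"
    by (rule superbracket_unit) (use ij kl in \<open>auto simp: ev_def\<close>)
  then have sb: "superbracket m n 0 0 ?a ?b = ?p + mat_scale (- 1) ?q"
    unfolding par by (simp add: ssgn_def par mat_scale_def fun_eq_iff)
  have hom: "homogeneous 0 ?a" "homogeneous 0 ?b"
    using homogeneous_mat_unit[of i j] homogeneous_mat_unit[of k l] par by simp_all
  note u = ev_unit[OF ij] ev_unit[OF kl]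
  have "A.gen ?a \<otimes>\<^bsub>A.U\<^esub> A.gen ?b = A.cst ((-1) ^ (0 * 0)) \<otimes>\<^bsub>A.U\<^esub> (A.gen ?b \<otimes>\<^bsub>A.U\<^esub> A.gen ?a) \<oplus>\<^bsub>A.U\<^esub>
      A.gen (superbracket m n 0 0 ?a ?b)"
    by (rule A.gen_bracket[OF u hom])
  then have br: "A.gen ?a \<otimes>\<^bsub>A.U\<^esub> A.gen ?b =
      (A.gen ?b \<otimes>\<^bsub>A.U\<^esub> A.gen ?a) \<oplus>\<^bsub>A.U\<^esub> A.gen (?p + mat_scale (- 1) ?q)"
    using u by (simp add: sb A.cst_one A.gen_closed)
  have m: "?p + mat_scale (- 1) ?q \<in> g_zero m n" "mat_scale (- 1) ?q \<in> g_zero m n"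
    by (rule A.add_mem[OF p(1) A.scale_mem[OF p(2)]], rule A.scale_mem[OF p(2)])
  have gv: "A.gen ?a \<odot>\<^bsub>L\<^esub> ?v \<in> carrier L" "A.gen ?b \<odot>\<^bsub>L\<^esub> ?v \<in> carrier L"
    by (intro gen_closed' u dec_closed)+
  have "A.gen ?a \<odot>\<^bsub>L\<^esub> (A.gen ?b \<odot>\<^bsub>L\<^esub> ?v) = (A.gen ?a \<otimes>\<^bsub>A.U\<^esub> A.gen ?b) \<odot>\<^bsub>L\<^esub> ?v"
    using u by (simp add: smult_assoc A.gen_closed dec_closed)
  also have "\<dots> = (A.gen ?b \<otimes>\<^bsub>A.U\<^esub> A.gen ?a) \<odot>\<^bsub>L\<^esub> ?v \<oplus>\<^bsub>L\<^esub> A.gen (?p + mat_scale (- 1) ?q) \<odot>\<^bsub>L\<^esub> ?v"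
    unfolding br using u by (intro smult_l_distr R.m_closed A.gen_closed m dec_closed)
  also have "(A.gen ?b \<otimes>\<^bsub>A.U\<^esub> A.gen ?a) \<odot>\<^bsub>L\<^esub> ?v = A.gen ?b \<odot>\<^bsub>L\<^esub> (A.gen ?a \<odot>\<^bsub>L\<^esub> ?v)"
    using u by (intro smult_assoc A.gen_closed dec_closed)
  finally have E: "A.gen ?a \<odot>\<^bsub>L\<^esub> (A.gen ?b \<odot>\<^bsub>L\<^esub> ?v) =
      A.gen ?b \<odot>\<^bsub>L\<^esub> (A.gen ?a \<odot>\<^bsub>L\<^esub> ?v) \<oplus>\<^bsub>L\<^esub> A.gen (?p + mat_scale (- 1) ?q) \<odot>\<^bsub>L\<^esub> ?v" .
  have z: "co (A.gen 0 \<odot>\<^bsub>L\<^esub> ?v) = 0"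
  proof -
    have "mat_scale 0 0 = (0 :: mat)" by (simp add: mat_scale_def fun_eq_iff)
    then show ?thesis using co_gen_scale[OF zero_g_zero dec_closed, of 0] by simp
  qed
  have pq: "co (A.gen ?p \<odot>\<^bsub>L\<^esub> ?v) = (if j = k then \<rho> i l x else 0)"
    "co (A.gen ?q \<odot>\<^bsub>L\<^esub> ?v) = (if l = i then \<rho> k j x else 0)"
    using z by (auto simp: \<rho>_def)
  have "\<rho> i j (\<rho> k l x) = co (A.gen ?a \<odot>\<^bsub>L\<^esub> (A.gen ?b \<odot>\<^bsub>L\<^esub> ?v))"
    using co_gen_unit[OF gv(2), of i j] by (simp add: \<rho>_def)
  also have "\<dots> = co (A.gen ?b \<odot>\<^bsub>L\<^esub> (A.gen ?a \<odot>\<^bsub>L\<^esub> ?v)) + co (A.gen (?p + mat_scale (- 1) ?q) \<odot>\<^bsub>L\<^esub> ?v)"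
    unfolding E by (intro co_add gen_closed' u gv m dec_closed)
  also have "co (A.gen ?b \<odot>\<^bsub>L\<^esub> (A.gen ?a \<odot>\<^bsub>L\<^esub> ?v)) = \<rho> k l (\<rho> i j x)"
    using co_gen_unit[OF gv(1), of k l] by (simp add: \<rho>_def)
  also have "co (A.gen (?p + mat_scale (- 1) ?q) \<odot>\<^bsub>L\<^esub> ?v) =
      (if j = k then \<rho> i l x else 0) + sc (- 1) (if l = i then \<rho> k j x else 0)"
    unfolding co_gen_add[OF p(1) m(2) dec_closed] co_gen_scale[OF p(2) dec_closed] pq ..
  finally show "\<rho> i j (\<rho> k l x) = \<rho> k l (\<rho> i j x) + (if j = k then \<rho> i l x else 0) -
      (if l = i then \<rho> k j x else 0)"
    by (simp only: fs.scale_minus_left fs.scale_one add_uminus_conv_diff add_diff_eq)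
qed

lemma co_gen:
  assumes x: "x \<in> g_zero m n" and v: "v \<in> carrier L"
  shows "co (A.gen x \<odot>\<^bsub>L\<^esub> v) = (\<Sum>i\<in>idx m n. \<Sum>j\<in>idx m n. sc (x i j) (\<rho> i j (co v)))"
  unfolding co_gen_unit[OF v, symmetric]
proof (rule A.linear_expand)
  show "x \<in> gl m n" using x by (simp add: g_zero_iff)
  show "mat_unit i j \<in> g_zero m n" if "i \<in> idx m n" "j \<in> idx m n" "x i j \<noteq> 0" for i j
    using that x mat_unit_g_zero[of i m n j] by (simp add: g_zero_iff)
qed (rule zero_g_zero, rule co_gen_add[OF _ _ v], assumption+, rule co_gen_scale[OF _ v])

text \<open>An even matrix has its nonzero entries at even positions, so invariance under the even
  units gives stability under all generators of the enveloping algebra, and from there under the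
  whole algebra.\<close>

lemma submodule_image:
  assumes N: "rep.invariant N" shows "submodule (dec ` N) A.U L"
proof -
  have sN: "fs.subspace N" "N \<subseteq> V" and cl: "\<And>i j x. ev m n i j \<Longrightarrow> x \<in> N \<Longrightarrow> \<rho> i j x \<in> N"
    using N by (auto simp: rep.invariant_def)
  have memI: "v \<in> dec ` N" if "v \<in> carrier L" "co v \<in> N" for v
    using that dec_co by (metis imageI)
  have gen: "A.gen x \<odot>\<^bsub>L\<^esub> dec c \<in> dec ` N" if x: "x \<in> g_zero m n" and c: "c \<in> N" for x c
  proof (rule memI)
    show "A.gen x \<odot>\<^bsub>L\<^esub> dec c \<in> carrier L" by (intro gen_closed' x dec_closed)
    have "co (dec c) = c" using c sN by (intro co_dec) auto
    then have "co (A.gen x \<odot>\<^bsub>L\<^esub> dec c) = (\<Sum>i\<in>idx m n. \<Sum>j\<in>idx m n. sc (x i j) (\<rho> i j c))"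
      using co_gen[OF x dec_closed[of c]] by simp
    also have "\<dots> \<in> N"
    proof (intro fs.subspace_sum[OF sN(1)])
      fix i j assume ij: "i \<in> idx m n" "j \<in> idx m n"
      show "sc (x i j) (\<rho> i j c) \<in> N"
      proof (cases "x i j = 0")
        case True
        then show ?thesis using fs.subspace_0[OF sN(1)] by simp
      next
        case False
        then have "ev m n i j" using x ij by (auto simp: g_zero_iff ev_def)
        then show ?thesis by (intro fs.subspace_scale[OF sN(1)] cl c)
      qed
    qed
    finally show "co (A.gen x \<odot>\<^bsub>L\<^esub> dec c) \<in> N" .
  qed
  have smul: "u \<odot>\<^bsub>L\<^esub> v \<in> dec ` N" if "u \<in> carrier A.U" "v \<in> dec ` N" for u v
    using that
  proof (induction u arbitrary: v rule: A.U_induct)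
    case (cst c)
    then obtain d where "d \<in> N" "v = dec d" by blast
    then show ?case using dec_scale[of c d] fs.subspace_scale[OF sN(1)] by (metis imageI)
  next
    case (gen x)
    then show ?case using \<open>\<And>x c. x \<in> g_zero m n \<Longrightarrow> c \<in> N \<Longrightarrow> A.gen x \<odot>\<^bsub>L\<^esub> dec c \<in> dec ` N\<close> by blast
  next
    case (add u w)
    then obtain a b where "a \<in> N" "b \<in> N" "u \<odot>\<^bsub>L\<^esub> v = dec a" "w \<odot>\<^bsub>L\<^esub> v = dec b" by blast
    moreover have "v \<in> carrier L" using add dec_closed by blast
    ultimately have "(u \<oplus>\<^bsub>A.U\<^esub> w) \<odot>\<^bsub>L\<^esub> v = dec (a + b)" "a + b \<in> N"
      using add fs.subspace_add[OF sN(1)] by (simp_all add: smult_l_distr dec_add)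
    then show ?case by blast
  next
    case (mult u w)
    have "v \<in> carrier L" using mult dec_closed by blast
    then show ?case using mult by (simp add: smult_assoc)
  qed
  show ?thesis
  proof (intro submodule.intro submodule_axioms.intro)
    show "subgroup (dec ` N) (add_monoid L)"
    proof (rule group.subgroupI[OF M.a_group])
      show "dec ` N \<noteq> {}" using fs.subspace_0[OF sN(1)] by blast
      fix a assume a: "a \<in> dec ` N"
      then have "A.cst (- 1) \<odot>\<^bsub>L\<^esub> a \<in> dec ` N" by (intro smul A.cst_closed)
      moreover have "\<ominus>\<^bsub>L\<^esub> a = A.cst (- 1) \<odot>\<^bsub>L\<^esub> a"
      proof (rule M.minus_equality)
        obtain c where c: "a = dec c" using a by blast
        have "dec (sc (- 1) c + c) = \<zero>\<^bsub>L\<^esub>" by (simp add: dec_zero)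
        then show "A.cst (- 1) \<odot>\<^bsub>L\<^esub> a \<oplus>\<^bsub>L\<^esub> a = \<zero>\<^bsub>L\<^esub>" unfolding c dec_add dec_scale .
      qed (use a dec_closed cst_closed' in blast)+
      ultimately show "inv\<^bsub>add_monoid L\<^esub> a \<in> dec ` N" by (simp add: a_inv_def)
    next
      fix a b assume "a \<in> dec ` N" "b \<in> dec ` N"
      then show "a \<otimes>\<^bsub>add_monoid L\<^esub> b \<in> dec ` N"
        using fs.subspace_add[OF sN(1)] dec_add by (auto simp: dec_add[symmetric])
    qed (use dec_closed in auto)
  qed (rule smul)
qed

lemma rep_irreducible:
  assumes N: "rep.invariant N" shows "N = {0} \<or> N = V"
proof -
  have "dec ` N = {\<zero>\<^bsub>L\<^esub>} \<or> dec ` N = carrier L"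
    using irr submodule_image[OF N] unfolding irreducible_module_def by blast
  moreover have "co ` dec ` N = (\<lambda>x. x) ` N"
    unfolding image_image using N co_dec by (intro image_cong refl) (auto simp: rep.invariant_def)
  moreover have "co ` carrier L = V"
  proof (intro equalityI subsetI)
    fix c assume "c \<in> V"
    then have "c = co (dec c)" by (simp add: co_dec)
    then show "c \<in> co ` carrier L" using dec_closed by blast
  qed (auto intro: co_V)
  ultimately show ?thesis using co_zero by (metis image_insert image_empty image_ident)
qed

end

locale L0_module = even_module m n L for m n and L :: "(free_alg set, 'a) module" +
  fixes v :: 'a and mu :: weight
  assumes hwv: "highest_weight_vector m n (g_zero m n) L mu v"
begin

lemma v_closed: "v \<in> carrier L"
  using hwv by (simp add: highest_weight_vector_def singular_def)

sublocale hw: hw_vector m n V \<rho> "co v" mu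
proof
  have v: "v \<noteq> \<zero>\<^bsub>L\<^esub>" "\<And>x. x \<in> g_zero m n \<inter> n_plus m n \<Longrightarrow> A.gen x \<odot>\<^bsub>L\<^esub> v = \<zero>\<^bsub>L\<^esub>"
    "\<And>h. h \<in> cartan m n \<Longrightarrow> A.gen h \<odot>\<^bsub>L\<^esub> v = A.cst (weight_apply m n mu h) \<odot>\<^bsub>L\<^esub> v"
    using hwv by (auto simp: highest_weight_vector_def singular_def has_weight_def)
  show "rep.extremal (co v)"
    unfolding rep.extremal_def
  proof (intro conjI allI impI)
    fix i j assume ij: "ev m n i j" "i < j"
    have "mat_unit i j \<in> g_zero m n \<inter> n_plus m n"
      using ev_unit[OF ij(1)] ij by (auto simp: n_plus_def g_zero_iff) (auto simp: mat_unit_def split: if_splits)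
    then show "\<rho> i j (co v) = 0"
      using v(2) co_gen_unit[OF v_closed, of i j] co_zero by metis
  qed (rule co_V[OF v_closed])
  show "co v \<noteq> 0" using v(1) co_eq_0[OF v_closed] by simp
  fix i assume i: "i \<in> idx m n"
  note mat_unit_cartan[OF i]
  moreover note weight_apply_unit[OF i, of mu]
  ultimately show "\<rho> i i (co v) = sc (mu i) (co v)"
    using v(3)[of "mat_unit i i"] co_gen_unit[OF v_closed, of i i] co_scale[OF v_closed] by metis
qed

end

section \<open>A Fock space model of the Kac module\<close>

text \<open>A set \<open>S\<close> stands for the exterior monomial with factors \<open>S\<close> in
  increasing order; a slice is the coefficient of that monomial, a vector of the second tensor
  factor.\<close>

definition slice :: "('p set \<times> 'a \<Rightarrow> complex) \<Rightarrow> 'p set \<Rightarrow> 'a \<Rightarrow> complex" where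
  "slice f S = (\<lambda>b. f (S, b))"

definition glue :: "('p set \<Rightarrow> 'a \<Rightarrow> complex) \<Rightarrow> 'p set \<times> 'a \<Rightarrow> complex" where
  "glue F = (\<lambda>(S, b). F S b)"

lemma slice_glue [simp]: "slice (glue F) = F"
  by (simp add: slice_def glue_def fun_eq_iff)

lemma slice_eqI: "(\<And>S. slice f S = slice g S) \<Longrightarrow> f = g"
  by (auto simp: slice_def fun_eq_iff)

lemma slice_simps [simp]:
  "slice 0 S = 0" "slice (f + g) S = slice f S + slice g S" "slice (f - g) S = slice f S - slice g S"
  "slice (- f) S = - slice f S" "slice (sc c f) S = sc c (slice f S)"
  by (auto simp: slice_def sc_def fun_eq_iff)

lemma slice_sum: "slice (sum f A) S = (\<Sum>a\<in>A. slice (f a) S)"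
  by (induction A rule: infinite_finite_induct) (auto simp: fun_eq_iff slice_def)

locale fock = g0_rep m n V \<rho>
  for m n and V :: "('a \<Rightarrow> complex) set" and \<rho>
begin

definition Ps :: "int set" where "Ps = {i \<in> idx m n. 0 < i}"
definition Ng :: "int set" where "Ng = {i \<in> idx m n. i < 0}"
definition P :: "(int \<times> int) set" where "P = Ps \<times> Ng"

lemma finite_Ps [simp]: "finite Ps" and finite_Ng [simp]: "finite Ng" and finite_P [simp]: "finite P"
  by (auto simp: Ps_def Ng_def P_def)

lemma P_iff: "(p, i) \<in> P \<longleftrightarrow> p \<in> Ps \<and> i \<in> Ng"
  by (simp add: P_def)

lemma idx_cases: "i \<in> idx m n \<longleftrightarrow> i \<in> Ps \<or> i \<in> Ng"
  by (auto simp: Ps_def Ng_def mem_idx)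

lemma PsD: "p \<in> Ps \<Longrightarrow> 0 < p" and NgD: "i \<in> Ng \<Longrightarrow> i < 0"
  by (auto simp: Ps_def Ng_def)

lemma Ps_Ng: "p \<in> Ps \<Longrightarrow> i \<in> Ng \<Longrightarrow> p \<noteq> i"
  by (auto simp: Ps_def Ng_def)

lemma e_iff: "e i j \<longleftrightarrow> i \<in> Ps \<and> j \<in> Ps \<or> i \<in> Ng \<and> j \<in> Ng"
  by (auto simp: ev_def Ps_def Ng_def mem_idx)

text \<open>The sign of moving the factor \<open>a\<close> to its sorted place in the monomial
  \<open>S\<close>, for the lexicographic order on pairs. The operators act on functions of
  arbitrary sets, and intersecting with \<open>P\<close> keeps the count finite.\<close>

definition sg :: "int \<times> int \<Rightarrow> (int \<times> int) set \<Rightarrow> complex" where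
  "sg a S = (-1) ^ card {b \<in> S \<inter> P. b < a}"

lemma sg_sq [simp]: "sg a S * sg a S = 1"
  by (simp add: sg_def flip: power_add)

lemma sg_insert_self [simp]: "sg a (insert a S) = sg a S"
  and sg_remove_self [simp]: "sg a (S - {a}) = sg a S"
proof -
  have "{b \<in> insert a S \<inter> P. b < a} = {b \<in> S \<inter> P. b < a}" "{b \<in> (S - {a}) \<inter> P. b < a} = {b \<in> S \<inter> P. b < a}"
    by auto
  then show "sg a (insert a S) = sg a S" "sg a (S - {a}) = sg a S" by (simp_all add: sg_def)
qed

lemma sg_insert: "a \<noteq> b \<Longrightarrow> b \<in> P \<Longrightarrow> b \<notin> S \<Longrightarrow> sg a (insert b S) = (if b < a then - sg a S else sg a S)"
proof -
  assume *: "a \<noteq> b" "b \<in> P" "b \<notin> S"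
  show ?thesis
  proof (cases "b < a")
    case True
    then have "{c \<in> insert b S \<inter> P. c < a} = insert b {c \<in> S \<inter> P. c < a}" using * by auto
    moreover have "finite {c \<in> S \<inter> P. c < a}" by (rule finite_subset[OF _ finite_P]) auto
    ultimately show ?thesis using True * by (simp add: sg_def)
  next
    case False
    then have "{c \<in> insert b S \<inter> P. c < a} = {c \<in> S \<inter> P. c < a}" by auto
    then show ?thesis using False by (simp add: sg_def)
  qed
qed

lemma sg_remove: "a \<noteq> b \<Longrightarrow> b \<in> P \<Longrightarrow> b \<in> S \<Longrightarrow> sg a (S - {b}) = (if b < a then - sg a S else sg a S)"
  using sg_insert[of a b "S - {b}"] by (auto simp: insert_absorb split: if_splits)

definition cre :: "int \<times> int \<Rightarrow> ((int \<times> int) set \<times> 'a \<Rightarrow> complex) \<Rightarrow> (int \<times> int) set \<times> 'a \<Rightarrow> complex" where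
  "cre a f = glue (\<lambda>S. if a \<in> S then sc (sg a S) (slice f (S - {a})) else 0)"

definition ann :: "int \<times> int \<Rightarrow> ((int \<times> int) set \<times> 'a \<Rightarrow> complex) \<Rightarrow> (int \<times> int) set \<times> 'a \<Rightarrow> complex" where
  "ann a f = glue (\<lambda>S. if a \<in> S then 0 else sc (sg a S) (slice f (insert a S)))"

definition rho :: "int \<Rightarrow> int \<Rightarrow> ((int \<times> int) set \<times> 'a \<Rightarrow> complex) \<Rightarrow> (int \<times> int) set \<times> 'a \<Rightarrow> complex" where
  "rho i j f = glue (\<lambda>S. \<rho> i j (slice f S))"

definition vac :: "('a \<Rightarrow> complex) \<Rightarrow> (int \<times> int) set \<times> 'a \<Rightarrow> complex" where
  "vac x = glue (\<lambda>S. if S = {} then x else 0)"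

definition W :: "((int \<times> int) set \<times> 'a \<Rightarrow> complex) set" where
  "W = {f. \<forall>S. slice f S \<in> V \<and> (\<not> S \<subseteq> P \<longrightarrow> slice f S = 0)}"

lemma slice_cre: "slice (cre a f) S = (if a \<in> S then sc (sg a S) (slice f (S - {a})) else 0)"
  and slice_ann: "slice (ann a f) S = (if a \<in> S then 0 else sc (sg a S) (slice f (insert a S)))"
  and slice_rho: "slice (rho i j f) S = \<rho> i j (slice f S)"
  and slice_vac: "slice (vac x) S = (if S = {} then x else 0)"
  by (simp_all add: cre_def ann_def rho_def vac_def)

lemma lin_cre: "lin (cre a)" and lin_ann: "lin (ann a)"
  unfolding lin_def by (auto intro!: slice_eqI simp: slice_cre slice_ann fs.scale_right_distrib mult.commute)

lemma lin_rho: "e i j \<Longrightarrow> lin (rho i j)"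
  unfolding lin_def by (auto intro!: slice_eqI simp: slice_rho lin_add[OF lin_\<rho>] lin_sc[OF lin_\<rho>])

lemma lin_vac: "lin vac"
  unfolding lin_def by (auto intro!: slice_eqI simp: slice_vac)

text \<open>For distinct indices exactly one of the two signs notices the other index, namely the
  sign of the larger one; this is the source of the minus here and in
  \<open>ann_cre\<close>.\<close>

lemma cre_cre:
  assumes "a \<in> P" "b \<in> P" shows "cre a (cre b f) = - cre b (cre a f)"
proof (rule slice_eqI)
  fix S
  have d: "S - {a} - {b} = S - {b} - {a}" by auto
  show "slice (cre a (cre b f)) S = slice (- cre b (cre a f)) S"
    using assms by (cases "a = b"; cases "a < b") (auto simp: slice_cre sg_remove d mult.commute)
qed

lemma ann_cre:
  assumes "a \<in> P" "b \<in> P" shows "ann a (cre b f) = (if a = b then f else 0) - cre b (ann a f)"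
proof (rule slice_eqI)
  fix S
  show "slice (ann a (cre b f)) S = slice ((if a = b then f else 0) - cre b (ann a f)) S"
  proof (cases "a = b")
    case True
    then show ?thesis by (auto simp: slice_cre slice_ann insert_absorb)
  next
    case False
    then have d: "insert a (S - {b}) = insert a S - {b}" by auto
    show ?thesis
      using assms False by (cases "a < b") (auto simp: slice_cre slice_ann sg_remove sg_insert d mult.commute)
  qed
qed

lemma rho_cre: "e i j \<Longrightarrow> rho i j (cre a f) = cre a (rho i j f)"
  by (auto intro!: slice_eqI simp: slice_cre slice_ann slice_rho lin_sc[OF lin_\<rho>] lin_zero[OF lin_\<rho>])

lemma rho_vac: "e i j \<Longrightarrow> rho i j (vac x) = vac (\<rho> i j x)"
  by (auto intro!: slice_eqI simp: slice_vac slice_rho lin_zero[OF lin_\<rho>])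

lemma ann_vac: "ann a (vac x) = 0"
  by (auto intro!: slice_eqI simp: slice_vac slice_ann)

lemma subspace_W: "fs.subspace W"
  by (rule fs.subspaceI) (auto simp: W_def fs.subspace_0[OF V] fs.subspace_add[OF V] fs.subspace_scale[OF V])

lemma vac_W: "x \<in> V \<Longrightarrow> vac x \<in> W"
  by (auto simp: W_def slice_vac fs.subspace_0[OF V])

lemma cre_W:
  assumes a: "a \<in> P" and f: "f \<in> W" shows "cre a f \<in> W"
proof -
  have "slice f (S - {a}) = 0" if "\<not> S \<subseteq> P" for S
  proof -
    have "\<not> S - {a} \<subseteq> P" using that a by blast
    then show ?thesis using f by (simp add: W_def)
  qed
  then show ?thesis
    using f unfolding W_def by (auto simp: slice_cre fs.subspace_0[OF V] intro!: fs.subspace_scale[OF V])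
qed

lemma ann_W: "a \<in> P \<Longrightarrow> f \<in> W \<Longrightarrow> ann a f \<in> W"
  unfolding W_def by (auto simp: slice_ann fs.subspace_0[OF V] intro!: fs.subspace_scale[OF V])

lemma rho_W: "e i j \<Longrightarrow> f \<in> W \<Longrightarrow> rho i j f \<in> W"
  unfolding W_def by (auto simp: slice_rho lin_zero[OF lin_\<rho>] intro: \<rho>_mem)

lemma W_induct [consumes 1, case_names vac cre add]:
  assumes f: "f \<in> W" and vac: "\<And>x. x \<in> V \<Longrightarrow> Q (vac x)"
    and cre: "\<And>r c f. r \<in> Ps \<Longrightarrow> c \<in> Ng \<Longrightarrow> f \<in> W \<Longrightarrow> Q f \<Longrightarrow> Q (cre (r, c) f)"
    and add: "\<And>f g. f \<in> W \<Longrightarrow> g \<in> W \<Longrightarrow> Q f \<Longrightarrow> Q g \<Longrightarrow> Q (f + g)"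
  shows "Q f"
proof -
  define mono where "mono S x = glue (\<lambda>S'. if S' = S then x else 0)" for S :: "(int \<times> int) set" and x :: "'a \<Rightarrow> complex"
  have m: "Q (mono S x) \<and> mono S x \<in> W" if "finite S" "S \<subseteq> P" "x \<in> V" for S x
    using that
  proof (induction S arbitrary: x rule: finite_induct)
    case empty
    have "mono {} x = vac x" by (simp add: mono_def vac_def)
    then show ?case using vac vac_W empty by simp
  next
    case (insert a S)
    \<comment> \<open>Creating \<open>a\<close> multiplies by \<open>sg a S\<close>; scaling by the
      same sign beforehand makes the total factor 1.\<close>
    let ?x = "sc (sg a S) x"
    have IH: "Q (mono S ?x)" "mono S ?x \<in> W" using insert fs.subspace_scale[OF V] by auto
    have "mono (insert a S) x = cre a (mono S ?x)"
    proof (rule slice_eqI)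
      fix S'
      have "a \<in> S' \<and> S' - {a} = S \<longleftrightarrow> S' = insert a S" using insert(2) by auto
      then show "slice (mono (insert a S) x) S' = slice (cre a (mono S ?x)) S'"
        by (auto simp: slice_cre mono_def)
    qed
    then show ?case
      using cre[of "fst a" "snd a" "mono S ?x"] IH insert.prems by (auto simp: cre_W P_def)
  qed
  have fin: "finite (Pow P)" by simp
  have s: "Q (\<Sum>S\<in>A. mono S (slice f S)) \<and> (\<Sum>S\<in>A. mono S (slice f S)) \<in> W"
    if "finite A" "A \<subseteq> Pow P" for A
    using that
  proof (induction A rule: finite_induct)
    case empty
    have "vac 0 = 0" by (rule lin_zero[OF lin_vac])
    then have "Q (0 :: (int \<times> int) set \<times> 'a \<Rightarrow> complex)" using vac[of 0] fs.subspace_0[OF V] by simp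
    then have "Q (\<Sum>S\<in>{}. mono S (slice f S)) \<and> (\<Sum>S\<in>{}. mono S (slice f S)) \<in> W"
      using fs.subspace_0[OF subspace_W] by simp
    then show ?case .
  next
    case (insert S A)
    have "finite S" "slice f S \<in> V" using insert.prems finite_subset[of S P] f by (auto simp: W_def)
    then have S: "Q (mono S (slice f S))" "mono S (slice f S) \<in> W" using m[of S] insert.prems by auto
    have A: "Q (\<Sum>S\<in>A. mono S (slice f S))" "(\<Sum>S\<in>A. mono S (slice f S)) \<in> W"
      using insert.IH insert.prems by auto
    have "Q (mono S (slice f S) + (\<Sum>S\<in>A. mono S (slice f S))) \<and>
        mono S (slice f S) + (\<Sum>S\<in>A. mono S (slice f S)) \<in> W"
      by (intro conjI add[OF S(2) A(2) S(1) A(1)] fs.subspace_add[OF subspace_W S(2) A(2)])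
    then have "Q (\<Sum>S\<in>insert S A. mono S (slice f S)) \<and> (\<Sum>S\<in>insert S A. mono S (slice f S)) \<in> W"
      using insert.hyps by simp
    then show ?case .
  qed
  have "f = (\<Sum>S\<in>Pow P. mono S (slice f S))"
  proof (rule slice_eqI)
    fix S'
    have "slice (\<Sum>S\<in>Pow P. mono S (slice f S)) S' = (\<Sum>S\<in>Pow P. if S = S' then slice f S' else 0)"
      unfolding slice_sum by (rule sum.cong) (auto simp: mono_def)
    also have "\<dots> = (if S' \<in> Pow P then slice f S' else 0)" using fin by (rule sum.delta)
    also have "\<dots> = slice f S'" using f by (auto simp: W_def)
    finally show "slice f S' = slice (\<Sum>S\<in>Pow P. mono S (slice f S)) S'" ..
  qed
  then have "Q f = Q (\<Sum>S\<in>Pow P. mono S (slice f S))" by (rule arg_cong)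
  then show ?thesis using s[OF fin subset_refl] by blast
qed

text \<open>Elements of g_{-1} act by exterior multiplication. Even units act on both factors: by
  \<open>rho\<close> on the module, and on g_{-1} by the adjoint action extended as a derivation,
  which is a sum of creations times annihilations. For the remaining odd units the formula is forced
  by \<open>upper_vac\<close> and \<open>upper_cre\<close>: contracting one factor leaves an even
  unit acting on the rest, and the cubic sum is the part of that action falling on the remaining
  exterior factors.\<close>

definition E :: "int \<Rightarrow> int \<Rightarrow> ((int \<times> int) set \<times> 'a \<Rightarrow> complex) \<Rightarrow> (int \<times> int) set \<times> 'a \<Rightarrow> complex" where
  "E i j f =
    (if 0 < i then
       if j < 0 then cre (i, j) f else rho i j f + (\<Sum>k\<in>Ng. cre (i, k) (ann (j, k) f))
     else
       if j < 0 then rho i j f - (\<Sum>p\<in>Ps. cre (p, j) (ann (p, i) f))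
       else (\<Sum>k\<in>Ng. rho i k (ann (j, k) f)) + (\<Sum>q\<in>Ps. rho q j (ann (q, i) f))
         - (\<Sum>q\<in>Ps. \<Sum>k\<in>Ng. cre (q, k) (ann (q, i) (ann (j, k) f))))"

lemma E_lower: "p \<in> Ps \<Longrightarrow> i \<in> Ng \<Longrightarrow> E p i = cre (p, i)"
  by (auto simp: E_def fun_eq_iff dest: PsD NgD)

lemma E_pos: "p \<in> Ps \<Longrightarrow> q \<in> Ps \<Longrightarrow> E p q f = rho p q f + (\<Sum>k\<in>Ng. cre (p, k) (ann (q, k) f))"
  by (auto simp: E_def dest!: PsD)

lemma E_neg: "i \<in> Ng \<Longrightarrow> j \<in> Ng \<Longrightarrow> E i j f = rho i j f - (\<Sum>p\<in>Ps. cre (p, j) (ann (p, i) f))"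
  by (auto simp: E_def dest!: NgD)

lemma E_upper: "i \<in> Ng \<Longrightarrow> p \<in> Ps \<Longrightarrow> E i p f =
    (\<Sum>k\<in>Ng. rho i k (ann (p, k) f)) + (\<Sum>q\<in>Ps. rho q p (ann (q, i) f))
         - (\<Sum>q\<in>Ps. \<Sum>k\<in>Ng. cre (q, k) (ann (q, i) (ann (p, k) f)))"
  by (auto simp: E_def dest!: NgD PsD)

lemma lin_E: "i \<in> idx m n \<Longrightarrow> j \<in> idx m n \<Longrightarrow> lin (E i j)"
proof -
  have pos: "lin (E p q)" if pq: "p \<in> Ps" "q \<in> Ps" for p q
  proof -
    have "lin (\<lambda>f. \<Sum>k\<in>Ng. cre (p, k) (ann (q, k) f))"
      by (rule lin_setsum[of Ng "\<lambda>k f. cre (p, k) (ann (q, k) f)"]) (rule lin_comp[OF lin_cre lin_ann])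
    from lin_plus[OF lin_rho this, of p q] show ?thesis
      unfolding E_pos[OF pq, abs_def] using pq by (simp add: e_iff)
  qed
  have neg: "lin (E i j)" if ij: "i \<in> Ng" "j \<in> Ng" for i j
  proof -
    have "lin (\<lambda>f. \<Sum>p\<in>Ps. cre (p, j) (ann (p, i) f))"
      by (rule lin_setsum[of Ps "\<lambda>p f. cre (p, j) (ann (p, i) f)"]) (rule lin_comp[OF lin_cre lin_ann])
    from lin_subtract[OF lin_rho this, of i j] show ?thesis
      unfolding E_neg[OF ij, abs_def] using ij by (simp add: e_iff)
  qed
  have up: "lin (E i p)" if ip: "i \<in> Ng" "p \<in> Ps" for i p
  proof -
    have 1: "lin (\<lambda>f. \<Sum>k\<in>Ng. rho i k (ann (p, k) f))"
      by (rule lin_setsum[of Ng "\<lambda>k f. rho i k (ann (p, k) f)"])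
        (rule lin_comp[OF lin_rho lin_ann], use ip in \<open>simp add: e_iff\<close>)
    have 2: "lin (\<lambda>f. \<Sum>q\<in>Ps. rho q p (ann (q, i) f))"
      by (rule lin_setsum[of Ps "\<lambda>q f. rho q p (ann (q, i) f)"])
        (rule lin_comp[OF lin_rho lin_ann], use ip in \<open>simp add: e_iff\<close>)
    have 3: "lin (\<lambda>f. \<Sum>q\<in>Ps. \<Sum>k\<in>Ng. cre (q, k) (ann (q, i) (ann (p, k) f)))"
      by (rule lin_setsum[of Ps "\<lambda>q f. \<Sum>k\<in>Ng. cre (q, k) (ann (q, i) (ann (p, k) f))"],
          rule lin_setsum[of Ng "\<lambda>k f. cre (q, k) (ann (q, i) (ann (p, k) f))" for q])
        (rule lin_comp[OF lin_cre lin_comp[OF lin_ann lin_ann]])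
    from lin_subtract[OF lin_plus[OF 1 2] 3] show ?thesis
      unfolding E_upper[OF ip, abs_def] .
  qed
  show "i \<in> idx m n \<Longrightarrow> j \<in> idx m n \<Longrightarrow> lin (E i j)"
    using pos neg up lin_cre by (auto simp: idx_cases E_lower)
qed

lemma E_mem: "i \<in> idx m n \<Longrightarrow> j \<in> idx m n \<Longrightarrow> f \<in> W \<Longrightarrow> E i j f \<in> W"
  unfolding idx_cases
  by (auto simp: E_lower E_pos E_neg E_upper e_iff P_iff
      intro!: cre_W fs.subspace_add[OF subspace_W] fs.subspace_diff[OF subspace_W]
        fs.subspace_sum[OF subspace_W] rho_W ann_W)

text \<open>The commutators of the matrix units with the creation operators follow from the canonical
  anticommutation relations; all other relations are then checked on the vacuum and propagated by
  creation operators through the Jacobi identity.\<close>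

lemma cac:
  assumes "a \<in> P" "c \<in> P" "d \<in> P"
  shows "cre c (ann d (cre a f)) = (if d = a then cre c f else 0) + cre a (cre c (ann d f))"
  unfolding ann_cre[OF assms(3,1)] lin_diff[OF lin_cre] cre_cre[OF assms(2,1)]
  by (simp add: lin_zero[OF lin_cre])

lemma caac:
  assumes "a \<in> P" "c \<in> P" "d \<in> P" "b \<in> P"
  shows "cre c (ann d (ann b (cre a f))) = (if b = a then cre c (ann d f) else 0) -
    (if d = a then cre c (ann b f) else 0) - cre a (cre c (ann d (ann b f)))"
  unfolding ann_cre[OF assms(4,1)] lin_diff[OF lin_ann] lin_diff[OF lin_cre] cac[OF assms(1-3)]
  by (simp add: lin_zero[OF lin_cre] lin_zero[OF lin_ann])

lemma sum_cre: "(\<Sum>k\<in>A. cre a (g k)) = cre a (\<Sum>k\<in>A. g k)"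
  by (simp add: lin_sum[OF lin_cre])

lemma even_cre:
  assumes ij: "e i j" and rc: "r \<in> Ps" "c \<in> Ng"
  shows "E i j (cre (r, c) f) = cre (r, c) (E i j f) + (if j = r then cre (i, c) f else 0) -
    (if i = c then cre (r, j) f else 0)"
proof (cases "i \<in> Ps")
  case True
  then have j: "j \<in> Ps" using ij Ps_Ng by (auto simp: e_iff)
  have "(\<Sum>k\<in>Ng. cre (i, k) (ann (j, k) (cre (r, c) f))) =
      (\<Sum>k\<in>Ng. (if k = c then (if j = r then cre (i, c) f else 0) else 0) + cre (r, c) (cre (i, k) (ann (j, k) f)))"
    by (rule sum.cong[OF refl], subst cac) (use rc True j in \<open>auto simp: P_iff\<close>)
  also have "\<dots> = (if j = r then cre (i, c) f else 0) + cre (r, c) (\<Sum>k\<in>Ng. cre (i, k) (ann (j, k) f))"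
    using rc by (simp add: sum.distrib sum_cre)
  finally show ?thesis
    using True rc j Ps_Ng[of i c] by (simp add: E_pos rho_cre[OF ij] lin_add[OF lin_cre])
next
  case False
  then have i: "i \<in> Ng" "j \<in> Ng" using ij by (auto simp: e_iff)
  have "(\<Sum>p\<in>Ps. cre (p, j) (ann (p, i) (cre (r, c) f))) =
      (\<Sum>p\<in>Ps. (if p = r then (if i = c then cre (r, j) f else 0) else 0) + cre (r, c) (cre (p, j) (ann (p, i) f)))"
    by (rule sum.cong[OF refl], subst cac) (use rc i in \<open>auto simp: P_iff\<close>)
  also have "\<dots> = (if i = c then cre (r, j) f else 0) + cre (r, c) (\<Sum>p\<in>Ps. cre (p, j) (ann (p, i) f))"
    using rc by (simp add: sum.distrib sum_cre)
  finally have s: "(\<Sum>p\<in>Ps. cre (p, j) (ann (p, i) (cre (r, c) f))) =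
      (if i = c then cre (r, j) f else 0) + cre (r, c) (\<Sum>p\<in>Ps. cre (p, j) (ann (p, i) f))" .
  have "j \<noteq> r" using Ps_Ng[OF rc(1) i(2)] by auto
  then show ?thesis
    unfolding E_neg[OF i] s rho_cre[OF ij] lin_diff[OF lin_cre] by simp
qed

text \<open>Two odd operators have an anticommutator, hence the minus. The first two sums contribute
  the \<open>rho\<close> parts of the even units \<open>E i c\<close> and \<open>E r p\<close>, the
  cubic sum their exterior parts.\<close>

lemma upper_cre:
  assumes ip: "i \<in> Ng" "p \<in> Ps" and rc: "r \<in> Ps" "c \<in> Ng"
  shows "E i p (cre (r, c) f) = - cre (r, c) (E i p f) + (if p = r then E i c f else 0) +
    (if i = c then E r p f else 0)"
proof -
  have 1: "(\<Sum>k\<in>Ng. rho i k (ann (p, k) (cre (r, c) f))) =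
      (if p = r then rho i c f else 0) - cre (r, c) (\<Sum>k\<in>Ng. rho i k (ann (p, k) f))"
  proof -
    have "(\<Sum>k\<in>Ng. rho i k (ann (p, k) (cre (r, c) f))) =
        (\<Sum>k\<in>Ng. (if k = c then (if p = r then rho i c f else 0) else 0) - cre (r, c) (rho i k (ann (p, k) f)))"
    proof (rule sum.cong[OF refl])
      fix k assume k: "k \<in> Ng"
      then have "e i k" using ip by (simp add: e_iff)
      moreover have "(p, k) \<in> P" "(r, c) \<in> P" using k ip rc by (auto simp: P_iff)
      ultimately show "rho i k (ann (p, k) (cre (r, c) f)) =
          (if k = c then (if p = r then rho i c f else 0) else 0) - cre (r, c) (rho i k (ann (p, k) f))"
        by (auto simp: ann_cre lin_diff[OF lin_rho] rho_cre lin_zero[OF lin_rho])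
    qed
    then show ?thesis using rc by (simp add: sum_subtractf sum_cre)
  qed
  have 2: "(\<Sum>q\<in>Ps. rho q p (ann (q, i) (cre (r, c) f))) =
      (if i = c then rho r p f else 0) - cre (r, c) (\<Sum>q\<in>Ps. rho q p (ann (q, i) f))"
  proof -
    have "(\<Sum>q\<in>Ps. rho q p (ann (q, i) (cre (r, c) f))) =
        (\<Sum>q\<in>Ps. (if q = r then (if i = c then rho r p f else 0) else 0) - cre (r, c) (rho q p (ann (q, i) f)))"
    proof (rule sum.cong[OF refl])
      fix q assume q: "q \<in> Ps"
      then have "e q p" using ip by (simp add: e_iff)
      moreover have "(q, i) \<in> P" "(r, c) \<in> P" using q ip rc by (auto simp: P_iff)
      ultimately show "rho q p (ann (q, i) (cre (r, c) f)) =
          (if q = r then (if i = c then rho r p f else 0) else 0) - cre (r, c) (rho q p (ann (q, i) f))"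
        by (auto simp: ann_cre lin_diff[OF lin_rho] rho_cre lin_zero[OF lin_rho])
    qed
    then show ?thesis using rc by (simp add: sum_subtractf sum_cre)
  qed
  have 3: "(\<Sum>q\<in>Ps. \<Sum>k\<in>Ng. cre (q, k) (ann (q, i) (ann (p, k) (cre (r, c) f)))) =
      (if p = r then (\<Sum>q\<in>Ps. cre (q, c) (ann (q, i) f)) else 0) -
      (if i = c then (\<Sum>k\<in>Ng. cre (r, k) (ann (p, k) f)) else 0) -
      cre (r, c) (\<Sum>q\<in>Ps. \<Sum>k\<in>Ng. cre (q, k) (ann (q, i) (ann (p, k) f)))"
  proof -
    have "(\<Sum>q\<in>Ps. \<Sum>k\<in>Ng. cre (q, k) (ann (q, i) (ann (p, k) (cre (r, c) f)))) =
        (\<Sum>q\<in>Ps. \<Sum>k\<in>Ng. (if k = c then (if p = r then cre (q, c) (ann (q, i) f) else 0) else 0) -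
          (if q = r then (if i = c then cre (r, k) (ann (p, k) f) else 0) else 0) -
          cre (r, c) (cre (q, k) (ann (q, i) (ann (p, k) f))))"
      by (intro sum.cong refl, subst caac) (use ip rc in \<open>auto simp: P_iff\<close>)
    also have "\<dots> = (\<Sum>q\<in>Ps. \<Sum>k\<in>Ng. (if k = c then (if p = r then cre (q, c) (ann (q, i) f) else 0) else 0)) -
        (\<Sum>q\<in>Ps. \<Sum>k\<in>Ng. (if q = r then (if i = c then cre (r, k) (ann (p, k) f) else 0) else 0)) -
        (\<Sum>q\<in>Ps. \<Sum>k\<in>Ng. cre (r, c) (cre (q, k) (ann (q, i) (ann (p, k) f))))"
      by (simp only: sum_subtractf)
    also have "(\<Sum>q\<in>Ps. \<Sum>k\<in>Ng. (if q = r then (if i = c then cre (r, k) (ann (p, k) f) else 0) else 0)) =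
        (\<Sum>k\<in>Ng. \<Sum>q\<in>Ps. (if q = r then (if i = c then cre (r, k) (ann (p, k) f) else 0) else 0))"
      by (rule sum.swap)
    also have "\<dots> = (if i = c then (\<Sum>k\<in>Ng. cre (r, k) (ann (p, k) f)) else 0)"
      using rc by (cases "i = c") (simp_all add: sum.delta)
    also have "(\<Sum>q\<in>Ps. \<Sum>k\<in>Ng. (if k = c then (if p = r then cre (q, c) (ann (q, i) f) else 0) else 0)) =
        (if p = r then (\<Sum>q\<in>Ps. cre (q, c) (ann (q, i) f)) else 0)"
      using rc by (cases "p = r") (simp_all add: sum.delta)
    finally show ?thesis unfolding sum_cre .
  qed
  have eq: "A1 - c1 + (A2 - c2) - (A3 - A4 - c3) = - (c1 + c2 - c3) + (A1 - A3) + (A2 + A4)"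
    for A1 A2 A3 A4 c1 c2 c3 :: "(int \<times> int) set \<times> 'a \<Rightarrow> complex" by (rule ext) simp
  have "- cre (r, c) (E i p f) = - (cre (r, c) (\<Sum>k\<in>Ng. rho i k (ann (p, k) f)) +
      cre (r, c) (\<Sum>q\<in>Ps. rho q p (ann (q, i) f)) -
      cre (r, c) (\<Sum>q\<in>Ps. \<Sum>k\<in>Ng. cre (q, k) (ann (q, i) (ann (p, k) f))))"
    by (simp only: E_upper[OF ip] lin_diff[OF lin_cre] lin_add[OF lin_cre])
  moreover have "(if p = r then E i c f else 0) = (if p = r then rho i c f else 0) -
      (if p = r then (\<Sum>q\<in>Ps. cre (q, c) (ann (q, i) f)) else 0)"
    using ip rc by (simp add: E_neg)
  moreover have "(if i = c then E r p f else 0) = (if i = c then rho r p f else 0) +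
      (if i = c then (\<Sum>k\<in>Ng. cre (r, k) (ann (p, k) f)) else 0)"
    using ip rc by (simp add: E_pos)
  ultimately show ?thesis
    unfolding E_upper[OF ip, of "cre (r, c) f"] 1 2 3 by (simp only: eq)
qed

lemma lin_if:
  assumes "lin T" shows "T (if b then f else 0) = (if b then T f else 0)"
  by (cases b) (simp_all add: lin_zero[OF assms])

lemma e_idx: "e i j \<Longrightarrow> i \<in> idx m n \<and> j \<in> idx m n"
  by (simp add: ev_def)

lemma lin_even: "e i j \<Longrightarrow> lin (E i j)"
  using lin_E e_idx by blast

lemma lin_upper: "i \<in> Ng \<Longrightarrow> p \<in> Ps \<Longrightarrow> lin (E i p)"
  using lin_E idx_cases by blast

lemma even_vac: "e i j \<Longrightarrow> E i j (vac x) = vac (\<rho> i j x)"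
  by (auto simp: e_iff E_pos E_neg rho_vac ann_vac lin_zero[OF lin_cre])

lemma upper_vac: "i \<in> Ng \<Longrightarrow> p \<in> Ps \<Longrightarrow> E i p (vac x) = 0"
proof -
  assume ip: "i \<in> Ng" "p \<in> Ps"
  have "(\<Sum>k\<in>Ng. rho i k 0) = 0" "(\<Sum>q\<in>Ps. rho q p 0) = 0"
    using ip by (auto intro!: sum.neutral lin_zero[OF lin_rho] simp: e_iff)
  then show ?thesis by (simp add: E_upper[OF ip] ann_vac lin_zero[OF lin_cre] lin_zero[OF lin_ann])
qed

lemma even_even:
  assumes "f \<in> W" and ij: "e i j" and kl: "e k l"
  shows "E i j (E k l f) = E k l (E i j f) + (if j = k then E i l f else 0) - (if l = i then E k j f else 0)"
  using assms(1)
proof (induction f rule: W_induct)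
  case (vac x)
  have 1: "(if j = k then E i l (vac x) else 0) = vac (if j = k then \<rho> i l x else 0)"
    "(if l = i then E k j (vac x) else 0) = vac (if l = i then \<rho> k j x else 0)"
    using even_vac[of i l x] even_vac[of k j x] e_trans ij kl lin_zero[OF lin_vac] by auto
  show ?case
    unfolding 1 even_vac[OF ij] even_vac[OF kl] \<rho>_comm[OF ij kl vac] lin_add[OF lin_vac] lin_diff[OF lin_vac] ..
next
  case (cre r c f)
  let ?Z = "cre (r, c)"
  note X = lin_even[OF ij] and Y = lin_even[OF kl]
  have XZ: "E i j (?Z g) = ?Z (E i j g) + (if j = r then cre (i, c) g else 0) - (if i = c then cre (r, j) g else 0)" for g
    by (rule even_cre[OF ij cre(1,2)])
  have YZ: "E k l (?Z g) = ?Z (E k l g) + (if l = r then cre (k, c) g else 0) - (if k = c then cre (r, l) g else 0)" for g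
    by (rule even_cre[OF kl cre(1,2)])
  have X1: "(if l = r then E i j (cre (k, c) f) else 0) = (if l = r then cre (k, c) (E i j f) else 0) +
      (if l = r \<and> j = k then cre (i, c) f else 0) - (if l = r \<and> i = c then cre (k, j) f else 0)"
    using even_cre[OF ij, of k c f] cre(1,2) kl Ps_Ng by (auto simp: e_iff)
  have X2: "(if k = c then E i j (cre (r, l) f) else 0) = (if k = c then cre (r, l) (E i j f) else 0) +
      (if k = c \<and> j = r then cre (i, l) f else 0) - (if k = c \<and> i = l then cre (r, j) f else 0)"
    using even_cre[OF ij, of r l f] cre(1,2) kl Ps_Ng by (auto simp: e_iff)
  have Y1: "(if j = r then E k l (cre (i, c) f) else 0) = (if j = r then cre (i, c) (E k l f) else 0) +
      (if j = r \<and> l = i then cre (k, c) f else 0) - (if j = r \<and> k = c then cre (i, l) f else 0)"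
    using even_cre[OF kl, of i c f] cre(1,2) ij Ps_Ng by (auto simp: e_iff)
  have Y2: "(if i = c then E k l (cre (r, j) f) else 0) = (if i = c then cre (r, j) (E k l f) else 0) +
      (if i = c \<and> l = r then cre (k, j) f else 0) - (if i = c \<and> k = j then cre (r, l) f else 0)"
    using even_cre[OF kl, of r j f] cre(1,2) ij Ps_Ng by (auto simp: e_iff)
  have D1: "(if j = k then E i l (?Z f) else 0) = (if j = k then ?Z (E i l f) else 0) +
      (if j = k \<and> l = r then cre (i, c) f else 0) - (if j = k \<and> i = c then cre (r, l) f else 0)"
    using even_cre[of i l r c f] cre(1,2) ij kl e_trans by auto
  have D2: "(if l = i then E k j (?Z f) else 0) = (if l = i then ?Z (E k j f) else 0) +
      (if l = i \<and> j = r then cre (k, c) f else 0) - (if l = i \<and> k = c then cre (r, j) f else 0)"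
    using even_cre[of k j r c f] cre(1,2) ij kl e_trans by auto
  \<comment> \<open>Moving \<open>?Z\<close> to the left everywhere produces the same terms on both
    sides, up to conditions on coinciding indices; the six case splits compare them.\<close>
  show ?case
    unfolding YZ[of f] XZ[of f] lin_add[OF X] lin_diff[OF X] lin_add[OF Y] lin_diff[OF Y] lin_if[OF X] lin_if[OF Y]
      XZ[of "E k l f"] YZ[of "E i j f"] X1 X2 Y1 Y2 D1 D2 cre(4) lin_add[OF lin_cre] lin_diff[OF lin_cre] lin_if[OF lin_cre]
    by (cases "j = r"; cases "i = c"; cases "l = r"; cases "k = c"; cases "j = k"; cases "l = i") (simp_all add: fun_eq_iff)
next
  case (add f g)
  show ?case
    unfolding lin_add[OF lin_even[OF ij]] lin_add[OF lin_even[OF kl]] add(3,4)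
    using lin_add[OF lin_even, of i l f g] lin_add[OF lin_even, of k j f g] e_trans ij kl
    by (intro ext) auto
qed

lemma upper_even:
  assumes "f \<in> W" and ip: "i \<in> Ng" "p \<in> Ps" and kl: "e k l"
  shows "E i p (E k l f) = E k l (E i p f) + (if p = k then E i l f else 0) - (if l = i then E k p f else 0)"
  using assms(1)
proof (induction f rule: W_induct)
  case (vac x)
  have 1: "(if p = k then E i l (vac x) else 0) = 0" "(if l = i then E k p (vac x) else 0) = 0"
    using upper_vac[of i l x] upper_vac[of k p x] ip kl Ps_Ng by (auto simp: e_iff)
  show ?case
    unfolding 1 even_vac[OF kl] upper_vac[OF ip] lin_zero[OF lin_even[OF kl]] by simp
next
  case (cre r c f)
  let ?Z = "cre (r, c)"
  note X = lin_upper[OF ip] and Y = lin_even[OF kl]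
  have ic: "e i c" and rp: "e r p" using cre ip by (auto simp: e_iff)
  have XZ: "E i p (?Z g) = - ?Z (E i p g) + (if p = r then E i c g else 0) + (if i = c then E r p g else 0)" for g
    by (rule upper_cre[OF ip cre(1,2)])
  have YZ: "E k l (?Z g) = ?Z (E k l g) + (if l = r then cre (k, c) g else 0) - (if k = c then cre (r, l) g else 0)" for g
    by (rule even_cre[OF kl cre(1,2)])
  have X1: "(if l = r then E i p (cre (k, c) f) else 0) = - (if l = r then cre (k, c) (E i p f) else 0) +
      (if l = r \<and> p = k then E i c f else 0) + (if l = r \<and> i = c then E k p f else 0)"
    using upper_cre[OF ip, of k c f] cre(1,2) kl Ps_Ng by (auto simp: e_iff)
  have X2: "(if k = c then E i p (cre (r, l) f) else 0) = - (if k = c then cre (r, l) (E i p f) else 0) +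
      (if k = c \<and> p = r then E i l f else 0) + (if k = c \<and> i = l then E r p f else 0)"
    using upper_cre[OF ip, of r l f] cre(1,2) kl Ps_Ng by (auto simp: e_iff)
  have Y1: "(if p = r then E k l (E i c f) else 0) = (if p = r then E i c (E k l f) else 0) +
      (if p = r \<and> l = i then E k c f else 0) - (if p = r \<and> c = k then E i l f else 0)"
    using even_even[OF cre(3) kl ic] by auto
  have Y2: "(if i = c then E k l (E r p f) else 0) = (if i = c then E r p (E k l f) else 0) +
      (if i = c \<and> l = r then E k p f else 0) - (if i = c \<and> p = k then E r l f else 0)"
    using even_even[OF cre(3) kl rp] by auto
  have D1: "(if p = k then E i l (?Z f) else 0) = - (if p = k then ?Z (E i l f) else 0) +
      (if p = k \<and> l = r then E i c f else 0) + (if p = k \<and> i = c then E r l f else 0)"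
    using upper_cre[of i l r c f] cre(1,2) ip kl Ps_Ng by (auto simp: e_iff)
  have D2: "(if l = i then E k p (?Z f) else 0) = - (if l = i then ?Z (E k p f) else 0) +
      (if l = i \<and> p = r then E k c f else 0) + (if l = i \<and> k = c then E r p f else 0)"
    using upper_cre[of k p r c f] cre(1,2) ip kl Ps_Ng by (auto simp: e_iff)
  show ?case
    unfolding YZ[of f] XZ[of f] lin_add[OF X] lin_diff[OF X] lin_add[OF Y] lin_minus[OF Y] lin_if[OF X] lin_if[OF Y]
      XZ[of "E k l f"] YZ[of "E i p f"] X1 X2 Y1 Y2 D1 D2 cre(4) lin_add[OF lin_cre] lin_diff[OF lin_cre] lin_if[OF lin_cre]
    by (cases "p = r"; cases "i = c"; cases "l = r"; cases "k = c"; cases "p = k"; cases "l = i") (simp_all add: fun_eq_iff)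
next
  case (add f g)
  have u: "(if p = k then E i l (f + g) else 0) = (if p = k then E i l f else 0) + (if p = k then E i l g else 0)"
    using lin_add[OF lin_upper[of i l], of f g] ip kl Ps_Ng by (auto simp: e_iff)
  have v: "(if l = i then E k p (f + g) else 0) = (if l = i then E k p f else 0) + (if l = i then E k p g else 0)"
    using lin_add[OF lin_upper[of k p], of f g] ip kl Ps_Ng by (auto simp: e_iff)
  show ?case
    unfolding lin_add[OF lin_upper[OF ip]] lin_add[OF lin_even[OF kl]] add(3,4) u v
    by (intro ext) simp
qed

lemma upper_upper:
  assumes "f \<in> W" and ip: "i \<in> Ng" "p \<in> Ps" and jq: "j \<in> Ng" "q \<in> Ps"
  shows "E i p (E j q f) = - E j q (E i p f)"
  using assms(1)
proof (induction f rule: W_induct)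
  case (vac x)
  show ?case
    unfolding upper_vac[OF ip] upper_vac[OF jq] lin_zero[OF lin_upper[OF ip]] lin_zero[OF lin_upper[OF jq]] by simp
next
  case (cre r c f)
  let ?Z = "cre (r, c)"
  note X = lin_upper[OF ip] and Y = lin_upper[OF jq]
  have e: "e i c" "e r p" "e j c" "e r q" using cre ip jq by (auto simp: e_iff)
  have ne: "p \<noteq> j" "q \<noteq> i" "c \<noteq> p" "q \<noteq> c" "p \<noteq> i" "i \<noteq> r" "j \<noteq> r" using Ps_Ng cre(1,2) ip jq by auto
  have XZ: "E i p (?Z g) = - ?Z (E i p g) + (if p = r then E i c g else 0) + (if i = c then E r p g else 0)" for g
    by (rule upper_cre[OF ip cre(1,2)])
  have YZ: "E j q (?Z g) = - ?Z (E j q g) + (if q = r then E j c g else 0) + (if j = c then E r q g else 0)" for g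
    by (rule upper_cre[OF jq cre(1,2)])
  have X1: "E i p (E j c f) = E j c (E i p f) - (if c = i then E j p f else 0)"
    using upper_even[OF cre(3) ip e(3)] ne by simp
  have X2: "E i p (E r q f) = E r q (E i p f) + (if p = r then E i q f else 0)"
    using upper_even[OF cre(3) ip e(4)] ne by simp
  have Y1: "E j q (E i c f) = E i c (E j q f) - (if c = j then E i q f else 0)"
    using upper_even[OF cre(3) jq e(1)] ne by simp
  have Y2: "E j q (E r p f) = E r p (E j q f) + (if q = r then E j p f else 0)"
    using upper_even[OF cre(3) jq e(2)] ne by simp
  show ?case
    unfolding YZ[of f] XZ[of f] lin_add[OF X] lin_minus[OF X] lin_add[OF Y] lin_minus[OF Y] lin_if[OF X] lin_if[OF Y]
      XZ[of "E j q f"] YZ[of "E i p f"] X1 X2 Y1 Y2 cre(4) lin_minus[OF lin_cre]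
    by (cases "p = r"; cases "i = c"; cases "q = r"; cases "j = c") (simp_all add: fun_eq_iff)
next
  case (add f g)
  show ?case
    unfolding lin_add[OF lin_upper[OF ip]] lin_add[OF lin_upper[OF jq]] add(3,4) by simp
qed

definition brk :: "int \<Rightarrow> int \<Rightarrow> int \<Rightarrow> int \<Rightarrow> ((int \<times> int) set \<times> 'a \<Rightarrow> complex) \<Rightarrow> bool" where
  "brk i j k l f \<longleftrightarrow> E i j (E k l f) - sc (ssgn i j k l) (E k l (E i j f)) =
        (if j = k then E i l f else 0) - sc (ssgn i j k l) (if l = i then E k j f else 0)"

text \<open>Multiplication by minus the sign, whose square is 1, exchanges the roles of the two
  units. With lower, even and upper units this leaves six types of pairs for
  \<open>brk_all\<close>.\<close>

lemma brk_sym: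
  assumes "brk k l i j f" shows "brk i j k l f"
proof -
  define \<sigma> where "\<sigma> = ssgn i j k l"
  have s: "ssgn k l i j = \<sigma>" by (simp add: \<sigma>_def ssgn_def mult.commute)
  have sq: "\<sigma> * \<sigma> = 1" by (simp add: \<sigma>_def ssgn_def flip: power_add)
  have "E k l (E i j f) - sc \<sigma> (E i j (E k l f)) = (if l = i then E k j f else 0) - sc \<sigma> (if j = k then E i l f else 0)"
    using assms by (simp only: brk_def s)
  then have "sc (- \<sigma>) (E k l (E i j f) - sc \<sigma> (E i j (E k l f))) =
      sc (- \<sigma>) ((if l = i then E k j f else 0) - sc \<sigma> (if j = k then E i l f else 0))" by (rule arg_cong)
  then show ?thesis
    unfolding brk_def \<sigma>_def[symmetric] fs.scale_right_diff_distrib fs.scale_scale fs.scale_minus_left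
      mult_minus_left sq fs.scale_one by simp
qed

lemma brk_all:
  assumes "i \<in> idx m n" "j \<in> idx m n" "k \<in> idx m n" "l \<in> idx m n" and f: "f \<in> W"
  shows "brk i j k l f"
proof -
  have par: "parity i j = (if e i j then 0 else 1)" if "i \<in> idx m n" "j \<in> idx m n" for i j
    using that by (auto simp: parity_def ev_def)
  have LL: "brk p i q j f" if "p \<in> Ps" "i \<in> Ng" "q \<in> Ps" "j \<in> Ng" for p i q j
    using that cre_cre[of "(p, i)" "(q, j)" f] Ps_Ng[of q i] Ps_Ng[of p j]
    by (auto simp: brk_def ssgn_def parity_def E_lower P_iff dest: PsD NgD)
  have EL: "brk i j r c f" if "e i j" "r \<in> Ps" "c \<in> Ng" for i j r c
    using that even_cre[OF that, of f] Ps_Ng[of r] Ps_Ng[of i c]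
    by (auto simp: brk_def ssgn_def par idx_cases E_lower e_iff)
  have UL: "brk i p r c f" if "i \<in> Ng" "p \<in> Ps" "r \<in> Ps" "c \<in> Ng" for i p r c
    using that upper_cre[OF that, of f]
    by (auto simp: brk_def ssgn_def parity_def E_lower fs.scale_minus_left dest: PsD NgD)
  have EE: "brk i j k l f" if "e i j" "e k l" for i j k l
    using that even_even[OF f that] by (auto simp: brk_def ssgn_def parity_def ev_def)
  have UE: "brk i p k l f" if "i \<in> Ng" "p \<in> Ps" "e k l" for i p k l
    using that upper_even[OF f that] by (auto simp: brk_def ssgn_def parity_def ev_def)
  have UU: "brk i p j q f" if "i \<in> Ng" "p \<in> Ps" "j \<in> Ng" "q \<in> Ps" for i p j q
    using that upper_upper[OF f that] Ps_Ng[of p j] Ps_Ng[of q i]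
    by (auto simp: brk_def ssgn_def parity_def fs.scale_minus_left dest: PsD NgD)
  have c: "e i j \<or> i \<in> Ps \<and> j \<in> Ng \<or> i \<in> Ng \<and> j \<in> Ps" "e k l \<or> k \<in> Ps \<and> l \<in> Ng \<or> k \<in> Ng \<and> l \<in> Ps"
    using assms by (auto simp: e_iff idx_cases)
  then show ?thesis
    by (elim disjE conjE) (blast intro: LL EL UL EE UE UU brk_sym)+
qed

sublocale gl_rep m n W E
  by (intro gl_rep.intro subspace_W lin_E E_mem) (use brk_all in \<open>simp_all only: brk_def\<close>)

end

section \<open>The singular vector\<close>

text \<open>The form is negative on the second block, so pairing with the root adds the two
  coordinates; the shift by half of \<open>m + n + 1\<close> has opposite signs in the two blocks
  and cancels.\<close>

lemma weight_form_atypical: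
  assumes "1 \<le> s" "s \<le> m" "1 \<le> t" "t \<le> n"
  shows "weight_form m n (mu + rho m n) (delta s - eps t) = mu (bar s) + mu (int t) + of_nat s - of_nat t"
proof -
  have b: "(delta s - eps t) (bar i) = (if i = s then 1 else 0)" if "i \<in> {1..m}" for i
    using that assms by (auto simp: delta_def eps_def bar_def)
  have p: "(delta s - eps t) (int j) = (if j = t then - 1 else 0)" if "j \<in> {1..n}" for j
    using that assms by (auto simp: delta_def eps_def bar_def)
  have "(\<Sum>i=1..m. (mu + rho m n) (bar i) * (delta s - eps t) (bar i)) =
      (\<Sum>i=1..m. if i = s then (mu + rho m n) (bar s) else 0)"
    by (rule sum.cong[OF refl], subst b) auto
  moreover have "(\<Sum>j=1..n. (mu + rho m n) (int j) * (delta s - eps t) (int j)) =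
      (\<Sum>j=1..n. if j = t then - (mu + rho m n) (int t) else 0)"
    by (rule sum.cong[OF refl], subst p) auto
  ultimately have w: "weight_form m n (mu + rho m n) (delta s - eps t) =
      (mu + rho m n) (bar s) + (mu + rho m n) (int t)"
    using assms by (simp add: weight_form_def)
  have d1: "(\<Sum>i=1..m. g i * delta i (bar s)) = g s" for g :: "nat \<Rightarrow> complex"
  proof -
    have "(\<Sum>i=1..m. g i * delta i (bar s)) = (\<Sum>i=1..m. if i = s then g s else 0)"
      by (rule sum.cong) (auto simp: delta_def bar_def)
    then show ?thesis using assms by simp
  qed
  have d2: "(\<Sum>j=1..n. g j * eps j (int t)) = g t" for g :: "nat \<Rightarrow> complex"
  proof -
    have "(\<Sum>j=1..n. g j * eps j (int t)) = (\<Sum>j=1..n. if j = t then g t else 0)"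
      by (rule sum.cong) (auto simp: eps_def)
    then show ?thesis using assms by simp
  qed
  have d3: "(\<Sum>j=1..n. g j * eps j (bar s)) = 0" for g :: "nat \<Rightarrow> complex"
    by (rule sum.neutral) (use assms in \<open>auto simp: eps_def bar_def\<close>)
  have d4: "(\<Sum>i=1..m. g i * delta i (int t)) = 0" for g :: "nat \<Rightarrow> complex"
    by (rule sum.neutral) (use assms in \<open>auto simp: delta_def bar_def\<close>)
  have "rho m n (bar s) = of_nat s - of_nat (m + n + 1) / 2"
    using d1[of of_nat] d3[of of_nat] d1[of "\<lambda>_. 1"] d3[of "\<lambda>_. 1"] by (simp add: rho_def)
  moreover have "rho m n (int t) = - of_nat t + of_nat (m + n + 1) / 2"
    using d2[of of_nat] d4[of of_nat] d2[of "\<lambda>_. 1"] d4[of "\<lambda>_. 1"] by (simp add: rho_def field_simps)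
  ultimately show ?thesis unfolding w by simp
qed

lemma sorted_list_of_set_insert_max:
  fixes x :: int
  assumes "finite A" "\<And>k. k \<in> A \<Longrightarrow> k < x"
  shows "sorted_list_of_set (insert x A) = sorted_list_of_set A @ [x]"
proof -
  have "sorted (sorted_list_of_set A @ [x])" "distinct (sorted_list_of_set A @ [x])"
    using assms by (force simp: sorted_append less_imp_le)+
  from sorted_list_of_set.idem_if_sorted_distinct[OF this] show ?thesis using assms(1) by simp
qed

locale kac_setup = fock m n V \<rho> + hw_vector m n V \<rho> v0 mu
  for m n and V :: "('a \<Rightarrow> complex) set" and \<rho> v0 mu +
  fixes s t :: nat
  assumes st: "1 \<le> s" "s \<le> m" "1 \<le> t" "t \<le> n"
    and dom: "dominant m n mu" and dom': "dominant m n (mu - (delta s - eps t))"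
    and atyp: "weight_form m n (mu + Defs.rho m n) (delta s - eps t) = 0"
    and irred: "\<And>N. invariant N \<Longrightarrow> N = {0} \<or> N = V"
begin

abbreviation "bs \<equiv> bar s"
abbreviation "tt \<equiv> int t"
abbreviation "c \<equiv> c_coeff mu s t"
abbreviation "vv \<equiv> vac v0"

lemma bs_Ng: "bs \<in> Ng" and tt_Ps: "tt \<in> Ps"
  using st by (auto simp: Ng_def Ps_def mem_idx bar_def)

lemma Ng_idx: "i \<in> Ng \<Longrightarrow> i \<in> idx m n" and Ps_idx: "p \<in> Ps \<Longrightarrow> p \<in> idx m n"
  by (auto simp: idx_cases)

lemma bs_idx: "bs \<in> idx m n" and tt_idx: "tt \<in> idx m n" and bs_tt: "bs < tt"
  using bs_Ng tt_Ps st by (auto simp: Ng_idx Ps_idx bar_def)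

lemma vv_W: "vv \<in> W"
  by (rule vac_W[OF v0_V])

lemma vv_raise: "i \<in> idx m n \<Longrightarrow> j \<in> idx m n \<Longrightarrow> i < j \<Longrightarrow> E i j vv = 0"
proof -
  assume ij: "i \<in> idx m n" "j \<in> idx m n" "i < j"
  then have "\<not> (i \<in> Ps \<and> j \<in> Ng)" using PsD NgD by fastforce
  with ij consider "e i j" | "i \<in> Ng" "j \<in> Ps"
    by (auto simp: e_iff idx_cases)
  then show ?thesis
  proof cases
    case 1
    then have "\<rho> i j v0 = 0" using v0 ij by (simp add: extremal_def)
    then show ?thesis using even_vac[OF 1] lin_zero[OF lin_vac] by simp
  qed (rule upper_vac)
qed

lemma vv_weight: "i \<in> idx m n \<Longrightarrow> E i i vv = sc (mu i) vv"
  by (simp add: even_vac[OF e_diag] v0_weight lin_sc[OF lin_vac])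

lemma E_comm:
  assumes "i \<in> idx m n" "j \<in> idx m n" "k \<in> idx m n" "l \<in> idx m n" "f \<in> W"
  shows "E i j (E k l f) = sc (ssgn i j k l) (E k l (E i j f)) +
    (if j = k then E i l f else 0) - sc (ssgn i j k l) (if l = i then E k j f else 0)"
proof -
  have "E i j (E k l f) = sc (ssgn i j k l) (E k l (E i j f)) +
      (E i j (E k l f) - sc (ssgn i j k l) (E k l (E i j f)))" by simp
  then show ?thesis unfolding E_bracket[OF assms] by (simp only: add_diff_eq)
qed

section \<open>The recursion for the vector \<open>S v\<close>\<close>

fun chop :: "int list \<Rightarrow> ((int \<times> int) set \<times> 'a \<Rightarrow> complex) \<Rightarrow> (int \<times> int) set \<times> 'a \<Rightarrow> complex" where
  "chop (i # j # xs) f = chop (j # xs) (E j i f)"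
| "chop _ f = f"

lemma chop_append: "chop (xs @ [x, q]) f = E q x (chop (xs @ [x]) f)"
proof (induction xs arbitrary: f)
  case (Cons y xs)
  then show ?case by (cases xs) auto
qed simp

text \<open>The vector \<open>S v\<close> with the set of intermediate indices and the final index
  left free, while the coefficients \<open>c\<close> keep referring to the fixed \<open>s\<close>
  and \<open>t\<close>. The freedom is what permits induction on the largest intermediate
  index.\<close>

definition SU :: "int set \<Rightarrow> int \<Rightarrow> (int \<times> int) set \<times> 'a \<Rightarrow> complex" where
  "SU A q = (\<Sum>J\<in>Pow A. sc (\<Prod>k\<in>A - J. c k) (chop (bs # sorted_list_of_set J @ [q]) vv))"

lemma SU_empty: "SU {} q = E q bs vv"
  by (simp add: SU_def)

text \<open>Subsets are split by whether they contain the largest index \<open>x\<close>. If they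
  do, the leftmost factor is \<open>E q x\<close> and the remaining word ends at \<open>x\<close>;
  otherwise \<open>x\<close> contributes its coefficient.\<close>

lemma SU_insert:
  assumes A: "finite A" "\<forall>k\<in>A. k < x" and q: "q \<in> idx m n" "x \<in> idx m n"
  shows "SU (insert x A) q = E q x (SU A x) + sc (c x) (SU A q)"
proof -
  have x: "x \<notin> A" using A(2) by blast
  have inj: "inj_on (insert x) (Pow A)" using x by (auto simp: inj_on_def)
  have dis: "Pow A \<inter> insert x ` Pow A = {}" using x by auto
  let ?g = "\<lambda>A q J. sc (\<Prod>k\<in>A - J. c k) (chop (bs # sorted_list_of_set J @ [q]) vv)"
  have "SU (insert x A) q = (\<Sum>J\<in>Pow A. ?g (insert x A) q J) + (\<Sum>J\<in>insert x ` Pow A. ?g (insert x A) q J)"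
    unfolding SU_def Pow_insert using A(1) dis by (intro sum.union_disjoint) auto
  also have "(\<Sum>J\<in>Pow A. ?g (insert x A) q J) = (\<Sum>J\<in>Pow A. sc (c x) (?g A q J))"
  proof (rule sum.cong[OF refl])
    fix J assume "J \<in> Pow A"
    then have "insert x A - J = insert x (A - J)" using x by auto
    then show "?g (insert x A) q J = sc (c x) (?g A q J)" using A(1) x by simp
  qed
  also have "(\<Sum>J\<in>insert x ` Pow A. ?g (insert x A) q J) = (\<Sum>J\<in>Pow A. E q x (?g A x J))"
    unfolding sum.reindex[OF inj] o_def
  proof (rule sum.cong[OF refl])
    fix J assume J: "J \<in> Pow A"
    then have "insert x A - insert x J = A - J" using x by auto
    moreover have "sorted_list_of_set (insert x J) = sorted_list_of_set J @ [x]"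
      using J A finite_subset[of J A] by (intro sorted_list_of_set_insert_max) auto
    ultimately show "?g (insert x A) q (insert x J) = E q x (?g A x J)"
      using chop_append[of "bs # sorted_list_of_set J" x q vv] lin_sc[OF lin_E[OF q]] by simp
  qed
  also have "(\<Sum>J\<in>Pow A. E q x (?g A x J)) = E q x (SU A x)"
    unfolding SU_def by (rule lin_sum[OF lin_E[OF q], symmetric])
  also have "(\<Sum>J\<in>Pow A. sc (c x) (?g A q J)) = sc (c x) (SU A q)"
    unfolding SU_def by (rule fs.scale_sum_right[symmetric])
  finally show ?thesis by (simp only: add.commute)
qed

lemma SU_W:
  assumes "finite A" "A \<subseteq> idx m n" "q \<in> idx m n" shows "SU A q \<in> W"
  using assms
proof (induction A arbitrary: q rule: finite_linorder_max_induct)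
  case empty
  then show ?case by (simp add: SU_empty E_mem bs_idx vv_W)
next
  case (insert x A)
  then show ?case
    by (subst SU_insert) (auto intro!: fs.subspace_add[OF subspace_W] fs.subspace_scale[OF subspace_W] E_mem)
qed

text \<open>No unit in the words has row \<open>b\<close> or column \<open>a\<close>, so
  \<open>E a b\<close> passes through them up to sign and reaches \<open>vv\<close>, which it
  kills.\<close>

lemma SU_comm0:
  assumes "finite A" "A \<subseteq> idx m n" "q \<in> idx m n" "a \<in> idx m n" "b \<in> idx m n" "a < b"
    and "a \<notin> insert bs A" "b \<notin> A" "q \<noteq> b"
  shows "E a b (SU A q) = 0"
  using assms
proof (induction A arbitrary: q rule: finite_linorder_max_induct)
  case empty
  have "E a b (E q bs vv) = 0"
    using empty bs_idx vv_raise[of a b] lin_zero[OF lin_E[of q bs]]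
    by (subst E_comm) (auto simp: vv_W)
  then show ?case by (simp add: SU_empty)
next
  case (insert x A)
  have x: "x \<in> idx m n" "x \<noteq> a" "x \<noteq> b" "A \<subseteq> idx m n" using insert by auto
  note ab = lin_E[OF insert.prems(3,4)]
  have 0: "E a b (SU A x) = 0" "E a b (SU A q) = 0" using insert x by auto
  have W: "SU A x \<in> W" by (rule SU_W[OF insert.hyps(1) x(4,1)])
  have 1: "E a b (E q x (SU A x)) = 0"
    using E_comm[OF insert.prems(3,4,2) x(1) W] insert.prems x lin_zero[OF lin_E[OF insert.prems(2) x(1)]]
    by (simp add: 0)
  have "E a b (SU (insert x A) q) = 0"
    unfolding SU_insert[OF insert.hyps(1,2) insert.prems(2) x(1)]
      lin_add[OF ab] lin_sc[OF ab] 0 1 by simp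
  then show ?case .
qed

text \<open>The only commutator that survives is the one with the leftmost factor, whose row
  \<open>b\<close> becomes \<open>a\<close>.\<close>

lemma SU_comm1:
  assumes "finite A" "A \<subseteq> idx m n" "a \<in> idx m n" "b \<in> idx m n" "a < b"
    and "a \<notin> insert bs A" "b \<notin> A"
  shows "E a b (SU A b) = SU A a"
  using assms
proof (induction A rule: finite_linorder_max_induct)
  case empty
  have "E a b (E b bs vv) = E a bs vv"
    using empty bs_idx vv_raise[of a b] lin_zero[OF lin_E[of b bs]]
    by (subst E_comm) (auto simp: vv_W)
  then show ?case by (simp add: SU_empty)
next
  case (insert x A)
  have x: "x \<in> idx m n" "x \<noteq> a" "x \<noteq> b" "A \<subseteq> idx m n" using insert by auto
  note ab = lin_E[OF insert.prems(2,3)]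
  have 0: "E a b (SU A x) = 0" using insert x by (intro SU_comm0) auto
  have IH: "E a b (SU A b) = SU A a" using insert x by auto
  have W: "SU A x \<in> W" by (rule SU_W[OF insert.hyps(1) x(4,1)])
  have 1: "E a b (E b x (SU A x)) = E a x (SU A x)"
    using E_comm[OF insert.prems(2,3,3) x(1) W] x lin_zero[OF lin_E[OF insert.prems(3) x(1)]]
    by (simp add: 0)
  have "E a b (SU (insert x A) b) = SU (insert x A) a"
    unfolding SU_insert[OF insert.hyps(1,2) insert.prems(3) x(1)]
      SU_insert[OF insert.hyps(1,2) insert.prems(2) x(1)]
      lin_add[OF ab] lin_sc[OF ab] IH 1 ..
  then show ?case .
qed

lemma SU_weight:
  assumes "finite A" "A \<subseteq> idx m n" "q \<in> idx m n" "k \<in> idx m n"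
  shows "E k k (SU A q) = sc (mu k - (if k = bs then 1 else 0) + (if k = q then 1 else 0)) (SU A q)"
  using assms
proof (induction A arbitrary: q rule: finite_linorder_max_induct)
  case empty
  note q = empty.prems(2) and k = empty.prems(3)
  have "E k k (E q bs vv) = E q bs (E k k vv) + (if k = q then E q bs vv else 0) - (if k = bs then E q bs vv else 0)"
    unfolding E_comm[OF k k q bs_idx vv_W] by (auto simp: ssgn_def parity_def)
  then have "E k k (E q bs vv) = sc (mu k - (if k = bs then 1 else 0) + (if k = q then 1 else 0)) (E q bs vv)"
    by (simp add: vv_weight[OF k] lin_sc[OF lin_E[OF q bs_idx]] fs.scale_left_distrib fs.scale_left_diff_distrib)
  then show ?case by (simp add: SU_empty)
next
  case (insert x A)
  note q = insert.prems(2) and k = insert.prems(3)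
  have x: "x \<in> idx m n" "A \<subseteq> idx m n" using insert by auto
  note kk = lin_E[OF k k]
  have W: "SU A x \<in> W" by (rule SU_W[OF insert.hyps(1) x(2,1)])
  let ?w = "\<lambda>q. mu k - (if k = bs then 1 else 0) + (if k = q then 1 else 0)"
  have IH: "E k k (SU A q) = sc (?w q) (SU A q)" "E k k (SU A x) = sc (?w x) (SU A x)"
    using insert x by auto
  have "E k k (E q x (SU A x)) = E q x (E k k (SU A x)) + (if k = q then E q x (SU A x) else 0) -
      (if k = x then E q x (SU A x) else 0)"
    unfolding E_comm[OF k k q x(1) W] by (auto simp: ssgn_def parity_def)
  then have 1: "E k k (E q x (SU A x)) = sc (?w q) (E q x (SU A x))"
    unfolding IH(2) lin_sc[OF lin_E[OF q x(1)]]
    by (simp add: fs.scale_left_distrib fs.scale_left_diff_distrib)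
  have "E k k (SU (insert x A) q) = sc (?w q) (SU (insert x A) q)"
    unfolding SU_insert[OF insert.hyps(1,2) q x(1)]
      lin_add[OF kk] lin_sc[OF kk] IH(1) 1
    by (simp add: fs.scale_right_distrib mult.commute)
  then show ?case .
qed

section \<open>Annihilation by the simple root vectors\<close>

definition btw :: "int \<Rightarrow> int set" where
  "btw x = {k \<in> idx m n. bs < k \<and> k < x}"

lemma btw: "finite (btw x)" "btw x \<subseteq> idx m n" "k \<in> btw x \<Longrightarrow> k < x"
  by (auto simp: btw_def)

lemma btw_less: "\<forall>k\<in>btw x. k < x"
  by (simp add: btw(3))

lemma btw_between: "btw tt = between m n s t"
  by (auto simp: btw_def between_def)

text \<open>These pairs are the simple roots. Since 0 is not an index, -1 and 1 are neighbours when
  both occur; this pair is the odd simple root.\<close>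

definition adjacent :: "int \<Rightarrow> int \<Rightarrow> bool" where
  "adjacent a b \<longleftrightarrow> a \<in> idx m n \<and> b \<in> idx m n \<and> a < b \<and> (\<forall>k\<in>idx m n. \<not> (a < k \<and> k < b))"

lemma adjacent_cases:
  assumes "adjacent a b"
  shows "b = a + 1 \<and> (a < 0) = (b < 0) \<or> a = - 1 \<and> b = 1"
proof -
  have ab: "a \<in> idx m n" "b \<in> idx m n" "a < b" "\<And>k. k \<in> idx m n \<Longrightarrow> \<not> (a < k \<and> k < b)"
    using assms by (auto simp: adjacent_def)
  show ?thesis
  proof (cases "a = - 1")
    case True
    then show ?thesis using ab(2,3) ab(4)[of 1] by (auto simp: mem_idx)
  next
    case False
    then show ?thesis using ab(1-3) ab(4)[of "a + 1"] by (auto simp: mem_idx)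
  qed
qed

lemma adjacent_le: "adjacent a b \<Longrightarrow> k \<in> idx m n \<Longrightarrow> k < b \<Longrightarrow> k \<le> a"
  using linorder_not_le by (auto simp: adjacent_def)

lemma btw_succ:
  assumes ab: "adjacent a b" "bs < a" shows "btw b = insert a (btw a)"
proof (rule Set.set_eqI)
  fix k
  have "a \<in> idx m n" "a < b" using ab by (auto simp: adjacent_def)
  then show "k \<in> btw b \<longleftrightarrow> k \<in> insert a (btw a)"
    using adjacent_le[OF ab(1), of k] ab(2) by (auto simp: btw_def)
qed

lemma btw_succ':
  assumes ab: "adjacent a b" "a = bs" shows "btw b = {}"
proof -
  have "\<not> (bs < k \<and> k < b)" if "k \<in> idx m n" for k
    using adjacent_le[OF ab(1) that] ab(2) by auto
  then show ?thesis by (auto simp: btw_def)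
qed

lemma atyp': "mu bs + mu tt + of_nat s - of_nat t = 0"
  using atyp weight_form_atypical[OF st] by simp

text \<open>\<open>gam a b\<close> is the scalar by which the simple root vector \<open>E a b\<close> sends \<open>SU (btw b) b\<close> to the
  vector one step before; the recursion for the coefficients \<open>c\<close> is what makes the two contributions
  to \<open>E a b (SU (insert b (btw b)) q)\<close> cancel.\<close>

definition gam :: "int \<Rightarrow> int \<Rightarrow> complex" where
  "gam a b = mu a + 1 - ssgn a b b a * mu b + c a"

text \<open>For an even simple root all signs are 1 and both sides agree by
  \<open>b = a + 1\<close>. At the odd one, \<open>c\<close> changes from its barred to its unbarred
  formula and the two signs differ; the two formulas then match exactly by atypicality.\<close>

lemma gam_c:
  assumes ab: "adjacent a b" and q: "q \<in> idx m n" "b < q"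
  shows "ssgn a b q b * gam a b = ssgn a b q a * c b"
  using adjacent_cases[OF ab] atyp' q
  by (auto simp: gam_def ssgn_def parity_def c_coeff_def bar_def algebra_simps)

text \<open>This continues \<open>gam_c\<close> to the final index, where the unbarred formula for
  \<open>c\<close> has the value 0. If \<open>t = 1\<close> the last simple root is the odd one, and
  the vanishing is the atypicality condition itself.\<close>

lemma gam_end:
  assumes "adjacent a tt" shows "gam a tt = 0"
proof -
  consider "a = tt - 1" "\<not> a < 0" | "a = - 1" "t = 1"
    using adjacent_cases[OF assms] st by auto
  then show ?thesis
  proof cases
    case 1
    then have "(of_int a :: complex) = of_nat t - 1" by simp
    with 1 show ?thesis by (simp add: gam_def ssgn_def parity_def c_coeff_def)
  next
    case 2
    then show ?thesis
      using atyp' unfolding gam_def c_coeff_def ssgn_def parity_def bar_def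
      by (simp add: algebra_simps)
  qed
qed

text \<open>One vector \<open>g\<close> serves all final indices: \<open>SU (btw a) a\<close>, or
  \<open>vv\<close> if the words start at \<open>a\<close>. For final index \<open>b\<close> the
  scalar collects the weight of \<open>g\<close>, from \<open>E a b E b a\<close>, and the
  coefficient \<open>c a\<close>; for a later \<open>q\<close> only the factor \<open>E q a\<close>
  is met, and its column becomes \<open>b\<close>.\<close>

lemma SU_step:
  assumes ab: "adjacent a b" "bs \<le> a"
  obtains g where "g \<in> W" "E a b g = 0" "E a b (SU (btw b) b) = sc (gam a b) g"
    "\<And>q. q \<in> idx m n \<Longrightarrow> b < q \<Longrightarrow> E a b (SU (btw b) q) = - sc (ssgn a b q a) (E q b g)"
proof -
  have i: "a \<in> idx m n" "b \<in> idx m n" "a < b" using ab by (auto simp: adjacent_def)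
  have par: "ssgn a b a a = 1" "ssgn a b b b = 1" by (simp_all add: ssgn_def parity_def)
  show thesis
  proof (cases "a = bs")
    case True
    have B: "btw b = {}" by (rule btw_succ'[OF ab(1) True])
    have z: "E a b vv = 0" using i by (rule vv_raise)
    \<comment> \<open>The barred formula at the starting index itself gives
      \<open>s - 1 - s\<close>. It offsets the 1 in \<open>gam\<close>, which stands for the raised
      weight of \<open>g\<close> at \<open>a\<close> and is absent for \<open>vv\<close>.\<close>
    have ca: "c a = - 1" using True st by (simp add: c_coeff_def bar_def)
    show thesis
    proof (rule that[of vv, OF vv_W z])
      show "E a b (SU (btw b) b) = sc (gam a b) vv"
        unfolding B SU_empty True[symmetric] E_comm[OF i(1,2,2,1) vv_W] z
        by (simp add: lin_zero[OF lin_E[OF i(2,1)]] vv_weight i fs.scale_left_diff_distrib gam_def ca)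
      fix q assume q: "q \<in> idx m n" "b < q"
      then show "E a b (SU (btw b) q) = - sc (ssgn a b q a) (E q b vv)"
        unfolding B SU_empty True[symmetric] E_comm[OF i(1,2) q(1) i(1) vv_W] z
        by (simp add: lin_zero[OF lin_E[OF q(1) i(1)]])
    qed
  next
    case False
    then have a: "bs < a" using ab by simp
    note B = btw_succ[OF ab(1) a]
    let ?A = "btw a"
    have na: "a \<notin> insert bs ?A" "b \<notin> ?A" using False i(3) by (auto simp: btw_def)
    let ?g = "SU ?A a"
    have g: "?g \<in> W" by (rule SU_W[OF btw(1,2) i(1)])
    have z: "E a b ?g = 0" using i na by (intro SU_comm0 btw(1,2)) auto
    have SU: "SU (btw b) q = E q a ?g + sc (c a) (SU ?A q)" if "q \<in> idx m n" for q
      unfolding B by (rule SU_insert[OF btw(1) btw_less that i(1)])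
    show thesis
    proof (rule that[of ?g, OF g z])
      have "E a a ?g = sc (mu a + 1) ?g" "E b b ?g = sc (mu b) ?g"
        using SU_weight[OF btw(1,2) i(1) i(1)] SU_weight[OF btw(1,2) i(1) i(2)] False i(3) a by auto
      then have "E a b (E b a ?g) = sc (mu a + 1 - ssgn a b b a * mu b) ?g"
        unfolding E_comm[OF i(1,2,2,1) g] z
        by (simp add: lin_zero[OF lin_E[OF i(2,1)]] fs.scale_left_diff_distrib)
      moreover have "E a b (SU ?A b) = ?g" using i na by (intro SU_comm1 btw(1,2)) auto
      ultimately show "E a b (SU (btw b) b) = sc (gam a b) ?g"
        unfolding SU[OF i(2)] lin_add[OF lin_E[OF i(1,2)]] lin_sc[OF lin_E[OF i(1,2)]]
        by (simp add: gam_def fs.scale_left_distrib)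
      fix q assume q: "q \<in> idx m n" "b < q"
      have "E a b (SU ?A q) = 0" using i na q by (intro SU_comm0 btw(1,2)) auto
      moreover have "E a b (E q a ?g) = - sc (ssgn a b q a) (E q b ?g)"
        unfolding E_comm[OF i(1,2) q(1) i(1) g] z using q by (simp add: lin_zero[OF lin_E[OF q(1) i(1)]])
      ultimately show "E a b (SU (btw b) q) = - sc (ssgn a b q a) (E q b ?g)"
        unfolding SU[OF q(1)] lin_add[OF lin_E[OF i(1,2)]] lin_sc[OF lin_E[OF i(1,2)]] by simp
    qed
  qed
qed

text \<open>By \<open>SU_insert\<close> the vector is a sum of two terms, with and without a factor
  through \<open>b\<close>. Both are sent to multiples of \<open>E q b g\<close>, and
  \<open>gam_c\<close> makes them cancel. The units through larger indices commute with
  \<open>E a b\<close> up to sign.\<close>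

lemma SU_kill:
  assumes ab: "adjacent a b" "bs \<le> a" and "finite D" "D \<subseteq> idx m n" "\<And>x. x \<in> D \<Longrightarrow> b < x"
    and "q \<in> idx m n" "b < q"
  shows "E a b (SU (insert b (btw b) \<union> D) q) = 0"
  using assms(3-7)
proof (induction D arbitrary: q rule: finite_linorder_max_induct)
  case empty
  have i: "a \<in> idx m n" "b \<in> idx m n" "a < b" using ab by (auto simp: adjacent_def)
  note q = empty(3,4)
  obtain g where g: "g \<in> W" "E a b g = 0" "E a b (SU (btw b) b) = sc (gam a b) g"
    "\<And>q. q \<in> idx m n \<Longrightarrow> b < q \<Longrightarrow> E a b (SU (btw b) q) = - sc (ssgn a b q a) (E q b g)"
    using SU_step[OF ab] by blast
  have W: "SU (btw b) b \<in> W" by (rule SU_W[OF btw(1,2) i(2)])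
  have 1: "E a b (E q b (SU (btw b) b)) = sc (ssgn a b q b * gam a b) (E q b g)"
    unfolding E_comm[OF i(1,2) q(1) i(2) W] g(3) lin_sc[OF lin_E[OF q(1) i(2)]] using q(2) i(3) by simp
  have 2: "sc (c b) (- sc (ssgn a b q a) (E q b g)) = - sc (ssgn a b q a * c b) (E q b g)"
    by (simp add: mult.commute)
  have "E a b (SU (insert b (btw b)) q) = 0"
    unfolding SU_insert[OF btw(1) btw_less q(1) i(2)] lin_add[OF lin_E[OF i(1,2)]]
      lin_sc[OF lin_E[OF i(1,2)]] 1 g(4)[OF q] 2 gam_c[OF ab(1) q] by simp
  then show ?case by simp
next
  case (insert x D)
  have i: "a \<in> idx m n" "b \<in> idx m n" "a < b" using ab by (auto simp: adjacent_def)
  have x: "x \<in> idx m n" "b < x" and D: "D \<subseteq> idx m n" "\<And>y. y \<in> D \<Longrightarrow> b < y" using insert.prems by auto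
  note q = insert.prems(3,4)
  let ?D = "insert b (btw b) \<union> D"
  have fin: "finite ?D" "?D \<subseteq> idx m n" using btw insert.hyps D i by auto
  have lt: "\<forall>k\<in>?D. k < x"
    using x insert.hyps(2) btw(3)[of _ b] by force
  have 0: "E a b (SU ?D x) = 0" "E a b (SU ?D q) = 0" using insert.IH[OF D] x q by blast+
  have "E a b (E q x (SU ?D x)) = 0"
    unfolding E_comm[OF i(1,2) q(1) x(1) SU_W[OF fin x(1)]] 0
    using q x i by (simp add: lin_zero[OF lin_E[OF q(1) x(1)]])
  moreover have "SU (insert x ?D) q = E q x (SU ?D x) + sc (c x) (SU ?D q)"
    by (rule SU_insert[OF fin(1) lt q(1) x(1)])
  ultimately have "E a b (SU (insert x ?D) q) = 0"
    by (simp only: lin_add[OF lin_E[OF i(1,2)]] lin_sc[OF lin_E[OF i(1,2)]] 0 fs.scale_zero_right add_0)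
  then show ?case by simp
qed

definition sv :: "(int \<times> int) set \<times> 'a \<Rightarrow> complex" where
  "sv = SU (btw tt) tt"

lemma sv_W: "sv \<in> W"
  unfolding sv_def by (rule SU_W[OF btw(1,2) tt_idx])

text \<open>A simple root below \<open>bs\<close> or above \<open>tt\<close> meets no factor of the
  words. The root ending at \<open>tt\<close> is settled by \<open>gam_end\<close>, and all roots in
  between by \<open>SU_kill\<close>.\<close>

lemma sv_simple: "adjacent a b \<Longrightarrow> E a b sv = 0"
proof -
  assume ab: "adjacent a b"
  then have i: "a \<in> idx m n" "b \<in> idx m n" "a < b" by (auto simp: adjacent_def)
  consider "a < bs" | "tt < b" | "bs \<le> a" "b = tt" | "bs \<le> a" "b < tt" by linarith
  then show ?thesis
  proof cases
    case 1
    then have "b \<le> bs" using ab bs_idx by (force simp: adjacent_def)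
    then show ?thesis
      unfolding sv_def using 1 i bs_tt by (intro SU_comm0 btw(1,2) tt_idx) (auto simp: btw_def)
  next
    case 2
    then have "tt \<le> a" using ab tt_idx by (force simp: adjacent_def)
    then show ?thesis
      unfolding sv_def using 2 i bs_tt by (intro SU_comm0 btw(1,2) tt_idx) (auto simp: btw_def)
  next
    case 3
    obtain g where "E a b (SU (btw b) b) = sc (gam a b) g"
      using SU_step[OF ab 3(1)] by blast
    then show ?thesis using gam_end ab 3 by (simp add: sv_def)
  next
    case 4
    let ?D = "{k \<in> idx m n. b < k \<and> k < tt}"
    have "btw tt = insert b (btw b) \<union> ?D" using 4 i by (auto simp: btw_def)
    moreover have "E a b (SU (insert b (btw b) \<union> ?D) tt) = 0"
      using 4 by (intro SU_kill ab tt_idx) auto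
    ultimately show ?thesis by (simp add: sv_def)
  qed
qed

text \<open>A non-simple raising unit is the commutator of two raising units through an index
  strictly in between, both with a smaller gap.\<close>

lemma raise_all:
  assumes f: "f \<in> W" and simple: "\<And>a b. adjacent a b \<Longrightarrow> E a b f = 0"
    and "i \<in> idx m n" "j \<in> idx m n" "i < j"
  shows "E i j f = 0"
  using assms(3-5)
proof (induction "nat (j - i)" arbitrary: i j rule: less_induct)
  case less
  show ?case
  proof (cases "adjacent i j")
    case True
    then show ?thesis by (rule simple)
  next
    case False
    then obtain k where k: "k \<in> idx m n" "i < k" "k < j" using less.prems by (auto simp: adjacent_def)
    then have 0: "E i k f = 0" "E k j f = 0" using less by auto
    have "E i k (E k j f) = sc (ssgn i k k j) (E k j (E i k f)) + E i j f"
      unfolding E_comm[OF less.prems(1) k(1) k(1) less.prems(2) f] using less.prems by simp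
    then show ?thesis
      unfolding 0 lin_zero[OF lin_E[OF less.prems(1) k(1)]] lin_zero[OF lin_E[OF k(1) less.prems(2)]] by simp
  qed
qed

lemma sv_raise: "i \<in> idx m n \<Longrightarrow> j \<in> idx m n \<Longrightarrow> i < j \<Longrightarrow> E i j sv = 0"
  by (rule raise_all[OF sv_W sv_simple])

definition mu' :: weight where "mu' = mu - (delta s - eps t)"

lemma mu'_eq: "i \<in> idx m n \<Longrightarrow> mu' i = mu i - (if i = bs then 1 else 0) + (if i = tt then 1 else 0)"
  by (auto simp: mu'_def delta_def eps_def)

lemma sv_weight: "i \<in> idx m n \<Longrightarrow> E i i sv = sc (mu' i) sv"
  unfolding sv_def using SU_weight[OF btw(1,2) tt_idx] by (simp add: mu'_eq)

section \<open>The component of \<open>S v\<close> at the lowest odd unit of the words\<close>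

lemma slice_cre_ann_single:
  "c' \<in> P \<Longrightarrow> d \<in> P \<Longrightarrow> slice (cre c' (ann d f)) {a} = (if c' = a then slice f {d} else 0)"
proof -
  have "{b \<in> {a} \<inter> P. b < a} = {}" by auto
  then have "sg a {a} = 1" unfolding sg_def by (simp only: card.empty power_0)
  then show ?thesis by (auto simp: slice_cre slice_ann sg_def)
qed

lemma slice_pos:
  assumes "p \<in> Ps" "q \<in> Ps" "k \<in> Ng"
  shows "slice (E p q f) {(r, k)} = \<rho> p q (slice f {(r, k)}) + (if p = r then slice f {(q, k)} else 0)"
proof -
  have "(\<Sum>l\<in>Ng. slice (cre (p, l) (ann (q, l) f)) {(r, k)}) =
      (\<Sum>l\<in>Ng. if l = k then (if p = r then slice f {(q, k)} else 0) else 0)"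
    by (rule sum.cong[OF refl], subst slice_cre_ann_single) (use assms in \<open>auto simp: P_iff\<close>)
  then show ?thesis using assms by (simp add: E_pos slice_sum slice_rho)
qed

lemma slice_neg:
  assumes "i \<in> Ng" "j \<in> Ng" "r \<in> Ps"
  shows "slice (E i j f) {(r, k)} = \<rho> i j (slice f {(r, k)}) - (if j = k then slice f {(r, i)} else 0)"
proof -
  have "(\<Sum>p\<in>Ps. slice (cre (p, j) (ann (p, i) f)) {(r, k)}) =
      (\<Sum>p\<in>Ps. if p = r then (if j = k then slice f {(r, i)} else 0) else 0)"
    by (rule sum.cong[OF refl], subst slice_cre_ann_single) (use assms in \<open>auto simp: P_iff\<close>)
  then show ?thesis using assms by (simp add: E_neg slice_sum slice_rho)
qed

text \<open>For a barred \<open>x\<close> the factor \<open>E q x\<close> creates a unit with column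
  \<open>x\<close>, different from \<open>bs\<close>, so it does not contribute and only
  \<open>c x\<close> remains. For an unbarred \<open>x\<close> its derivation part replaces the row
  \<open>x\<close> by \<open>q\<close> and adds 1 to \<open>c x\<close>. Components with larger row
  \<open>q'\<close> are included because their vanishing removes the \<open>\<rho>\<close> part of
  \<open>E q x\<close>.\<close>

lemma SU_slice:
  assumes "finite A" "A \<subseteq> {k \<in> idx m n. bs < k}" "q \<in> Ps" "\<And>k. k \<in> A \<Longrightarrow> k < q" "q' \<in> Ps" "q \<le> q'"
  shows "slice (SU A q) {(q', bs)} =
    (if q' = q then sc (\<Prod>k\<in>A. if k < 0 then c k else 1 + c k) v0 else 0)"
  using assms
proof (induction A arbitrary: q q' rule: finite_linorder_max_induct)
  case empty
  have "{b \<in> {(q, bs)} \<inter> P. b < (q, bs)} = {}" by auto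
  then have "sg (q, bs) {(q, bs)} = 1" unfolding sg_def by (simp only: card.empty power_0)
  then have "slice (E q bs vv) {(q', bs)} = (if q' = q then v0 else 0)"
    using empty bs_Ng by (auto simp: E_lower slice_cre slice_vac)
  then show ?case by (simp add: SU_empty)
next
  case (insert x A)
  note q = insert.prems(2) and q' = insert.prems(4,5)
  have x: "x \<in> idx m n" "bs < x" "x < q" and A: "A \<subseteq> {k \<in> idx m n. bs < k}" "x \<notin> A"
    using insert by auto
  let ?\<kappa> = "\<Prod>k\<in>A. if k < 0 then c k else 1 + c k"
  have IH: "slice (SU A q) {(q', bs)} = (if q' = q then sc ?\<kappa> v0 else 0)"
    using insert.IH[OF A(1) q _ q'] insert.hyps(2) x(3) by force
  have eq: "slice (SU (insert x A) q) {(q', bs)} = slice (E q x (SU A x)) {(q', bs)} + sc (c x) (slice (SU A q) {(q', bs)})"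
    using SU_insert[OF insert.hyps(1,2) Ps_idx[OF q] x(1)] by simp
  have "slice (SU (insert x A) q) {(q', bs)} =
      (if q' = q then sc ((if x < 0 then c x else 1 + c x) * ?\<kappa>) v0 else 0)"
  proof (cases "x \<in> Ng")
    case True
    then have "slice (E q x (SU A x)) {(q', bs)} = 0" using q x by (auto simp: E_lower slice_cre)
    then show ?thesis unfolding eq IH using NgD[OF True] by simp
  next
    case False
    then have xP: "x \<in> Ps" using x by (simp add: idx_cases)
    have 1: "slice (SU A x) {(q', bs)} = 0" "slice (SU A x) {(x, bs)} = sc ?\<kappa> v0"
      using insert.IH[OF A(1) xP insert.hyps(2)[rule_format] q'(1)] insert.IH[OF A(1) xP insert.hyps(2)[rule_format] xP]
        q' x by auto
    have "e q x" using q xP by (simp add: e_iff)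
    then have "slice (E q x (SU A x)) {(q', bs)} = (if q' = q then sc ?\<kappa> v0 else 0)"
      unfolding slice_pos[OF q xP bs_Ng] 1 by (simp add: lin_zero[OF lin_\<rho>])
    then show ?thesis unfolding eq IH using PsD[OF xP] by (auto simp: fs.scale_left_distrib algebra_simps)
  qed
  then show ?case using insert.hyps(1) A(2) by simp
qed

text \<open>Passing to \<open>mu'\<close> lowers the coordinate at \<open>bar s\<close> and raises
  the one at \<open>t\<close> by 1, so dominance of \<open>mu'\<close> makes the relevant
  differences of \<open>mu\<close> at least 1. The factor is then the positive integer
  \<open>N + (s - i)\<close> or the negative integer \<open>- (N + (t - p))\<close>.\<close>

lemma c_nonzero:
  assumes "k \<in> btw tt" shows "(if k < 0 then c k else 1 + c k) \<noteq> 0"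
proof (cases "k < 0")
  case True
  define i where "i = nat (- k)"
  have i: "k = bar i" "1 \<le> i" "i < s" "i \<le> m" using True assms st by (auto simp: i_def btw_def bar_def mem_idx)
  have "mu' (bar s) - mu' (bar i) \<in> \<nat>" using dom' i st by (auto simp: dominant_def mu'_def)
  then obtain N where N: "mu' (bar s) - mu' (bar i) = of_nat N" by (auto elim: Nats_cases)
  have "mu' (bar s) = mu (bar s) - 1" "mu' (bar i) = mu (bar i)"
    using i st by (auto simp: mu'_def delta_def eps_def bar_def)
  then have "mu (bar s) - mu (bar i) = of_nat N + 1" using N by (simp add: algebra_simps)
  then have "c k = of_nat (N + (s - i))"
    using i True by (simp add: c_coeff_def bar_def of_nat_diff algebra_simps)
  moreover have "N + (s - i) \<noteq> 0" using i by simp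
  ultimately show ?thesis using True by (metis of_nat_eq_0_iff)
next
  case False
  define p where "p = nat k"
  have p: "k = int p" "1 \<le> p" "p < t" using False assms by (auto simp: p_def btw_def mem_idx)
  have "mu' (int p) - mu' (int t) \<in> \<nat>" using dom' p st by (auto simp: dominant_def mu'_def)
  then obtain N where N: "mu' (int p) - mu' (int t) = of_nat N" by (auto elim: Nats_cases)
  have "mu' (int t) = mu (int t) + 1" "mu' (int p) = mu (int p)"
    using p st by (auto simp: mu'_def delta_def eps_def bar_def)
  then have "mu (int p) = of_nat N + mu (int t) + 1" using N by (simp add: algebra_simps)
  then have "1 + c k = - of_nat (N + (t - p))"
    using p False by (simp add: c_coeff_def of_nat_diff algebra_simps)
  moreover have "N + (t - p) \<noteq> 0" using p by simp
  ultimately show ?thesis using False by (metis neg_equal_0_iff_equal of_nat_eq_0_iff)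
qed

lemma sv_slice: obtains \<kappa> where "\<kappa> \<noteq> 0" "slice sv {(tt, bs)} = sc \<kappa> v0"
proof (rule that)
  show "(\<Prod>k\<in>btw tt. if k < 0 then c k else 1 + c k) \<noteq> 0"
    using c_nonzero btw(1) by (simp add: prod_zero_iff)
  show "slice sv {(tt, bs)} = sc (\<Prod>k\<in>btw tt. if k < 0 then c k else 1 + c k) v0"
  proof -
    have "btw tt \<subseteq> {k \<in> idx m n. bs < k}" by (auto simp: btw_def)
    from SU_slice[OF btw(1) this tt_Ps btw(3) tt_Ps order_refl] show ?thesis
      by (simp add: sv_def)
  qed
qed

lemma sv_nz: "sv \<noteq> 0"
proof
  assume z: "sv = 0"
  obtain \<kappa> where k: "\<kappa> \<noteq> 0" "slice sv {(tt, bs)} = sc \<kappa> v0" by (rule sv_slice)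
  then have "sc \<kappa> v0 = 0" using z by simp
  then show False using k(1) v0_nz by (simp add: fs.scale_eq_0_iff)
qed

section \<open>Uniqueness of the singular vector\<close>

lemma V_cyc: "V = cyc"
  by (rule irreducible_cyc[OF irred, symmetric])

text \<open>The trace of the barred block commutes with all even units, so it acts on the module
  generated by \<open>v0\<close> by its eigenvalue on \<open>v0\<close>. In the Fock space it
  measures the exterior degree.\<close>

lemma block_trace: "x \<in> V \<Longrightarrow> (\<Sum>i\<in>Ng. \<rho> i i x) = sc (\<Sum>i\<in>Ng. mu i) x"
proof -
  have l: "(\<Sum>i\<in>Ng. \<rho> i i y) = sc (\<Sum>i\<in>Ng. mu i) y" if "lw k y" for k y
    using that
  proof (induction rule: lw.induct)
    case base
    have "(\<Sum>i\<in>Ng. \<rho> i i v0) = sc (\<Sum>i\<in>Ng. mu i) v0"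
      unfolding fs.scale_sum_left by (rule sum.cong) (auto simp: v0_weight Ng_idx)
    then show ?case .
  next
    case (step k x a b)
    have "(\<Sum>i\<in>Ng. \<rho> i i (\<rho> a b x)) = (\<Sum>i\<in>Ng. \<rho> a b (\<rho> i i x) +
        (if i = a then \<rho> a b x else 0) - (if i = b then \<rho> a b x else 0))"
    proof (rule sum.cong[OF refl])
      fix i assume "i \<in> Ng"
      then have "e i i" using e_diag Ng_idx by blast
      from \<rho>_comm[OF this step(2) lw_V[OF step(1)]]
      show "\<rho> i i (\<rho> a b x) = \<rho> a b (\<rho> i i x) + (if i = a then \<rho> a b x else 0) - (if i = b then \<rho> a b x else 0)"
        by auto
    qed
    also have "\<dots> = (\<Sum>i\<in>Ng. \<rho> a b (\<rho> i i x)) +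
        ((\<Sum>i\<in>Ng. if i = a then \<rho> a b x else 0) - (\<Sum>i\<in>Ng. if i = b then \<rho> a b x else 0))"
      by (simp only: sum.distrib sum_subtractf add_diff_eq)
    also have "(\<Sum>i\<in>Ng. if i = a then \<rho> a b x else 0) = (\<Sum>i\<in>Ng. if i = b then \<rho> a b x else 0)"
      using step(2) Ps_Ng by (auto simp: e_iff sum.delta)
    also have "(\<Sum>i\<in>Ng. \<rho> a b (\<rho> i i x)) = sc (\<Sum>i\<in>Ng. mu i) (\<rho> a b x)"
      using lin_sum[OF lin_\<rho>[OF step(2)]] step(4) lin_sc[OF lin_\<rho>[OF step(2)]] by metis
    finally have "(\<Sum>i\<in>Ng. \<rho> i i (\<rho> a b x)) = sc (\<Sum>i\<in>Ng. mu i) (\<rho> a b x)" by simp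
    then show ?case .
  qed
  have li: "lin (\<lambda>x. \<Sum>i\<in>Ng. \<rho> i i x)"
    by (rule lin_setsum[of Ng "\<lambda>i. \<rho> i i"]) (auto intro: lin_\<rho> e_diag Ng_idx)
  assume "x \<in> V"
  then have "x \<in> fs.span {x. \<exists>l. lw l x}" unfolding V_cyc cyc_def .
  then have "(\<Sum>i\<in>Ng. \<rho> i i x) - sc (\<Sum>i\<in>Ng. mu i) x \<in> {0}"
    by (rule image_span[OF lin_subtract[OF li lin_smul[OF lin_id]]]) (use l in auto)
  then show ?thesis by simp
qed

section \<open>Extremal vectors of exterior degree one\<close>

definition W1 :: "((int \<times> int) set \<times> 'a \<Rightarrow> complex) set" where
  "W1 = {f \<in> W. \<forall>S. (\<forall>a. S \<noteq> {a}) \<longrightarrow> slice f S = 0}"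

lemma subspace_W1: "fs.subspace W1"
  using subspace_W by (intro fs.subspaceI) (auto simp: W1_def fs.subspace_0 fs.subspace_add fs.subspace_scale)

lemma W1_W: "f \<in> W1 \<Longrightarrow> f \<in> W"
  by (simp add: W1_def)

lemma W1_eqI:
  assumes "f \<in> W1" "\<And>a. a \<in> P \<Longrightarrow> slice f {a} = 0" shows "f = 0"
proof (rule slice_eqI)
  fix S
  have W: "f \<in> W" using assms(1) by (rule W1_W)
  show "slice f S = slice 0 S"
  proof (cases "\<exists>a. S = {a}")
    case True
    then obtain a where a: "S = {a}" by blast
    show ?thesis
    proof (cases "a \<in> P")
      case False
      then have "\<not> S \<subseteq> P" using a by simp
      then show ?thesis using W by (simp add: W_def)
    qed (use assms a in simp)
  next
    case False
    then show ?thesis using assms(1) by (simp add: W1_def)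
  qed
qed

lemma W1_even:
  assumes f: "f \<in> W1" and ij: "e i j" shows "E i j f \<in> W1"
proof -
  have ca: "slice (cre a (ann b f)) S = 0" if "\<And>x. S \<noteq> {x}" for a b S
  proof -
    have "slice f (insert b (S - {a})) = 0" if "a \<in> S" "b \<notin> S - {a}"
    proof -
      have "insert b (S - {a}) \<noteq> {x}" for x
        using that \<open>\<And>x. S \<noteq> {x}\<close>[of a] by auto
      then show ?thesis using f by (simp add: W1_def)
    qed
    then show ?thesis by (auto simp: slice_cre slice_ann)
  qed
  have "slice (E i j f) S = 0" if S: "\<And>x. S \<noteq> {x}" for S
  proof -
    have "\<rho> i j (slice f S) = 0" using f S lin_zero[OF lin_\<rho>[OF ij]] by (simp add: W1_def)
    then show ?thesis
      using ij by (auto simp: e_iff E_pos E_neg slice_sum slice_rho ca[OF S])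
  qed
  then have "\<forall>S. (\<forall>a. S \<noteq> {a}) \<longrightarrow> slice (E i j f) S = 0" by blast
  moreover have "E i j f \<in> W" using W1_W[OF f] E_mem e_idx[OF ij] by blast
  ultimately show ?thesis unfolding W1_def by blast
qed

text \<open>On the component \<open>S\<close> the barred trace is that of \<open>mu\<close> minus
  the number of elements of \<open>S\<close>, since each odd lowering unit removes 1. For
  \<open>mu'\<close> it is that of \<open>mu\<close> minus 1, which leaves only singletons.\<close>

lemma weight_W1:
  assumes f: "f \<in> W" and wt: "\<And>i. i \<in> idx m n \<Longrightarrow> E i i f = sc (mu' i) f"
  shows "f \<in> W1"
proof -
  have "slice f S = 0" if S: "\<And>a. S \<noteq> {a}" for S
  proof (cases "S \<subseteq> P")
    case True
    have fin: "finite S" using True finite_P finite_subset by blast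
    have "(\<Sum>i\<in>Ng. slice (E i i f) S) = (\<Sum>i\<in>Ng. \<rho> i i (slice f S)) -
        (\<Sum>i\<in>Ng. \<Sum>p\<in>Ps. if (p, i) \<in> S then slice f S else 0)"
      unfolding sum_subtractf[symmetric]
    proof (rule sum.cong[OF refl])
      fix i assume i: "i \<in> Ng"
      have "(\<Sum>p\<in>Ps. slice (cre (p, i) (ann (p, i) f)) S) = (\<Sum>p\<in>Ps. if (p, i) \<in> S then slice f S else 0)"
        by (rule sum.cong[OF refl]) (auto simp: slice_cre slice_ann insert_absorb)
      then show "slice (E i i f) S = \<rho> i i (slice f S) - (\<Sum>p\<in>Ps. if (p, i) \<in> S then slice f S else 0)"
        using i by (simp add: E_neg slice_sum slice_rho)
    qed
    also have "(\<Sum>i\<in>Ng. \<rho> i i (slice f S)) = sc (\<Sum>i\<in>Ng. mu i) (slice f S)"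
      using f by (intro block_trace) (simp add: W_def)
    also have "(\<Sum>i\<in>Ng. \<Sum>p\<in>Ps. if (p, i) \<in> S then slice f S else 0) = sc (of_nat (card S)) (slice f S)"
    proof -
      have "(\<Sum>i\<in>Ng. \<Sum>p\<in>Ps. if (p, i) \<in> S then slice f S else 0) =
          (\<Sum>p\<in>Ps. \<Sum>i\<in>Ng. if (p, i) \<in> S then slice f S else 0)" by (rule sum.swap)
      also have "\<dots> = (\<Sum>a\<in>P. if a \<in> S then slice f S else 0)"
        unfolding P_def sum.cartesian_product by (rule sum.cong) auto
      also have "\<dots> = (\<Sum>a\<in>S. slice f S)"
        using True by (intro sum.mono_neutral_cong_right) auto
      also have "\<dots> = sc (\<Sum>a\<in>S. 1) (slice f S)" unfolding fs.scale_sum_left by simp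
      finally show ?thesis by simp
    qed
    finally have 1: "(\<Sum>i\<in>Ng. slice (E i i f) S) = sc ((\<Sum>i\<in>Ng. mu i) - of_nat (card S)) (slice f S)"
      by (simp only: fs.scale_left_diff_distrib)
    have "(\<Sum>i\<in>Ng. slice (E i i f) S) = sc (\<Sum>i\<in>Ng. mu' i) (slice f S)"
      unfolding fs.scale_sum_left by (rule sum.cong) (auto simp: wt Ng_idx)
    moreover have "(\<Sum>i\<in>Ng. mu' i) = (\<Sum>i\<in>Ng. mu i) - 1"
    proof -
      have "(\<Sum>i\<in>Ng. mu' i) = (\<Sum>i\<in>Ng. mu i - (if i = bs then 1 else 0))"
        using Ps_Ng[OF tt_Ps] by (intro sum.cong) (auto simp: mu'_eq Ng_idx)
      then show ?thesis using bs_Ng by (simp add: sum_subtractf)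
    qed
    ultimately have "sc ((\<Sum>i\<in>Ng. mu i) - 1) (slice f S) - sc ((\<Sum>i\<in>Ng. mu i) - of_nat (card S)) (slice f S) = 0"
      using 1 by simp
    then have "sc (of_nat (card S) - 1) (slice f S) = 0"
      unfolding fs.scale_left_diff_distrib[symmetric] by simp
    moreover have "card S \<noteq> 1" using S by (auto simp: card_1_singleton_iff)
    then have "of_nat (card S) - 1 \<noteq> (0 :: complex)"
      by (metis of_nat_1 of_nat_eq_iff right_minus_eq)
    ultimately show ?thesis by (simp add: fs.scale_eq_0_iff)
  qed (use f in \<open>simp add: W_def\<close>)
  then have "\<forall>S. (\<forall>a. S \<noteq> {a}) \<longrightarrow> slice f S = 0" by blast
  with f show ?thesis unfolding W1_def by blast
qed

text \<open>The weight of \<open>E r k\<close> applied to the highest weight vector.\<close>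

definition shift :: "int \<Rightarrow> int \<Rightarrow> weight" where
  "shift r k = (\<lambda>i. mu i - (if i = k then 1 else 0) + (if i = r then 1 else 0))"

lemma shift_slice:
  assumes "r \<in> Ps" "k \<in> Ng" "i \<in> idx m n" "slice f {(r, k)} = sc a v0"
  shows "slice (E i i f) {(r, k)} = sc (shift r k i) (slice f {(r, k)})"
proof -
  have "i \<in> Ps \<or> i \<in> Ng" using assms by (simp add: idx_cases)
  then have "slice (E i i f) {(r, k)} = \<rho> i i (slice f {(r, k)}) +
      sc ((if i = r then 1 else 0) - (if i = k then 1 else 0)) (slice f {(r, k)})"
    using Ps_Ng assms(1,2) by (elim disjE) (auto simp: slice_pos slice_neg)
  moreover have "\<rho> i i (slice f {(r, k)}) = sc (mu i) (slice f {(r, k)})"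
    unfolding assms(4) by (simp add: lin_sc[OF lin_\<rho>[OF e_diag[OF assms(3)]]] v0_weight[OF assms(3)] mult.commute)
  ultimately show ?thesis
    by (simp only: fs.scale_left_distrib[symmetric] shift_def) (simp add: algebra_simps)
qed

text \<open>Among the nonzero components one with maximal \<open>r - k\<close> is taken. An even
  raising unit acts on it by \<open>\<rho>\<close>, up to components of larger \<open>r - k\<close>,
  which vanish; so this component is extremal in the irreducible module and a multiple of
  \<open>v0\<close>.\<close>

lemma extremal_slice:
  assumes f: "f \<in> W1" "f \<noteq> 0" and ext: "\<And>i j. e i j \<Longrightarrow> i < j \<Longrightarrow> E i j f = 0"
  obtains r k a where "r \<in> Ps" "k \<in> Ng" "a \<noteq> 0" "slice f {(r, k)} = sc a v0"
proof -
  let ?A = "{a \<in> P. slice f {a} \<noteq> 0}"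
  let ?h = "\<lambda>(r, k). r - k"
  have "?A \<noteq> {}" using W1_eqI[OF f(1)] f(2) by blast
  then have ne: "?h ` ?A \<noteq> {}" by simp
  have fin: "finite (?h ` ?A)" by simp
  from Max_in[OF fin ne] obtain r k where rk: "(r, k) \<in> P" "slice f {(r, k)} \<noteq> 0" "r - k = Max (?h ` ?A)"
    by auto
  have max: "slice f {(r', k')} = 0" if "(r', k') \<in> P" "r - k < r' - k'" for r' k'
  proof (rule ccontr)
    assume "slice f {(r', k')} \<noteq> 0"
    then have "r' - k' \<in> ?h ` ?A" using that by force
    then have "r' - k' \<le> r - k" unfolding rk(3) using fin by (intro Max_ge)
    then show False using that by simp
  qed
  have rP: "r \<in> Ps" and kN: "k \<in> Ng" using rk by (auto simp: P_iff)
  have "extremal (slice f {(r, k)})"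
    unfolding extremal_def
  proof (intro conjI allI impI)
    show "slice f {(r, k)} \<in> V" using W1_W[OF f(1)] by (simp add: W_def)
    fix i j assume ij: "e i j" "i < j"
    have z: "slice (E i j f) {(r, k)} = 0" using ext[OF ij] by simp
    have "i \<in> Ps \<and> j \<in> Ps \<or> i \<in> Ng \<and> j \<in> Ng" using ij by (simp add: e_iff)
    then show "\<rho> i j (slice f {(r, k)}) = 0"
    proof (elim disjE conjE)
      assume *: "i \<in> Ps" "j \<in> Ps"
      have "i = r \<Longrightarrow> slice f {(j, k)} = 0" using * kN ij(2) by (intro max) (auto simp: P_iff)
      then show ?thesis using z unfolding slice_pos[OF * kN] by (auto split: if_splits)
    next
      assume *: "i \<in> Ng" "j \<in> Ng"
      have "j = k \<Longrightarrow> slice f {(r, i)} = 0" using * rP ij(2) by (intro max) (auto simp: P_iff)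
      then show ?thesis using z unfolding slice_neg[OF * rP] by (auto split: if_splits)
    qed
  qed
  then obtain a where a: "slice f {(r, k)} = sc a v0"
    by (rule irreducible_extremal[rotated]) (blast, erule irred)
  then have "a \<noteq> 0" using rk(2) by auto
  then show thesis using that rP kN a by blast
qed

lemma sv_W1: "sv \<in> W1"
  by (rule weight_W1[OF sv_W sv_weight])

text \<open>A suitable multiple of \<open>sv\<close> is subtracted so that the component at
  \<open>(tt, bs)\<close> falls into \<open>low\<close>. If the difference were nonzero, it would
  have a component that is a nonzero multiple of \<open>v0\<close>; the weight forces its position
  to be \<open>(tt, bs)\<close>, but \<open>v0\<close> is not in \<open>low\<close>.\<close>

lemma singular_unique:
  assumes w: "w \<in> W" and raise: "\<And>i j. i \<in> idx m n \<Longrightarrow> j \<in> idx m n \<Longrightarrow> i < j \<Longrightarrow> E i j w = 0"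
    and wt: "\<And>i. i \<in> idx m n \<Longrightarrow> E i i w = sc (mu' i) w"
  obtains a where "w = sc a sv"
proof -
  obtain \<kappa> where \<kappa>: "\<kappa> \<noteq> 0" "slice sv {(tt, bs)} = sc \<kappa> v0" by (rule sv_slice)
  have w1: "w \<in> W1" by (rule weight_W1[OF w wt])
  have "slice w {(tt, bs)} \<in> cyc" using w by (simp add: W_def V_cyc[symmetric])
  then obtain a where a: "slice w {(tt, bs)} - sc a v0 \<in> low" by (rule cyc_decomp)
  \<comment> \<open>The component of \<open>sv\<close> is \<open>\<kappa>\<close> times
    \<open>v0\<close>, so this multiple removes exactly the \<open>v0\<close> part of the component
    of \<open>w\<close>.\<close>
  define z where "z = w - sc (a / \<kappa>) sv"
  have z1: "z \<in> W1"
    unfolding z_def by (intro fs.subspace_diff[OF subspace_W1] fs.subspace_scale[OF subspace_W1] w1 sv_W1)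
  have zs: "slice z {(tt, bs)} \<in> low" using a \<kappa> by (simp add: z_def)
  have zr: "E i j z = 0" if "e i j" "i < j" for i j
  proof -
    have ij: "i \<in> idx m n" "j \<in> idx m n" using that e_idx by auto
    show ?thesis
      unfolding z_def lin_diff[OF lin_E[OF ij]] lin_sc[OF lin_E[OF ij]]
      using raise[OF ij that(2)] sv_raise[OF ij that(2)] by simp
  qed
  have zw: "E i i z = sc (mu' i) z" if i: "i \<in> idx m n" for i
    unfolding z_def lin_diff[OF lin_E[OF i i]] lin_sc[OF lin_E[OF i i]] wt[OF i] sv_weight[OF i]
    by (simp add: fs.scale_right_diff_distrib mult.commute)
  have "z = 0"
  proof (rule ccontr)
    assume "z \<noteq> 0"
    then obtain r k b where rk: "r \<in> Ps" "k \<in> Ng" "b \<noteq> 0" "slice z {(r, k)} = sc b v0"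
      using extremal_slice[OF z1 _ zr] by blast
    have nz: "slice z {(r, k)} \<noteq> 0" using rk v0_nz by (simp add: fs.scale_eq_0_iff)
    have eq: "shift r k i = mu' i" if "i \<in> idx m n" for i
    proof -
      have "sc (shift r k i) (slice z {(r, k)}) = sc (mu' i) (slice z {(r, k)})"
        unfolding shift_slice[OF rk(1,2) that rk(4), symmetric] zw[OF that] slice_simps ..
      then show ?thesis using nz unfolding fs.scale_cancel_right by blast
    qed
    \<comment> \<open>At the index \<open>r\<close> the shifted weight exceeds \<open>mu\<close> by
      1, which \<open>mu'\<close> does only at \<open>tt\<close>.\<close>
    have "r = tt" using eq[OF Ps_idx[OF rk(1)]] Ps_Ng[OF rk(1,2)] Ps_Ng[OF rk(1) bs_Ng]
      by (auto simp: shift_def mu'_eq Ps_idx[OF rk(1)] split: if_splits)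
    moreover have "k = bs" using eq[OF Ng_idx[OF rk(2)]] Ps_Ng[OF rk(1,2)] Ps_Ng[OF tt_Ps rk(2)]
      by (auto simp: shift_def mu'_eq Ng_idx[OF rk(2)] split: if_splits)
    ultimately have "sc b v0 \<in> low" using zs rk by simp
    then show False using v0_notin_low rk(3) by blast
  qed
  then have "w = sc (a / \<kappa>) sv" by (simp add: z_def)
  then show thesis by (rule that)
qed

subsection \<open>Casimir values\<close>

text \<open>Collecting the differences over pairs gives each coordinate the number of larger minus
  the number of smaller indices of its block as coefficient. This number \<open>h - 2 * i\<close> is
  twice the coordinate of the half sum of positive roots.\<close>

lemma casimir_value_block:
  assumes "finite blk" and h: "\<And>i. i \<in> blk \<Longrightarrow> int (card {j \<in> blk. i < j}) - int (card {j \<in> blk. j < i}) = h - 2 * i"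
  shows "casimir_value blk \<nu> = (\<Sum>i\<in>blk. \<nu> i * (\<nu> i + of_int h - 2 * of_int i))"
proof -
  have *: "(if i < j then \<nu> i - \<nu> j else if i = j then \<nu> i * \<nu> i else 0) =
      (if i = j then \<nu> i * \<nu> i else 0) + ((if i < j then \<nu> i else 0) - (if i < j then \<nu> j else 0))" for i j
    by simp
  have "casimir_value blk \<nu> = (\<Sum>i\<in>blk. \<Sum>j\<in>blk. if i = j then \<nu> i * \<nu> i else 0) +
      ((\<Sum>i\<in>blk. \<Sum>j\<in>blk. if i < j then \<nu> i else 0) - (\<Sum>i\<in>blk. \<Sum>j\<in>blk. if i < j then \<nu> j else 0))"
    unfolding casimir_value_def * by (simp only: sum.distrib sum_subtractf)
  also have "(\<Sum>i\<in>blk. \<Sum>j\<in>blk. if i < j then \<nu> j else 0) = (\<Sum>j\<in>blk. \<Sum>i\<in>blk. if i < j then \<nu> j else 0)"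
    by (rule sum.swap)
  also have "\<dots> = (\<Sum>j\<in>blk. of_nat (card {i \<in> blk. i < j}) * \<nu> j)"
    using \<open>finite blk\<close> by (intro sum.cong refl) (simp add: sum.inter_filter[symmetric])
  also have "(\<Sum>i\<in>blk. \<Sum>j\<in>blk. if i < j then \<nu> i else 0) = (\<Sum>i\<in>blk. of_nat (card {j \<in> blk. i < j}) * \<nu> i)"
    using \<open>finite blk\<close> by (intro sum.cong refl) (simp add: sum.inter_filter[symmetric])
  also have "(\<Sum>i\<in>blk. \<Sum>j\<in>blk. if i = j then \<nu> i * \<nu> i else 0) = (\<Sum>i\<in>blk. \<nu> i * \<nu> i)"
    using \<open>finite blk\<close> by (intro sum.cong refl) (simp add: sum.delta')
  finally have "casimir_value blk \<nu> = (\<Sum>i\<in>blk. \<nu> i * \<nu> i + (of_nat (card {j \<in> blk. i < j}) * \<nu> i -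
      of_nat (card {i' \<in> blk. i' < i}) * \<nu> i))"
    by (simp only: sum.distrib sum_subtractf)
  also have "\<dots> = (\<Sum>i\<in>blk. \<nu> i * (\<nu> i + of_int h - 2 * of_int i))"
  proof (rule sum.cong[OF refl])
    fix i assume "i \<in> blk"
    from h[OF this] have "(of_int (int (card {j \<in> blk. i < j}) - int (card {j \<in> blk. j < i})) :: complex) = of_int (h - 2 * i)"
      by (rule arg_cong)
    then have E: "(of_nat (card {j \<in> blk. i < j}) - of_nat (card {j \<in> blk. j < i}) :: complex) = of_int h - 2 * of_int i" by simp
    show "\<nu> i * \<nu> i + (of_nat (card {j \<in> blk. i < j}) * \<nu> i - of_nat (card {i' \<in> blk. i' < i}) * \<nu> i) =
        \<nu> i * (\<nu> i + of_int h - 2 * of_int i)"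
      unfolding left_diff_distrib[symmetric] E by (simp add: algebra_simps)
  qed
  finally show ?thesis .
qed

lemma casimir_value_Ng: "casimir_value Ng \<nu> = (\<Sum>i\<in>Ng. \<nu> i * (\<nu> i + of_int (- 1 - int m) - 2 * of_int i))"
proof (rule casimir_value_block)
  fix i assume "i \<in> Ng"
  then have i: "- int m \<le> i" "i < 0" by (auto simp: Ng_def mem_idx)
  then have "{j \<in> Ng. i < j} = {i + 1 .. - 1}" "{j \<in> Ng. j < i} = {- int m .. i - 1}"
    by (auto simp: Ng_def mem_idx)
  then show "int (card {j \<in> Ng. i < j}) - int (card {j \<in> Ng. j < i}) = (- 1 - int m) - 2 * i"
    using i by simp
qed simp

lemma casimir_value_Ps: "casimir_value Ps \<nu> = (\<Sum>i\<in>Ps. \<nu> i * (\<nu> i + of_int (1 + int n) - 2 * of_int i))"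
proof (rule casimir_value_block)
  fix i assume "i \<in> Ps"
  then have i: "0 < i" "i \<le> int n" by (auto simp: Ps_def mem_idx)
  then have "{j \<in> Ps. i < j} = {i + 1 .. int n}" "{j \<in> Ps. j < i} = {1 .. i - 1}"
    by (auto simp: Ps_def mem_idx)
  then show "int (card {j \<in> Ps. i < j}) - int (card {j \<in> Ps. j < i}) = (1 + int n) - 2 * i"
    using i by simp
qed simp

lemma shift_sum:
  fixes g :: "int \<Rightarrow> complex \<Rightarrow> complex"
  assumes "finite A" "k \<in> A" "\<And>i. i \<in> A \<Longrightarrow> \<nu> i = (if i = k then y else mu i)"
  shows "(\<Sum>i\<in>A. g i (\<nu> i)) = (\<Sum>i\<in>A. g i (mu i)) + (g k y - g k (mu k))"
proof -
  have "(\<Sum>i\<in>A. g i (\<nu> i)) = (\<Sum>i\<in>A. g i (mu i) + (if i = k then g k y - g k (mu k) else 0))"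
    by (rule sum.cong[OF refl], subst assms(3)) auto
  then show ?thesis using assms(1,2) by (simp add: sum.distrib)
qed

text \<open>Up to a constant these numbers are the coordinates of the highest weight shifted by the
  half sum of positive roots of the block; dominance makes them strictly decreasing by
  integers.\<close>

lemma mu_strict_Ng:
  assumes "k \<in> Ng" "l \<in> Ng" "k < l" shows "mu k - of_int k \<noteq> mu l - of_int l"
proof -
  define i j where "i = nat (- k)" and "j = nat (- l)"
  have ij: "k = bar i" "l = bar j" "1 \<le> j" "j < i" "i \<le> m"
    using assms by (auto simp: i_def j_def Ng_def mem_idx bar_def)
  then have "mu k - mu l \<in> \<nat>" using dom by (auto simp: dominant_def)
  then obtain N where "mu k - mu l = of_nat N" by (auto elim: Nats_cases)
  then have "(mu k - of_int k) - (mu l - of_int l) = of_nat (N + (i - j))"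
    using ij by (simp add: bar_def of_nat_diff algebra_simps)
  moreover have "N + (i - j) \<noteq> 0" using ij by simp
  ultimately show ?thesis by (metis of_nat_eq_0_iff right_minus_eq)
qed

lemma mu_strict_Ps:
  assumes "k \<in> Ps" "l \<in> Ps" "k < l" shows "mu k - of_int k \<noteq> mu l - of_int l"
proof -
  define i j where "i = nat k" and "j = nat l"
  have ij: "k = int i" "l = int j" "1 \<le> i" "i < j" "j \<le> n"
    using assms by (auto simp: i_def j_def Ps_def mem_idx)
  then have "mu k - mu l \<in> \<nat>" using dom by (auto simp: dominant_def)
  then obtain N where "mu k - mu l = of_nat N" by (auto elim: Nats_cases)
  then have "(mu k - of_int k) - (mu l - of_int l) = of_nat (N + (j - i))"
    using ij by (simp add: of_nat_diff algebra_simps)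
  moreover have "N + (j - i) \<noteq> 0" using ij by simp
  ultimately show ?thesis by (metis of_nat_eq_0_iff right_minus_eq)
qed

lemma mu'_shift: "i \<in> idx m n \<Longrightarrow> mu' i = shift tt bs i"
  by (simp add: mu'_eq shift_def)

text \<open>Only the summand at \<open>k\<close> changes, and the finite difference of a quadratic
  polynomial is affine in \<open>mu k - k\<close>.\<close>

lemma casimir_shift_Ng:
  assumes "r \<in> Ps" "k \<in> Ng"
  shows "casimir_value Ng (shift r k) = casimir_value Ng mu + (1 - of_int (- 1 - int m) - 2 * (mu k - of_int k))"
  unfolding casimir_value_Ng
  by (subst shift_sum[where g = "\<lambda>i x. x * (x + of_int (- 1 - int m) - 2 * of_int i)" and k = k and y = "mu k - 1"])
    (use assms Ps_Ng[OF assms(1)] in \<open>auto simp: shift_def algebra_simps\<close>)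

lemma casimir_shift_Ps:
  assumes "r \<in> Ps" "k \<in> Ng"
  shows "casimir_value Ps (shift r k) = casimir_value Ps mu + (1 + of_int (1 + int n) + 2 * (mu r - of_int r))"
  unfolding casimir_value_Ps
  by (subst shift_sum[where g = "\<lambda>i x. x * (x + of_int (1 + int n) - 2 * of_int i)" and k = r and y = "mu r + 1"])
    (use assms Ps_Ng[OF _ assms(2)] in \<open>auto simp: shift_def algebra_simps\<close>)

text \<open>The Casimir values of the two blocks determine \<open>mu k - k\<close> and
  \<open>mu r - r\<close>, and these determine the indices by \<open>mu_strict_Ng\<close> and
  \<open>mu_strict_Ps\<close>.\<close>

lemma casimir_separates:
  assumes rk: "r \<in> Ps" "k \<in> Ng"
    and "casimir_value Ng (shift r k) = casimir_value Ng mu'" "casimir_value Ps (shift r k) = casimir_value Ps mu'"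
  shows "r = tt" "k = bs"
proof -
  have c: "casimir_value Ng mu' = casimir_value Ng (shift tt bs)" "casimir_value Ps mu' = casimir_value Ps (shift tt bs)"
    unfolding casimir_value_def by (intro sum.cong refl; simp add: mu'_shift Ng_idx Ps_idx)+
  have "mu k - of_int k = mu bs - of_int bs" "mu r - of_int r = mu tt - of_int tt"
    using assms(3,4) unfolding c casimir_shift_Ng[OF rk] casimir_shift_Ng[OF tt_Ps bs_Ng]
      casimir_shift_Ps[OF rk] casimir_shift_Ps[OF tt_Ps bs_Ng]
    by (simp_all del: right_diff_distrib_numeral)
  then show "r = tt" "k = bs"
    using mu_strict_Ng[OF rk(2) bs_Ng] mu_strict_Ng[OF bs_Ng rk(2)] mu_strict_Ps[OF rk(1) tt_Ps]
      mu_strict_Ps[OF tt_Ps rk(1)] by (metis linorder_neqE)+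
qed

end

section \<open>Existence of the homomorphism\<close>

definition lft :: "('b + 'c \<Rightarrow> complex) \<Rightarrow> 'b \<Rightarrow> complex" where "lft x = (\<lambda>b. x (Inl b))"
definition rgt :: "('b + 'c \<Rightarrow> complex) \<Rightarrow> 'c \<Rightarrow> complex" where "rgt x = (\<lambda>c. x (Inr c))"
definition pr :: "('b \<Rightarrow> complex) \<Rightarrow> ('c \<Rightarrow> complex) \<Rightarrow> 'b + 'c \<Rightarrow> complex" where "pr x y = case_sum x y"

lemma lft_rgt_simps [simp]:
  "lft (pr x y) = x" "rgt (pr x y) = y"
  "lft 0 = 0" "rgt 0 = 0" "lft (f + g) = lft f + lft g" "rgt (f + g) = rgt f + rgt g"
  "lft (f - g) = lft f - lft g" "rgt (f - g) = rgt f - rgt g"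
  "lft (sc c f) = sc c (lft f)" "rgt (sc c f) = sc c (rgt f)"
  by (auto simp: lft_def rgt_def pr_def sc_def fun_eq_iff)

lemma pr_eqI: "lft f = lft g \<Longrightarrow> rgt f = rgt g \<Longrightarrow> f = g"
proof
  fix z assume "lft f = lft g" "rgt f = rgt g"
  then show "f z = g z" by (cases z) (auto simp: lft_def rgt_def fun_eq_iff)
qed

lemma lin_lft: "lin lft" and lin_rgt: "lin rgt"
  by (simp_all add: lin_def)

text \<open>The submodule \<open>D.cyc\<close> of \<open>V2 \<oplus> W\<close> generated by the pair of highest weight vectors is the graph
  of a homomorphism.\<close>

locale kac_pair = kac_setup m n V \<rho> v0 mu s t +
  L2: hw_vector m n V2 \<rho>2 v2 "mu - (delta s - eps t)"
  for m n and V :: "('a \<Rightarrow> complex) set" and \<rho> v0 mu s t and V2 :: "('d \<Rightarrow> complex) set" and \<rho>2 v2 +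
  assumes irred2: "\<And>N. L2.invariant N \<Longrightarrow> N = {0} \<or> N = V2"
begin

interpretation WE: g0_rep m n W E
  by (intro g0_rep.intro subspace_W even_even lin_even E_mem) (auto simp: ev_def)

definition VD :: "('d + (int \<times> int) set \<times> 'a \<Rightarrow> complex) set" where
  "VD = {x. lft x \<in> V2 \<and> rgt x \<in> W}"

definition \<rho>D :: "int \<Rightarrow> int \<Rightarrow> ('d + (int \<times> int) set \<times> 'a \<Rightarrow> complex) \<Rightarrow> 'd + (int \<times> int) set \<times> 'a \<Rightarrow> complex" where
  "\<rho>D i j x = pr (\<rho>2 i j (lft x)) (E i j (rgt x))"

lemma D_simps [simp]: "lft (\<rho>D i j x) = \<rho>2 i j (lft x)" "rgt (\<rho>D i j x) = E i j (rgt x)"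
  by (simp_all add: \<rho>D_def)

interpretation D: hw_vector m n VD \<rho>D "pr v2 sv" mu'
proof -
  have g: "g0_rep m n VD \<rho>D"
  proof
    show "fs.subspace VD"
      by (rule fs.subspaceI) (auto simp: VD_def fs.subspace_0[OF L2.V] fs.subspace_add[OF L2.V]
        fs.subspace_scale[OF L2.V] fs.subspace_0[OF subspace_W] fs.subspace_add[OF subspace_W]
        fs.subspace_scale[OF subspace_W])
    fix i j assume ij: "ev m n i j"
    show "lin (\<rho>D i j)"
      unfolding lin_def
      by (auto intro!: pr_eqI simp: lin_add[OF L2.lin_\<rho>[OF ij]] lin_sc[OF L2.lin_\<rho>[OF ij]]
          lin_add[OF lin_even[OF ij]] lin_sc[OF lin_even[OF ij]])
    fix x assume x: "x \<in> VD"
    show "\<rho>D i j x \<in> VD" using x L2.\<rho>_mem[OF ij] WE.\<rho>_mem[OF ij] by (simp add: VD_def)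
    fix k l assume kl: "ev m n k l"
    have x': "lft x \<in> V2" "rgt x \<in> W" using x by (auto simp: VD_def)
    show "\<rho>D i j (\<rho>D k l x) = \<rho>D k l (\<rho>D i j x) + (if j = k then \<rho>D i l x else 0) - (if l = i then \<rho>D k j x else 0)"
    proof (rule pr_eqI)
      show "lft (\<rho>D i j (\<rho>D k l x)) = lft (\<rho>D k l (\<rho>D i j x) + (if j = k then \<rho>D i l x else 0) - (if l = i then \<rho>D k j x else 0))"
        using L2.\<rho>_comm[OF ij kl x'(1)] by auto
      show "rgt (\<rho>D i j (\<rho>D k l x)) = rgt (\<rho>D k l (\<rho>D i j x) + (if j = k then \<rho>D i l x else 0) - (if l = i then \<rho>D k j x else 0))"
        using even_even[OF x'(2) ij kl] by auto
    qed
  qed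
  interpret G: g0_rep m n VD \<rho>D by (rule g)
  show "hw_vector m n VD \<rho>D (pr v2 sv) mu'"
  proof
    show "G.extremal (pr v2 sv)"
      unfolding G.extremal_def
    proof (intro conjI allI impI)
      show "pr v2 sv \<in> VD" using L2.v0_V sv_W by (simp add: VD_def)
      fix i j assume ij: "ev m n i j" "i < j"
      have "\<rho>2 i j v2 = 0" using L2.v0 ij by (simp add: L2.extremal_def)
      moreover have "E i j sv = 0" using ij e_idx by (intro sv_raise) auto
      ultimately show "\<rho>D i j (pr v2 sv) = 0" by (intro pr_eqI) simp_all
    qed
    show "pr v2 sv \<noteq> 0"
    proof
      assume "pr v2 sv = 0"
      then have "lft (pr v2 sv) = lft 0" by simp
      then show False using L2.v0_nz by simp
    qed
    fix i assume i: "i \<in> idx m n"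
    show "\<rho>D i i (pr v2 sv) = sc (mu' i) (pr v2 sv)"
      using L2.v0_weight[OF i] sv_weight[OF i] by (intro pr_eqI) (simp_all add: mu'_def)
  qed
qed

lemma D_cyc_W1:
  assumes "x \<in> D.cyc" shows "rgt x \<in> W1"
proof -
  have l: "rgt y \<in> W1" if "D.lw k y" for k y
    using that
  proof (induction rule: D.lw.induct)
    case base
    then show ?case by (simp add: sv_W1)
  next
    case (step k x i j)
    then show ?case using W1_even by simp
  qed
  show ?thesis
    by (rule D.image_span[OF lin_rgt assms[unfolded D.cyc_def] _ subspace_W1]) (use l in auto)
qed

lemma rgt_casimir: "rgt (D.casimir blk x) = WE.casimir blk (rgt x)"
  unfolding D.casimir_def WE.casimir_def by (simp add: lin_sum[OF lin_rgt])

text \<open>A diagonal unit multiplies the chosen component by its shifted weight and leaves it a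
  multiple of \<open>v0\<close>, so it can be applied twice.\<close>

lemma casimir_slice:
  assumes blk: "\<And>i j. i \<in> blk \<Longrightarrow> j \<in> blk \<Longrightarrow> e i j" and y: "WE.extremal y"
    and rk: "r \<in> Ps" "k \<in> Ng" "slice y {(r, k)} = sc a v0"
  shows "slice (WE.casimir blk y) {(r, k)} = sc (casimir_value blk (shift r k)) (sc a v0)"
proof -
  have ce: "WE.casimir blk y = (\<Sum>i\<in>blk. \<Sum>j\<in>blk. if i < j then E i i y - E j j y
      else if i = j then E i i (E i i y) else 0)"
    by (rule WE.casimir_extremal[OF blk y])
  have "slice (WE.casimir blk y) {(r, k)} = (\<Sum>i\<in>blk. \<Sum>j\<in>blk. sc (if i < j then shift r k i - shift r k j
      else if i = j then shift r k i * shift r k i else 0) (sc a v0))"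
    unfolding ce slice_sum
  proof (intro sum.cong refl)
    fix i j assume "i \<in> blk" "j \<in> blk"
    then have ij: "i \<in> idx m n" "j \<in> idx m n" using blk by (auto simp: ev_def)
    have s: "slice (E i i y) {(r, k)} = sc (shift r k i * a) v0" if "i \<in> idx m n" for i
      using shift_slice[OF rk(1,2) that rk(3)] rk(3) by simp
    have ss: "slice (E i i (E i i y)) {(r, k)} = sc (shift r k i * shift r k i * a) v0" if "i \<in> idx m n" for i
      using shift_slice[OF rk(1,2) that s[OF that]] s[OF that] by (simp add: mult.assoc)
    show "slice (if i < j then E i i y - E j j y else if i = j then E i i (E i i y) else 0) {(r, k)} =
        sc (if i < j then shift r k i - shift r k j else if i = j then shift r k i * shift r k i else 0) (sc a v0)"
      using s[OF ij(1)] s[OF ij(2)] ss[OF ij(1)] ss[OF ij(2)]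
      by (auto simp: fs.scale_left_diff_distrib[symmetric] left_diff_distrib mult.assoc)
  qed
  then show ?thesis unfolding casimir_value_def fs.scale_sum_left .
qed

text \<open>In this component the height operator has the same eigenvalue as on the generator
  \<open>pr v2 sv\<close>. The separating operator therefore acts on it as on a word of height zero,
  with a nonzero factor, whatever the heights occurring in \<open>x\<close>.\<close>

lemma sep_slice:
  assumes "slice (rgt x) {(tt, bs)} = sc a v0"
  shows "slice (rgt (D.sep K x)) {(tt, bs)} = sc ((\<Prod>j=1..K. - of_nat j) * a) v0"
proof (induction K)
  case 0
  then show ?case using assms by simp
next
  case (Suc K)
  let ?y = "rgt (D.sep K x)" and ?H = "\<Sum>i\<in>idx m n. of_int i * mu' i"
  have "slice (rgt (D.heightop (D.sep K x))) {(tt, bs)} = sc ?H (slice ?y {(tt, bs)})"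
    unfolding D.heightop_def lin_sum[OF lin_rgt] slice_sum fs.scale_sum_left
  proof (rule sum.cong[OF refl])
    fix i assume i: "i \<in> idx m n"
    show "slice (rgt (sc (of_int i) (\<rho>D i i (D.sep K x)))) {(tt, bs)} = sc (of_int i * mu' i) (slice ?y {(tt, bs)})"
      using shift_slice[OF tt_Ps bs_Ng i Suc] by (simp add: mu'_shift[OF i])
  qed
  then have "slice (rgt (D.sep (Suc K) x)) {(tt, bs)} =
      sc ?H (slice ?y {(tt, bs)}) - sc (?H + of_nat (Suc K)) (slice ?y {(tt, bs)})"
    by simp
  also have "\<dots> = sc (- of_nat (Suc K)) (slice ?y {(tt, bs)})"
    unfolding fs.scale_left_diff_distrib[symmetric] by simp
  finally have "slice (rgt (D.sep (Suc K) x)) {(tt, bs)} = sc (- of_nat (Suc K)) (sc ((\<Prod>j=1..K. - of_nat j) * a) v0)"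
    unfolding Suc .
  then have "slice (rgt (D.sep (Suc K) x)) {(tt, bs)} = sc ((\<Prod>j=1..Suc K. - of_nat j) * a) v0"
    by (simp add: mult.commute mult.left_commute)
  then show ?case .
qed

lemma sep_lft:
  assumes "lft x = 0" shows "lft (D.sep K x) = 0"
proof (induction K)
  case (Suc K)
  have S: "lft (D.sep K x) = 0" using Suc .
  have H: "lft (D.heightop (D.sep K x)) = 0"
    unfolding D.heightop_def lin_sum[OF lin_lft]
  proof (rule sum.neutral, rule ballI)
    fix i assume "i \<in> idx m n"
    then have z: "\<rho>2 i i 0 = 0" by (rule lin_zero[OF L2.lin_\<rho>[OF e_diag]])
    show "lft (sc (of_int i) (\<rho>D i i (D.sep K x))) = 0"
      unfolding lft_rgt_simps D_simps S z by (rule fs.scale_zero_right)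
  qed
  have "lft (D.sep (Suc K) x) = 0"
    unfolding D.sep.simps lft_rgt_simps S H fs.scale_zero_right by (rule diff_0_right)
  then show ?case .
qed (simp add: assms)

lemma factorial_nz: "(\<Prod>j=1..K. - of_nat j :: complex) \<noteq> 0"
  by (auto simp: prod_zero_iff)

text \<open>By induction along the height filtration a counterexample has an extremal right part.
  Its leading component is a multiple of \<open>v0\<close>, and the Casimir values, constant on
  \<open>D.cyc\<close>, force the position \<open>(tt, bs)\<close>. There the separating operator
  acts by a nonzero scalar, while the zero left part makes it annihilate \<open>x\<close>.\<close>

lemma graph_zero:
  assumes "x \<in> D.cyc" "lft x = 0" shows "rgt x = 0"
proof -
  have "\<forall>x\<in>D.filt (int K). lft x = 0 \<longrightarrow> rgt x = 0" for K
  proof (induction K rule: less_induct)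
    case (less K)
    show ?case
    proof (intro ballI impI, rule ccontr)
      fix x assume x: "x \<in> D.filt (int K)" and l: "lft x = 0" and r: "rgt x \<noteq> 0"
      have xc: "x \<in> D.cyc" using x D.filt_cyc by blast
      have y1: "rgt x \<in> W1" by (rule D_cyc_W1[OF xc])
      \<comment> \<open>Raising reduces the filtration index and keeps the left part zero, so the
        induction hypothesis applies; at negative index the filtration is zero anyway.\<close>
      have ext: "E i j (rgt x) = 0" if ij: "e i j" "i < j" for i j
      proof -
        have m: "\<rho>D i j x \<in> D.filt (int K + (i - j))" by (rule D.filt_act[OF x ij(1)])
        have l': "lft (\<rho>D i j x) = 0" by (simp add: l lin_zero[OF L2.lin_\<rho>[OF ij(1)]])
        have "rgt (\<rho>D i j x) = 0"
        proof (cases "int K + (i - j) < 0")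
          case True
          then show ?thesis using m D.filt_neg by simp
        next
          case False
          define K' where "K' = nat (int K + (i - j))"
          have "K' < K" "int K + (i - j) = int K'" using False ij(2) by (auto simp: K'_def)
          then have K': "K' < K" "\<rho>D i j x \<in> D.filt (int K')" using m by simp_all
          show ?thesis by (rule less[OF K'(1), rule_format, OF K'(2) l'])
        qed
        then show ?thesis by simp
      qed
      obtain p k a where a: "p \<in> Ps" "k \<in> Ng" "a \<noteq> 0" "slice (rgt x) {(p, k)} = sc a v0"
        using extremal_slice[OF y1 r ext] by blast
      have nz: "sc a v0 \<noteq> 0" using a(3) v0_nz by (simp add: fs.scale_eq_0_iff)
      have y: "WE.extremal (rgt x)" using ext W1_W[OF y1] by (simp add: WE.extremal_def)
      have cv: "casimir_value blk (shift p k) = casimir_value blk mu'"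
        if blk: "\<And>i j. i \<in> blk \<Longrightarrow> j \<in> blk \<Longrightarrow> e i j" "finite blk" "\<And>k l. e k l \<Longrightarrow> k \<in> blk \<longleftrightarrow> l \<in> blk" for blk
      proof -
        have "D.casimir blk x = sc (casimir_value blk mu') x"
          by (rule D.casimir_cyc) (use blk xc in auto)
        then have "WE.casimir blk (rgt x) = sc (casimir_value blk mu') (rgt x)"
          using rgt_casimir[of blk x] by simp
        then have "slice (WE.casimir blk (rgt x)) {(p, k)} = sc (casimir_value blk mu') (sc a v0)"
          by (simp only: slice_simps a(4))
        moreover have "slice (WE.casimir blk (rgt x)) {(p, k)} = sc (casimir_value blk (shift p k)) (sc a v0)"
          by (rule casimir_slice[OF blk(1) y a(1,2,4)])
        ultimately have "sc (casimir_value blk (shift p k)) (sc a v0) = sc (casimir_value blk mu') (sc a v0)"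
          by metis
        then show ?thesis using nz unfolding fs.scale_cancel_right by blast
      qed
      have "casimir_value Ng (shift p k) = casimir_value Ng mu'" "casimir_value Ps (shift p k) = casimir_value Ps mu'"
        using Ps_Ng by (intro cv; auto simp: e_iff)+
      then have pk: "p = tt" "k = bs" by (rule casimir_separates[OF a(1,2)])+
      \<comment> \<open>A large separating operator kills the \<open>low\<close> part and leaves a
        multiple of the generator. The left part of the generator is \<open>v2\<close>, so the
        vanishing left part of \<open>x\<close> forces \<open>\<alpha> = 0\<close>.\<close>
      obtain \<alpha> where \<alpha>: "x - sc \<alpha> (pr v2 sv) \<in> D.low" using D.cyc_decomp[OF xc] by blast
      obtain K' where "D.sep K' (x - sc \<alpha> (pr v2 sv)) = 0" using D.sep_low[OF \<alpha>] by blast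
      then have sx: "D.sep K' x = sc (\<alpha> * (\<Prod>j=1..K'. - of_nat j)) (pr v2 sv)"
        using D.sep_lw[OF D.lw.base, of K'] by (simp add: lin_diff[OF D.lin_sep] lin_sc[OF D.lin_sep])
      have "sc (\<alpha> * (\<Prod>j=1..K'. - of_nat j)) v2 = 0" using sep_lft[OF l, of K'] unfolding sx by simp
      then have "\<alpha> = 0" using L2.v0_nz factorial_nz[of K'] by (simp add: fs.scale_eq_0_iff)
      then have "slice (rgt (D.sep K' x)) {(tt, bs)} = 0" unfolding sx by simp
      moreover have "slice (rgt (D.sep K' x)) {(tt, bs)} = sc ((\<Prod>j=1..K'. - of_nat j) * a) v0"
        using a(4) unfolding pk by (rule sep_slice)
      ultimately show False using v0_nz a(3) factorial_nz[of K'] by (simp add: fs.scale_eq_0_iff)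
    qed
  qed
  moreover obtain k where "0 \<le> k" "x \<in> D.filt k" using D.cyc_filt[OF assms(1)] by blast
  ultimately show ?thesis using assms(2) by (metis nonneg_int_cases)
qed

text \<open>The projection of \<open>D.cyc\<close> is an invariant subspace containing
  \<open>v2\<close>, hence all of the irreducible \<open>V2\<close>.\<close>

lemma graph_total:
  assumes "x2 \<in> V2" obtains x where "x \<in> D.cyc" "lft x = x2"
proof -
  have "L2.invariant (lft ` D.cyc)"
    unfolding L2.invariant_def
  proof (intro conjI allI impI)
    show "fs.subspace (lft ` D.cyc)"
    proof (rule fs.subspaceI)
      show "0 \<in> lft ` D.cyc"
        using fs.subspace_0[OF D.subspace_cyc] by (intro image_eqI[of _ _ 0]) simp_all
    next
      fix x y assume "x \<in> lft ` D.cyc" "y \<in> lft ` D.cyc"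
      then obtain f g where "f \<in> D.cyc" "g \<in> D.cyc" "x = lft f" "y = lft g" by blast
      then show "x + y \<in> lft ` D.cyc"
        using fs.subspace_add[OF D.subspace_cyc] by (intro image_eqI[of _ _ "f + g"]) simp_all
    next
      fix a x assume "x \<in> lft ` D.cyc"
      then obtain f where "f \<in> D.cyc" "x = lft f" by blast
      then show "sc a x \<in> lft ` D.cyc"
        using fs.subspace_scale[OF D.subspace_cyc] by (intro image_eqI[of _ _ "sc a f"]) simp_all
    qed
    show "lft ` D.cyc \<subseteq> V2" using D.cyc_V by (auto simp: VD_def)
    fix i j x assume ij: "e i j" and "x \<in> lft ` D.cyc"
    then obtain f where f: "f \<in> D.cyc" "x = lft f" by blast
    have "\<rho>D i j f \<in> D.cyc" using D.cyc_invariant ij f(1) unfolding D.invariant_def by blast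
    then show "\<rho>2 i j x \<in> lft ` D.cyc"
      using f(2) by (intro image_eqI[of _ _ "\<rho>D i j f"]) simp_all
  qed
  then have "lft ` D.cyc = {0} \<or> lft ` D.cyc = V2" by (rule irred2)
  moreover have "v2 \<in> lft ` D.cyc" using D.v0_cyc by (intro image_eqI[of _ _ "pr v2 sv"]) simp_all
  ultimately have "lft ` D.cyc = V2" using L2.v0_nz by blast
  then show thesis using assms that by blast
qed

text \<open>By \<open>graph_zero\<close> all preimages of \<open>x2\<close> in \<open>D.cyc\<close>
  have the same right part, so the choice is immaterial.\<close>

definition \<theta> :: "('d \<Rightarrow> complex) \<Rightarrow> (int \<times> int) set \<times> 'a \<Rightarrow> complex" where
  "\<theta> x2 = rgt (SOME x. x \<in> D.cyc \<and> lft x = x2)"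

lemma \<theta>_lft: "x \<in> D.cyc \<Longrightarrow> \<theta> (lft x) = rgt x"
proof -
  assume x: "x \<in> D.cyc"
  define y where "y = (SOME y. y \<in> D.cyc \<and> lft y = lft x)"
  have y: "y \<in> D.cyc \<and> lft y = lft x" unfolding y_def by (rule someI[of _ x]) (use x in simp)
  then have "rgt (y - x) = 0" using x by (intro graph_zero fs.subspace_diff[OF D.subspace_cyc]) auto
  then show ?thesis by (simp add: \<theta>_def y_def[symmetric])
qed

lemma \<theta>_v2: "\<theta> v2 = sv"
  using \<theta>_lft[OF D.v0_cyc] by simp

lemma \<theta>_mem: "x \<in> V2 \<Longrightarrow> \<theta> x \<in> W"
  using graph_total \<theta>_lft D_cyc_W1 W1_W by metis

lemma \<theta>_add: "x \<in> V2 \<Longrightarrow> y \<in> V2 \<Longrightarrow> \<theta> (x + y) = \<theta> x + \<theta> y"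
proof -
  assume "x \<in> V2" "y \<in> V2"
  then obtain f g where f: "f \<in> D.cyc" "lft f = x" and g: "g \<in> D.cyc" "lft g = y"
    using graph_total by metis
  then show ?thesis
    using \<theta>_lft[OF f(1)] \<theta>_lft[OF g(1)] \<theta>_lft[OF fs.subspace_add[OF D.subspace_cyc f(1) g(1)]] by simp
qed

lemma \<theta>_scale: "x \<in> V2 \<Longrightarrow> \<theta> (sc a x) = sc a (\<theta> x)"
proof -
  assume "x \<in> V2"
  then obtain f where f: "f \<in> D.cyc" "lft f = x" using graph_total by metis
  then show ?thesis
    using \<theta>_lft[OF f(1)] \<theta>_lft[OF fs.subspace_scale[OF D.subspace_cyc f(1)], of a] by simp
qed

lemma \<theta>_even: "e i j \<Longrightarrow> x \<in> V2 \<Longrightarrow> \<theta> (\<rho>2 i j x) = E i j (\<theta> x)"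
proof -
  assume ij: "e i j" and "x \<in> V2"
  then obtain f where f: "f \<in> D.cyc" "lft f = x" using graph_total by metis
  have "\<rho>D i j f \<in> D.cyc" using D.cyc_invariant ij f(1) by (simp add: D.invariant_def)
  then show ?thesis using \<theta>_lft[OF f(1)] \<theta>_lft[of "\<rho>D i j f"] f by simp
qed

text \<open>Odd raising units kill \<open>sv\<close>, and commuting one past an even unit yields odd
  raising units again; hence they kill the whole g_0-module generated by \<open>sv\<close>.\<close>

lemma \<theta>_upper:
  assumes ip: "i \<in> Ng" "p \<in> Ps" and x: "x \<in> V2"
  shows "E i p (\<theta> x) = 0"
proof -
  have l: "\<forall>i\<in>Ng. \<forall>p\<in>Ps. E i p (rgt y) = 0" if "D.lw k y" for k y
    using that
  proof (induction rule: D.lw.induct)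
    case base
    show ?case
    proof (intro ballI)
      fix i p assume "i \<in> Ng" "p \<in> Ps"
      then show "E i p (rgt (pr v2 sv)) = 0"
        using sv_raise[of i p] Ng_idx[of i] Ps_idx[of p] PsD[of p] NgD[of i] by simp
    qed
  next
    case (step k y a b)
    show ?case
    proof (intro ballI)
      fix i p assume ip: "i \<in> Ng" "p \<in> Ps"
      have W: "rgt y \<in> W" using D.lw_V[OF step(1)] by (simp add: VD_def)
      have z: "(if p = a then E i b (rgt y) else 0) = 0" "(if b = i then E a p (rgt y) else 0) = 0"
        using step(2,4) ip Ps_Ng by (auto simp: e_iff)
      have "E i p (E a b (rgt y)) = E a b (E i p (rgt y)) + (if p = a then E i b (rgt y) else 0) -
          (if b = i then E a p (rgt y) else 0)"
        by (rule upper_even[OF W ip step(2)])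
      moreover have "E i p (rgt y) = 0" using step(4) ip by blast
      ultimately show "E i p (rgt (\<rho>D a b y)) = 0"
        unfolding z using lin_zero[OF lin_even[OF step(2)]] by simp
    qed
  qed
  obtain f where f: "f \<in> D.cyc" "lft f = x" using graph_total[OF x] by blast
  have "lin (\<lambda>f. E i p (rgt f))" by (rule lin_comp[OF lin_upper[OF ip] lin_rgt])
  then have "E i p (rgt f) \<in> {0}"
    by (rule D.image_span[OF _ f(1)[unfolded D.cyc_def]]) (use l ip in auto)
  then show ?thesis using \<theta>_lft[OF f(1)] f(2) by simp
qed

end

section \<open>The isomorphism of the Kac module with the Fock space\<close>

lemma left_module_restrict:
  assumes "ring S" "left_module R M" "\<psi> \<in> ring_hom S R"
  shows "left_module S (restrict_scalars \<psi> M)"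
proof -
  interpret S: ring S by fact
  interpret M: left_module R M by fact
  have \<psi>: "\<psi> x \<in> carrier R" if "x \<in> carrier S" for x using ring_hom_closed[OF assms(3) that] .
  show ?thesis
  proof (intro left_module.intro left_module_axioms.intro S.ring_axioms)
    show "abelian_group (restrict_scalars \<psi> M)"
    proof (rule abelian_groupI)
      fix x assume "x \<in> carrier (restrict_scalars \<psi> M)"
      then show "\<exists>y\<in>carrier (restrict_scalars \<psi> M). y \<oplus>\<^bsub>restrict_scalars \<psi> M\<^esub> x = \<zero>\<^bsub>restrict_scalars \<psi> M\<^esub>"
        by (intro bexI[of _ "\<ominus>\<^bsub>M\<^esub> x"]) (simp_all add: restrict_scalars_def M.M.l_neg)
    qed (simp_all add: restrict_scalars_def M.M.a_ac)
  qed (auto simp: restrict_scalars_def \<psi> M.smult_closed M.smult_l_distr M.smult_r_distr M.smult_assoc M.smult_one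
      ring_hom_add[OF assms(3)] ring_hom_mult[OF assms(3)] ring_hom_one[OF assms(3)])
qed

lemma (in left_module) finsum_smult:
  assumes "finite A" "\<And>a. a \<in> A \<Longrightarrow> u a \<in> carrier R" "x \<in> carrier M"
  shows "(\<Oplus>\<^bsub>R\<^esub>a\<in>A. u a) \<odot>\<^bsub>M\<^esub> x = (\<Oplus>\<^bsub>M\<^esub>a\<in>A. u a \<odot>\<^bsub>M\<^esub> x)"
  using assms(1,2)
proof (induction A rule: finite_induct)
  case empty
  then show ?case using assms(3) by (simp add: smult_l_null)
next
  case (insert a A)
  have "(\<Oplus>\<^bsub>R\<^esub>a\<in>insert a A. u a) = u a \<oplus>\<^bsub>R\<^esub> (\<Oplus>\<^bsub>R\<^esub>a\<in>A. u a)"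
    using insert by (intro R.finsum_insert) auto
  moreover have "(\<Oplus>\<^bsub>M\<^esub>a\<in>insert a A. u a \<odot>\<^bsub>M\<^esub> x) = u a \<odot>\<^bsub>M\<^esub> x \<oplus>\<^bsub>M\<^esub> (\<Oplus>\<^bsub>M\<^esub>a\<in>A. u a \<odot>\<^bsub>M\<^esub> x)"
    using insert assms(3) by (intro M.finsum_insert) (auto simp: smult_closed)
  moreover have "(\<Oplus>\<^bsub>R\<^esub>a\<in>A. u a) \<in> carrier R" using insert by (intro R.finsum_closed) auto
  ultimately show ?case using insert assms(3) by (simp add: smult_l_distr)
qed

section \<open>Homomorphisms out of the Kac module\<close>

context L0_module
begin

interpretation Gl: lie_subspace m n "gl m n" by (rule lie_gl)
interpretation Pa: lie_subspace m n "parabolic m n" by (rule lie_parabolic)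
interpretation inc: lie_map m n "parabolic m n" "gl m n" id by (rule lie_map_incl)
interpretation evp: lie_map m n "parabolic m n" "g_zero m n" even_part by (rule lie_map_even)

abbreviation "Li \<equiv> inflate m n L"

lemma Li_simps [simp]:
  "carrier Li = carrier L" "x \<oplus>\<^bsub>Li\<^esub> y = x \<oplus>\<^bsub>L\<^esub> y" "\<zero>\<^bsub>Li\<^esub> = \<zero>\<^bsub>L\<^esub>"
  "u \<odot>\<^bsub>Li\<^esub> x = UEA_map m n (g_zero m n) even_part u \<odot>\<^bsub>L\<^esub> x"
  by (simp_all add: inflate_def restrict_scalars_def)

lemma left_module_Li: "left_module (UEA m n (parabolic m n)) Li"
  unfolding inflate_def
  by (rule left_module_restrict[OF Pa.ring_U left_module_axioms evp.map_ring_hom])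

sublocale SE: scalar_extension "UEA m n (gl m n)" "UEA m n (parabolic m n)" "UEA_map m n (gl m n) id" Li
  by (intro scalar_extension.intro scalar_extension_axioms.intro Gl.ring_U Pa.ring_U left_module_Li inc.map_ring_hom)

sublocale Fk: fock m n V \<rho>
  by (rule fock.intro) (rule rep.g0_rep_axioms)

abbreviation "Kac \<equiv> kac m n L"
abbreviation "vt x \<equiv> kac_vector m n L x"

lemma Kac_eq: "Kac = SE.K"
  by (simp add: kac_def)

lemma vt_eq: "vt x = SE.tensor \<one>\<^bsub>Gl.U\<^esub> x"
  by (simp add: kac_vector_def)

lemma left_module_Kac: "left_module Gl.U Kac"
  unfolding Kac_eq by (rule SE.left_module_K)

interpretation K: left_module "UEA m n (gl m n)" Kac
  by (rule left_module_Kac)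

lemma vt_closed: "x \<in> carrier L \<Longrightarrow> vt x \<in> carrier Kac"
  unfolding Kac_eq vt_eq by (rule SE.tensor_closed) simp_all

lemma vt_add: "x \<in> carrier L \<Longrightarrow> y \<in> carrier L \<Longrightarrow> vt (x \<oplus>\<^bsub>L\<^esub> y) = vt x \<oplus>\<^bsub>Kac\<^esub> vt y"
  unfolding Kac_eq vt_eq using SE.tensor_add_right[of "\<one>\<^bsub>Gl.U\<^esub>" x y] by simp

lemma vt_parabolic:
  assumes "y \<in> carrier Pa.U" "x \<in> carrier L"
  shows "UEA_map m n (gl m n) id y \<odot>\<^bsub>Kac\<^esub> vt x = vt (UEA_map m n (g_zero m n) even_part y \<odot>\<^bsub>L\<^esub> x)"
proof -
  have y: "UEA_map m n (gl m n) id y \<in> carrier Gl.U" using SE.\<phi>_closed assms(1) .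
  show ?thesis
    using SE.tensor_balanced[of "\<one>\<^bsub>Gl.U\<^esub>" y x] SE.tensor_smult[OF y, of "\<one>\<^bsub>Gl.U\<^esub>" x] y assms
    unfolding Kac_eq vt_eq by simp
qed

lemma vt_gen: "y \<in> parabolic m n \<Longrightarrow> x \<in> carrier L \<Longrightarrow> Gl.gen y \<odot>\<^bsub>Kac\<^esub> vt x = vt (A.gen (even_part y) \<odot>\<^bsub>L\<^esub> x)"
  using vt_parabolic[OF Pa.gen_closed] by (simp add: inc.map_gen evp.map_gen)

lemma vt_cst: "x \<in> carrier L \<Longrightarrow> Gl.cst c \<odot>\<^bsub>Kac\<^esub> vt x = vt (A.cst c \<odot>\<^bsub>L\<^esub> x)"
  using vt_parabolic[OF Pa.cst_closed] by (simp add: inc.map_cst evp.map_cst)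

text \<open>This is Frobenius reciprocity in coordinates: a linear g_0-map whose image is killed by
  g_1 is equivariant for the parabolic subalgebra and extends by the universal property.\<close>

lemma Kac_hom:
  fixes W2 :: "('w \<Rightarrow> complex) set"
  assumes G: "gl_rep m n W2 E2" and \<tau>: "\<And>x. x \<in> V \<Longrightarrow> \<tau> x \<in> W2"
    and \<tau>_add: "\<And>x y. x \<in> V \<Longrightarrow> y \<in> V \<Longrightarrow> \<tau> (x + y) = \<tau> x + \<tau> y"
    and scale: "\<And>x a. x \<in> V \<Longrightarrow> \<tau> (sc a x) = sc a (\<tau> x)"
    and even: "\<And>i j x. ev m n i j \<Longrightarrow> x \<in> V \<Longrightarrow> \<tau> (\<rho> i j x) = E2 i j (\<tau> x)"
    and upper: "\<And>i p x. i \<in> Fk.Ng \<Longrightarrow> p \<in> Fk.Ps \<Longrightarrow> x \<in> V \<Longrightarrow> E2 i p (\<tau> x) = 0"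
  obtains f where "module_hom Gl.U Kac (op_rep.rep_module W2 (unit_op m n E2)) f"
    "\<And>x. x \<in> carrier L \<Longrightarrow> f (vt x) = \<tau> (co x)"
proof -
  interpret G: gl_rep m n W2 E2 by (rule G)
  interpret N: left_module Gl.U G.rep_module by (rule G.left_module_rep)
  have \<tau>_sum: "\<tau> (\<Sum>a\<in>A. g a) = (\<Sum>a\<in>A. \<tau> (g a))" if "finite A" "\<And>a. a \<in> A \<Longrightarrow> g a \<in> V" for A :: "int set" and g
    using that
  proof (induction A rule: finite_induct)
    case empty
    have "\<tau> 0 = 0" using scale[OF fs.subspace_0[OF subspace_V], of 0] by simp
    then have "\<tau> (\<Sum>a\<in>{}. g a) = (\<Sum>a\<in>{}. \<tau> (g a))" by simp
    then show ?case .
  next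
    case (insert a A)
    have "(\<Sum>a\<in>A. g a) \<in> V" using insert by (intro fs.subspace_sum[OF subspace_V]) auto
    then have "\<tau> (\<Sum>a\<in>insert a A. g a) = (\<Sum>a\<in>insert a A. \<tau> (g a))"
      using insert \<tau>_add[of "g a" "\<Sum>a\<in>A. g a"] by simp
    then show ?case .
  qed
  have gen: "\<tau> (co (A.gen (even_part y) \<odot>\<^bsub>L\<^esub> x)) = unit_op m n E2 y (\<tau> (co x))"
    if y: "y \<in> parabolic m n" and x: "x \<in> carrier L" for x y
  proof -
    note cx = co_V[OF x]
    have t: "sc (even_part y i j) (\<rho> i j (co x)) \<in> V" if "i \<in> idx m n" "j \<in> idx m n" for i j
    proof (cases "ev m n i j")
      case True
      then show ?thesis by (intro fs.subspace_scale[OF subspace_V] rep.\<rho>_mem cx)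
    next
      case False
      then have "even_part y i j = 0" using that by (auto simp: even_part_def ev_def)
      then show ?thesis using fs.subspace_0[OF subspace_V] by simp
    qed
    have u: "\<tau> (sc (even_part y i j) (\<rho> i j (co x))) = sc (y i j) (E2 i j (\<tau> (co x)))"
      if ij: "i \<in> idx m n" "j \<in> idx m n" for i j
    proof (cases "ev m n i j")
      case True
      then have "even_part y i j = y i j" by (auto simp: even_part_def ev_def)
      then show ?thesis using True by (simp add: scale rep.\<rho>_mem cx even)
    next
      case False
      then have ep: "even_part y i j = 0" using ij by (auto simp: even_part_def ev_def)
      have \<tau>0: "\<tau> 0 = 0" using scale[OF cx, of 0] by simp
      have "i \<in> Fk.Ps \<and> j \<in> Fk.Ng \<or> i \<in> Fk.Ng \<and> j \<in> Fk.Ps"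
        using ij False by (auto simp: Fk.idx_cases Fk.e_iff)
      then show ?thesis
      proof (elim disjE conjE)
        assume "i \<in> Fk.Ps" "j \<in> Fk.Ng"
        then have "y i j = 0" using y Fk.PsD Fk.NgD by (auto simp: parabolic_iff)
        then show ?thesis by (simp add: ep \<tau>0)
      next
        assume *: "i \<in> Fk.Ng" "j \<in> Fk.Ps"
        show ?thesis using upper[OF * cx] by (simp add: ep \<tau>0)
      qed
    qed
    have ey: "even_part y \<in> g_zero m n" using y even_part_g_zero parabolic_subset_gl by blast
    have "\<tau> (co (A.gen (even_part y) \<odot>\<^bsub>L\<^esub> x)) =
        (\<Sum>i\<in>idx m n. \<tau> (\<Sum>j\<in>idx m n. sc (even_part y i j) (\<rho> i j (co x))))"
      unfolding co_gen[OF ey x] using t by (intro \<tau>_sum fs.subspace_sum[OF subspace_V]) auto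
    also have "\<dots> = (\<Sum>i\<in>idx m n. \<Sum>j\<in>idx m n. \<tau> (sc (even_part y i j) (\<rho> i j (co x))))"
      using t by (intro sum.cong[OF refl] \<tau>_sum) auto
    also have "\<dots> = unit_op m n E2 y (\<tau> (co x))"
      unfolding unit_op_def using u by (intro sum.cong[OF refl]) auto
    finally show ?thesis .
  qed
  define \<iota> where "\<iota> = UEA_map m n (gl m n) id"
  define \<kappa> where "\<kappa> = UEA_map m n (g_zero m n) even_part"
  have \<iota>: "\<And>y. y \<in> parabolic m n \<Longrightarrow> \<iota> (Pa.gen y) = Gl.gen y" "\<And>c. \<iota> (Pa.cst c) = Gl.cst c"
    "\<iota> \<in> ring_hom Pa.U Gl.U"
    unfolding \<iota>_def by (simp_all add: inc.map_gen inc.map_cst inc.map_ring_hom)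
  have \<kappa>: "\<And>y. y \<in> parabolic m n \<Longrightarrow> \<kappa> (Pa.gen y) = A.gen (even_part y)" "\<And>c. \<kappa> (Pa.cst c) = A.cst c"
    "\<kappa> \<in> ring_hom Pa.U A.U"
    unfolding \<kappa>_def by (simp_all add: evp.map_gen evp.map_cst evp.map_ring_hom)
  \<comment> \<open>Equivariance is known for the elements of the parabolic subalgebra; this carries
    it to products and sums, as required by balancedness.\<close>
  have bal: "\<tau> (co (\<kappa> y \<odot>\<^bsub>L\<^esub> x)) = G.act (\<iota> y) (\<tau> (co x))"
    if "y \<in> carrier Pa.U" "x \<in> carrier L" for x y
    using that
  proof (induction y arbitrary: x rule: Pa.U_induct)
    case (cst c)
    then show ?case by (simp add: \<iota>(2) \<kappa>(2) co_scale scale co_V G.act_cst \<tau>)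
  next
    case (gen y)
    then have "y \<in> gl m n" using parabolic_subset_gl by blast
    with gen show ?case
      by (simp add: \<iota>(1) \<kappa>(1) G.act_gen \<tau> co_V \<open>\<And>y x. y \<in> parabolic m n \<Longrightarrow> x \<in> carrier L \<Longrightarrow>
        \<tau> (co (A.gen (even_part y) \<odot>\<^bsub>L\<^esub> x)) = unit_op m n E2 y (\<tau> (co x))\<close>)
  next
    case (add u w)
    have c: "\<kappa> u \<in> carrier A.U" "\<kappa> w \<in> carrier A.U"
      "\<iota> u \<in> carrier Gl.U" "\<iota> w \<in> carrier Gl.U"
      using add ring_hom_closed[OF \<kappa>(3)] ring_hom_closed[OF \<iota>(3)] by auto
    have "G.act (\<iota> u \<oplus>\<^bsub>Gl.U\<^esub> \<iota> w) (\<tau> (co x)) =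
        G.act (\<iota> u) (\<tau> (co x)) + G.act (\<iota> w) (\<tau> (co x))"
      using N.smult_l_distr[OF c(3,4), of "\<tau> (co x)"] \<tau> co_V add(5) by simp
    moreover have "\<tau> (co ((\<kappa> u \<oplus>\<^bsub>A.U\<^esub> \<kappa> w) \<odot>\<^bsub>L\<^esub> x)) = \<tau> (co (\<kappa> u \<odot>\<^bsub>L\<^esub> x)) + \<tau> (co (\<kappa> w \<odot>\<^bsub>L\<^esub> x))"
      unfolding smult_l_distr[OF c(1,2) add(5)]
      using add(5) c by (subst co_add) (auto intro!: \<tau>_add smult_closed co_V)
    ultimately show ?case
      unfolding ring_hom_add[OF \<kappa>(3) add(1,2)] ring_hom_add[OF \<iota>(3) add(1,2)] add(3)[OF add(5)] add(4)[OF add(5)]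
      by (rule trans[rotated, OF sym])
  next
    case (mult u w)
    have c: "\<kappa> u \<in> carrier A.U" "\<kappa> w \<in> carrier A.U"
      "\<iota> u \<in> carrier Gl.U" "\<iota> w \<in> carrier Gl.U"
      using mult ring_hom_closed[OF \<kappa>(3)] ring_hom_closed[OF \<iota>(3)] by auto
    have "G.act (\<iota> u \<otimes>\<^bsub>Gl.U\<^esub> \<iota> w) (\<tau> (co x)) =
        G.act (\<iota> u) (G.act (\<iota> w) (\<tau> (co x)))"
      using N.smult_assoc[OF c(3,4), of "\<tau> (co x)"] \<tau> co_V mult(5) by simp
    then show ?case
      unfolding ring_hom_mult[OF \<kappa>(3) mult(1,2)] ring_hom_mult[OF \<iota>(3) mult(1,2)]
      using mult c by (simp add: smult_assoc smult_closed)
  qed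
  obtain f where f: "module_hom Gl.U SE.K G.rep_module f"
    "\<And>u x. u \<in> carrier Gl.U \<Longrightarrow> x \<in> carrier Li \<Longrightarrow> f (SE.tensor u x) = u \<odot>\<^bsub>G.rep_module\<^esub> \<tau> (co x)"
  proof (rule SE.universal[OF G.left_module_rep, of "\<lambda>x. \<tau> (co x)"])
    show "(\<lambda>x. \<tau> (co x)) \<in> carrier Li \<rightarrow> carrier G.rep_module" using \<tau> co_V by auto
  qed (use bal[unfolded \<iota>_def \<kappa>_def] in \<open>auto simp: co_add \<tau>_add co_V\<close>)
  have "f (vt x) = \<tau> (co x)" if "x \<in> carrier L" for x
    using f(2)[of "\<one>\<^bsub>Gl.U\<^esub>" x] that N.smult_one[of "\<tau> (co x)"] \<tau> co_V by (simp add: vt_eq)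
  then show thesis using that f(1) unfolding Kac_eq by blast
qed

text \<open>The vectors of \<open>L\<close> on which both homomorphisms agree form a submodule
  containing \<open>v\<close>. Irreducibility makes it all of \<open>L\<close>, and the vectors
  \<open>vt x\<close> generate the Kac module.\<close>

lemma Kac_hom_vt_eqI:
  assumes N: "left_module Gl.U N" and f: "module_hom Gl.U Kac N f" and g: "module_hom Gl.U Kac N g"
    and v: "f (vt v) = g (vt v)" and k: "k \<in> carrier Kac"
  shows "f k = g k"
proof -
  interpret N: left_module Gl.U N by (rule N)
  let ?H = "{x \<in> carrier L. f (vt x) = g (vt x)}"
  have fg: "f (u \<odot>\<^bsub>Kac\<^esub> vt x) = u \<odot>\<^bsub>N\<^esub> f (vt x)" "g (u \<odot>\<^bsub>Kac\<^esub> vt x) = u \<odot>\<^bsub>N\<^esub> g (vt x)"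
    if "u \<in> carrier Gl.U" "x \<in> carrier L" for u x
    using module_homD(3)[OF f that(1) vt_closed[OF that(2)]] module_homD(3)[OF g that(1) vt_closed[OF that(2)]] by auto
  have cl: "u \<odot>\<^bsub>L\<^esub> x \<in> ?H" if "u \<in> carrier A.U" "x \<in> ?H" for u x
    using that
  proof (induction u arbitrary: x rule: A.U_induct)
    case (cst c)
    then show ?case
      using fg[OF Gl.cst_closed, of x c] by (simp add: vt_cst cst_closed')
  next
    case (gen y)
    have y: "y \<in> parabolic m n" "even_part y = y" "y \<in> gl m n"
      using gen(1) subsetD[OF g_zero_subset_parabolic] 
      by (auto simp: g_zero_iff even_part_def fun_eq_iff)
    then show ?case
      using gen fg[OF Gl.gen_closed, of y x] vt_gen[OF y(1), of x] by (simp add: gen_closed')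
  next
    case (add u w)
    have x: "u \<odot>\<^bsub>L\<^esub> x \<in> ?H" "w \<odot>\<^bsub>L\<^esub> x \<in> ?H" "x \<in> carrier L" using add by auto
    then have "f (vt (u \<odot>\<^bsub>L\<^esub> x \<oplus>\<^bsub>L\<^esub> w \<odot>\<^bsub>L\<^esub> x)) = g (vt (u \<odot>\<^bsub>L\<^esub> x \<oplus>\<^bsub>L\<^esub> w \<odot>\<^bsub>L\<^esub> x))"
      using module_homD(2)[OF f vt_closed vt_closed] module_homD(2)[OF g vt_closed vt_closed] by (simp add: vt_add)
    then show ?case using x add by (simp add: smult_l_distr)
  next
    case (mult u w)
    then show ?case by (simp add: smult_assoc)
  qed
  have "submodule ?H A.U L"
  proof (intro submodule.intro submodule_axioms.intro cl)
    show "subgroup ?H (add_monoid L)"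
    proof (rule group.subgroupI[OF M.a_group])
      show "?H \<noteq> {}" using v v_closed by blast
      fix a assume a: "a \<in> ?H"
      then have "A.cst (- 1) \<odot>\<^bsub>L\<^esub> a \<in> ?H" by (intro cl A.cst_closed)
      moreover have "\<ominus>\<^bsub>L\<^esub> a = A.cst (- 1) \<odot>\<^bsub>L\<^esub> a"
      proof (rule M.minus_equality)
        have "A.cst (- 1) \<odot>\<^bsub>L\<^esub> a \<oplus>\<^bsub>L\<^esub> a = A.cst (- 1) \<odot>\<^bsub>L\<^esub> a \<oplus>\<^bsub>L\<^esub> A.cst 1 \<odot>\<^bsub>L\<^esub> a"
          using a by (simp add: A.cst_one smult_one)
        also have "\<dots> = A.cst (- 1 + 1) \<odot>\<^bsub>L\<^esub> a"
          using a by (simp only: A.cst_add smult_l_distr A.cst_closed mem_Collect_eq)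
        finally show "A.cst (- 1) \<odot>\<^bsub>L\<^esub> a \<oplus>\<^bsub>L\<^esub> a = \<zero>\<^bsub>L\<^esub>" using a by (simp add: A.cst_zero smult_l_null)
      qed (use a cst_closed' in auto)
      ultimately show "inv\<^bsub>add_monoid L\<^esub> a \<in> ?H" by (simp add: a_inv_def)
    next
      fix a b assume "a \<in> ?H" "b \<in> ?H"
      then show "a \<otimes>\<^bsub>add_monoid L\<^esub> b \<in> ?H"
        using module_homD(2)[OF f vt_closed vt_closed] module_homD(2)[OF g vt_closed vt_closed] by (simp add: vt_add)
    qed auto
  qed
  then have "?H = {\<zero>\<^bsub>L\<^esub>} \<or> ?H = carrier L" using irr unfolding irreducible_module_def by blast
  moreover have "v \<in> ?H" "v \<noteq> \<zero>\<^bsub>L\<^esub>"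
    using v v_closed hwv by (auto simp: highest_weight_vector_def singular_def)
  ultimately have "?H = carrier L" by blast
  then have eq: "f (SE.tensor \<one>\<^bsub>Gl.U\<^esub> x) = g (SE.tensor \<one>\<^bsub>Gl.U\<^esub> x)" if "x \<in> carrier Li" for x
    using that unfolding vt_eq by auto
  show ?thesis
    by (rule SE.module_hom_eqI[OF N f[unfolded Kac_eq] g[unfolded Kac_eq] eq k[unfolded Kac_eq]])
qed

end

section \<open>The Kac module is spanned by lowering words\<close>

context L0_module
begin

interpretation K: left_module "UEA m n (gl m n)" Kac
  by (rule left_module_Kac)

abbreviation "lo a \<equiv> UEA_gen m n (gl m n) (mat_unit (fst a) (snd a))"

lemma P_idx: "a \<in> Fk.P \<Longrightarrow> fst a \<in> idx m n" "a \<in> Fk.P \<Longrightarrow> snd a \<in> idx m n"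
  by (auto simp: Fk.P_def Fk.idx_cases)

lemma X_closed: "a \<in> Fk.P \<Longrightarrow> lo a \<in> carrier Fk.U"
  by (intro Fk.gen_closed mat_unit_gl P_idx)

lemma X_Kac: "a \<in> Fk.P \<Longrightarrow> k \<in> carrier Kac \<Longrightarrow> lo a \<odot>\<^bsub>Kac\<^esub> k \<in> carrier Kac"
  by (intro K.smult_closed X_closed)

lemma zero_gl: "0 \<in> gl m n"
  by (simp add: gl_iff)

lemma gen_zero: "k \<in> carrier Kac \<Longrightarrow> Fk.gen 0 \<odot>\<^bsub>Kac\<^esub> k = \<zero>\<^bsub>Kac\<^esub>"
proof -
  assume k: "k \<in> carrier Kac"
  have "mat_scale 0 0 = (0 :: mat)" by (simp add: mat_scale_def fun_eq_iff)
  then have "Fk.gen 0 = \<zero>\<^bsub>Fk.U\<^esub> \<otimes>\<^bsub>Fk.U\<^esub> Fk.gen 0"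
    using Fk.gen_scale[OF zero_gl, of 0] by (simp add: Fk.cst_zero)
  then have "Fk.gen 0 = \<zero>\<^bsub>Fk.U\<^esub>"
    using Fk.gen_closed[OF zero_gl] SE.R.l_null by metis
  then show ?thesis using k by (simp add: K.smult_l_null)
qed

lemma cst_smult_comm:
  assumes "u \<in> carrier Fk.U" "k \<in> carrier Kac"
  shows "Fk.cst c \<odot>\<^bsub>Kac\<^esub> (u \<odot>\<^bsub>Kac\<^esub> k) = u \<odot>\<^bsub>Kac\<^esub> (Fk.cst c \<odot>\<^bsub>Kac\<^esub> k)"
  using assms Fk.cst_central[OF assms(1), of c] by (simp add: K.smult_assoc[symmetric] Fk.cst_closed)

lemma gen_unit_X:
  assumes i: "i \<in> idx m n" and j: "j \<in> idx m n" and a: "a \<in> Fk.P" and k: "k \<in> carrier Kac"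
  shows "Fk.gen (mat_unit i j) \<odot>\<^bsub>Kac\<^esub> (lo a \<odot>\<^bsub>Kac\<^esub> k) =
    Fk.cst (ssgn i j (fst a) (snd a)) \<odot>\<^bsub>Kac\<^esub> (lo a \<odot>\<^bsub>Kac\<^esub> (Fk.gen (mat_unit i j) \<odot>\<^bsub>Kac\<^esub> k)) \<oplus>\<^bsub>Kac\<^esub>
    Fk.gen ((if j = fst a then mat_unit i (snd a) else 0) +
      mat_scale (- ssgn i j (fst a) (snd a)) (if snd a = i then mat_unit (fst a) j else 0)) \<odot>\<^bsub>Kac\<^esub> k"
    (is "_ = _ \<oplus>\<^bsub>Kac\<^esub> Fk.gen ?D \<odot>\<^bsub>Kac\<^esub> k")
proof -
  let ?u = "mat_unit i j" and ?v = "mat_unit (fst a) (snd a)"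
  note g = mat_unit_gl[OF i j] mat_unit_gl[OF P_idx[OF a]]
  have D: "superbracket m n (parity i j) (parity (fst a) (snd a)) ?u ?v = ?D"
    using superbracket_unit[OF j P_idx(2)[OF a], of i "fst a"]
    by (simp add: mat_scale_def fun_eq_iff)
  have Dg: "?D \<in> gl m n"
    unfolding D[symmetric] using g by (rule superbracket_gl)
  have U: "Fk.gen ?u \<in> carrier Fk.U" "Fk.gen ?v \<in> carrier Fk.U" "Fk.gen ?D \<in> carrier Fk.U"
    by (intro Fk.gen_closed g Dg)+
  have "Fk.gen ?u \<otimes>\<^bsub>Fk.U\<^esub> Fk.gen ?v = Fk.cst (ssgn i j (fst a) (snd a)) \<otimes>\<^bsub>Fk.U\<^esub> (Fk.gen ?v \<otimes>\<^bsub>Fk.U\<^esub> Fk.gen ?u) \<oplus>\<^bsub>Fk.U\<^esub> Fk.gen ?D"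
    using Fk.gen_bracket[OF g homogeneous_mat_unit homogeneous_mat_unit] unfolding D ssgn_def .
  then have "(Fk.gen ?u \<otimes>\<^bsub>Fk.U\<^esub> Fk.gen ?v) \<odot>\<^bsub>Kac\<^esub> k =
      (Fk.cst (ssgn i j (fst a) (snd a)) \<otimes>\<^bsub>Fk.U\<^esub> (Fk.gen ?v \<otimes>\<^bsub>Fk.U\<^esub> Fk.gen ?u) \<oplus>\<^bsub>Fk.U\<^esub> Fk.gen ?D) \<odot>\<^bsub>Kac\<^esub> k"
    by simp
  then show ?thesis
    using U k by (simp add: K.smult_l_distr K.smult_assoc K.smult_closed SE.R.m_closed Fk.cst_closed)
qed

lemma X_X:
  assumes "a \<in> Fk.P" "b \<in> Fk.P" "k \<in> carrier Kac"
  shows "lo a \<odot>\<^bsub>Kac\<^esub> (lo b \<odot>\<^bsub>Kac\<^esub> k) = Fk.cst (- 1) \<odot>\<^bsub>Kac\<^esub> (lo b \<odot>\<^bsub>Kac\<^esub> (lo a \<odot>\<^bsub>Kac\<^esub> k))"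
proof -
  have s: "snd a \<noteq> fst b" "snd b \<noteq> fst a" "ssgn (fst a) (snd a) (fst b) (snd b) = - 1"
    using assms(1,2) Fk.PsD Fk.NgD by (fastforce simp: Fk.P_def ssgn_def parity_def)+
  have "mat_scale c 0 = (0 :: mat)" for c by (simp add: mat_scale_def fun_eq_iff)
  then show ?thesis
    using gen_unit_X[OF P_idx[OF assms(1)] assms(2,3)] s assms gen_zero[OF assms(3)]
    by (simp add: K.smult_closed X_closed Fk.cst_closed)
qed

text \<open>The anticommutation relation at equal units says that twice the vector is zero, and 1/2
  is a scalar.\<close>

lemma X_X_same:
  assumes "a \<in> Fk.P" "k \<in> carrier Kac"
  shows "lo a \<odot>\<^bsub>Kac\<^esub> (lo a \<odot>\<^bsub>Kac\<^esub> k) = \<zero>\<^bsub>Kac\<^esub>"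
proof -
  let ?z = "lo a \<odot>\<^bsub>Kac\<^esub> (lo a \<odot>\<^bsub>Kac\<^esub> k)"
  have z: "?z \<in> carrier Kac" using assms by (simp add: X_Kac)
  have "?z \<oplus>\<^bsub>Kac\<^esub> ?z = Fk.cst 1 \<odot>\<^bsub>Kac\<^esub> ?z \<oplus>\<^bsub>Kac\<^esub> Fk.cst (- 1) \<odot>\<^bsub>Kac\<^esub> ?z"
    unfolding X_X[OF assms(1) assms, symmetric] Fk.cst_one K.smult_one[OF z] ..
  also have "\<dots> = Fk.cst (1 + - 1) \<odot>\<^bsub>Kac\<^esub> ?z"
    unfolding Fk.cst_add by (rule K.smult_l_distr[OF Fk.cst_closed Fk.cst_closed z, symmetric])
  also have "\<dots> = \<zero>\<^bsub>Kac\<^esub>" using z by (simp add: Fk.cst_zero K.smult_l_null)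
  finally have zz: "?z \<oplus>\<^bsub>Kac\<^esub> ?z = \<zero>\<^bsub>Kac\<^esub>" .
  have "?z = Fk.cst (1 / 2 + 1 / 2) \<odot>\<^bsub>Kac\<^esub> ?z" using z by (simp add: Fk.cst_one K.smult_one)
  also have "\<dots> = Fk.cst (1 / 2) \<odot>\<^bsub>Kac\<^esub> (?z \<oplus>\<^bsub>Kac\<^esub> ?z)"
    unfolding Fk.cst_add K.smult_r_distr[OF Fk.cst_closed z z] by (rule K.smult_l_distr[OF Fk.cst_closed Fk.cst_closed z])
  also have "\<dots> = \<zero>\<^bsub>Kac\<^esub>" unfolding zz by (rule K.smult_r_null[OF Fk.cst_closed])
  finally show ?thesis .
qed

lemma vt_zero: "vt \<zero>\<^bsub>L\<^esub> = \<zero>\<^bsub>Kac\<^esub>"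
  by (rule M.additive_map_zero[OF K.M.abelian_group_axioms]) (auto simp: vt_closed vt_add)

text \<open>The additive closure of the words in g_{-1} applied to the image of \<open>L\<close>. It
  turns out to be the whole Kac module, and its induction rule then reduces statements on the Kac
  module to creation steps.\<close>

inductive_set wd :: "((free_alg set \<times> 'a) \<Rightarrow>\<^sub>0 int) set set" where
  wd_vt: "x \<in> carrier L \<Longrightarrow> vt x \<in> wd"
| wd_add: "k \<in> wd \<Longrightarrow> l \<in> wd \<Longrightarrow> k \<oplus>\<^bsub>Kac\<^esub> l \<in> wd"
| wd_X: "a \<in> Fk.P \<Longrightarrow> k \<in> wd \<Longrightarrow> lo a \<odot>\<^bsub>Kac\<^esub> k \<in> wd"

lemma wd_Kac: "k \<in> wd \<Longrightarrow> k \<in> carrier Kac"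
  by (induction rule: wd.induct) (auto simp: vt_closed X_Kac)

lemma wd_zero: "\<zero>\<^bsub>Kac\<^esub> \<in> wd"
  using wd_vt[of "\<zero>\<^bsub>L\<^esub>"] by (simp add: vt_zero)

lemma wd_cst: "k \<in> wd \<Longrightarrow> Fk.cst c \<odot>\<^bsub>Kac\<^esub> k \<in> wd"
proof (induction rule: wd.induct)
  case (wd_vt x)
  then show ?case by (simp add: vt_cst cst_closed' wd.wd_vt)
next
  case (wd_add k l)
  then show ?case by (simp add: K.smult_r_distr Fk.cst_closed wd_Kac wd.wd_add)
next
  case (wd_X a k)
  then show ?case by (simp add: cst_smult_comm X_closed wd_Kac wd.wd_X)
qed

definition stable :: "mat \<Rightarrow> bool" where
  "stable y \<longleftrightarrow> y \<in> gl m n \<and> (\<forall>k\<in>wd. Fk.gen y \<odot>\<^bsub>Kac\<^esub> k \<in> wd)"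

lemma stable_zero: "stable 0"
  by (simp add: stable_def zero_gl gen_zero wd_Kac wd_zero)

lemma stable_add: "stable x \<Longrightarrow> stable y \<Longrightarrow> stable (x + y)"
  by (simp add: stable_def Fk.add_mem Fk.gen_add K.smult_l_distr Fk.gen_closed wd_Kac wd_add)

lemma stable_scale: "stable x \<Longrightarrow> stable (mat_scale c x)"
  by (simp add: stable_def Fk.scale_mem Fk.gen_scale K.smult_assoc Fk.gen_closed Fk.cst_closed wd_Kac wd_cst)

text \<open>The unit is moved past an odd lowering unit; the commutator consists of units whose
  stability is assumed. Lower units are stable by construction, commutators of even units with them
  are lower, and those of upper units are even, so the three classes follow in this order.\<close>

lemma stable_unitI:
  assumes ij: "i \<in> idx m n" "j \<in> idx m n" "\<not> (0 < i \<and> j < 0)"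
    and st: "\<And>r c. r \<in> Fk.Ps \<Longrightarrow> c \<in> Fk.Ng \<Longrightarrow> j = r \<Longrightarrow> stable (mat_unit i c)"
      "\<And>r c. r \<in> Fk.Ps \<Longrightarrow> c \<in> Fk.Ng \<Longrightarrow> c = i \<Longrightarrow> stable (mat_unit r j)"
  shows "stable (mat_unit i j)"
  unfolding stable_def
proof (intro conjI ballI)
  show g: "mat_unit i j \<in> gl m n" using ij by (simp add: mat_unit_gl)
  fix k assume "k \<in> wd"
  then show "Fk.gen (mat_unit i j) \<odot>\<^bsub>Kac\<^esub> k \<in> wd"
  proof (induction rule: wd.induct)
    case (wd_vt x)
    have p: "mat_unit i j \<in> parabolic m n" using ij by (rule mat_unit_parabolic)
    have "A.gen (even_part (mat_unit i j)) \<odot>\<^bsub>L\<^esub> x \<in> carrier L"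
      by (intro gen_closed' even_part_g_zero g wd_vt)
    then show ?case using wd_vt by (simp add: vt_gen[OF p] wd.wd_vt)
  next
    case (wd_add k l)
    then show ?case by (simp add: K.smult_r_distr Fk.gen_closed g wd_Kac wd.wd_add)
  next
    case (wd_X a k)
    have a: "fst a \<in> Fk.Ps" "snd a \<in> Fk.Ng" using wd_X by (auto simp: Fk.P_def)
    let ?D = "(if j = fst a then mat_unit i (snd a) else 0) +
      mat_scale (- ssgn i j (fst a) (snd a)) (if snd a = i then mat_unit (fst a) j else 0)"
    have "stable ?D"
      using st[OF a] by (intro stable_add stable_scale) (simp_all add: stable_zero)
    then have "Fk.gen ?D \<odot>\<^bsub>Kac\<^esub> k \<in> wd" using wd_X by (simp add: stable_def)
    then show ?case
      unfolding gen_unit_X[OF ij(1,2) wd_X(1) wd_Kac[OF wd_X(2)]]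
      using wd_X by (intro wd.wd_add wd_cst wd.wd_X)
  qed
qed

lemma stable_lower: "r \<in> Fk.Ps \<Longrightarrow> c \<in> Fk.Ng \<Longrightarrow> stable (mat_unit r c)"
  using wd_X[of "(r, c)"] by (auto simp: stable_def Fk.P_def Fk.idx_cases intro: mat_unit_gl)

lemma stable_even: "ev m n i j \<Longrightarrow> stable (mat_unit i j)"
  by (rule stable_unitI) (auto simp: Fk.e_iff Fk.idx_cases dest: Fk.PsD Fk.NgD Fk.Ps_Ng intro: stable_lower)

lemma stable_upper: "i \<in> Fk.Ng \<Longrightarrow> p \<in> Fk.Ps \<Longrightarrow> stable (mat_unit i p)"
  by (rule stable_unitI) (auto simp: Fk.e_iff Fk.idx_cases dest: Fk.PsD Fk.NgD Fk.Ps_Ng intro: stable_even)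

lemma stable_gl:
  assumes "y \<in> gl m n" shows "stable y"
proof -
  have u: "stable (mat_unit i j)" if "i \<in> idx m n" "j \<in> idx m n" for i j
    using that stable_lower stable_even stable_upper by (auto simp: Fk.idx_cases Fk.e_iff)
  have "stable (\<Sum>(i, j)\<in>A. mat_scale (y i j) (mat_unit i j))" if "finite A" "A \<subseteq> idx m n \<times> idx m n" for A
    using that
  proof (induction A rule: finite_induct)
    case empty
    have "stable (\<Sum>(i, j)\<in>{}. mat_scale (y i j) (mat_unit i j))" using stable_zero by simp
    then show ?case .
  next
    case (insert p A)
    obtain i j where p: "p = (i, j)" by (cases p)
    then have "stable (mat_scale (y i j) (mat_unit i j) + (\<Sum>(i, j)\<in>A. mat_scale (y i j) (mat_unit i j)))"
      using insert by (intro stable_add stable_scale u) auto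
    then have "stable (\<Sum>(i, j)\<in>insert p A. mat_scale (y i j) (mat_unit i j))"
      using insert p by simp
    then show ?case .
  qed
  from this[of "{(i, j) \<in> idx m n \<times> idx m n. y i j \<noteq> 0}"] show ?thesis
    using mat_expand[OF assms] finite_subset[of "{(i, j) \<in> idx m n \<times> idx m n. y i j \<noteq> 0}" "idx m n \<times> idx m n"]
    by fastforce
qed

lemma wd_eq: "wd = carrier Kac"
proof (intro equalityI subsetI wd_Kac)
  have U: "u \<odot>\<^bsub>Kac\<^esub> k \<in> wd" if "u \<in> carrier Fk.U" "k \<in> wd" for u k
    using that
  proof (induction u arbitrary: k rule: Fk.U_induct)
    case (gen x)
    then show ?case using stable_gl by (simp add: stable_def)
  qed (simp_all add: wd_cst K.smult_l_distr K.smult_assoc wd_Kac wd_add)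
  fix k assume "k \<in> carrier Kac"
  then show "k \<in> wd"
    unfolding Kac_eq
  proof (induction k rule: SE.K_induct)
    case zero
    then show ?case using wd_zero unfolding Kac_eq .
  next
    case (diff x y)
    have "Fk.cst (- 1) \<odot>\<^bsub>Kac\<^esub> y \<oplus>\<^bsub>Kac\<^esub> y = Fk.cst (- 1 + 1) \<odot>\<^bsub>Kac\<^esub> y"
      using diff(2) unfolding Fk.cst_add Kac_eq
      by (simp add: SE.K.smult_l_distr Fk.cst_closed Fk.cst_one SE.K.smult_one)
    then have "\<ominus>\<^bsub>Kac\<^esub> y = Fk.cst (- 1) \<odot>\<^bsub>Kac\<^esub> y"
      using diff(2) unfolding Kac_eq
      by (intro SE.K.M.minus_equality) (simp_all add: Fk.cst_zero SE.K.smult_l_null SE.K.smult_closed Fk.cst_closed)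
    then have "x \<ominus>\<^bsub>Kac\<^esub> y = x \<oplus>\<^bsub>Kac\<^esub> Fk.cst (- 1) \<odot>\<^bsub>Kac\<^esub> y" by (simp add: a_minus_def)
    then show ?case using wd_add[OF diff(3) wd_cst[OF diff(4)]] unfolding Kac_eq by simp
  next
    case (tensor u x)
    then show ?case using U[OF tensor(1) wd_vt, of x] unfolding vt_eq Kac_eq by simp
  qed
qed

section \<open>The mutually inverse maps between Kac module and Fock space\<close>

definition lower_word :: "(int \<times> int) list \<Rightarrow> ((free_alg set \<times> 'a) \<Rightarrow>\<^sub>0 int) set \<Rightarrow> ((free_alg set \<times> 'a) \<Rightarrow>\<^sub>0 int) set" where
  "lower_word as k = foldr (\<lambda>a k. lo a \<odot>\<^bsub>Kac\<^esub> k) as k"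

lemma lower_word_simps [simp]:
  "lower_word [] k = k" "lower_word (a # as) k = lo a \<odot>\<^bsub>Kac\<^esub> lower_word as k"
  by (simp_all add: lower_word_def)

lemma lower_word_closed: "set as \<subseteq> Fk.P \<Longrightarrow> k \<in> carrier Kac \<Longrightarrow> lower_word as k \<in> carrier Kac"
  by (induction as) (auto simp: X_Kac)

lemma lower_word_add: "set as \<subseteq> Fk.P \<Longrightarrow> k \<in> carrier Kac \<Longrightarrow> l \<in> carrier Kac \<Longrightarrow>
    lower_word as (k \<oplus>\<^bsub>Kac\<^esub> l) = lower_word as k \<oplus>\<^bsub>Kac\<^esub> lower_word as l"
  by (induction as) (auto simp: K.smult_r_distr X_closed lower_word_closed)

lemma lower_word_cst: "set as \<subseteq> Fk.P \<Longrightarrow> k \<in> carrier Kac \<Longrightarrow>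
    lower_word as (Fk.cst c \<odot>\<^bsub>Kac\<^esub> k) = Fk.cst c \<odot>\<^bsub>Kac\<^esub> lower_word as k"
  by (induction as) (auto simp: cst_smult_comm X_closed lower_word_closed)

lemma cst_cst: "k \<in> carrier Kac \<Longrightarrow> Fk.cst c \<odot>\<^bsub>Kac\<^esub> (Fk.cst d \<odot>\<^bsub>Kac\<^esub> k) = Fk.cst (c * d) \<odot>\<^bsub>Kac\<^esub> k"
  by (simp add: Fk.cst_mult K.smult_assoc Fk.cst_closed)

text \<open>The new letter moves right past each smaller letter at the cost of a sign and stops at
  its sorted place; meeting its own copy it gives zero. The sign is the one in the creation
  operator.\<close>

lemma lo_lower_word:
  assumes "sorted as" "set as \<subseteq> Fk.P" "a \<in> Fk.P" "k \<in> carrier Kac"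
  shows "lo a \<odot>\<^bsub>Kac\<^esub> lower_word as k = (if a \<in> set as then \<zero>\<^bsub>Kac\<^esub>
    else Fk.cst ((-1) ^ length (filter (\<lambda>b. b < a) as)) \<odot>\<^bsub>Kac\<^esub> lower_word (insort a as) k)"
  using assms(1,2)
proof (induction as)
  case Nil
  then show ?case using assms(3,4) by (simp add: Fk.cst_one K.smult_one X_Kac)
next
  case (Cons b as)
  have w: "lower_word as k \<in> carrier Kac" "lower_word (insort a as) k \<in> carrier Kac"
    using Cons.prems assms(3,4) by (auto intro!: lower_word_closed simp: set_insort_key)
  have b: "b \<in> Fk.P" using Cons.prems by simp
  consider "a < b" | "a = b" | "b < a" by (rule linorder_cases)
  then show ?case
  proof cases
    case 1
    then have n: "a \<notin> set (b # as)" and f: "filter (\<lambda>b. b < a) (b # as) = []"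
      using Cons.prems by (auto simp: filter_empty_conv)
    show ?thesis
      unfolding f using n less_imp_le[OF 1] w b assms(3) by (simp add: Fk.cst_one K.smult_one X_Kac)
  next
    case 2
    then show ?thesis using w b by (simp add: X_X_same)
  next
    case 3
    have IH: "lo a \<odot>\<^bsub>Kac\<^esub> lower_word as k = (if a \<in> set as then \<zero>\<^bsub>Kac\<^esub>
        else Fk.cst ((-1) ^ length (filter (\<lambda>b. b < a) as)) \<odot>\<^bsub>Kac\<^esub> lower_word (insort a as) k)"
      using Cons by simp
    have "lo a \<odot>\<^bsub>Kac\<^esub> lower_word (b # as) k = Fk.cst (- 1) \<odot>\<^bsub>Kac\<^esub> (lo b \<odot>\<^bsub>Kac\<^esub> (lo a \<odot>\<^bsub>Kac\<^esub> lower_word as k))"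
      using X_X[OF assms(3) b w(1)] by simp
    also have "lo a \<odot>\<^bsub>Kac\<^esub> lower_word as k = (if a \<in> set as then \<zero>\<^bsub>Kac\<^esub>
        else Fk.cst ((-1) ^ length (filter (\<lambda>b. b < a) as)) \<odot>\<^bsub>Kac\<^esub> lower_word (insort a as) k)"
      by (rule IH)
    finally have E: "lo a \<odot>\<^bsub>Kac\<^esub> lower_word (b # as) k = Fk.cst (- 1) \<odot>\<^bsub>Kac\<^esub> (lo b \<odot>\<^bsub>Kac\<^esub>
        (if a \<in> set as then \<zero>\<^bsub>Kac\<^esub>
         else Fk.cst ((-1) ^ length (filter (\<lambda>b. b < a) as)) \<odot>\<^bsub>Kac\<^esub> lower_word (insort a as) k))" .
    show ?thesis
    proof (cases "a \<in> set as")
      case True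
      then show ?thesis
        unfolding E by (simp add: K.smult_r_null[OF X_closed[OF b]] K.smult_r_null[OF Fk.cst_closed])
    next
      case False
      have "\<not> a \<le> b" "a \<noteq> b" using 3 by auto
      then show ?thesis
        unfolding E cst_smult_comm[OF X_closed[OF b] w(2), symmetric]
          cst_smult_comm[OF X_closed[OF b] w(2), symmetric]
        using False 3 by (simp add: cst_cst[OF X_Kac[OF b w(2)]] cst_smult_comm[OF X_closed[OF b] w(2), symmetric])
    qed
  qed
qed

text \<open>The inverse of the map into the Fock space: a monomial \<open>S\<close> with coefficient
  \<open>x\<close> goes to the sorted word \<open>S\<close> applied to the vector with coordinates
  \<open>x\<close>.\<close>

definition \<Theta> :: "((int \<times> int) set \<times> 'a \<Rightarrow> complex) \<Rightarrow> ((free_alg set \<times> 'a) \<Rightarrow>\<^sub>0 int) set" where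
  "\<Theta> f = (\<Oplus>\<^bsub>Kac\<^esub>S\<in>Pow Fk.P. lower_word (sorted_list_of_set S) (vt (dec (slice f S))))"

lemma set_P: "S \<subseteq> Fk.P \<Longrightarrow> set (sorted_list_of_set S) \<subseteq> Fk.P"
  using finite_subset[OF _ Fk.finite_P] by auto

lemma word_vt_closed: "S \<subseteq> Fk.P \<Longrightarrow> lower_word (sorted_list_of_set S) (vt (dec c)) \<in> carrier Kac"
  by (intro lower_word_closed set_P vt_closed dec_closed)

lemma \<Theta>_add: "\<Theta> (f + g) = \<Theta> f \<oplus>\<^bsub>Kac\<^esub> \<Theta> g"
proof -
  have "\<Theta> (f + g) = (\<Oplus>\<^bsub>Kac\<^esub>S\<in>Pow Fk.P. lower_word (sorted_list_of_set S) (vt (dec (slice f S))) \<oplus>\<^bsub>Kac\<^esub>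
      lower_word (sorted_list_of_set S) (vt (dec (slice g S))))"
    unfolding \<Theta>_def
  proof (rule K.M.finsum_cong'[OF refl])
    fix S assume "S \<in> Pow Fk.P"
    then have "set (sorted_list_of_set S) \<subseteq> Fk.P" by (intro set_P) simp
    then have "lower_word (sorted_list_of_set S) (vt (dec (slice f S + slice g S))) =
        lower_word (sorted_list_of_set S) (vt (dec (slice f S))) \<oplus>\<^bsub>Kac\<^esub>
        lower_word (sorted_list_of_set S) (vt (dec (slice g S)))"
      unfolding dec_add vt_add[OF dec_closed dec_closed]
      by (intro lower_word_add vt_closed dec_closed)
    then show "lower_word (sorted_list_of_set S) (vt (dec (slice (f + g) S))) =
        lower_word (sorted_list_of_set S) (vt (dec (slice f S))) \<oplus>\<^bsub>Kac\<^esub>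
        lower_word (sorted_list_of_set S) (vt (dec (slice g S)))"
      unfolding slice_simps .
  qed (auto intro!: word_vt_closed K.M.a_closed)
  also have "\<dots> = \<Theta> f \<oplus>\<^bsub>Kac\<^esub> \<Theta> g"
    unfolding \<Theta>_def by (rule K.M.finsum_addf) (auto intro: word_vt_closed)
  finally show ?thesis .
qed

lemma \<Theta>_vac: "\<Theta> (Fk.vac c) = vt (dec c)"
proof -
  have z: "lower_word as \<zero>\<^bsub>Kac\<^esub> = \<zero>\<^bsub>Kac\<^esub>" if "set as \<subseteq> Fk.P" for as
    using that by (induction as) (auto simp: K.smult_r_null X_closed)
  have "\<Theta> (Fk.vac c) = (\<Oplus>\<^bsub>Kac\<^esub>S\<in>{{} :: (int \<times> int) set}. vt (dec c))"
    unfolding \<Theta>_def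
  proof (rule K.M.finsum_mono_neutral_cong_right)
    fix S assume "S \<in> Pow Fk.P - {{}}"
    then show "lower_word (sorted_list_of_set S) (vt (dec (slice (Fk.vac c) S))) = \<zero>\<^bsub>Kac\<^esub>"
      using z[OF set_P, of S] by (simp add: Fk.slice_vac dec_zero vt_zero)
  qed (auto simp: Fk.slice_vac intro: word_vt_closed)
  then show ?thesis using vt_closed[OF dec_closed, of c] by simp
qed

lemma sg_length:
  assumes "S \<subseteq> Fk.P"
  shows "Fk.sg a S = (-1) ^ length (filter (\<lambda>b. b < a) (sorted_list_of_set S))"
proof -
  have "length (filter (\<lambda>b. b < a) (sorted_list_of_set S)) = card (set (filter (\<lambda>b. b < a) (sorted_list_of_set S)))"
    by (intro distinct_card[symmetric] distinct_filter distinct_sorted_list_of_set)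
  also have "set (filter (\<lambda>b. b < a) (sorted_list_of_set S)) = {b \<in> S \<inter> Fk.P. b < a}"
    using assms finite_subset[OF assms Fk.finite_P] by auto
  finally show ?thesis by (simp add: Fk.sg_def)
qed

text \<open>Terms whose set contains \<open>a\<close> are killed by \<open>lo a\<close>. On the
  others, inserting \<open>a\<close> is a bijection onto the sets containing \<open>a\<close>, which
  are the only ones where \<open>cre a f\<close> is nonzero.\<close>

lemma \<Theta>_cre:
  assumes a: "a \<in> Fk.P"
  shows "\<Theta> (Fk.cre a f) = lo a \<odot>\<^bsub>Kac\<^esub> \<Theta> f"
proof -
  let ?w = "\<lambda>S c. lower_word (sorted_list_of_set S) (vt (dec c))"
  let ?B = "{S \<in> Pow Fk.P. a \<notin> S}"
  have ins: "lo a \<odot>\<^bsub>Kac\<^esub> ?w S c = (if a \<in> S then \<zero>\<^bsub>Kac\<^esub> else Fk.cst (Fk.sg a S) \<odot>\<^bsub>Kac\<^esub> ?w (insert a S) c)"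
    if "S \<subseteq> Fk.P" for S c
  proof -
    have fin: "finite S" by (rule finite_subset[OF that Fk.finite_P])
    show ?thesis
      using lo_lower_word[OF sorted_sorted_list_of_set set_P[OF that] a vt_closed[OF dec_closed], of c]
        sorted_list_of_set_insert[OF fin, of a] fin
      by (auto simp: sg_length[OF that])
  qed
  have "lo a \<odot>\<^bsub>Kac\<^esub> \<Theta> f = (\<Oplus>\<^bsub>Kac\<^esub>S\<in>Pow Fk.P. lo a \<odot>\<^bsub>Kac\<^esub> ?w S (slice f S))"
    unfolding \<Theta>_def by (rule K.smult_finsum) (auto intro: X_closed a word_vt_closed)
  also have "\<dots> = (\<Oplus>\<^bsub>Kac\<^esub>S\<in>?B. Fk.cst (Fk.sg a S) \<odot>\<^bsub>Kac\<^esub> ?w (insert a S) (slice f S))"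
  proof (rule K.M.finsum_mono_neutral_cong_right)
    show "(\<lambda>S. lo a \<odot>\<^bsub>Kac\<^esub> ?w S (slice f S)) \<in> Pow Fk.P \<rightarrow> carrier Kac"
      by (auto intro!: X_Kac a word_vt_closed)
  qed (auto simp: ins)
  also have "\<dots> = (\<Oplus>\<^bsub>Kac\<^esub>S\<in>?B. ?w (insert a S) (slice (Fk.cre a f) (insert a S)))"
  proof (rule K.M.finsum_cong'[OF refl])
    show "(\<lambda>S. ?w (insert a S) (slice (Fk.cre a f) (insert a S))) \<in> ?B \<rightarrow> carrier Kac"
      using a by (auto intro!: word_vt_closed)
    fix S assume S: "S \<in> ?B"
    then have "insert a S - {a} = S" by blast
    then have "slice (Fk.cre a f) (insert a S) = sc (Fk.sg a S) (slice f S)"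
      by (simp add: Fk.slice_cre)
    then show "Fk.cst (Fk.sg a S) \<odot>\<^bsub>Kac\<^esub> ?w (insert a S) (slice f S) =
        ?w (insert a S) (slice (Fk.cre a f) (insert a S))"
      using S a
      by (simp add: dec_scale vt_cst[symmetric] dec_closed lower_word_cst set_P vt_closed)
  qed
  also have "\<dots> = (\<Oplus>\<^bsub>Kac\<^esub>S\<in>insert a ` ?B. ?w S (slice (Fk.cre a f) S))"
    using a by (intro K.M.finsum_reindex[symmetric]) (auto intro!: word_vt_closed inj_onI)
  also have "\<dots> = \<Theta> (Fk.cre a f)"
    unfolding \<Theta>_def
  proof (rule K.M.finsum_mono_neutral_cong_left)
    show "insert a ` ?B \<subseteq> Pow Fk.P" using a by auto
    fix S assume S: "S \<in> Pow Fk.P - insert a ` ?B"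
    have "a \<notin> S"
    proof
      assume "a \<in> S"
      then have "S = insert a (S - {a})" "S - {a} \<in> ?B" using S by auto
      then show False using S by blast
    qed
    moreover have "lower_word as \<zero>\<^bsub>Kac\<^esub> = \<zero>\<^bsub>Kac\<^esub>" if "set as \<subseteq> Fk.P" for as
      using that by (induction as) (auto simp: K.smult_r_null X_closed)
    ultimately show "?w S (slice (Fk.cre a f) S) = \<zero>\<^bsub>Kac\<^esub>"
      using S set_P[of S] by (simp add: Fk.slice_cre dec_zero vt_zero)
  qed (auto intro: word_vt_closed)
  finally show ?thesis ..
qed

definition \<Psi> :: "((free_alg set \<times> 'a) \<Rightarrow>\<^sub>0 int) set \<Rightarrow> (int \<times> int) set \<times> 'a \<Rightarrow> complex" where
  "\<Psi> = (SOME h. module_hom Fk.U Kac Fk.rep_module h \<and> (\<forall>x\<in>carrier L. h (vt x) = Fk.vac (co x)))"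

lemma \<Psi>: "module_hom Fk.U Kac Fk.rep_module \<Psi>" "x \<in> carrier L \<Longrightarrow> \<Psi> (vt x) = Fk.vac (co x)"
proof -
  obtain h where h: "module_hom Fk.U Kac Fk.rep_module h" "\<And>x. x \<in> carrier L \<Longrightarrow> h (vt x) = Fk.vac (co x)"
  proof (rule Kac_hom[OF Fk.gl_rep_axioms])
    show "Fk.vac (x + y) = Fk.vac x + Fk.vac y" for x y by (rule lin_add[OF Fk.lin_vac])
    show "Fk.vac (sc a x) = sc a (Fk.vac x)" for a x by (rule lin_sc[OF Fk.lin_vac])
  qed (auto simp: Fk.vac_W Fk.even_vac Fk.upper_vac)
  then have "\<exists>h. module_hom Fk.U Kac Fk.rep_module h \<and> (\<forall>x\<in>carrier L. h (vt x) = Fk.vac (co x))" by blast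
  then have "module_hom Fk.U Kac Fk.rep_module \<Psi> \<and> (\<forall>x\<in>carrier L. \<Psi> (vt x) = Fk.vac (co x))"
    unfolding \<Psi>_def by (rule someI_ex)
  then show "module_hom Fk.U Kac Fk.rep_module \<Psi>" "x \<in> carrier L \<Longrightarrow> \<Psi> (vt x) = Fk.vac (co x)" by auto
qed

lemma \<Psi>_W: "k \<in> carrier Kac \<Longrightarrow> \<Psi> k \<in> Fk.W"
  and \<Psi>_add: "k \<in> carrier Kac \<Longrightarrow> l \<in> carrier Kac \<Longrightarrow> \<Psi> (k \<oplus>\<^bsub>Kac\<^esub> l) = \<Psi> k + \<Psi> l"
  and \<Psi>_smult: "u \<in> carrier Fk.U \<Longrightarrow> k \<in> carrier Kac \<Longrightarrow> \<Psi> (u \<odot>\<^bsub>Kac\<^esub> k) = Fk.act u (\<Psi> k)"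
  using module_homD[OF \<Psi>(1)] by simp_all

lemma \<Psi>_unit:
  assumes "i \<in> idx m n" "j \<in> idx m n" "k \<in> carrier Kac"
  shows "\<Psi> (Fk.gen (mat_unit i j) \<odot>\<^bsub>Kac\<^esub> k) = Fk.E i j (\<Psi> k)"
  using assms by (simp add: \<Psi>_smult Fk.gen_closed mat_unit_gl Fk.act_gen \<Psi>_W Fk.op_unit)

lemma \<Psi>_cst: "k \<in> carrier Kac \<Longrightarrow> \<Psi> (Fk.cst c \<odot>\<^bsub>Kac\<^esub> k) = sc c (\<Psi> k)"
  by (simp add: \<Psi>_smult Fk.cst_closed Fk.act_cst \<Psi>_W)

lemma \<Psi>_lo: "a \<in> Fk.P \<Longrightarrow> k \<in> carrier Kac \<Longrightarrow> \<Psi> (lo a \<odot>\<^bsub>Kac\<^esub> k) = Fk.cre a (\<Psi> k)"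
  using \<Psi>_unit[OF P_idx, of a a k] Fk.E_lower[of "fst a" "snd a"] by (simp add: Fk.P_def mem_Times_iff)

text \<open>Both maps carry \<open>lo a\<close> to \<open>cre a\<close> and back, so the identity
  passes from \<open>vt x\<close> to all lowering words. This gives injectivity of
  \<open>\<Psi>\<close>.\<close>

lemma \<Theta>_\<Psi>: "k \<in> carrier Kac \<Longrightarrow> \<Theta> (\<Psi> k) = k"
  unfolding wd_eq[symmetric]
proof (induction rule: wd.induct)
  case (wd_vt x)
  then show ?case by (simp add: \<Psi>(2) \<Theta>_vac dec_co)
next
  case (wd_add k l)
  show ?case unfolding \<Psi>_add[OF wd_add(1,2)[unfolded wd_eq]] \<Theta>_add wd_add(3,4) ..
next
  case (wd_X a k)
  then show ?case by (simp add: \<Psi>_lo wd_Kac \<Theta>_cre)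
qed

lemma \<Psi>_surj: "f \<in> Fk.W \<Longrightarrow> \<exists>k\<in>carrier Kac. \<Psi> k = f"
proof (induction rule: Fk.W_induct)
  case (vac x)
  then show ?case by (intro bexI[of _ "vt (dec x)"]) (auto simp: \<Psi>(2) dec_closed co_dec vt_closed)
next
  case (cre r c f)
  then obtain k where "k \<in> carrier Kac" "\<Psi> k = f" by blast
  moreover have "(r, c) \<in> Fk.P" using cre by (simp add: Fk.P_def)
  ultimately show ?case using \<Psi>_lo X_Kac by (metis fst_conv snd_conv)
next
  case (add f g)
  then obtain k l where "k \<in> carrier Kac" "\<Psi> k = f" "l \<in> carrier Kac" "\<Psi> l = g" by blast
  then have "k \<oplus>\<^bsub>Kac\<^esub> l \<in> carrier Kac" "\<Psi> (k \<oplus>\<^bsub>Kac\<^esub> l) = f + g" by (simp_all add: \<Psi>_add)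
  then show ?case by metis
qed

lemma bij_\<Psi>: "bij_betw \<Psi> (carrier Kac) Fk.W"
  unfolding bij_betw_def
proof
  show "inj_on \<Psi> (carrier Kac)" by (rule inj_on_inverseI) (rule \<Theta>_\<Psi>)
  show "\<Psi> ` carrier Kac = Fk.W" using \<Psi>_W \<Psi>_surj by blast
qed

lemma \<Psi>_inj: "k \<in> carrier Kac \<Longrightarrow> l \<in> carrier Kac \<Longrightarrow> \<Psi> k = \<Psi> l \<Longrightarrow> k = l"
  using \<Theta>_\<Psi> by metis

lemma \<Psi>_zero: "\<Psi> \<zero>\<^bsub>Kac\<^esub> = 0"
  using module_hom_zero[OF \<Psi>(1) left_module_Kac Fk.left_module_rep] by simp

lemma \<Psi>_eq_0: "k \<in> carrier Kac \<Longrightarrow> \<Psi> k = 0 \<longleftrightarrow> k = \<zero>\<^bsub>Kac\<^esub>"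
  using \<Psi>_inj[of k "\<zero>\<^bsub>Kac\<^esub>"] by (auto simp: \<Psi>_zero)

section \<open>Singular vectors and weights seen in the Fock space\<close>

lemma raise_iff:
  assumes k: "k \<in> carrier Kac"
  shows "(\<forall>x\<in>n_plus m n. Fk.gen x \<odot>\<^bsub>Kac\<^esub> k = \<zero>\<^bsub>Kac\<^esub>) \<longleftrightarrow>
    (\<forall>i\<in>idx m n. \<forall>j\<in>idx m n. i < j \<longrightarrow> Fk.E i j (\<Psi> k) = 0)" (is "?l \<longleftrightarrow> ?r")
proof
  assume ?l
  then show ?r using \<Psi>_unit[OF _ _ k] mat_unit_n_plus \<Psi>_zero by metis
next
  assume r: ?r
  show ?l
  proof
    fix x assume x: "x \<in> n_plus m n"
    then have "\<Psi> (Fk.gen x \<odot>\<^bsub>Kac\<^esub> k) = unit_op m n Fk.E x (\<Psi> k)"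
      using k by (simp add: \<Psi>_smult Fk.gen_closed n_plus_gl Fk.act_gen \<Psi>_W)
    also have "\<dots> = 0" using r by (intro unit_op_upper[OF x]) blast
    finally show "Fk.gen x \<odot>\<^bsub>Kac\<^esub> k = \<zero>\<^bsub>Kac\<^esub>"
      using k x by (simp add: \<Psi>_eq_0 K.smult_closed Fk.gen_closed n_plus_gl)
  qed
qed

lemma singular_iff:
  "singular m n (gl m n) Kac k \<longleftrightarrow> k \<in> carrier Kac \<and> \<Psi> k \<noteq> 0 \<and>
    (\<forall>i\<in>idx m n. \<forall>j\<in>idx m n. i < j \<longrightarrow> Fk.E i j (\<Psi> k) = 0)"
proof -
  have "gl m n \<inter> n_plus m n = n_plus m n" using n_plus_gl by blast
  then show ?thesis
    unfolding singular_def using raise_iff[of k] \<Psi>_eq_0[of k] by auto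
qed

lemma has_weight_iff:
  "has_weight m n (gl m n) Kac \<mu> k \<longleftrightarrow> k \<in> carrier Kac \<and> (\<forall>i\<in>idx m n. Fk.E i i (\<Psi> k) = sc (\<mu> i) (\<Psi> k))"
proof (cases "k \<in> carrier Kac")
  case k: True
  have "(\<forall>h\<in>cartan m n. Fk.gen h \<odot>\<^bsub>Kac\<^esub> k = Fk.cst (weight_apply m n \<mu> h) \<odot>\<^bsub>Kac\<^esub> k) \<longleftrightarrow>
      (\<forall>i\<in>idx m n. Fk.E i i (\<Psi> k) = sc (\<mu> i) (\<Psi> k))" (is "?l \<longleftrightarrow> ?r")
  proof
    assume l: ?l
    show ?r
    proof
      fix i assume i: "i \<in> idx m n"
      then have "Fk.gen (mat_unit i i) \<odot>\<^bsub>Kac\<^esub> k = Fk.cst (\<mu> i) \<odot>\<^bsub>Kac\<^esub> k"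
        using l mat_unit_cartan weight_apply_unit by metis
      then show "Fk.E i i (\<Psi> k) = sc (\<mu> i) (\<Psi> k)"
        using \<Psi>_unit[OF i i k] \<Psi>_cst[OF k] by simp
    qed
  next
    assume r: ?r
    show ?l
    proof
      fix h assume h: "h \<in> cartan m n"
      have "\<Psi> (Fk.gen h \<odot>\<^bsub>Kac\<^esub> k) = unit_op m n Fk.E h (\<Psi> k)"
        unfolding \<Psi>_smult[OF Fk.gen_closed[OF cartan_gl[OF h]] k] by (rule Fk.act_gen[OF cartan_gl[OF h] \<Psi>_W[OF k]])
      also have "\<dots> = \<Psi> (Fk.cst (weight_apply m n \<mu> h) \<odot>\<^bsub>Kac\<^esub> k)"
        unfolding \<Psi>_cst[OF k] using r by (intro unit_op_diag[OF h]) blast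
      finally show "Fk.gen h \<odot>\<^bsub>Kac\<^esub> k = Fk.cst (weight_apply m n \<mu> h) \<odot>\<^bsub>Kac\<^esub> k"
        using k h by (intro \<Psi>_inj) (simp_all add: K.smult_closed Fk.gen_closed Fk.cst_closed cartan_gl)
    qed
  qed
  then show ?thesis using k by (simp add: has_weight_def)
qed (simp add: has_weight_def)

lemma vt_raise:
  assumes x: "x \<in> n_plus m n" shows "Fk.gen x \<odot>\<^bsub>Kac\<^esub> vt v = \<zero>\<^bsub>Kac\<^esub>"
proof -
  have lt: "i < j" if "x i j \<noteq> 0" for i j using x that by (simp add: n_plus_def)
  have p: "x \<in> parabolic m n"
    unfolding parabolic_iff using n_plus_gl[OF x] lt by (metis less_asym less_trans)
  have ev: "even_part x \<in> g_zero m n" by (rule even_part_g_zero[OF n_plus_gl[OF x]])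
  moreover have "even_part x \<in> n_plus m n"
    unfolding n_plus_def
  proof (intro CollectI conjI allI impI)
    show "even_part x \<in> gl m n" using ev by (simp add: g_zero_iff)
    show "i < j" if "even_part x i j \<noteq> 0" for i j
      using that by (intro lt) (simp add: even_part_def split: if_splits)
  qed
  ultimately have "even_part x \<in> g_zero m n \<inter> n_plus m n" by blast
  then have "A.gen (even_part x) \<odot>\<^bsub>L\<^esub> v = \<zero>\<^bsub>L\<^esub>"
    using hwv by (simp add: highest_weight_vector_def singular_def)
  then show ?thesis using vt_gen[OF p v_closed] by (simp add: vt_zero)
qed

lemma vt_weight: "has_weight m n (gl m n) Kac mu (vt v)"
  unfolding has_weight_def
proof (intro conjI ballI vt_closed v_closed)
  fix h assume h: "h \<in> cartan m n"
  have p: "h \<in> parabolic m n" 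
    unfolding parabolic_iff using h by (metis (mono_tags, lifting) cartan_def less_asym mem_Collect_eq)
  have "even_part h = h" using h by (auto simp: cartan_def even_part_def fun_eq_iff)
  then show "Fk.gen h \<odot>\<^bsub>Kac\<^esub> vt v = Fk.cst (weight_apply m n mu h) \<odot>\<^bsub>Kac\<^esub> vt v"
    using vt_gen[OF p v_closed] vt_cst[OF v_closed] h hwv by (simp add: highest_weight_vector_def has_weight_def)
qed

end

section \<open>The singular vector inside the Kac module\<close>

locale atypical_kac = L0_module m n L v mu for m n and L :: "(free_alg set, 'a) module" and v mu +
  fixes s t :: nat
  assumes range: "1 \<le> s" "s \<le> m" "1 \<le> t" "t \<le> n"
    and dominant: "dominant m n mu" "dominant m n (mu - (delta s - eps t))"
    and atypical: "weight_form m n (mu + Defs.rho m n) (delta s - eps t) = 0"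
begin

sublocale ks: kac_setup m n V \<rho> "co v" mu s t
  using range dominant atypical rep_irreducible by unfold_locales

interpretation K: left_module "UEA m n (gl m n)" Kac
  by (rule left_module_Kac)

lemma chain_closed: "set xs \<subseteq> idx m n \<Longrightarrow> chain m n xs \<in> carrier Fk.U"
  by (induction xs rule: induct_list012) (auto simp: Fk.gen_closed mat_unit_gl)

lemma \<Psi>_chain: "set xs \<subseteq> idx m n \<Longrightarrow> k \<in> carrier Kac \<Longrightarrow> \<Psi> (chain m n xs \<odot>\<^bsub>Kac\<^esub> k) = ks.chop xs (\<Psi> k)"
proof (induction xs arbitrary: k rule: induct_list012)
  case (3 i j xs)
  then have ij: "i \<in> idx m n" "j \<in> idx m n" "set (j # xs) \<subseteq> idx m n" by auto
  note g = Fk.gen_closed[OF mat_unit_gl[OF ij(2,1)]]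
  show ?case
    using 3(2)[OF ij(3) K.smult_closed[OF g 3(4)]] chain_closed[OF ij(3)] \<Psi>_unit[OF ij(2,1) 3(4)] g 3(4)
    by (simp add: K.smult_assoc)
qed (simp_all add: K.smult_one)

abbreviation "S \<equiv> S_elem m n mu s t"
abbreviation "y0 \<equiv> S \<odot>\<^bsub>Kac\<^esub> vt v"

lemma E_prod_closed: "J \<subseteq> between m n s t \<Longrightarrow> E_prod m n s t J \<in> carrier Fk.U"
  and \<Psi>_E_prod: "J \<subseteq> between m n s t \<Longrightarrow> \<Psi> (E_prod m n s t J \<odot>\<^bsub>Kac\<^esub> vt v) =
    ks.chop (ks.bs # sorted_list_of_set J @ [ks.tt]) ks.vv"
proof -
  assume J: "J \<subseteq> between m n s t"
  have "set (ks.bs # sorted_list_of_set J @ [ks.tt]) \<subseteq> idx m n"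
    using J finite_subset[OF J] ks.bs_Ng ks.tt_Ps ks.btw(1,2)[of ks.tt]
    by (auto simp: Fk.idx_cases ks.btw_between)
  note c = this
  show "E_prod m n s t J \<in> carrier Fk.U"
    unfolding E_prod_def by (rule chain_closed[OF c])
  show "\<Psi> (E_prod m n s t J \<odot>\<^bsub>Kac\<^esub> vt v) = ks.chop (ks.bs # sorted_list_of_set J @ [ks.tt]) ks.vv"
    unfolding E_prod_def by (simp only: \<Psi>_chain[OF c vt_closed[OF v_closed]] \<Psi>(2)[OF v_closed])
qed

lemma S_closed: "S \<in> carrier Fk.U"
  unfolding S_elem_def by (intro SE.R.finsum_closed Pi_I SE.R.m_closed Fk.cst_closed E_prod_closed) auto

lemma y0_closed: "y0 \<in> carrier Kac"
  by (intro K.smult_closed S_closed vt_closed v_closed)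

lemma \<Psi>_finsum:
  assumes "finite A" "\<And>a. a \<in> A \<Longrightarrow> g a \<in> carrier Kac"
  shows "\<Psi> (\<Oplus>\<^bsub>Kac\<^esub>a\<in>A. g a) = (\<Sum>a\<in>A. \<Psi> (g a))"
  using assms
proof (induction A rule: finite_induct)
  case empty
  have "\<Psi> (\<Oplus>\<^bsub>Kac\<^esub>a\<in>{}. g a) = (\<Sum>a\<in>{}. \<Psi> (g a))" by (simp add: \<Psi>_zero)
  then show ?case .
next
  case (insert a A)
  have "(\<Oplus>\<^bsub>Kac\<^esub>a\<in>insert a A. g a) = g a \<oplus>\<^bsub>Kac\<^esub> (\<Oplus>\<^bsub>Kac\<^esub>a\<in>A. g a)"
    using insert by (intro K.M.finsum_insert) auto
  moreover have "(\<Oplus>\<^bsub>Kac\<^esub>a\<in>A. g a) \<in> carrier Kac" using insert by (intro K.M.finsum_closed) auto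
  ultimately have "\<Psi> (\<Oplus>\<^bsub>Kac\<^esub>a\<in>insert a A. g a) = (\<Sum>a\<in>insert a A. \<Psi> (g a))"
    using insert by (simp add: \<Psi>_add)
  then show ?case .
qed

lemma \<Psi>_y0: "\<Psi> y0 = ks.sv"
proof -
  let ?E = "\<lambda>J. E_prod m n s t J" and ?d = "\<lambda>J. d_coeff m n mu s t J"
  let ?B = "Pow (between m n s t)"
  have fin: "finite ?B" using ks.btw(1)[of ks.tt] by (simp add: ks.btw_between)
  note vc = vt_closed[OF v_closed]
  have t: "(Fk.cst (?d J) \<otimes>\<^bsub>Fk.U\<^esub> ?E J) \<odot>\<^bsub>Kac\<^esub> vt v = Fk.cst (?d J) \<odot>\<^bsub>Kac\<^esub> (?E J \<odot>\<^bsub>Kac\<^esub> vt v)"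
    if "J \<in> ?B" for J
    using that by (intro K.smult_assoc Fk.cst_closed E_prod_closed vc) auto
  have "y0 = (\<Oplus>\<^bsub>Kac\<^esub>J\<in>?B. (Fk.cst (?d J) \<otimes>\<^bsub>Fk.U\<^esub> ?E J) \<odot>\<^bsub>Kac\<^esub> vt v)"
    unfolding S_elem_def
    by (rule K.finsum_smult[OF fin _ vc]) (intro SE.R.m_closed Fk.cst_closed E_prod_closed, auto)
  then have "\<Psi> y0 = (\<Sum>J\<in>?B. \<Psi> ((Fk.cst (?d J) \<otimes>\<^bsub>Fk.U\<^esub> ?E J) \<odot>\<^bsub>Kac\<^esub> vt v))"
    using \<Psi>_finsum[OF fin, of "\<lambda>J. (Fk.cst (?d J) \<otimes>\<^bsub>Fk.U\<^esub> ?E J) \<odot>\<^bsub>Kac\<^esub> vt v"]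
    by (simp add: K.smult_closed SE.R.m_closed Fk.cst_closed E_prod_closed vc)
  also have "\<dots> = (\<Sum>J\<in>?B. sc (?d J) (ks.chop (ks.bs # sorted_list_of_set J @ [ks.tt]) ks.vv))"
  proof (rule sum.cong[OF refl])
    fix J assume J: "J \<in> ?B"
    show "\<Psi> ((Fk.cst (?d J) \<otimes>\<^bsub>Fk.U\<^esub> ?E J) \<odot>\<^bsub>Kac\<^esub> vt v) =
        sc (?d J) (ks.chop (ks.bs # sorted_list_of_set J @ [ks.tt]) ks.vv)"
      unfolding t[OF J] using J by (subst \<Psi>_cst) (simp_all add: K.smult_closed E_prod_closed vc \<Psi>_E_prod)
  qed
  also have "\<dots> = ks.sv"
    unfolding ks.sv_def ks.SU_def ks.btw_between d_coeff_def ..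
  finally show ?thesis .
qed

lemma y0_singular: "singular m n (gl m n) Kac y0"
  using y0_closed ks.sv_nz ks.sv_raise by (simp add: singular_iff \<Psi>_y0)

lemma y0_weight: "has_weight m n (gl m n) Kac (mu - (delta s - eps t)) y0"
  using y0_closed ks.sv_weight unfolding has_weight_iff \<Psi>_y0 ks.mu'_def by blast

lemma y0_unique:
  assumes r: "\<forall>x\<in>n_plus m n. Fk.gen x \<odot>\<^bsub>Kac\<^esub> w = \<zero>\<^bsub>Kac\<^esub>"
    and wt: "has_weight m n (gl m n) Kac (mu - (delta s - eps t)) w"
  obtains a where "w = Fk.cst a \<odot>\<^bsub>Kac\<^esub> y0"
proof -
  have w: "w \<in> carrier Kac" using wt by (simp add: has_weight_def)
  have "Fk.E i i (\<Psi> w) = sc (ks.mu' i) (\<Psi> w)" if "i \<in> idx m n" for i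
    using wt that unfolding has_weight_iff ks.mu'_def by blast
  moreover have "Fk.E i j (\<Psi> w) = 0" if "i \<in> idx m n" "j \<in> idx m n" "i < j" for i j
    using r that raise_iff[OF w] by blast
  ultimately obtain a where "\<Psi> w = sc a ks.sv"
    using ks.singular_unique[OF \<Psi>_W[OF w]] by blast
  then have "\<Psi> w = \<Psi> (Fk.cst a \<odot>\<^bsub>Kac\<^esub> y0)" by (simp add: \<Psi>_cst y0_closed \<Psi>_y0)
  then have "w = Fk.cst a \<odot>\<^bsub>Kac\<^esub> y0"
    by (intro \<Psi>_inj w K.smult_closed Fk.cst_closed y0_closed)
  then show thesis by (rule that)
qed

end

section \<open>The space of homomorphisms\<close>

locale atypical_pair = A: atypical_kac m n L v mu s t + B: L0_module m n L2 v2 "mu - (delta s - eps t)"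
  for m n and L :: "(free_alg set, 'a) module" and v mu s t and L2 :: "(free_alg set, 'b) module" and v2
begin

sublocale kp: kac_pair m n A.V A.\<rho> "A.co v" mu s t B.V B.\<rho> "B.co v2"
  using B.rep_irreducible by unfold_locales

interpretation KA: left_module "UEA m n (gl m n)" A.Kac
  by (rule A.left_module_Kac)
interpretation KB: left_module "UEA m n (gl m n)" B.Kac
  by (rule B.left_module_Kac)

text \<open>The graph map \<open>kp.\<theta>\<close> induces a homomorphism into the Fock space of
  \<open>L\<close>, and the inverse of \<open>A.\<Psi>\<close> brings it into the Kac
  module.\<close>

lemma hom_exists:
  obtains f where "module_hom A.Fk.U B.Kac A.Kac f" "f (B.vt v2) = A.y0"
proof -
  obtain g where g: "module_hom A.Fk.U B.Kac A.Fk.rep_module g" "\<And>x. x \<in> carrier L2 \<Longrightarrow> g (B.vt x) = kp.\<theta> (B.co x)"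
    by (rule B.Kac_hom[OF A.Fk.gl_rep_axioms kp.\<theta>_mem kp.\<theta>_add kp.\<theta>_scale kp.\<theta>_even kp.\<theta>_upper])
      (auto simp: A.Fk.Ng_def B.Fk.Ng_def A.Fk.Ps_def B.Fk.Ps_def)
  let ?i = "inv_into (carrier A.Kac) A.\<Psi>"
  have "module_hom A.Fk.U A.Fk.rep_module A.Kac ?i"
    using A.bij_\<Psi> by (intro module_hom_inv_into A.\<Psi>(1) A.left_module_Kac) simp
  from module_hom_comp[OF g(1) this] have "module_hom A.Fk.U B.Kac A.Kac (?i \<circ> g)" .
  moreover have "(?i \<circ> g) (B.vt v2) = A.y0"
    using g(2)[OF B.v_closed] A.bij_\<Psi> A.y0_closed inv_into_f_f[of A.\<Psi> "carrier A.Kac" A.y0]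
    by (simp add: kp.\<theta>_v2 A.\<Psi>_y0 bij_betw_def)
  ultimately show thesis by (rule that)
qed

lemma hom_cst:
  assumes "module_hom A.Fk.U B.Kac A.Kac f"
  shows "module_hom A.Fk.U B.Kac A.Kac (\<lambda>k. A.Fk.cst c \<odot>\<^bsub>A.Kac\<^esub> f k)"
  using module_homD[OF assms] unfolding module_hom_def
  by (auto simp: KA.smult_closed A.Fk.cst_closed KA.smult_r_distr A.cst_smult_comm)

text \<open>The image of the highest weight vector is killed by raising elements and has weight
  \<open>\<lambda> - \<beta>\<close>, so it is a multiple of \<open>y0\<close>; two homomorphisms
  agreeing on that vector are equal.\<close>

lemma hom_unique:
  assumes f: "module_hom A.Fk.U B.Kac A.Kac f" and g: "module_hom A.Fk.U B.Kac A.Kac g" "g (B.vt v2) = A.y0"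
  obtains c where "\<And>k. k \<in> carrier B.Kac \<Longrightarrow> f k = A.Fk.cst c \<odot>\<^bsub>A.Kac\<^esub> g k"
proof -
  note vc = B.vt_closed[OF B.v_closed]
  have fs: "f (u \<odot>\<^bsub>B.Kac\<^esub> B.vt v2) = u \<odot>\<^bsub>A.Kac\<^esub> f (B.vt v2)" if "u \<in> carrier A.Fk.U" for u
    by (rule module_homD(3)[OF f that vc])
  have f0: "f \<zero>\<^bsub>B.Kac\<^esub> = \<zero>\<^bsub>A.Kac\<^esub>"
    by (rule module_hom_zero[OF f B.left_module_Kac A.left_module_Kac])
  have r: "\<forall>x\<in>n_plus m n. A.Fk.gen x \<odot>\<^bsub>A.Kac\<^esub> f (B.vt v2) = \<zero>\<^bsub>A.Kac\<^esub>"
  proof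
    fix x assume x: "x \<in> n_plus m n"
    show "A.Fk.gen x \<odot>\<^bsub>A.Kac\<^esub> f (B.vt v2) = \<zero>\<^bsub>A.Kac\<^esub>"
      unfolding fs[OF A.Fk.gen_closed[OF n_plus_gl[OF x]], symmetric] B.vt_raise[OF x] f0 ..
  qed
  have w: "has_weight m n (gl m n) A.Kac (mu - (delta s - eps t)) (f (B.vt v2))"
    unfolding has_weight_def
  proof (intro conjI ballI module_homD(1)[OF f vc])
    fix h assume h: "h \<in> cartan m n"
    let ?c = "weight_apply m n (mu - (delta s - eps t)) h"
    have e: "A.Fk.gen h \<odot>\<^bsub>B.Kac\<^esub> B.vt v2 = A.Fk.cst ?c \<odot>\<^bsub>B.Kac\<^esub> B.vt v2"
      using B.vt_weight h unfolding has_weight_def by blast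
    show "A.Fk.gen h \<odot>\<^bsub>A.Kac\<^esub> f (B.vt v2) = A.Fk.cst ?c \<odot>\<^bsub>A.Kac\<^esub> f (B.vt v2)"
      unfolding fs[OF A.Fk.gen_closed[OF cartan_gl[OF h]], symmetric] e fs[OF A.Fk.cst_closed] ..
  qed
  obtain c where "f (B.vt v2) = A.Fk.cst c \<odot>\<^bsub>A.Kac\<^esub> A.y0"
    by (rule A.y0_unique[OF r w])
  then have e: "f (B.vt v2) = A.Fk.cst c \<odot>\<^bsub>A.Kac\<^esub> g (B.vt v2)" unfolding g(2) .
  show thesis
    by (rule that[of c], rule B.Kac_hom_vt_eqI[OF A.left_module_Kac f hom_cst[OF g(1)] e])
qed

text \<open>The map sends a scalar to that multiple of one fixed homomorphism with value
  \<open>y0\<close> at the highest weight vector. It is injective because \<open>y0\<close> is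
  nonzero.\<close>

lemma Hom_bij:
  "\<exists>\<Phi>. bij_betw \<Phi> (UNIV :: complex set) (carrier (Hom_g m n B.Kac A.Kac)) \<and>
    (\<forall>a b. \<Phi> (a + b) = \<Phi> a \<oplus>\<^bsub>Hom_g m n B.Kac A.Kac\<^esub> \<Phi> b) \<and>
    (\<forall>a b. \<Phi> (a * b) = a \<odot>\<^bsub>Hom_g m n B.Kac A.Kac\<^esub> \<Phi> b)"
proof -
  obtain g where g: "module_hom A.Fk.U B.Kac A.Kac g" "g (B.vt v2) = A.y0"
    by (rule hom_exists)
  have gc: "g k \<in> carrier A.Kac" if "k \<in> carrier B.Kac" for k
    by (rule module_homD(1)[OF g(1) that])
  let ?\<Phi> = "\<lambda>a. \<lambda>k\<in>carrier B.Kac. A.Fk.cst a \<odot>\<^bsub>A.Kac\<^esub> g k"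
  note vc = B.vt_closed[OF B.v_closed]
  have "inj ?\<Phi>"
  proof (rule injI)
    fix a b assume "?\<Phi> a = ?\<Phi> b"
    from fun_cong[OF this, of "B.vt v2"] have "A.Fk.cst a \<odot>\<^bsub>A.Kac\<^esub> A.y0 = A.Fk.cst b \<odot>\<^bsub>A.Kac\<^esub> A.y0"
      using vc g(2) by simp
    then have "sc a (A.ks.sv) = sc b (A.ks.sv)"
      using A.\<Psi>_cst[OF A.y0_closed] A.\<Psi>_y0 by metis
    then show "a = b" using A.ks.sv_nz by (simp add: fs.scale_cancel_right)
  qed
  moreover have "range ?\<Phi> = carrier (Hom_g m n B.Kac A.Kac)"
  proof (intro equalityI subsetI)
    fix f assume "f \<in> range ?\<Phi>"
    then obtain a where f: "f = ?\<Phi> a" by blast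
    note h = hom_cst[OF g(1), of a]
    show "f \<in> carrier (Hom_g m n B.Kac A.Kac)"
      unfolding f Hom_g_def using module_homD[OF h] KB.smult_closed by auto
  next
    fix f assume "f \<in> carrier (Hom_g m n B.Kac A.Kac)"
    then have f: "f \<in> carrier B.Kac \<rightarrow>\<^sub>E carrier A.Kac" and h: "module_hom A.Fk.U B.Kac A.Kac f"
      by (auto simp: Hom_g_def module_hom_def)
    obtain c where "\<And>k. k \<in> carrier B.Kac \<Longrightarrow> f k = A.Fk.cst c \<odot>\<^bsub>A.Kac\<^esub> g k"
      using hom_unique[OF h g] by blast
    then have "f = ?\<Phi> c"
      using f by (intro ext) (auto simp: PiE_iff extensional_def)
    then show "f \<in> range ?\<Phi>" by blast
  qed
  moreover have "?\<Phi> (a + b) = ?\<Phi> a \<oplus>\<^bsub>Hom_g m n B.Kac A.Kac\<^esub> ?\<Phi> b" for a b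
    using gc by (auto simp: Hom_g_def A.Fk.cst_add KA.smult_l_distr A.Fk.cst_closed intro!: restrict_ext)
  moreover have "?\<Phi> (a * b) = a \<odot>\<^bsub>Hom_g m n B.Kac A.Kac\<^esub> ?\<Phi> b" for a b
    using gc by (auto simp: Hom_g_def A.Fk.cst_mult KA.smult_assoc A.Fk.cst_closed intro!: restrict_ext)
  ultimately show ?thesis by (intro exI[of _ ?\<Phi>]) (simp add: bij_betw_def)
qed

end

lemma L0_moduleI:
  assumes "is_L0 m n mu L" "highest_weight_vector m n (g_zero m n) L mu v"
  shows "L0_module m n L v mu"
  using assms lie_g_zero unfolding is_L0_def irreducible_module_def
  by (auto simp: L0_module_def L0_module_axioms_def even_module_def even_module_axioms_def fd_module_def
      fd_module_axioms_def irreducible_module_def)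

theorem theorem5:
  fixes m n s t :: nat and lambda beta :: weight
    and L :: "(free_alg set, 'a) module" and L' :: "(free_alg set, 'b) module"
    and v :: 'a
  assumes "1 \<le> m" and "1 \<le> n"
    and "1 \<le> s" and "s \<le> m" and "1 \<le> t" and "t \<le> n"
    and beta: "beta = delta s - eps t"
    and "dominant m n lambda" and "dominant m n (lambda - beta)"
    and "weight_form m n (lambda + rho m n) beta = 0"
    and L: "is_L0 m n lambda L" and L': "is_L0 m n (lambda - beta) L'"
    and v: "highest_weight_vector m n (g_zero m n) L lambda v"
  shows "(singular m n (gl m n) (kac m n L)
           (S_elem m n lambda s t \<odot>\<^bsub>kac m n L\<^esub> kac_vector m n L v))
     \<and> (has_weight m n (gl m n) (kac m n L) (lambda - beta)
           (S_elem m n lambda s t \<odot>\<^bsub>kac m n L\<^esub> kac_vector m n L v))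
     \<and> (\<forall>w. singular m n (gl m n) (kac m n L) w \<and>
             has_weight m n (gl m n) (kac m n L) (lambda - beta) w \<longrightarrow>
           (\<exists>c. w = UEA_const m n (gl m n) c \<odot>\<^bsub>kac m n L\<^esub>
                      (S_elem m n lambda s t \<odot>\<^bsub>kac m n L\<^esub> kac_vector m n L v)))
     \<and> (\<exists>\<Phi>. bij_betw \<Phi> (UNIV :: complex set) (carrier (Hom_g m n (kac m n L') (kac m n L))) \<and>
           (\<forall>a b. \<Phi> (a + b) = \<Phi> a \<oplus>\<^bsub>Hom_g m n (kac m n L') (kac m n L)\<^esub> \<Phi> b) \<and>
           (\<forall>a b. \<Phi> (a * b) = a \<odot>\<^bsub>Hom_g m n (kac m n L') (kac m n L)\<^esub> \<Phi> b))"
proof -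
  obtain v' where v': "highest_weight_vector m n (g_zero m n) L' (lambda - beta) v'"
    using L' unfolding is_L0_def by blast
  interpret L: L0_module m n L v lambda by (rule L0_moduleI[OF L v])
  interpret L': L0_module m n L' v' "lambda - (delta s - eps t)"
    using L0_moduleI[OF L' v'] unfolding beta .
  interpret atypical_pair m n L v lambda s t L' v'
    by unfold_locales (use assms in \<open>simp_all add: beta\<close>)
  have "\<exists>c. w = UEA_const m n (gl m n) c \<odot>\<^bsub>kac m n L\<^esub> A.y0"
    if "singular m n (gl m n) (kac m n L) w" "has_weight m n (gl m n) (kac m n L) (lambda - beta) w" for w
  proof (rule A.y0_unique[of w])
    show "\<forall>x\<in>n_plus m n. UEA_gen m n (gl m n) x \<odot>\<^bsub>kac m n L\<^esub> w = \<zero>\<^bsub>kac m n L\<^esub>"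
      using that(1) n_plus_gl unfolding singular_def by blast
  qed (use that(2) in \<open>auto simp: beta\<close>)
  then show ?thesis
    using A.y0_singular A.y0_weight Hom_bij unfolding beta by blast
qed

end
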